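(* Let $H_\omega=-\Delta+V_\omega$ be the Anderson Hamiltonian on $\ell^2(\mathbb{Z}^d)$ and let $E_F\in\Xi^{\mathrm{CL}}$ (the region of complete localization). Let $\ell_{E_F}>0$ be a localization length at $E_F$, i.e. a constant $\ell$ for which there exist an open interval $I_{E_F}\ni E_F$, an exponent $s\in(0,1)$ and a constant $K$ such that $$\sup_{E'\in I_{E_F}}\sup_{\eta\neq0}\mathbb{E}\{|\langle\delta_x,R(E'+i\eta)\delta_y\rangle|^s\}\le K e^{-|x-y|/\ell}\quad\text{for all }x,y\in\mathbb{Z}^d.$$ Then $$\limsup_{\nu\downarrow0}\frac{\overline{\sigma}^{\mathrm{in}}_{E_F}(\nu)}{\nu^2\left(\log\frac1\nu\right)^{d+2}}\le C^{d+2}\pi^3\|\rho\|_\infty^2\,\ell_{E_F}^{d+2},$$ where $\rho$ is the density of the single site distribution and $C$ is a constant independent of all parameters.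
   Context: The Anderson Hamiltonian is the random operator $H_\omega=-\Delta+V_\omega$ on $\ell^2(\mathbb{Z}^d)$, where $(\Delta\varphi)(x)=-\sum_{y\in\mathbb{Z}^d,|x-y|=1}\varphi(y)$ and $\{V_\omega(x)\}_{x\in\mathbb{Z}^d}$ are independent identically distributed random variables on a probability space $(\Omega,\mathbb{P})$ (expectation $\mathbb{E}$) whose common distribution has a bounded density $\rho$ with compact support. $R(z)=(H-z)^{-1}$. The region of complete localization $\Xi^{\mathrm{CL}}$ is the set of $E\in\mathbb{R}$ for which there are an open interval $I_E\ni E$, $s\in(0,1)$, $K<\infty$, $\ell>0$ with $\sup_{E'\in I_E}\sup_{\eta\ne0}\mathbb{E}\{|\langle\delta_x,R(E'+i\eta)\delta_y\rangle|^s\}\le Ke^{-|x-y|/\ell}$ for all $x,y$. Let $U(a)$ be the translations $U(a)\delta_b=\delta_{b+a}$ and $\tau_a$ the corresponding shifts of the potential, so $U(a)H_\omega U(a)^*=H_{\tau_a\omega}$. Let $\mathcal{K}_2$ be the Hilbert space of (a.e.-equivalence classes of) measurable maps $\omega\mapsto A_\omega$ of linear operators from finitely supported functions into $\ell^2(\mathbb{Z}^d)$ which are covariant ($U(a)A_\omega U(a)^*=A_{\tau_a\omega}$), locally bounded, and satisfy $\mathbb{E}\{\langle\delta_0,|\overline{A_\omega}|^2\delta_0\rangle\}<\infty$, with inner product $\langle\langle A,B\rangle\rangle=\mathbb{E}\{\langle A_\omega\delta_0,B_\omega\delta_0\rangle\}$. On $\mathcal{K}_2$ define the commuting bounded self-adjoint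 operators $\mathcal{H}_LA=HA$, $\mathcal{H}_RA=AH$, and $\mathcal{L}=\mathcal{H}_L-\mathcal{H}_R$, and $\mathcal{P}_{E_F}=\chi_{(-\infty,E_F]}(\mathcal{H}_L)-\chi_{(-\infty,E_F]}(\mathcal{H}_R)$. Let $X_1$ be multiplication by the first coordinate, $P_{E_F}=\chi_{(-\infty,E_F]}(H)$, and $Y_{E_F}=i[X_1,P_{E_F}]$ (which lies in $\mathcal{K}_2$ for $E_F\in\Xi^{\mathrm{CL}}$). The conductivity measure is $\Sigma_{E_F}(B)=\pi\langle\langle Y_{E_F},\chi_B(\mathcal{L})(-\mathcal{L}\mathcal{P}_{E_F})Y_{E_F}\rangle\rangle$ for Borel $B\subset\mathbb{R}$, and the average in phase conductivity is $\overline{\sigma}^{\mathrm{in}}_{E_F}(\nu)=\frac1\nu\Sigma_{E_F}([0,\nu])$ for $\nu>0$. *)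

theory Defs
  imports "HOL-Probability.Probability"
begin

text \<open>Points of Z^d are functions nat => int vanishing at indices >= d;
  coordinate i (0-based) is the (i+1)-th coordinate. So X_1 is x 0.\<close>

definition Zd :: "nat \<Rightarrow> (nat \<Rightarrow> int) set" where
  "Zd d = {x. \<forall>i\<ge>d. x i = 0}"

definition box :: "nat \<Rightarrow> nat \<Rightarrow> (nat \<Rightarrow> int) set" where
  "box d n = {a. (\<forall>i<d. \<bar>a i\<bar> \<le> int n) \<and> (\<forall>i\<ge>d. a i = 0)}"

definition zdist :: "nat \<Rightarrow> (nat \<Rightarrow> int) \<Rightarrow> (nat \<Rightarrow> int) \<Rightarrow> real" where
  "zdist d x y = sqrt (\<Sum>i<d. (real_of_int (x i - y i))^2)"

definition nbrs :: "nat \<Rightarrow> (nat \<Rightarrow> int) \<Rightarrow> (nat \<Rightarrow> int) set" where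
  "nbrs d x = {x(i := x i + 1) | i. i < d} \<union> {x(i := x i - 1) | i. i < d}"

text \<open>H_omega = -Delta + V_omega with (Delta phi)(x) = - sum_{|x-y|=1} phi(y),
  acting pointwise on arbitrary functions Z^d -> C (finite sums).\<close>
definition Hop :: "nat \<Rightarrow> ((nat \<Rightarrow> int) \<Rightarrow> real) \<Rightarrow> ((nat \<Rightarrow> int) \<Rightarrow> complex) \<Rightarrow> (nat \<Rightarrow> int) \<Rightarrow> complex" where
  "Hop d \<omega> f x = (\<Sum>y\<in>nbrs d x. f y) + complex_of_real (\<omega> x) * f x"

definition delta :: "(nat \<Rightarrow> int) \<Rightarrow> (nat \<Rightarrow> int) \<Rightarrow> complex" where
  "delta y = (\<lambda>x. if x = y then 1 else 0)"

definition innerZ :: "nat \<Rightarrow> ((nat \<Rightarrow> int) \<Rightarrow> complex) \<Rightarrow> ((nat \<Rightarrow> int) \<Rightarrow> complex) \<Rightarrow> complex" where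
  "innerZ d u v = infsum (\<lambda>x. cnj (u x) * v x) (Zd d)"

text \<open>Spectral measure of H_omega for a finitely supported vector v: the unique
  compactly supported finite Borel measure on R whose moments are <v, H^n v>
  (unique by Weierstrass approximation).\<close>
definition specmeas :: "nat \<Rightarrow> ((nat \<Rightarrow> int) \<Rightarrow> real) \<Rightarrow> ((nat \<Rightarrow> int) \<Rightarrow> complex) \<Rightarrow> real measure" where
  "specmeas d \<omega> v = (THE \<mu>. sets \<mu> = sets borel \<and> finite_measure \<mu> \<and>
      (\<exists>R. emeasure \<mu> (UNIV - {-R..R}) = 0) \<and>
      (\<forall>n. complex_of_real (\<integral>t. t ^ n \<partial>\<mu>) = innerZ d v ((Hop d \<omega> ^^ n) v)))"

text \<open>Matrix element <delta_x, f(H_omega) delta_y> for a bounded Borel f (polarization;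
  H_omega is real symmetric).\<close>
definition fmat :: "nat \<Rightarrow> ((nat \<Rightarrow> int) \<Rightarrow> real) \<Rightarrow> (real \<Rightarrow> complex) \<Rightarrow> (nat \<Rightarrow> int) \<Rightarrow> (nat \<Rightarrow> int) \<Rightarrow> complex" where
  "fmat d \<omega> f x y =
     ((\<integral>t. f t \<partial>specmeas d \<omega> (\<lambda>z. delta x z + delta y z))
      - (\<integral>t. f t \<partial>specmeas d \<omega> (\<lambda>z. delta x z - delta y z))) / 4"

definition green :: "nat \<Rightarrow> ((nat \<Rightarrow> int) \<Rightarrow> real) \<Rightarrow> complex \<Rightarrow> (nat \<Rightarrow> int) \<Rightarrow> (nat \<Rightarrow> int) \<Rightarrow> complex" where
  "green d \<omega> z x y = fmat d \<omega> (\<lambda>t. 1 / (complex_of_real t - z)) x y"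

definition fermiP :: "nat \<Rightarrow> ((nat \<Rightarrow> int) \<Rightarrow> real) \<Rightarrow> real \<Rightarrow> (nat \<Rightarrow> int) \<Rightarrow> (nat \<Rightarrow> int) \<Rightarrow> complex" where
  "fermiP d \<omega> E x y = fmat d \<omega> (\<lambda>t. if t \<le> E then 1 else 0) x y"

definition single_site_density :: "(real \<Rightarrow> real) \<Rightarrow> bool" where
  "single_site_density \<rho> \<longleftrightarrow> \<rho> \<in> borel_measurable borel \<and> (\<forall>t. 0 \<le> \<rho> t) \<and>
     (\<integral>\<^sup>+ t. ennreal (\<rho> t) \<partial>lborel) = 1 \<and> (\<exists>M. \<forall>t. \<rho> t \<le> M) \<and>
     (\<exists>R. \<forall>t. R < \<bar>t\<bar> \<longrightarrow> \<rho> t = 0)"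

definition Omega :: "nat \<Rightarrow> (real \<Rightarrow> real) \<Rightarrow> ((nat \<Rightarrow> int) \<Rightarrow> real) measure" where
  "Omega d \<rho> = PiM (Zd d) (\<lambda>_. density lborel (\<lambda>t. ennreal (\<rho> t)))"

definition normInf :: "(real \<Rightarrow> real) \<Rightarrow> ereal" where
  "normInf \<rho> = esssup lborel (\<lambda>t. ereal \<bar>\<rho> t\<bar>)"

text \<open>Y_omega = i[X_1, P_{E_F}] applied to a vector g (finitely supported in box d n).\<close>
definition Yapply :: "nat \<Rightarrow> ((nat \<Rightarrow> int) \<Rightarrow> real) \<Rightarrow> real \<Rightarrow> nat \<Rightarrow> ((nat \<Rightarrow> int) \<Rightarrow> complex) \<Rightarrow> (nat \<Rightarrow> int) \<Rightarrow> complex" where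
  "Yapply d \<omega> E n g = (\<lambda>x. \<Sum>a\<in>box d n. g a * (\<i> * of_int (x 0 - a 0) * fermiP d \<omega> E x a))"

text \<open>Joint moments <<Y, H_L^m H_R^n Y>> = E{<Y delta_0, H^m Y H^n delta_0>}.\<close>
definition Ymoment :: "nat \<Rightarrow> (real \<Rightarrow> real) \<Rightarrow> real \<Rightarrow> nat \<Rightarrow> nat \<Rightarrow> complex" where
  "Ymoment d \<rho> E m n = (\<integral>\<omega>. innerZ d (Yapply d \<omega> E 0 (delta (\<lambda>_. 0)))
        ((Hop d \<omega> ^^ m) (Yapply d \<omega> E n ((Hop d \<omega> ^^ n) (delta (\<lambda>_. 0))))) \<partial>Omega d \<rho>)"

text \<open>Joint spectral measure of the commuting pair (H_L, H_R) in the vector Y: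
  unique compactly supported finite Borel measure on R^2 with these moments.\<close>
definition Yjoint :: "nat \<Rightarrow> (real \<Rightarrow> real) \<Rightarrow> real \<Rightarrow> (real \<times> real) measure" where
  "Yjoint d \<rho> E = (THE \<mu>. sets \<mu> = sets borel \<and> finite_measure \<mu> \<and>
      (\<exists>R. emeasure \<mu> (UNIV - {-R..R} \<times> {-R..R}) = 0) \<and>
      (\<forall>m n. complex_of_real (\<integral>p. fst p ^ m * snd p ^ n \<partial>\<mu>) = Ymoment d \<rho> E m n))"

text \<open>Sigma_{E_F}(B) = pi <<Y, chi_B(L)(-L P) Y>>, computed with the joint spectral
  measure: L = lambda1 - lambda2, P = chi(lambda1 <= E) - chi(lambda2 <= E).\<close>
definition cond_measure :: "nat \<Rightarrow> (real \<Rightarrow> real) \<Rightarrow> real \<Rightarrow> real set \<Rightarrow> real" where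
  "cond_measure d \<rho> E B = pi * (\<integral>p. indicator {q. fst q - snd q \<in> B} p *
       (- (fst p - snd p) * ((if fst p \<le> E then 1 else 0) - (if snd p \<le> E then 1 else 0)))
       \<partial>Yjoint d \<rho> E)"

definition sigma_in :: "nat \<Rightarrow> (real \<Rightarrow> real) \<Rightarrow> real \<Rightarrow> real \<Rightarrow> real" where
  "sigma_in d \<rho> E \<nu> = cond_measure d \<rho> E {0..\<nu>} / \<nu>"

definition loc_estimate :: "nat \<Rightarrow> (real \<Rightarrow> real) \<Rightarrow> real \<Rightarrow> real \<Rightarrow> real \<Rightarrow> real \<Rightarrow> real \<Rightarrow> bool" where
  "loc_estimate d \<rho> a b s K l \<longleftrightarrow>
     (\<forall>E'\<in>{a<..<b}. \<forall>\<eta>::real. \<eta> \<noteq> 0 \<longrightarrow> (\<forall>x\<in>Zd d. \<forall>y\<in>Zd d.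
        (\<integral>\<^sup>+\<omega>. ennreal (cmod (green d \<omega> (Complex E' \<eta>) x y) powr s) \<partial>Omega d \<rho>)
          \<le> ennreal (K * exp (- zdist d x y / l))))"

end

theory Submission
  imports Defs "HOL-Computational_Algebra.Polynomial"
begin

text \<open>
  Everything is done in infinite volume. The spectral measures and the joint measure of the pair
  \<open>(H\<^sub>L, H\<^sub>R)\<close> in \<open>Y\<close> are given only by their moments, so they are produced by the Hausdorff moment
  problem; for the joint measure the required positivity is that of the trace per unit volume,
  \<open>\<langle>\<langle>Y, f(H\<^sub>L) g(H\<^sub>R) Y\<rangle>\<rangle> = T((Y \<surd>g)\<^sup>* f (Y \<surd>g))\<close>, which follows from the translation invariance of
  the potential.

  On \<open>\<lambda>\<^sub>1 - \<lambda>\<^sub>2 \<in> [0, \<nu>]\<close> the density \<open>- \<L> \<P>\<close> is at most \<open>\<nu>\<close> and lives on \<open>(E, E + \<nu>] \<times> (E - \<nu>, E]\<close>.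
  Writing \<open>F\<^sub>\<plusminus>\<close> for the spectral projections of these intervals, the averaged conductivity is therefore
  at most \<open>\<pi> T(F\<^sub>- X F\<^sub>+ X F\<^sub>-)\<close>. The Fermi projection decays exponentially in mean (write it as an
  integral of the resolvent along the vertical line through \<open>E\<close> and use fractional moments), so up to
  errors of higher order only sites in a box of side \<open>L \<approx> l ln (1/\<nu>)\<close> matter. There the
  trace is at most \<open>2 L\<^sup>2\<close> times the sum over the sites \<open>j\<close> of \<open>F\<^sub>+(j,j) F\<^sub>-(0,0)\<close>, and each term is
  a two-site determinant of \<open>F\<^sub>+ + F\<^sub>-\<close>, up to a sum that vanishes by orthogonality. Minami's estimate
  bounds the expected determinant by \<open>4 \<pi>\<^sup>2 \<nu>\<^sup>2\<close> times the square of the sup norm of the density: by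
  rank one perturbation, averaging over the two potentials at \<open>0\<close> and \<open>j\<close> bounds the expected
  determinant of the imaginary part of the resolvent.
\<close>

section \<open>Bounded Borel functions as limits of polynomials\<close>

text \<open>No operator on a Hilbert space is ever built. The calculus consists of the real form
  \<open>rf d V f v w\<close>, standing for <v, f(H) w> with finitely supported v and w; nearly
  every identity in it is checked on powers of t and then extended to bounded Borel f, since both
  sides are linear and continuous under bounded pointwise limits. The rates explain the constants.
  Integrating the resolvent over \<eta> needs more than the fractional moment of order s: in |G| =
  |G|^(1-s/2) |G|^(s/2) the first factor has a bound integrable in \<eta> for all s < 1, but the
  moment of order s/2 decays only at rate \<open>c0\<close> = 1/(2l). The kernels are dependent, so
  a product of three of them is controlled by its smallest mean, which gives the rate c0/3 in the
  sum of the distances; half of this pays for the weights of the commutator with X_1. What remains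
  is \<kappa> = 1/(12l), hence a box of radius 12 l ln(1/\<nu>). All these losses multiply l by
  absolute factors, which C^(d+2) absorbs.\<close>

definition bbm :: "('a::topological_space => real) => bool" where
  "bbm f \<longleftrightarrow> f \<in> borel_measurable borel \<and> (\<exists>B. \<forall>x. \<bar>f x\<bar> \<le> B)"

lemma bbmI: "f \<in> borel_measurable borel ==> (!!x. \<bar>f x\<bar> \<le> B) ==> bbm f"
  unfolding bbm_def by blast

lemma bbm_measurable[measurable_dest]: "bbm f ==> f \<in> borel_measurable borel"
  by (simp add: bbm_def)

lemma bbm_bound:
  assumes "bbm f" obtains B where "0 \<le> B" "!!x. \<bar>f x\<bar> \<le> B"
  using assms unfolding bbm_def by (metis abs_ge_zero order_trans)

lemma bbm_const: "bbm (%_. c)"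
  by (rule bbmI[where B="\<bar>c\<bar>"]) auto

lemma bbm_indicator: "A \<in> sets borel ==> bbm (indicator A)"
  by (rule bbmI[where B=1]) (auto simp: indicator_def)

lemma bbm_add: "bbm f ==> bbm g ==> bbm (%x. f x + g x)"
proof -
  assume f: "bbm f" and g: "bbm g"
  obtain B where "!!x. \<bar>f x\<bar> \<le> B" using bbm_bound[OF f] by metis
  moreover obtain C where "!!x. \<bar>g x\<bar> \<le> C" using bbm_bound[OF g] by metis
  ultimately show ?thesis
    using f g by (intro bbmI[where B="B+C"]) (auto intro!: borel_measurable_add bbm_measurable intro: order_trans[OF abs_triangle_ineq add_mono])
qed

lemma bbm_mult: "bbm f ==> bbm g ==> bbm (%x. f x * g x)"
proof -
  assume f: "bbm f" and g: "bbm g"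
  obtain B where "!!x. \<bar>f x\<bar> \<le> B" using bbm_bound[OF f] by metis
  moreover obtain C where "!!x. \<bar>g x\<bar> \<le> C" using bbm_bound[OF g] by metis
  ultimately show ?thesis
    using f g by (intro bbmI[where B="B*C"])
      (auto intro!: borel_measurable_times bbm_measurable simp: abs_mult intro!: mult_mono intro: order_trans[OF abs_ge_zero])
qed

lemma bbm_scale: "bbm f ==> bbm (%x. c * f x)"
  by (rule bbm_mult[OF bbm_const])

lemma bbm_uminus: "bbm f ==> bbm (%x. - f x)"
  using bbm_scale[of f "-1"] by simp

lemma bbm_diff: "bbm f ==> bbm g ==> bbm (%x. f x - g x)"
  using bbm_add[OF _ bbm_uminus, of f g] by simp

lemma bbm_sum: "(!!i. i \<in> I ==> bbm (f i)) ==> bbm (%x. \<Sum>i\<in>I. f i x)"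
  by (induction I rule: infinite_finite_induct) (auto intro: bbm_add bbm_const)

lemma bbm_continuous_compact:
  fixes f :: "'a::t2_space => real"
  assumes "continuous_on UNIV f" "compact K"
  shows "bbm (%x. f x * indicator K x)"
proof -
  have "bounded (f ` K)"
    using assms by (intro compact_imp_bounded compact_continuous_image) (auto intro: continuous_on_subset)
  then obtain B where "!!x. x \<in> K ==> \<bar>f x\<bar> \<le> B"
    unfolding bounded_iff by auto
  moreover have "K \<in> sets borel" using assms(2) by (simp add: borel_compact)
  ultimately show ?thesis
    using borel_measurable_continuous_onI[OF assms(1)]
    by (intro bbmI[where B="max B 0"] borel_measurable_times borel_measurable_indicator)
      (auto simp: indicator_def le_max_iff_disj)
qed

lemma bbm_LIMSEQ:
  fixes F :: "nat => 'a::topological_space => real"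
  assumes "!!n. bbm (F n)" "!!n x. \<bar>F n x\<bar> \<le> B" "!!x. (%n. F n x) \<longlonglongrightarrow> f x"
  shows "bbm f" "!!x. \<bar>f x\<bar> \<le> B"
proof -
  show b: "!!x. \<bar>f x\<bar> \<le> B"
    by (rule tendsto_upperbound[OF tendsto_rabs[OF assms(3)]]) (use assms(2) in auto)
  show "bbm f"
    by (rule bbmI[OF borel_measurable_LIMSEQ_real[OF assms(3)] b]) (use assms(1) bbm_measurable in auto)
qed

text \<open>The linear span of \<open>S\<close>, generated inductively so that properties such as
  continuity pass to it by rule induction.\<close>

inductive lincomb :: "('a => real) set => ('a => real) => bool" for S where
  base: "f \<in> S ==> lincomb S f"
| add: "lincomb S f ==> lincomb S g ==> lincomb S (%x. f x + g x)"
| scale: "lincomb S f ==> lincomb S (%x. c * f x)"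

lemma lincomb_mult:
  assumes "!!f g. f \<in> S ==> g \<in> S ==> (%x. f x * g x) \<in> S"
  shows "lincomb S f ==> lincomb S g ==> lincomb S (%x. f x * g x)"
proof (induction f rule: lincomb.induct)
  case (base f)
  show ?case using base(2,1)
  proof (induction g rule: lincomb.induct)
    case (base g) then show ?case by (intro lincomb.base assms)
  next
    case (add f' g') then show ?case using lincomb.add[of S "%x. f x * f' x" "%x. f x * g' x"]
      by (simp add: algebra_simps)
  next
    case (scale f' c) then show ?case using lincomb.scale[of S "%x. f x * f' x" c]
      by (simp add: algebra_simps)
  qed
next
  case (add f' g') then show ?case using lincomb.add[of S "%x. f' x * g x" "%x. g' x * g x"]
    by (simp add: algebra_simps)
next
  case (scale f' c) then show ?case using lincomb.scale[of S "%x. f' x * g x" c]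
    by (simp add: algebra_simps)
qed

definition sq :: "real => (real \<times> real) set" where
  "sq R = {-R..R} \<times> {-R..R}"

lemma sq_borel[measurable]: "sq R \<in> sets borel" and compact_sq: "compact (sq R)"
proof -
  show "compact (sq R)" unfolding sq_def by (intro compact_Times) auto
  then show "sq R \<in> sets borel" by (rule borel_compact)
qed

definition mono2 :: "nat => nat => real \<times> real => real" where
  "mono2 m n p = fst p ^ m * snd p ^ n"

lemma continuous_mono2: "continuous_on A (mono2 m n)"
  unfolding mono2_def by (intro continuous_intros)

lemma bbm_mono2: "bbm (%p. mono2 m n p * indicator (sq R) p)"
  by (rule bbm_continuous_compact[OF continuous_mono2 compact_sq])

lemma mono2_approx:
  assumes "continuous_on (sq R) f" "0 < e"
  shows "\<exists>g. lincomb (range (%(m,n). mono2 m n)) g \<and> (\<forall>x\<in>sq R. \<bar>f x - g x\<bar> < e)"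
proof (rule Stone_Weierstrass_HOL)
  let ?M = "range (%(m,n). mono2 m n)"
  have M: "mono2 m n \<in> ?M" for m n by auto
  show "compact (sq R)" by (rule compact_sq)
  show "lincomb ?M (%x. c)" for c
    using lincomb.scale[OF lincomb.base[OF M[of 0 0]], of c] by (simp add: mono2_def)
  show "continuous_on (sq R) f" if "lincomb ?M f" for f
    using that
    by induction (auto simp: mono2_def intro!: continuous_intros)
  show "lincomb ?M (%x. f x + g x)" if "lincomb ?M f \<and> lincomb ?M g" for f g
    using that by (auto intro: lincomb.add)
  show "lincomb ?M (%x. f x * g x)" if "lincomb ?M f \<and> lincomb ?M g" for f g
  proof (rule lincomb_mult)
    show "(%x. f x * g x) \<in> ?M" if "f \<in> ?M" "g \<in> ?M" for f g
    proof -
      from that obtain m n m' n' where "f = mono2 m n" "g = mono2 m' n'" by auto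
      then have "(%x. f x * g x) = mono2 (m+m') (n+n')"
        by (auto simp: mono2_def power_add fun_eq_iff)
      then show ?thesis using M by metis
    qed
  qed (use that in auto)
  show "\<exists>f. lincomb ?M f \<and> f x \<noteq> f y" if "x \<in> sq R \<and> y \<in> sq R \<and> x \<noteq> y" for x y
  proof (cases "fst x = fst y")
    case True
    then have "snd x \<noteq> snd y" using that by (auto simp: prod_eq_iff)
    then show ?thesis by (intro exI[of _ "mono2 0 1"] conjI lincomb.base M) (auto simp: mono2_def)
  next
    case False
    then show ?thesis by (intro exI[of _ "mono2 1 0"] conjI lincomb.base M) (auto simp: mono2_def)
  qed
qed (use assms in auto)

text \<open>A monotone class principle. Uniform limits of polynomials give continuous functions
  (Stone-Weierstrass), functions of the distance give indicators of closed sets, Dynkin's lemma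
  gives Borel sets, and step functions give the rest; each stage uses only linearity and bounded
  pointwise limits.\<close>

lemma bounded_borel_class2:
  fixes P :: "(real \<times> real => real) => bool"
  assumes mono: "!!m n. P (%p. mono2 m n p * indicator (sq R) p)"
    and add: "!!f g. bbm f ==> bbm g ==> P f ==> P g ==> P (%p. f p + g p)"
    and scale: "!!f c. bbm f ==> P f ==> P (%p. c * f p)"
    and lim: "!!F f B. (!!n. bbm (F n)) ==> (!!n. P (F n)) ==> (!!n p. \<bar>F n p\<bar> \<le> B) ==>
         (!!p. (%n. F n p) \<longlonglongrightarrow> f p) ==> P f"
    and f: "bbm f"
  shows "P (%p. f p * indicator (sq R) p)"
proof -
  define Q where "Q f \<longleftrightarrow> bbm f \<and> P f" for f
  note [measurable] = sq_borel[of R]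
  let ?I = "indicator (sq R) :: _ => real"
  have Qadd: "Q (%p. f p + g p)" if "Q f" "Q g" for f g
    using that add unfolding Q_def by (auto intro: bbm_add)
  have Qscale: "Q (%p. c * f p)" if "Q f" for f c
    using that scale unfolding Q_def by (auto intro: bbm_scale)
  have Qlim: "Q f" if "!!n. Q (F n)" "!!n p. \<bar>F n p\<bar> \<le> B" "!!p. (%n. F n p) \<longlonglongrightarrow> f p" for F f B
    using that lim[of F B f] bbm_LIMSEQ(1)[of F B f] unfolding Q_def by auto
  have Q0: "Q (%_. 0)"
  proof -
    have "Q (%p. mono2 0 0 p * ?I p)"
      unfolding Q_def using mono bbm_mono2 by auto
    from Qscale[OF this, of 0] show ?thesis by simp
  qed
  have Qsum: "Q (%p. \<Sum>i\<in>I. f i p)" if "!!i. i \<in> I ==> Q (f i)" for f and I :: "'i set"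
    using that by (induction I rule: infinite_finite_induct) (auto intro: Qadd Q0)
  have Qlc: "Q (%p. g p * ?I p)" if "lincomb (range (%(m,n). mono2 m n)) g" for g
    using that
  proof induction
    case (base f)
    then obtain m n where "f = mono2 m n" by auto
    then show ?case unfolding Q_def using mono bbm_mono2 by auto
  next
    case (add f g) then show ?case using Qadd by (simp add: distrib_right)
  next
    case (scale f c) then show ?case using Qscale by (simp add: mult.assoc)
  qed
  have Qcont: "Q (%p. f p * ?I p)" if f: "continuous_on UNIV f" for f
  proof -
    have "\<exists>g. lincomb (range (%(m,n). mono2 m n)) g \<and> (\<forall>x\<in>sq R. \<bar>f x - g x\<bar> < 1 / real (Suc n))" for n
      by (rule mono2_approx) (use f in \<open>auto intro: continuous_on_subset\<close>)
    then obtain g where g: "!!n. lincomb (range (%(m,n). mono2 m n)) (g n)"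
        "!!n x. x \<in> sq R ==> \<bar>f x - g n x\<bar> < 1 / real (Suc n)" by metis
    obtain B where B: "!!x. \<bar>f x * ?I x\<bar> \<le> B"
      using bbm_bound[OF bbm_continuous_compact[OF f compact_sq[of R]]] by metis
    have le: "\<bar>f x * ?I x - g n x * ?I x\<bar> \<le> 1 / real (Suc n)" for x n
      using g(2)[of x n] by (cases "x \<in> sq R") auto
    show ?thesis
    proof (rule Qlim[where F="%n p. g n p * ?I p" and B="B + 1"])
      show "\<bar>g n p * ?I p\<bar> \<le> B + 1" for n p
      proof -
        have "1 / real (Suc n) \<le> 1" by simp
        then show ?thesis using le[of p n] B[of p] by linarith
      qed
      show "(%n. g n p * ?I p) \<longlonglongrightarrow> f p * ?I p" for p
      proof (rule LIMSEQ_I)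
        fix e :: real assume "0 < e"
        then obtain N where N: "1 / real (Suc N) < e" using nat_approx_posE by blast
        have "norm (g n p * ?I p - f p * ?I p) < e" if "n \<ge> N" for n
        proof -
          have "1 / real (Suc n) \<le> 1 / real (Suc N)" using that by (simp add: field_simps)
          then show ?thesis using le[of p n] N by (simp add: abs_minus_commute)
        qed
        then show "\<exists>no. \<forall>n\<ge>no. norm (g n p * ?I p - f p * ?I p) < e" by blast
      qed
    qed (rule Qlc[OF g(1)])
  qed
  have Qclosed: "Q (%p. indicator C p * ?I p)" if C: "closed C" for C
  proof (cases "C = {}")
    case True then show ?thesis using Q0 by simp
  next
    case False
    show ?thesis
    \<comment> \<open>These continuous functions decrease to the indicator of \<open>C\<close>,
      since a point outside a closed set has positive distance from it.\<close>
    proof (rule Qlim[where F="%n p. max 0 (1 - real n * infdist p C) * ?I p" and B=1])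
      show "Q (%p. max 0 (1 - real n * infdist p C) * ?I p)" for n
        by (rule Qcont) (auto intro!: continuous_intros)
      show "\<bar>max 0 (1 - real n * infdist p C) * ?I p\<bar> \<le> 1" for n p
        using infdist_nonneg[of p C] by (auto simp: indicator_def max_def)
      show "(%n. max 0 (1 - real n * infdist p C) * ?I p) \<longlonglongrightarrow> indicator C p * ?I p" for p
      proof (cases "p \<in> C")
        case True then show ?thesis by simp
      next
        case nC: False
        then have pos: "infdist p C > 0"
          using C False in_closed_iff_infdist_zero infdist_nonneg[of p C] by fastforce
        obtain N where N: "1 / infdist p C < real N" using reals_Archimedean2 by blast
        have "eventually (%n. max 0 (1 - real n * infdist p C) * ?I p = 0) sequentially"
          using eventually_ge_at_top[of N]
        proof eventually_elim
          case (elim n)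
          have "1 < real N * infdist p C" using N pos by (simp add: field_simps)
          also have "\<dots> \<le> real n * infdist p C" using elim pos by simp
          finally show ?case by simp
        qed
        then show ?thesis using nC by (simp add: tendsto_eventually)
      qed
    qed
  qed
  have Qset: "Q (%p. indicator A p * ?I p)" if "A \<in> sets borel" for A
  proof -
    have "Int_stable (Collect closed :: (real \<times> real) set set)" by (auto simp: Int_stable_def)
    moreover have "Collect closed \<subseteq> Pow (UNIV :: (real \<times> real) set)" by simp
    moreover have "A \<in> sigma_sets UNIV (Collect closed)"
      using that by (simp add: borel_eq_closed)
    ultimately show ?thesis
    proof (induction rule: sigma_sets_induct_disjoint)
      case (basic A) then show ?case using Qclosed by auto
    next
      case empty then show ?case using Q0 by simp
    next
      case (compl A)
      have "Q (%p. indicator UNIV p * ?I p + (-1) * (indicator A p * ?I p))"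
        by (intro Qadd Qscale Qclosed compl) auto
      moreover have "(%p. indicator UNIV p * ?I p + (-1) * (indicator A p * ?I p))
          = (%p. indicator (UNIV - A) p * ?I p)"
        by (auto simp: indicator_def fun_eq_iff)
      ultimately show ?case by simp
    next
      case (union A)
      show ?case
      proof (rule Qlim[where F="%n p. \<Sum>i<n. indicator (A i) p * ?I p" and B=1])
        show "Q (%p. \<Sum>i<n. indicator (A i) p * ?I p)" for n
          by (intro Qsum union)
        have eq: "(\<Sum>i<n. indicator (A i) p * ?I p) = indicator (\<Union>i<n. A i) p * ?I p" for n p
        proof -
          have "disjoint_family_on A {..<n}"
            using union(1) by (auto simp: disjoint_family_on_def)
          then have "indicator (\<Union>i<n. A i) p = (\<Sum>i<n. indicator (A i) p :: real)"
            by (subst indicator_UN_disjoint) auto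
          then show ?thesis by (simp add: sum_distrib_right)
        qed
        show "\<bar>\<Sum>i<n. indicator (A i) p * ?I p\<bar> \<le> 1" for n p
          unfolding eq by (auto simp: indicator_def)
        show "(%n. \<Sum>i<n. indicator (A i) p * ?I p) \<longlonglongrightarrow> indicator (\<Union>(range A)) p * ?I p" for p
          unfolding eq
        proof (intro tendsto_mult tendsto_const)
          show "(%n. indicator (\<Union>i<n. A i) p :: real) \<longlonglongrightarrow> indicator (\<Union>(range A)) p"
            using LIMSEQ_indicator_UN[of A p] by simp
        qed
      qed
    qed
  qed
  obtain B where B: "0 \<le> B" "!!x. \<bar>f x\<bar> \<le> B" using bbm_bound[OF f] by metis
  note [measurable] = bbm_measurable[OF f]
  \<comment> \<open>The extra 1 leaves room for rounding down, so that
    \<open>\<lfloor>real (Suc n) * f p\<rfloor>\<close> lies in the index range of the sum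
    \<open>fn\<close>.\<close>
  define K where "K = nat \<lceil>B\<rceil> + 1"
  have KB: "B \<le> real K - 1" unfolding K_def by linarith
  define fn where "fn n p = (\<Sum>k\<in>{- int (K * Suc n)..int (K * Suc n)}. (real_of_int k / real (Suc n)) *
      (indicator {p. \<lfloor>real (Suc n) * f p\<rfloor> = k} p * ?I p))" for n p
  have fn: "fn n p = (real_of_int \<lfloor>real (Suc n) * f p\<rfloor> / real (Suc n)) * ?I p" for n p
  proof -
    have "\<bar>f p\<bar> \<le> real K - 1" using B(2)[of p] KB by linarith
    then have "\<bar>real (Suc n) * f p\<bar> \<le> real (Suc n) * (real K - 1)"
      by (simp add: abs_mult)
    moreover have "real (Suc n) * (real K - 1) \<le> real (K * Suc n) - 1" by (simp add: algebra_simps)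
    ultimately have "\<bar>real (Suc n) * f p\<bar> \<le> real (K * Suc n) - 1" by linarith
    moreover have "\<lfloor>y\<rfloor> \<in> {- int N..int N}" if "\<bar>y\<bar> \<le> real N - 1" for y :: real and N :: nat
      using that by (auto simp: le_floor_iff floor_le_iff)
    ultimately have "\<lfloor>real (Suc n) * f p\<rfloor> \<in> {- int (K * Suc n)..int (K * Suc n)}" by blast
    moreover have "fn n p = (\<Sum>k\<in>{- int (K * Suc n)..int (K * Suc n)}.
        if k = \<lfloor>real (Suc n) * f p\<rfloor> then (real_of_int k / real (Suc n)) * ?I p else 0)"
      unfolding fn_def by (intro sum.cong) (auto simp: indicator_def)
    ultimately show ?thesis by (subst (asm) sum.delta) auto
  qed
  have le: "\<bar>fn n p - f p * ?I p\<bar> \<le> 1 / real (Suc n)" for n p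
  proof -
    have "\<bar>real_of_int \<lfloor>real (Suc n) * f p\<rfloor> - real (Suc n) * f p\<bar> \<le> 1" by linarith
    note that = this
    have "\<bar>real_of_int \<lfloor>real (Suc n) * f p\<rfloor> / real (Suc n) - f p\<bar> \<le> 1 / real (Suc n)" (is "?l \<le> _")
    proof -
      have "?l = \<bar>(real_of_int \<lfloor>real (Suc n) * f p\<rfloor> - real (Suc n) * f p) / real (Suc n)\<bar>"
        by (simp add: diff_divide_distrib)
      also have "\<dots> \<le> 1 / real (Suc n)"
        unfolding abs_divide using that by (intro divide_mono) auto
      finally show ?thesis .
    qed
    then show ?thesis unfolding fn by (auto simp: indicator_def)
  qed
  have "Q (%p. f p * ?I p)"
  proof (rule Qlim[where F=fn and B="B + 1"])
    show "Q (fn n)" for n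
      unfolding fn_def by (intro Qsum Qscale Qset) measurable
    show "\<bar>fn n p\<bar> \<le> B + 1" for n p
    proof -
      have "\<bar>f p * ?I p\<bar> \<le> B" using B by (auto simp: indicator_def)
      moreover have "1 / real (Suc n) \<le> 1" by simp
      ultimately show ?thesis using le[of n p] by linarith
    qed
    show "(%n. fn n p) \<longlonglongrightarrow> f p * ?I p" for p
    proof (rule LIMSEQ_I)
      fix e :: real assume "0 < e"
      then obtain N where N: "1 / real (Suc N) < e" using nat_approx_posE by blast
      have "norm (fn n p - f p * ?I p) < e" if "n \<ge> N" for n
      proof -
        have "1 / real (Suc n) \<le> 1 / real (Suc N)" using that by (simp add: field_simps)
        then show ?thesis using le[of n p] N by simp
      qed
      then show "\<exists>no. \<forall>n\<ge>no. norm (fn n p - f p * ?I p) < e" by blast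
    qed
  qed
  then show ?thesis by (simp add: Q_def)
qed

text \<open>The planar principle is applied to the class of functions whose restriction to the axis
  \<open>(t, 0)\<close> satisfies \<open>P\<close>; monomials with a positive power of the second
  coordinate vanish there, so only powers of t have to be checked.\<close>

lemma bounded_borel_class1:
  fixes P :: "(real => real) => bool"
  assumes mono: "!!m. P (%t. t ^ m * indicator {-R..R} t)"
    and add: "!!f g. bbm f ==> bbm g ==> P f ==> P g ==> P (%t. f t + g t)"
    and scale: "!!f c. bbm f ==> P f ==> P (%t. c * f t)"
    and lim: "!!F f B. (!!n. bbm (F n)) ==> (!!n. P (F n)) ==> (!!n t. \<bar>F n t\<bar> \<le> B) ==>
         (!!t. (%n. F n t) \<longlonglongrightarrow> f t) ==> P f"
    and f: "bbm f"
  shows "P (%t. f t * indicator {-R..R} t)"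
proof -
  have restr: "bbm (%t. g (t, 0))" if g: "bbm g" for g :: "real \<times> real => real"
  proof -
    obtain B where "!!x. \<bar>g x\<bar> \<le> B" using bbm_bound[OF g] by metis
    moreover have "(%t. g (t, 0)) \<in> borel_measurable borel"
      using bbm_measurable[OF g] unfolding borel_prod[symmetric] by measurable
    ultimately show ?thesis by (intro bbmI)
  qed
  have ext: "bbm (%p::real \<times> real. f (fst p))" (is "bbm ?g")
  proof -
    obtain B where "!!x. \<bar>f x\<bar> \<le> B" using bbm_bound[OF f] by metis
    moreover have "?g \<in> borel_measurable borel"
      using bbm_measurable[OF f] unfolding borel_prod[symmetric] by measurable
    ultimately show ?thesis by (intro bbmI[where B=B]) auto
  qed
  have ind: "indicator (sq R) (t, 0) = (indicator {-R..R} t :: real)" for t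
    by (auto simp: sq_def indicator_def)
  have "P (%t. (f (fst (t, 0::real))) * indicator (sq R) (t, 0))"
  proof (rule bounded_borel_class2[where P="%g. P (%t. g (t, 0))", OF _ _ _ _ ext])
    fix m n
    show "P (%t. mono2 m n (t, 0) * indicator (sq R) (t, 0))"
    proof (cases n)
      case 0 then show ?thesis using mono[of m] by (simp add: mono2_def ind)
    next
      case (Suc k)
      have "bbm (%t::real. t ^ m * indicator {-R..R} t)"
        by (intro bbm_continuous_compact continuous_intros) auto
      from scale[OF this mono, of 0] show ?thesis using Suc by (simp add: mono2_def)
    qed
  next
    fix F :: "nat => real \<times> real => real" and f B
    assume F: "!!n. bbm (F n)" "!!n. P (%t. F n (t, 0))" "!!n p. \<bar>F n p\<bar> \<le> B"
      "!!p. (%n. F n p) \<longlonglongrightarrow> f p"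
    show "P (%t. f (t, 0))"
      by (rule lim[OF restr[OF F(1)] F(2) F(3) F(4)])
  next
    fix f g :: "real \<times> real => real"
    assume "bbm f" "bbm g" "P (%t. f (t, 0))" "P (%t. g (t, 0))"
    then show "P (%t. f (t, 0) + g (t, 0))" by (intro add restr)
  next
    fix f :: "real \<times> real => real" and c
    assume "bbm f" "P (%t. f (t, 0))"
    then show "P (%t. c * f (t, 0))" by (intro scale restr)
  qed
  then show ?thesis by (simp only: ind fst_conv)
qed

section \<open>Integrals of bounded Borel functions and uniqueness of measures with given
  moments\<close>

lemma integral_limit_bbm:
  assumes M: "finite_measure M" "sets M = sets borel"
    and F: "!!n. bbm (F n)" "!!n x. \<bar>F n x\<bar> \<le> B" "!!x. (%n. F n x) \<longlonglongrightarrow> f x"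
  shows "(%n. \<integral>x. F n x \<partial>M) \<longlonglongrightarrow> (\<integral>x. f x \<partial>M)"
proof -
  interpret finite_measure M by fact
  note [measurable_cong] = M(2)
  have [measurable]: "F n \<in> borel_measurable borel" for n using F(1) bbm_measurable by auto
  have [measurable]: "f \<in> borel_measurable borel" using bbm_LIMSEQ(1)[OF F] bbm_measurable by auto
  show ?thesis
    by (rule integral_dominated_convergence[where w="%_. B"]) (use F in auto)
qed

lemma integrable_bbm:
  assumes M: "finite_measure M" "sets M = sets borel" and f: "bbm f"
  shows "integrable M f"
proof -
  interpret finite_measure M by fact
  note [measurable_cong] = M(2)
  obtain B where "!!x. \<bar>f x\<bar> \<le> B" using bbm_bound[OF f] by metis
  then show ?thesis using bbm_measurable[OF f]
    by (intro integrable_const_bound[where B=B]) auto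
qed

lemma integral_AE_indicator:
  fixes f :: "'a::topological_space => 'b::{banach, second_countable_topology}"
  assumes "emeasure M (UNIV - A) = 0" "A \<in> sets borel" "sets M = sets borel" "f \<in> borel_measurable borel"
  shows "(\<integral>x. f x \<partial>M) = (\<integral>x. indicator A x *\<^sub>R f x \<partial>M)"
proof (rule integral_cong_AE)
  note [measurable_cong] = assms(3)
  note [measurable] = assms(2,4)
  show "f \<in> borel_measurable M" "(%x. indicator A x *\<^sub>R f x) \<in> borel_measurable M" by measurable
  have "UNIV - A \<in> null_sets M" using assms by (auto simp: null_sets_def)
  from AE_not_in[OF this] show "AE x in M. f x = indicator A x *\<^sub>R f x"
    by eventually_elim auto
qed

lemma measure_eqI_bbm:
  assumes M: "finite_measure M" "sets M = sets borel" and N: "finite_measure N" "sets N = sets borel"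
    and eq: "!!f. bbm f ==> (\<integral>x. f x \<partial>M) = (\<integral>x. f x \<partial>N)"
  shows "M = N"
proof (rule measure_eqI)
  interpret M: finite_measure M by fact
  interpret N: finite_measure N by fact
  show "sets M = sets N" using M N by simp
  fix A assume "A \<in> sets M"
  then have A: "A \<in> sets borel" "A \<in> sets M" "A \<in> sets N" using M N by auto
  from eq[OF bbm_indicator[OF A(1)]] have "measure M A = measure N A" using A by simp
  then show "emeasure M A = emeasure N A" by (simp add: M.emeasure_eq_measure N.emeasure_eq_measure)
qed

text \<open>On a common square both integrals are linear and continuous under bounded limits, and
  they agree on monomials; the class principle does the rest.\<close>

lemma moment_unique2:
  assumes M: "finite_measure M" "sets M = sets borel" "emeasure M (UNIV - sq R) = 0"
    and N: "finite_measure N" "sets N = sets borel" "emeasure N (UNIV - sq S) = 0"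
    and eq: "!!m n. (\<integral>p. mono2 m n p \<partial>M) = (\<integral>p. mono2 m n p \<partial>N)"
  shows "M = N"
proof (rule measure_eqI_bbm[OF M(1,2) N(1,2)])
  fix f :: "real \<times> real => real" assume f: "bbm f"
  define T where "T = max R S"
  have sub: "sq R \<subseteq> sq T" "sq S \<subseteq> sq T" by (auto simp: sq_def T_def)
  have MT: "emeasure M (UNIV - sq T) = 0"
    by (rule emeasure_eq_0[OF _ M(3)]) (use sub M(2) sq_borel[of R] in auto)
  have NT: "emeasure N (UNIV - sq T) = 0"
    by (rule emeasure_eq_0[OF _ N(3)]) (use sub N(2) sq_borel[of S] in auto)
  have c: "continuous_on UNIV (mono2 m n)" for m n
    by (auto simp: mono2_def intro!: continuous_intros)
  have "(\<integral>p. f p * indicator (sq T) p \<partial>M) = (\<integral>p. f p * indicator (sq T) p \<partial>N)"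
  proof (rule bounded_borel_class2[where P="%f. (\<integral>x. f x \<partial>M) = (\<integral>x. f x \<partial>N)", OF _ _ _ _ f])
    fix m n
    show "(\<integral>x. mono2 m n x * indicator (sq T) x \<partial>M) = (\<integral>x. mono2 m n x * indicator (sq T) x \<partial>N)"
      using eq[of m n] integral_AE_indicator[OF MT sq_borel M(2) borel_measurable_continuous_onI[OF c[of m n]]]
        integral_AE_indicator[OF NT sq_borel N(2) borel_measurable_continuous_onI[OF c[of m n]]]
      by (simp add: mult.commute)
  next
    fix F f B assume F: "!!n. bbm (F n)" "!!n. integral\<^sup>L M (F n) = integral\<^sup>L N (F n)"
      "!!n p. \<bar>F n p\<bar> \<le> B" "!!p. (%n. F n p) \<longlonglongrightarrow> f p"
    show "integral\<^sup>L M f = integral\<^sup>L N f"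
      using integral_limit_bbm[OF M(1,2) F(1,3,4)] integral_limit_bbm[OF N(1,2) F(1,3,4)] F(2)
      by (auto intro: LIMSEQ_unique)
  qed (auto simp: integrable_bbm[OF M(1,2)] integrable_bbm[OF N(1,2)])
  then show "integral\<^sup>L M f = integral\<^sup>L N f"
    using integral_AE_indicator[OF MT sq_borel M(2) bbm_measurable[OF f]]
      integral_AE_indicator[OF NT sq_borel N(2) bbm_measurable[OF f]] by (simp add: mult.commute)
qed

lemma moment_unique1:
  fixes M N :: "real measure"
  assumes M: "finite_measure M" "sets M = sets borel" "emeasure M (UNIV - {-R..R}) = 0"
    and N: "finite_measure N" "sets N = sets borel" "emeasure N (UNIV - {-S..S}) = 0"
    and eq: "!!m. (\<integral>t. t ^ m \<partial>M) = (\<integral>t. t ^ m \<partial>N)"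
  shows "M = N"
proof (rule measure_eqI_bbm[OF M(1,2) N(1,2)])
  fix f :: "real => real" assume f: "bbm f"
  define T where "T = max R S"
  have MT: "emeasure M (UNIV - {-T..T}) = 0"
    by (rule emeasure_eq_0[OF _ M(3)]) (use M(2) in \<open>auto simp: T_def\<close>)
  have NT: "emeasure N (UNIV - {-T..T}) = 0"
    by (rule emeasure_eq_0[OF _ N(3)]) (use N(2) in \<open>auto simp: T_def\<close>)
  have c: "continuous_on UNIV (%t::real. t ^ m)" for m
    by (auto intro!: continuous_intros)
  have T: "{-T..T} \<in> sets borel" by simp
  have "(\<integral>p. f p * indicator {-T..T} p \<partial>M) = (\<integral>p. f p * indicator {-T..T} p \<partial>N)"
  proof (rule bounded_borel_class1[where P="%f. (\<integral>x. f x \<partial>M) = (\<integral>x. f x \<partial>N)", OF _ _ _ _ f])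
    fix m
    show "(\<integral>x. x ^ m * indicator {-T..T} x \<partial>M) = (\<integral>x. x ^ m * indicator {-T..T} x \<partial>N)"
      using eq[of m] integral_AE_indicator[OF MT T M(2) borel_measurable_continuous_onI[OF c[of m]]]
        integral_AE_indicator[OF NT T N(2) borel_measurable_continuous_onI[OF c[of m]]]
      by (simp add: mult.commute)
  next
    fix F f B assume F: "!!n. bbm (F n)" "!!n. integral\<^sup>L M (F n) = integral\<^sup>L N (F n)"
      "!!n p. \<bar>F n p\<bar> \<le> B" "!!p. (%n. F n p) \<longlonglongrightarrow> f p"
    show "integral\<^sup>L M f = integral\<^sup>L N f"
      using integral_limit_bbm[OF M(1,2) F(1,3,4)] integral_limit_bbm[OF N(1,2) F(1,3,4)] F(2)
      by (auto intro: LIMSEQ_unique)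
  qed (auto simp: integrable_bbm[OF M(1,2)] integrable_bbm[OF N(1,2)])
  then show "integral\<^sup>L M f = integral\<^sup>L N f"
    using integral_AE_indicator[OF MT T M(2) bbm_measurable[OF f]]
      integral_AE_indicator[OF NT T N(2) bbm_measurable[OF f]] by (simp add: mult.commute)
qed

section \<open>The two-dimensional Hausdorff moment problem\<close>

text \<open>A point of the unit square is coded by a real number whose base 8 digits combine the binary
  digits of both coordinates; the inverse of this coding is uniformly continuous, which reduces weak
  compactness in the plane to Helly's theorem on the line.\<close>

definition bdig :: "real => nat => int" where
  "bdig x i = \<lfloor>2 ^ Suc i * x\<rfloor> mod 2"

definition cdig :: "real \<times> real => nat => int" where
  "cdig p i = bdig (fst p / 2) i + 2 * bdig (snd p / 2) i"

definition code :: "real \<times> real => real" where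
  "code p = (\<Sum>i. real_of_int (cdig p i) / 8 ^ Suc i)"

lemma bdig_range: "bdig x i = 0 \<or> bdig x i = 1"
  unfolding bdig_def by presburger

lemma cdig_range: "0 \<le> cdig p i" "cdig p i \<le> 3"
  using bdig_range[of "fst p / 2" i] bdig_range[of "snd p / 2" i] by (auto simp: cdig_def)

lemma geo8: "(%i. 3 / 8 ^ Suc i :: real) sums (3/7)"
proof -
  have "(%i. (3/8) * (1/8::real) ^ i) sums ((3/8) * (1 / (1 - 1/8)))"
    by (intro sums_mult geometric_sums) auto
  then show ?thesis by (simp add: power_divide)
qed

lemma code_summable: "summable (%i. real_of_int (cdig p i) / 8 ^ Suc i)"
proof (rule summable_comparison_test'[OF sums_summable[OF geo8], of 0])
  show "norm (real_of_int (cdig p n) / 8 ^ Suc n) \<le> 3 / 8 ^ Suc n" for n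
    using cdig_range[of p n] by (auto simp: field_simps)
qed

lemma code_range: "0 \<le> code p" "code p \<le> 1"
proof -
  show "0 \<le> code p" unfolding code_def
    by (rule suminf_nonneg[OF code_summable]) (use cdig_range in auto)
  have "code p \<le> (\<Sum>i. 3 / 8 ^ Suc i :: real)" unfolding code_def
    by (rule suminf_le[OF _ code_summable sums_summable[OF geo8]])
      (use cdig_range(2)[of p] in \<open>auto simp: divide_right_mono\<close>)
  also have "\<dots> = 3/7" using geo8 by (simp add: sums_iff)
  finally show "code p \<le> 1" by simp
qed

text \<open>The first different digit contributes at least one unit of its place; all later digits
  together contribute at most 3/8 + 3/64 + ... = 3/7 of that unit, which leaves 4/7.\<close>

lemma code_separates:
  assumes eq: "!!i. i < j ==> cdig p i = cdig q i" and ne: "cdig p j \<noteq> cdig q j"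
  shows "4/7 / 8 ^ Suc j \<le> \<bar>code p - code q\<bar>"
proof -
  let ?f = "%i. real_of_int (cdig p i - cdig q i) / 8 ^ Suc i"
  have sf: "summable ?f"
    using summable_diff[OF code_summable[of p] code_summable[of q]] by (simp add: diff_divide_distrib)
  have "code p - code q = suminf ?f"
    unfolding code_def by (subst suminf_diff[OF code_summable code_summable]) (simp add: diff_divide_distrib)
  also have "\<dots> = (\<Sum>i. ?f (i + Suc j)) + (\<Sum>i<Suc j. ?f i)"
    by (rule suminf_split_initial_segment[OF sf])
  also have "(\<Sum>i<Suc j. ?f i) = ?f j" using eq by (simp add: sum.neutral)
  finally have split: "code p - code q = (\<Sum>i. ?f (i + Suc j)) + ?f j" .
  have geo: "(%i. (1 / 8 ^ Suc j) * (3 / 8 ^ Suc i :: real)) sums ((1 / 8 ^ Suc j) * (3/7))"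
    by (intro sums_mult geo8)
  have bd: "norm (?f (i + Suc j)) \<le> (1 / 8 ^ Suc j) * (3 / 8 ^ Suc i)" for i
  proof -
    have "\<bar>real_of_int (cdig p (i + Suc j) - cdig q (i + Suc j))\<bar> \<le> 3"
      using cdig_range[of p "i + Suc j"] cdig_range[of q "i + Suc j"] by linarith
    then have "norm (?f (i + Suc j)) \<le> 3 / 8 ^ Suc (i + Suc j)"
      by (simp add: divide_right_mono del: power_Suc)
    also have "\<dots> = (1 / 8 ^ Suc j) * (3 / 8 ^ Suc i)" by (simp add: power_add)
    finally show ?thesis .
  qed
  have "norm (\<Sum>i. ?f (i + Suc j)) \<le> (\<Sum>i. (1 / 8 ^ Suc j) * (3 / 8 ^ Suc i :: real))"
    by (rule norm_suminf_le[OF bd sums_summable[OF geo]])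
  also have "\<dots> = 3/7 / 8 ^ Suc j" using geo by (simp add: sums_iff)
  finally have tail: "\<bar>\<Sum>i. ?f (i + Suc j)\<bar> \<le> 3/7 / 8 ^ Suc j" by simp
  have "1 \<le> \<bar>real_of_int (cdig p j - cdig q j)\<bar>" using ne by linarith
  then have "1 / 8 ^ Suc j \<le> \<bar>?f j\<bar>"
    by (simp add: divide_right_mono del: power_Suc)
  moreover have "(1::real) / 8 ^ Suc j = 3/7 / 8 ^ Suc j + 4/7 / 8 ^ Suc j"
    by (simp add: field_simps)
  ultimately show ?thesis using tail unfolding split by linarith
qed

text \<open>The integer parts satisfy \<open>\<lfloor>2 ^ Suc i * z\<rfloor> = 2 * \<lfloor>2 ^ i *
  z\<rfloor> + bdig z i\<close>, so equal digits propagate the equality of integer parts.\<close>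

lemma bdig_eq_close:
  assumes eq: "!!i. i < k ==> bdig x i = bdig y i" and fl: "\<lfloor>x\<rfloor> = \<lfloor>y\<rfloor>"
  shows "\<bar>x - y\<bar> \<le> 1 / 2 ^ k"
proof -
  have step: "\<lfloor>2 ^ Suc i * z\<rfloor> = 2 * \<lfloor>2 ^ i * z\<rfloor> + bdig z i" for i and z :: real
  proof -
    have "\<lfloor>2 ^ i * z\<rfloor> = \<lfloor>2 ^ Suc i * z\<rfloor> div 2"
    proof -
      have "\<lfloor>2 ^ i * z\<rfloor> = \<lfloor>(2 ^ Suc i * z) / real_of_int 2\<rfloor>" by simp
      then show ?thesis using floor_divide_real_eq_div[of 2 "2 ^ Suc i * z"] by simp
    qed
    then show ?thesis unfolding bdig_def by simp
  qed
  have "\<lfloor>2 ^ k * x\<rfloor> = \<lfloor>2 ^ k * y\<rfloor>"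
    using eq
  proof (induction k)
    case 0 then show ?case using fl by simp
  next
    case (Suc k) then show ?case using step[of k x] step[of k y] by simp
  qed
  then have "\<bar>2 ^ k * x - 2 ^ k * y\<bar> \<le> 1" by linarith
  then have "2 ^ k * \<bar>x - y\<bar> \<le> 1" by (simp add: right_diff_distrib[symmetric] abs_mult)
  then show ?thesis by (simp add: field_simps)
qed

text \<open>Contrapositive of \<open>code_separates\<close>: close codes share their first k digits.
  In the 4, one factor 2 undoes the halving in \<open>cdig\<close> and the other adds up the two
  coordinates.\<close>

lemma code_inverse_close:
  assumes p: "p \<in> {0..1} \<times> {0..1}" and q: "q \<in> {0..1} \<times> {0..1}"
    and close: "\<bar>code p - code q\<bar> < 4/7 / 8 ^ k"
  shows "dist p q \<le> 4 / 2 ^ k"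
proof -
  have ceq: "cdig p i = cdig q i" if "i < k" for i
    using that
  proof (induction i rule: less_induct)
    case (less i)
    show ?case
    proof (rule ccontr)
      assume "cdig p i \<noteq> cdig q i"
      then have "4/7 / 8 ^ Suc i \<le> \<bar>code p - code q\<bar>"
        using less by (intro code_separates) auto
      moreover have "(8::real) ^ Suc i \<le> 8 ^ k" using less.prems by (intro power_increasing) auto
      then have "4/7 / 8 ^ k \<le> (4/7 / 8 ^ Suc i :: real)"
        by (intro divide_left_mono) auto
      ultimately show False using close by linarith
    qed
  qed
  have beq: "bdig (fst p / 2) i = bdig (fst q / 2) i" "bdig (snd p / 2) i = bdig (snd q / 2) i" if "i < k" for i
    using ceq[OF that] bdig_range[of "fst p / 2" i] bdig_range[of "snd p / 2" i]
      bdig_range[of "fst q / 2" i] bdig_range[of "snd q / 2" i]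
    unfolding cdig_def by auto
  have fl: "\<lfloor>u / 2\<rfloor> = 0" if "u \<in> {0..1}" for u :: real
    using that by (simp add: floor_eq_iff)
  have "\<bar>fst p / 2 - fst q / 2\<bar> \<le> 1 / 2 ^ k" "\<bar>snd p / 2 - snd q / 2\<bar> \<le> 1 / 2 ^ k"
    using beq fl p q by (auto intro!: bdig_eq_close)
  then have "\<bar>fst p - fst q\<bar> \<le> 2 / 2 ^ k" "\<bar>snd p - snd q\<bar> \<le> 2 / 2 ^ k" by auto
  moreover have "dist p q \<le> \<bar>fst p - fst q\<bar> + \<bar>snd p - snd q\<bar>"
    unfolding dist_prod_def dist_real_def by (rule order_trans[OF sqrt_sum_squares_le_sum_abs]) simp
  ultimately show ?thesis by simp
qed

text \<open>The inverse of \<open>code\<close> is uniformly continuous on the image of the square,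
  extends to its closure, and from there to the line by Tietze's theorem; the bound 2 for the norm
  on the square survives both extensions.\<close>

lemma decode_exists:
  obtains g :: "real => real \<times> real" where
    "continuous_on UNIV g" "!!x. norm (g x) \<le> 2" "!!p. p \<in> {0..1} \<times> {0..1} ==> g (code p) = p"
proof -
  let ?Q = "{0..1} \<times> {0..1} :: (real \<times> real) set"
  define S where "S = code ` ?Q"
  define h where "h = inv_into ?Q code"
  have hc: "h (code p) = p" if "p \<in> ?Q" for p
  proof -
    have hp: "h (code p) \<in> ?Q" "code (h (code p)) = code p"
      using that unfolding h_def by (auto intro: inv_into_into f_inv_into_f)
    have "dist (h (code p)) p \<le> 4 / 2 ^ k" for k
      by (rule code_inverse_close) (use hp that in auto)
    moreover have "(%k. 4 / 2 ^ k :: real) \<longlonglongrightarrow> 0" by real_asymp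
    ultimately have "dist (h (code p)) p \<le> 0"
      by (intro tendsto_lowerbound[where F=sequentially and f="%k. 4 / 2 ^ k"]) auto
    then show ?thesis by simp
  qed
  have "uniformly_continuous_on S h"
    unfolding uniformly_continuous_on_def
  proof (intro allI impI)
    fix e :: real assume e: "0 < e"
    have "(%k. 4 / 2 ^ k :: real) \<longlonglongrightarrow> 0" by real_asymp
    then have "eventually (%k. 4 / 2 ^ k < e) sequentially" using e by (rule order_tendstoD)
    then obtain k where k: "4 / 2 ^ k < e" by (auto simp: eventually_sequentially)
    show "\<exists>d>0. \<forall>x\<in>S. \<forall>x'\<in>S. dist x' x < d \<longrightarrow> dist (h x') (h x) < e"
    proof (intro exI[of _ "4/7 / 8 ^ k"] conjI ballI impI)
      fix x x' assume "x \<in> S" "x' \<in> S" and d: "dist x' x < 4/7 / 8 ^ k"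
      then obtain p p' where p: "p \<in> ?Q" "x = code p" "p' \<in> ?Q" "x' = code p'" by (auto simp: S_def)
      have "dist p' p \<le> 4 / 2 ^ k" using p d by (intro code_inverse_close) (auto simp: dist_real_def)
      then show "dist (h x') (h x) < e" using p hc k by simp
    qed simp
  qed
  then obtain g0 where g0: "uniformly_continuous_on (closure S) g0" "!!x. x \<in> S ==> h x = g0 x"
    using uniformly_continuous_on_extension_on_closure[of S h] by (metis (no_types, lifting))
  have nQ: "norm p \<le> 2" if "p \<in> ?Q" for p
  proof -
    have "norm p \<le> norm (fst p) + norm (snd p)" by (cases p) (simp add: norm_Pair sqrt_sum_squares_le_sum_abs)
    then show ?thesis using that by auto
  qed
  have c0: "continuous_on (closure S) g0" using g0(1) by (rule uniformly_continuous_imp_continuous)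
  have n0: "norm (g0 x) \<le> 2" if "x \<in> closure S" for x
  proof -
    have "x \<in> {x \<in> closure S. norm (g0 x) \<le> 2}"
    proof -
      have "closed {x \<in> closure S. norm (g0 x) \<le> 2}"
        by (intro continuous_on_closed_Collect_le continuous_on_norm c0 continuous_on_const closed_closure)
      moreover have "S \<subseteq> {x \<in> closure S. norm (g0 x) \<le> 2}"
        using g0(2) hc nQ closure_subset[of S] by (auto simp: S_def)
      ultimately show ?thesis using closure_minimal that by blast
    qed
    then show ?thesis by simp
  qed
  obtain g where g: "continuous_on UNIV g" "!!x. x \<in> closure S ==> g x = g0 x" "!!x. norm (g x) \<le> 2"
    using Tietze[of "closure S" g0 UNIV 2] c0 n0 by auto
  show ?thesis
  proof (rule that[OF g(1,3)])
    fix p assume p: "p \<in> ?Q"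
    then have "code p \<in> S" by (simp add: S_def)
    then have "g (code p) = h (code p)" using g(2) g0(2) closure_subset[of S] by auto
    then show "g (code p) = p" using hc p by simp
  qed
qed

text \<open>The coded measures live on [0,1] and are tight, so a subsequence converges weakly;
  transporting the limit by the continuous \<open>g\<close> keeps the moments. Since
  \<open>g\<close> is only known to be bounded by 2, the result is located on \<open>sq 2\<close>
  rather than on the unit square.\<close>

lemma discrete_moment_limit:
  fixes I :: "nat => 'i set" and w :: "nat => 'i => real" and z :: "nat => 'i => real \<times> real"
  assumes fin: "!!n. finite (I n)" and w0: "!!n i. i \<in> I n ==> 0 \<le> w n i"
    and w1: "!!n. (\<Sum>i\<in>I n. w n i) = 1" and z: "!!n i. i \<in> I n ==> z n i \<in> {0..1} \<times> {0..1}"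
    and lim: "!!a b. (%n. \<Sum>i\<in>I n. w n i * mono2 a b (z n i)) \<longlonglongrightarrow> m a b"
  shows "\<exists>M. prob_space M \<and> sets M = sets borel \<and> emeasure M (UNIV - sq 2) = 0 \<and>
      (\<forall>a b. (\<integral>p. mono2 a b p \<partial>M) = m a b)"
proof -
  obtain g :: "real => real \<times> real" where
    g: "continuous_on UNIV g" "!!x. norm (g x) \<le> 2" "!!p. p \<in> {0..1} \<times> {0..1} ==> g (code p) = p"
    using decode_exists by metis
  have gm[measurable]: "g \<in> borel_measurable borel"
    using borel_measurable_continuous_onI[OF g(1)] .
  define D where "D n = point_measure (I n) (%i. ennreal (w n i))" for n
  have spD: "space (D n) = I n" "sets (D n) = Pow (I n)" for n
    by (auto simp: D_def space_point_measure sets_point_measure)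
  have pD: "prob_space (D n)" for n
  proof
    have "emeasure (D n) (I n) = (\<Sum>i\<in>I n. ennreal (w n i))"
      unfolding D_def by (rule emeasure_point_measure_finite[OF fin]) auto
    also have "\<dots> = ennreal (\<Sum>i\<in>I n. w n i)" by (rule sum_ennreal) (use w0 in auto)
    finally show "emeasure (D n) (space (D n)) = 1" by (simp add: spD w1)
  qed
  define \<nu> where "\<nu> n = distr (D n) borel (%i. code (z n i))" for n
  have mz: "(%i. code (z n i)) \<in> measurable (D n) borel" for n
    by (auto simp: measurable_def spD)
  have rd: "real_distribution (\<nu> n)" for n
  proof -
    interpret prob_space "D n" by (rule pD)
    show ?thesis unfolding \<nu>_def by (rule real_distribution_distr[OF mz])
  qed
  have int: "(\<integral>x. f x \<partial>\<nu> n) = (\<Sum>i\<in>I n. w n i * f (code (z n i)))"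
    if "f \<in> borel_measurable borel" for f :: "real => real" and n
  proof -
    have "(\<integral>x. f x \<partial>\<nu> n) = (\<integral>i. f (code (z n i)) \<partial>D n)"
      unfolding \<nu>_def by (rule integral_distr[OF mz that])
    also have "\<dots> = (\<Sum>i\<in>I n. w n i *\<^sub>R f (code (z n i)))"
      unfolding D_def by (rule lebesgue_integral_point_measure_finite[OF fin]) (use w0 in auto)
    finally show ?thesis by simp
  qed
  have "tight \<nu>"
    unfolding tight_def
  proof (intro conjI allI impI rd)
    fix e :: real assume "0 < e"
    show "\<exists>a b. a < b \<and> (\<forall>n. 1 - e < measure (\<nu> n) {a<..b})"
    proof (rule exI[of _ "-1"], rule exI[of _ 1], intro conjI allI)
      fix n
      interpret prob_space "D n" by (rule pD)
      have "measure (\<nu> n) {-1<..1} = measure (D n) ((%i. code (z n i)) -` {-1<..1} \<inter> space (D n))"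
        unfolding \<nu>_def by (rule measure_distr[OF mz]) auto
      also have "(%i. code (z n i)) -` {-1<..1} \<inter> space (D n) = space (D n)"
      proof -
        have "code q \<in> {-1<..1}" for q using code_range[of q] by simp
        then show ?thesis by blast
      qed
      finally show "1 - e < measure (\<nu> n) {-1<..1}" using \<open>0 < e\<close> prob_space by simp
    qed simp
  qed
  from tight_imp_convergent_subsubsequence[OF this strict_mono_id] obtain r M0 where
    r: "strict_mono r" "real_distribution M0" "weak_conv_m (\<nu> \<circ> id \<circ> r) M0"
    by (auto simp: id_def)
  define M where "M = distr M0 borel g"
  interpret M0: real_distribution M0 by fact
  have gM0: "g \<in> measurable M0 borel" using gm by measurable
  have "(\<integral>p. mono2 a b p \<partial>M) = m a b" for a b
  proof -
    have cm: "continuous_on UNIV (%x. mono2 a b (g x))"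
      by (rule continuous_on_compose2[OF continuous_mono2 g(1)]) auto
    have fb: "\<bar>fst (g x)\<bar> \<le> 2" "\<bar>snd (g x)\<bar> \<le> 2" for x
      using norm_fst_le[of "fst (g x)" "snd (g x)"] norm_snd_le[of "snd (g x)" "fst (g x)"] g(2)[of x]
      by auto
    have bd: "norm (mono2 a b (g x)) \<le> 2 ^ a * 2 ^ b" for x
      using fb[of x] by (auto simp: mono2_def abs_mult power_abs intro!: mult_mono power_mono)
    have "(%n. \<integral>x. mono2 a b (g x) \<partial>(\<nu> \<circ> id \<circ> r) n) \<longlonglongrightarrow> (\<integral>x. mono2 a b (g x) \<partial>M0)"
      by (rule weak_conv_imp_integral_bdd_continuous_conv[OF _ r(2,3) _ bd])
        (use cm rd in \<open>auto simp: continuous_on_eq_continuous_at\<close>)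
    moreover have "(\<integral>x. mono2 a b (g x) \<partial>(\<nu> \<circ> id \<circ> r) n) = (\<Sum>i\<in>I (r n). w (r n) i * mono2 a b (z (r n) i))" for n
      using int[OF borel_measurable_continuous_onI[OF cm], of "r n"] z g(3) by simp
    moreover have "(%n. (\<Sum>i\<in>I (r n). w (r n) i * mono2 a b (z (r n) i))) \<longlonglongrightarrow> m a b"
      using LIMSEQ_subseq_LIMSEQ[OF lim r(1)] by (simp add: o_def)
    ultimately have "(\<integral>x. mono2 a b (g x) \<partial>M0) = m a b" by (auto intro: LIMSEQ_unique)
    then show ?thesis unfolding M_def
      by (subst integral_distr[OF gM0 borel_measurable_continuous_onI[OF continuous_mono2]])
  qed
  moreover have "prob_space M" unfolding M_def by (rule M0.prob_space_distr[OF gM0])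
  moreover have "emeasure M (UNIV - sq 2) = 0"
  proof -
    have "g -` (UNIV - sq 2) = {}"
    proof -
      have "g x \<in> sq 2" for x
        using norm_fst_le[of "fst (g x)" "snd (g x)"] norm_snd_le[of "snd (g x)" "fst (g x)"] g(2)[of x]
        by (cases "g x") (auto simp: sq_def)
      then show ?thesis by blast
    qed
    then show ?thesis unfolding M_def by (subst emeasure_distr[OF gM0]) auto
  qed
  ultimately show ?thesis unfolding M_def by (intro exI[of _ "distr M0 borel g"]) auto
qed

section \<open>Moment functionals on pairs of polynomials and Bernstein weights\<close>

definition mfun :: "(nat => nat => real) => real poly => real poly => real" where
  "mfun m p q = (\<Sum>i\<le>degree p. \<Sum>j\<le>degree q. coeff p i * coeff q j * m i j)"

lemma mfun_altdef:
  assumes "degree p \<le> N" "degree q \<le> M"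
  shows "mfun m p q = (\<Sum>i\<le>N. \<Sum>j\<le>M. coeff p i * coeff q j * m i j)"
proof -
  have "(\<Sum>i\<le>N. \<Sum>j\<le>M. coeff p i * coeff q j * m i j) = (\<Sum>i\<le>degree p. \<Sum>j\<le>M. coeff p i * coeff q j * m i j)"
    using assms by (intro sum.mono_neutral_right) (auto simp: coeff_eq_0)
  also have "\<dots> = mfun m p q"
    unfolding mfun_def using assms
    by (intro sum.cong refl sum.mono_neutral_right) (auto simp: coeff_eq_0)
  finally show ?thesis by simp
qed

lemma mfun_add_left: "mfun m (p + p') q = mfun m p q + mfun m p' q"
proof -
  let ?N = "max (degree p) (degree p')"
  have "degree (p + p') \<le> ?N" by (rule degree_add_le_max)
  then show ?thesis
    by (simp add: mfun_altdef[of _ ?N _ "degree q"] sum.distrib[symmetric] algebra_simps)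
qed

lemma mfun_add_right: "mfun m p (q + q') = mfun m p q + mfun m p q'"
proof -
  let ?N = "max (degree q) (degree q')"
  have "degree (q + q') \<le> ?N" by (rule degree_add_le_max)
  then show ?thesis
    by (simp add: mfun_altdef[of _ "degree p" _ ?N] sum.distrib[symmetric] algebra_simps)
qed

lemma mfun_smult_left: "mfun m (smult c p) q = c * mfun m p q"
  using degree_smult_le[of c p]
  by (simp add: mfun_altdef[of _ "degree p" _ "degree q"] sum_distrib_left mult.assoc)

lemma mfun_smult_right: "mfun m p (smult c q) = c * mfun m p q"
  using degree_smult_le[of c q]
  by (simp add: mfun_altdef[of _ "degree p" _ "degree q"] sum_distrib_left mult_ac)

lemma mfun_0_left: "mfun m 0 q = 0" and mfun_0_right: "mfun m p 0 = 0"
  by (simp_all add: mfun_def)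

lemma mfun_sum_left: "mfun m (\<Sum>i\<in>I. p i) q = (\<Sum>i\<in>I. mfun m (p i) q)"
  by (induction I rule: infinite_finite_induct) (auto simp: mfun_0_left mfun_add_left)

lemma mfun_sum_right: "mfun m p (\<Sum>i\<in>I. q i) = (\<Sum>i\<in>I. mfun m p (q i))"
  by (induction I rule: infinite_finite_induct) (auto simp: mfun_0_right mfun_add_right)

lemma X_power: "[:0, 1:] ^ n = monom (1::real) n"
  by (simp add: monom_altdef)

lemma mfun_monom: "mfun m ([:0, 1:] ^ a) ([:0, 1:] ^ b) = m a b"
proof -
  have "mfun m ([:0, 1:] ^ a) ([:0, 1:] ^ b) = (\<Sum>i\<le>a. \<Sum>j\<le>b. if i = a then (if j = b then m a b else 0) else 0)"
    by (subst mfun_altdef[of _ a _ b])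
      (auto simp: X_power degree_monom_le coeff_monom intro!: sum.cong)
  also have "\<dots> = (\<Sum>i\<le>a. if i = a then (\<Sum>j\<le>b. if j = b then m a b else 0) else 0)"
    by (intro sum.cong) auto
  finally show ?thesis by (simp add: sum.delta)
qed

lemma poly_as_sum_X: "p = (\<Sum>i\<le>degree p. smult (coeff p i) ([:0, 1:] ^ i))" for p :: "real poly"
  using poly_as_sum_of_monoms[of p] by (simp add: X_power smult_monom)

text \<open>Bilinear forms on polynomials are determined by their values on monomials; this
  identifies a substituted functional, or an integral, with \<open>mfun\<close>.\<close>

lemma mfun_unique:
  assumes "!!p p' q. L (p + p') q = L p q + L p' q" "!!p q q'. L p (q + q') = L p q + L p q'"
    "!!c p q. L (smult c p) q = c * L p q" "!!c p q. L p (smult c q) = c * (L p q :: real)"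
    "!!a b. L ([:0, 1:] ^ a) ([:0, 1:] ^ b) = m a b"
  shows "L p q = mfun m p q"
proof -
  have 0: "L 0 q = 0" "L p 0 = 0" for p q using assms(3)[of 0 0 q] assms(4)[of p 0 0] by auto
  have suml: "L (\<Sum>i\<in>I. f i) q = (\<Sum>i\<in>I. L (f i) q)" for I :: "nat set" and f q
    by (induction I rule: infinite_finite_induct) (auto simp: 0 assms)
  have sumr: "L p (\<Sum>i\<in>I. f i) = (\<Sum>i\<in>I. L p (f i))" for I :: "nat set" and f p
    by (induction I rule: infinite_finite_induct) (auto simp: 0 assms)
  have "L p q = L (\<Sum>i\<le>degree p. smult (coeff p i) ([:0, 1:] ^ i)) (\<Sum>i\<le>degree q. smult (coeff q i) ([:0, 1:] ^ i))"
    by (simp add: poly_as_sum_X[symmetric])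
  also have "\<dots> = mfun m p q"
    unfolding mfun_def suml sumr by (subst sum.swap) (simp add: assms sum_distrib_left mult_ac)
  finally show ?thesis .
qed

definition bern :: "nat => nat => real poly" where
  "bern k l = [:0, 1:] ^ k * [:1, -1:] ^ l"

text \<open>Factor out X^a and expand 1 = (X + (1 - X))^(n - a); \<open>choose_mult\<close> rewrites
  the binomial coefficients of that expansion. The quotient of binomials plays the part of (k/n)^a,
  but makes the identity exact.\<close>

lemma bern_sum:
  assumes "a \<le> n"
  shows "(\<Sum>k\<le>n. smult (real (k choose a) / real (n choose a) * real (n choose k)) (bern k (n - k))) = [:0, 1:] ^ a"
proof -
  have "(\<Sum>k\<le>n. smult (real (k choose a) / real (n choose a) * real (n choose k)) (bern k (n - k)))
      = (\<Sum>k\<in>{a..n}. smult (real (k choose a) / real (n choose a) * real (n choose k)) (bern k (n - k)))"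
    by (rule sum.mono_neutral_right) (auto simp: binomial_eq_0)
  also have "\<dots> = (\<Sum>k\<in>{a..n}. smult (real ((n - a) choose (k - a))) (bern k (n - k)))"
  proof (intro sum.cong refl)
    fix k assume k: "k \<in> {a..n}"
    have "(n choose k) * (k choose a) = (n choose a) * ((n - a) choose (k - a))"
      using k by (intro choose_mult) auto
    then have "real (n choose k) * real (k choose a) = real (n choose a) * real ((n - a) choose (k - a))"
      by (metis of_nat_mult)
    moreover have "real (n choose a) \<noteq> 0" using assms by simp
    ultimately have "real (k choose a) / real (n choose a) * real (n choose k) = real ((n - a) choose (k - a))"
      by (simp add: field_simps)
    then show "smult (real (k choose a) / real (n choose a) * real (n choose k)) (bern k (n - k)) =
        smult (real ((n - a) choose (k - a))) (bern k (n - k))" by simp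
  qed
  also have "\<dots> = (\<Sum>i\<le>n - a. smult (real ((n - a) choose i)) (bern (i + a) (n - a - i)))"
    by (rule sum.reindex_bij_witness[of _ "%i. i + a" "%k. k - a"]) (use assms in auto)
  also have "\<dots> = [:0, 1:] ^ a * (\<Sum>i\<le>n - a. of_nat ((n - a) choose i) * [:0, 1:] ^ i * [:1, -1:] ^ (n - a - i))"
    unfolding sum_distrib_left
    by (intro sum.cong refl) (simp add: bern_def power_add of_nat_poly mult_ac)
  also have "(\<Sum>i\<le>n - a. of_nat ((n - a) choose i) * [:0, 1:] ^ i * [:1, -1:] ^ (n - a - i)) = ([:0, 1:] + [:1, -1:] :: real poly) ^ (n - a)"
    by (rule binomial_ring[symmetric])
  also have "[:0, 1:] + [:1, -1:] = (1 :: real poly)" by (simp add: one_pCons)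
  finally show ?thesis by simp
qed

text \<open>Both numbers are products of a factors of modulus at most 1, namely (k - i)/(n - i) and
  k/n, which differ by at most a/(n - a). For k < i the first modulus is controlled by 2a <
  n.\<close>

lemma factorial_ratio_close:
  assumes n: "2 * a < n" and k: "k \<le> n"
  shows "\<bar>real (k choose a) / real (n choose a) - (real k / real n) ^ a\<bar> \<le> real a * (real a / real (n - a))"
proof -
  have ch: "real (k choose a) / real (n choose a) = (\<Prod>i\<in>{0..<a}. (real k - real i) / (real n - real i))"
  proof -
    have "real (j choose a) = (\<Prod>i\<in>{0..<a}. real j - real i) / fact a" for j
      by (simp add: binomial_gbinomial gbinomial_prod_rev)
    then show ?thesis by (simp add: prod_dividef)
  qed
  have pw: "(real k / real n) ^ a = (\<Prod>i\<in>{0..<a}. real k / real n)" by simp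
  have "\<bar>real (k choose a) / real (n choose a) - (real k / real n) ^ a\<bar>
      \<le> (\<Sum>i\<in>{0..<a}. norm ((real k - real i) / (real n - real i) - real k / real n))"
    unfolding ch pw real_norm_def[symmetric]
  proof (rule norm_prod_diff)
    fix i assume i: "i \<in> {0..<a}"
    then have "\<bar>real k - real i\<bar> \<le> real n - real i" "0 < real n - real i" using n k by auto
    then show "norm ((real k - real i) / (real n - real i)) \<le> 1" by simp
    show "norm (real k / real n) \<le> 1" using n k by simp
  qed
  also have "\<dots> \<le> (\<Sum>i\<in>{0..<a}. real a / real (n - a))"
  proof (rule sum_mono)
    fix i assume i: "i \<in> {0..<a}"
    have pos: "0 < real n - real i" "0 < real n" "0 < real (n - a)" using i n by auto
    have "(real k - real i) / (real n - real i) - real k / real n = - (real i * (real n - real k)) / ((real n - real i) * real n)"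
      using pos by (simp add: field_simps)
    then have "norm ((real k - real i) / (real n - real i) - real k / real n) = (real i / (real n - real i)) * ((real n - real k) / real n)"
      using pos k by (simp add: abs_mult abs_divide)
    also have "\<dots> \<le> (real i / (real n - real i)) * 1"
      using pos k by (intro mult_left_mono) auto
    also have "\<dots> \<le> real a / real (n - a)"
      using i n by (simp add: frac_le of_nat_diff)
    finally show "norm ((real k - real i) / (real n - real i) - real k / real n) \<le> real a / real (n - a)" .
  qed
  finally show ?thesis by simp
qed

text \<open>The values on Bernstein products are nonnegative weights on the grid (k/n, j/n) with
  total mass \<open>m 0 0\<close>. By \<open>bern_sum\<close> their factorial moments are exactly
  \<open>m a b\<close>; hence their ordinary moments converge to \<open>m a b\<close>, and
  \<open>discrete_moment_limit\<close> applies.\<close>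

lemma hausdorff_unit:
  assumes pos: "!!k l i j. 0 \<le> mfun m (bern k l) (bern i j)" and m00: "m 0 0 \<noteq> 0"
  shows "\<exists>M. prob_space M \<and> sets M = sets borel \<and> emeasure M (UNIV - sq 2) = 0 \<and>
      (\<forall>a b. (\<integral>p. mono2 a b p \<partial>M) = m a b / m 0 0)"
proof -
  define W where "W n k j = real (n choose k) * real (n choose j) * mfun m (bern k (n - k)) (bern j (n - j))" for n k j
  have W0: "0 \<le> W n k j" for n k j unfolding W_def using pos by simp
  have exact: "(\<Sum>(k,j)\<in>{..n} \<times> {..n}. W n k j * ((real (k choose a) / real (n choose a)) * (real (j choose b) / real (n choose b)))) = m a b"
    if "a \<le> n" "b \<le> n" for a b n
  proof -
    have "m a b = mfun m ([:0, 1:] ^ a) ([:0, 1:] ^ b)" by (simp add: mfun_monom)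
    also have "\<dots> = (\<Sum>k\<le>n. \<Sum>j\<le>n. W n k j * ((real (k choose a) / real (n choose a)) * (real (j choose b) / real (n choose b))))"
      unfolding bern_sum[OF that(1), symmetric] bern_sum[OF that(2), symmetric]
      unfolding mfun_sum_left mfun_sum_right mfun_smult_left mfun_smult_right W_def
      by (subst sum.swap) (intro sum.cong refl, simp add: sum_distrib_left mult_ac)
    finally show ?thesis by (simp add: sum.cartesian_product)
  qed
  have tot: "(\<Sum>(k,j)\<in>{..n} \<times> {..n}. W n k j) = m 0 0" for n
    using exact[of 0 n 0] by simp
  have gen: "(\<Sum>(k,j)\<in>S. W n k j * c) = (\<Sum>(k,j)\<in>S. W n k j) * c" for n S c
    by (simp add: sum_distrib_right split_def)
  have m0: "0 < m 0 0"
  proof -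
    have "0 \<le> (\<Sum>(k,j)\<in>{..0::nat} \<times> {..0}. W 0 k j)" by (intro sum_nonneg) (auto simp: W0)
    then show ?thesis using tot[of 0] m00 by simp
  qed
  show ?thesis
  proof (rule discrete_moment_limit[where I="%n. {..Suc n} \<times> {..Suc n}"
        and w="%n (k,j). W (Suc n) k j / m 0 0" and z="%n (k,j). (real k / real (Suc n), real j / real (Suc n))"])
    show "(\<Sum>i\<in>{..Suc n} \<times> {..Suc n}. case i of (k, j) => W (Suc n) k j / m 0 0) = 1" for n
    proof -
      have "(\<Sum>i\<in>{..Suc n} \<times> {..Suc n}. case i of (k, j) => W (Suc n) k j / m 0 0)
          = (\<Sum>(k,j)\<in>{..Suc n} \<times> {..Suc n}. W (Suc n) k j) / m 0 0"
        unfolding sum_divide_distrib by (intro sum.cong) auto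
      then show ?thesis using tot[of "Suc n"] m0 by simp
    qed
    fix a b
    define D where "D n = (\<Sum>i\<in>{..n} \<times> {..n}. case i of (k,j) => W n k j * ((real k / real n) ^ a * (real j / real n) ^ b))" for n
    have close: "\<bar>D n - m a b\<bar> \<le> m 0 0 * (real a * (real a / real (n - a)) + real b * (real b / real (n - b)))"
      if n: "2 * a < n" "2 * b < n" for n
    proof -
      let ?e = "real a * (real a / real (n - a)) + real b * (real b / real (n - b))"
      define S where "S = (\<Sum>(k,j)\<in>{..n} \<times> {..n}. W n k j * ((real k / real n) ^ a * (real j / real n) ^ b
          - (real (k choose a) / real (n choose a)) * (real (j choose b) / real (n choose b))))"
      have eq: "D n - m a b = S"
        using n unfolding D_def S_def by (subst exact[of a n b, symmetric])
          (auto simp: sum_subtractf[symmetric] algebra_simps split_def)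
      have "\<bar>S\<bar> \<le> (\<Sum>(k,j)\<in>{..n} \<times> {..n}. W n k j * ?e)"
        unfolding S_def
      proof (rule order_trans[OF sum_abs], rule sum_mono)
        fix i assume "i \<in> {..n} \<times> {..n}"
        then obtain k j where i: "i = (k, j)" and kj: "k \<le> n" "j \<le> n" by auto
        let ?x = "real k / real n" and ?y = "real j / real n"
        let ?r = "real (k choose a) / real (n choose a)" and ?s = "real (j choose b) / real (n choose b)"
        have 1: "\<bar>?x ^ a\<bar> \<le> 1" using kj n by (simp add: power_le_one)
        have 2: "\<bar>?s\<bar> \<le> 1" using kj n by (auto intro!: binomial_right_mono simp: divide_le_eq_1)
        have "?x ^ a * ?y ^ b - ?r * ?s = ?x ^ a * (?y ^ b - ?s) + (?x ^ a - ?r) * ?s"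
          by (simp add: algebra_simps)
        also have "\<bar>\<dots>\<bar> \<le> \<bar>?x ^ a\<bar> * \<bar>?y ^ b - ?s\<bar> + \<bar>?x ^ a - ?r\<bar> * \<bar>?s\<bar>"
          by (rule order_trans[OF abs_triangle_ineq]) (simp only: abs_mult order_refl)
        also have "\<dots> \<le> 1 * \<bar>?y ^ b - ?s\<bar> + \<bar>?x ^ a - ?r\<bar> * 1"
          by (intro add_mono mult_right_mono mult_left_mono 1 2) auto
        also have "\<dots> \<le> ?e"
          using factorial_ratio_close[OF n(1) kj(1)] factorial_ratio_close[OF n(2) kj(2)]
          by (simp add: abs_minus_commute)
        finally have "\<bar>?x ^ a * ?y ^ b - ?r * ?s\<bar> \<le> ?e" .
        then have "\<bar>W n k j * (?x ^ a * ?y ^ b - ?r * ?s)\<bar> \<le> W n k j * ?e"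
          unfolding abs_mult using W0[of n k j] by (simp only: abs_of_nonneg mult_left_mono)
        then show "\<bar>case i of (k, j) => W n k j * ((real k / real n) ^ a * (real j / real n) ^ b
            - (real (k choose a) / real (n choose a)) * (real (j choose b) / real (n choose b)))\<bar> \<le> (case i of (k, j) => W n k j * ?e)"
          unfolding i prod.case .
      qed
      then show ?thesis unfolding gen tot eq .
    qed
    have "(%n. m 0 0 * (real a * (real a / real (n - a)) + real b * (real b / real (n - b)))) \<longlonglongrightarrow> m 0 0 * (real a * 0 + real b * 0)"
    proof -
      have "(%n. real c / real (n - c)) \<longlonglongrightarrow> 0" for c
        by (rule LIMSEQ_offset[where k=c]) (simp add: lim_const_over_n)
      then show ?thesis by (intro tendsto_intros)
    qed
    then have e0: "(%n. m 0 0 * (real a * (real a / real (n - a)) + real b * (real b / real (n - b)))) \<longlonglongrightarrow> 0" by simp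
    have "(%n. D n - m a b) \<longlonglongrightarrow> 0"
    proof (rule Lim_null_comparison[OF _ e0])
      show "eventually (%n. norm (D n - m a b) \<le> m 0 0 * (real a * (real a / real (n - a)) + real b * (real b / real (n - b)))) sequentially"
        using eventually_gt_at_top[of "2 * a"] eventually_gt_at_top[of "2 * b"]
        by eventually_elim (use close in auto)
    qed
    then have "D \<longlonglongrightarrow> m a b" by (simp add: LIM_zero_iff)
    then have "(%n. D (Suc n) / m 0 0) \<longlonglongrightarrow> m a b / m 0 0"
      by (intro tendsto_divide tendsto_const LIMSEQ_Suc) (use m0 in auto)
    moreover have "D (Suc n) / m 0 0 = (\<Sum>i\<in>{..Suc n} \<times> {..Suc n}. (case i of (k, j) => W (Suc n) k j / m 0 0) *
        mono2 a b (case i of (k, j) => (real k / real (Suc n), real j / real (Suc n))))" for n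
      unfolding D_def sum_divide_distrib by (intro sum.cong) (auto simp: mono2_def)
    ultimately show "(%n. \<Sum>i\<in>{..Suc n} \<times> {..Suc n}. (case i of (k, j) => W (Suc n) k j / m 0 0) *
        mono2 a b (case i of (k, j) => (real k / real (Suc n), real j / real (Suc n)))) \<longlonglongrightarrow> m a b / m 0 0"
      by simp
  qed (auto simp: W0 m0 less_imp_le)
qed

section \<open>The moment problem on squares and intervals of any size\<close>

definition bernR :: "real => nat => nat => real poly" where
  "bernR R k l = [:R, 1:] ^ k * [:R, -1:] ^ l"

lemma poly_bernR_nonneg: "t \<in> {-R..R} ==> 0 \<le> poly (bernR R k l) t"
  by (auto simp: bernR_def)

lemma mfun_integral:
  assumes M: "finite_measure M" "sets M = sets borel" "emeasure M (UNIV - sq S) = 0"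
    and m: "!!a b. (\<integral>p. mono2 a b p \<partial>M) = m a b"
  shows "integrable M (%u. poly p (fst u) * poly q (snd u))"
    "(\<integral>u. poly p (fst u) * poly q (snd u) \<partial>M) = mfun m p q"
proof -
  have int: "integrable M (%u. poly p (fst u) * poly q (snd u))" for p q
  proof -
    have c: "continuous_on UNIV (%u::real\<times>real. poly p (fst u) * poly q (snd u))"
      by (auto intro!: continuous_intros)
    have meas: "(%u::real\<times>real. poly p (fst u) * poly q (snd u)) \<in> borel_measurable M"
      using borel_measurable_continuous_onI[OF c] measurable_cong_sets[OF M(2) refl] by blast
    have "UNIV - sq S \<in> null_sets M" using M(2,3) sq_borel[of S] by (auto simp: null_sets_def)
    from AE_not_in[OF this] show ?thesis
    proof (intro integrable_cong_AE_imp[OF integrable_bbm[OF M(1,2) bbm_continuous_compact[OF c compact_sq[of S]]] meas])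
      show "AE x in M. poly p (fst x) * poly q (snd x) * indicat_real (sq S) x = poly p (fst x) * poly q (snd x)"
        if "AE x in M. x \<notin> UNIV - sq S" using that by eventually_elim auto
    qed
  qed
  then show "integrable M (%u. poly p (fst u) * poly q (snd u))" .
  show "(\<integral>u. poly p (fst u) * poly q (snd u) \<partial>M) = mfun m p q"
  proof (rule mfun_unique)
    show "(\<integral>u. poly ([:0, 1:] ^ a) (fst u) * poly ([:0, 1:] ^ b) (snd u) \<partial>M) = m a b" for a b
      using m[of a b] by (simp add: mono2_def poly_power)
  qed (simp_all add: distrib_right distrib_left int mult.assoc mult.left_commute[of _ c for c :: real])
qed

text \<open>The affine map \<open>T\<close> takes [-R,R] to [0,1] and turns Bernstein polynomials
  into positive multiples of \<open>bernR\<close>. Its inverse u \<mapsto> 2Ru - R takes [-2,2] to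
  [-5R,3R], whence the 5. A functional of total mass zero cannot be normalised and is treated
  apart.\<close>

theorem hausdorff2:
  assumes R: "0 < R" and pos: "!!k l i j. 0 \<le> mfun m (bernR R k l) (bernR R i j)"
  shows "\<exists>M. sets M = sets borel \<and> finite_measure M \<and> emeasure M (UNIV - sq (5 * R)) = 0 \<and>
      (\<forall>a b. (\<integral>p. mono2 a b p \<partial>M) = m a b)"
proof -
  define T where "T = [:1/2, 1/(2*R):]"
  define m' where "m' a b = mfun m (pcompose ([:0,1:]^a) T) (pcompose ([:0,1:]^b) T)" for a b
  have mm: "mfun m (pcompose p T) (pcompose q T) = mfun m' p q" for p q
    by (rule mfun_unique)
      (auto simp: pcompose_add mfun_add_left mfun_add_right pcompose_smult mfun_smult_left mfun_smult_right m'_def)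
  have pcp: "pcompose (p ^ n) T = pcompose p T ^ n" for p :: "real poly" and n
    by (induction n) (auto simp: pcompose_mult pcompose_1)
  have cb: "pcompose (bern k l) T = smult ((1/(2*R)) ^ (k + l)) (bernR R k l)" for k l
  proof -
    have 1: "T = smult (1/(2*R)) [:R, 1:]" "[:1/2, -(1/(2*R)):] = smult (1/(2*R)) [:R, -1:]"
      using R by (auto simp: T_def)
    have 2: "pcompose [:0, 1:] T = T" "pcompose [:1, -1:] T = [:1/2, -(1/(2*R)):]"
      by (simp_all add: T_def pcompose_pCons)
    show ?thesis
      unfolding bern_def bernR_def pcompose_mult pcp 2 unfolding 1
      by (simp only: smult_power mult_smult_left mult_smult_right smult_smult power_add mult_ac)
  qed
  have pos': "0 \<le> mfun m' (bern k l) (bern i j)" for k l i j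
    unfolding mm[symmetric] cb using pos R by (simp add: mfun_smult_left mfun_smult_right)
  show ?thesis
  proof (cases "m 0 0 = 0")
    case True
    have "m a b = 0" for a b
    proof -
      \<comment> \<open>With total mass zero all Bernstein weights vanish, hence all moments.\<close>
      have W: "mfun m' (bern k (n - k)) (bern j (n - j)) = 0" if "k \<le> n" "j \<le> n" for n k j
      proof -
        let ?w = "%k j. real (n choose k) * real (n choose j) * mfun m' (bern k (n - k)) (bern j (n - j))"
        have "mfun m' ([:0,1:]^0) ([:0,1:]^0) = (\<Sum>j\<le>n. \<Sum>k\<le>n. ?w k j)"
          unfolding bern_sum[of 0 n, OF le0, symmetric] mfun_sum_left mfun_sum_right mfun_smult_left mfun_smult_right
          by (simp add: sum_distrib_left mult_ac)
        moreover have "mfun m' ([:0,1:]^0) ([:0,1:]^0) = 0"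
          using True mfun_monom[of m 0 0] unfolding mm[symmetric] by (simp add: pcompose_1)
        ultimately have "(\<Sum>j\<le>n. \<Sum>k\<le>n. ?w k j) = 0" by simp
        then have "(\<Sum>k\<le>n. ?w k j) = 0"
          using that by (subst (asm) sum_nonneg_eq_0_iff) (auto intro!: sum_nonneg simp: pos')
        then have "?w k j = 0"
          using that by (subst (asm) sum_nonneg_eq_0_iff) (auto simp: pos')
        then show ?thesis using that by simp
      qed
      have Z: "mfun m' ([:0,1:]^a) ([:0,1:]^b) = 0" for a b
      proof -
        have "mfun m' ([:0,1:]^a) ([:0,1:]^b) = (\<Sum>j\<le>max a b. \<Sum>k\<le>max a b.
            mfun m' (smult (real (k choose a) / real (max a b choose a) * real (max a b choose k)) (bern k (max a b - k)))
              (smult (real (j choose b) / real (max a b choose b) * real (max a b choose j)) (bern j (max a b - j))))"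
          unfolding mfun_sum_left[symmetric] mfun_sum_right[symmetric]
          by (simp only: bern_sum[OF max.cobounded1] bern_sum[OF max.cobounded2])
        also have "\<dots> = 0" by (simp add: mfun_smult_left mfun_smult_right W)
        finally show ?thesis .
      qed
      have Z': "mfun m' p q = 0" for p q
        by (simp add: mfun_def Z[unfolded mfun_monom])
      have "pcompose ([:-R, 2*R:]) T = [:0, 1:]" using R by (simp add: T_def pcompose_pCons)
      then have "m a b = mfun m (pcompose ([:-R, 2*R:] ^ a) T) (pcompose ([:-R, 2*R:] ^ b) T)"
        by (simp add: pcp mfun_monom)
      also have "\<dots> = 0" unfolding mm by (rule Z')
      finally show ?thesis .
    qed
    then show ?thesis
      by (intro exI[of _ "null_measure borel"])
        (auto intro!: finite_measureI simp: integral_null_measure)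
  next
    case False
    have "m' 0 0 = m 0 0" unfolding m'_def using mfun_monom[of m 0 0] by (simp add: pcompose_1)
    then have nz: "m' 0 0 \<noteq> 0" using False by simp
    have m0: "0 < m' 0 0"
      using pos'[of 0 0 0 0] nz mfun_monom[of m' 0 0] by (simp add: bern_def)
    obtain M0 where M0: "prob_space M0" "sets M0 = sets borel" "emeasure M0 (UNIV - sq 2) = 0"
      "!!a b. (\<integral>p. mono2 a b p \<partial>M0) = m' a b / m' 0 0"
      using hausdorff_unit[OF pos' nz] by blast
    interpret M0: prob_space M0 by fact
    define \<phi> :: "real \<times> real => real \<times> real" where "\<phi> u = (2 * R * fst u - R, 2 * R * snd u - R)" for u
    have c\<phi>: "continuous_on UNIV \<phi>" unfolding \<phi>_def by (intro continuous_intros)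
    have m\<phi>: "\<phi> \<in> measurable M0 borel"
      using borel_measurable_continuous_onI[OF c\<phi>] measurable_cong_sets[OF M0(2) refl] by blast
    define M1 where "M1 = distr M0 borel \<phi>"
    interpret M1: prob_space M1 unfolding M1_def by (rule M0.prob_space_distr[OF m\<phi>])
    define M where "M = density M1 (%_. ennreal (m' 0 0))"
    have setsM: "sets M = sets borel" by (simp add: M_def M1_def)
    have emM: "emeasure M A = ennreal (m' 0 0) * emeasure M1 A" if "A \<in> sets borel" for A
      unfolding M_def using that by (subst emeasure_density_const) (auto simp: M1_def)
    have "finite_measure M"
      by (rule finite_measureI)
        (use emM[of UNIV] M1.emeasure_space_1 in \<open>auto simp: M_def M1_def ennreal_mult_eq_top_iff\<close>)
    moreover have "emeasure M (UNIV - sq (5 * R)) = 0"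
    proof -
      have "\<phi> -` (UNIV - sq (5 * R)) \<subseteq> UNIV - sq 2"
      proof -
        have "\<phi> u \<in> sq (5 * R)" if "u \<in> sq 2" for u
        proof -
          have "2 * R * (-2) \<le> 2 * R * fst u" "2 * R * fst u \<le> 2 * R * 2"
            "2 * R * (-2) \<le> 2 * R * snd u" "2 * R * snd u \<le> 2 * R * 2"
            by (intro mult_left_mono; use that R in \<open>auto simp: sq_def\<close>)+
          then show ?thesis unfolding sq_def \<phi>_def by auto
        qed
        then show ?thesis by blast
      qed
      moreover have "emeasure M1 (UNIV - sq (5 * R)) = emeasure M0 (\<phi> -` (UNIV - sq (5 * R)))"
        unfolding M1_def using sets_eq_imp_space_eq[OF M0(2)] by (subst emeasure_distr[OF m\<phi>]) auto
      ultimately have "emeasure M1 (UNIV - sq (5 * R)) \<le> emeasure M0 (UNIV - sq 2)"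
        using M0(2) sq_borel[of 2] by (auto intro!: emeasure_mono)
      then show ?thesis using M0(3) emM[of "UNIV - sq (5 * R)"] sq_borel[of "5 * R"] by auto
    qed
    moreover have "(\<integral>p. mono2 a b p \<partial>M) = m a b" for a b
    proof -
      have meas: "mono2 a b \<in> borel_measurable borel"
        by (rule borel_measurable_continuous_onI[OF continuous_mono2])
      have "(\<integral>p. mono2 a b p \<partial>M) = (\<integral>p. m' 0 0 * mono2 a b p \<partial>M1)"
        unfolding M_def using m0 meas
        by (subst integral_real_density) (auto simp: M1_def measurable_distr_eq1)
      also have "\<dots> = (\<integral>u. m' 0 0 * mono2 a b (\<phi> u) \<partial>M0)"
        unfolding M1_def using meas by (subst integral_distr[OF m\<phi>]) auto
      also have "\<dots> = m' 0 0 * (\<integral>u. poly ([:-R, 2*R:] ^ a) (fst u) * poly ([:-R, 2*R:] ^ b) (snd u) \<partial>M0)"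
        by (simp add: mono2_def \<phi>_def poly_power algebra_simps)
      also have "(\<integral>u. poly ([:-R, 2*R:] ^ a) (fst u) * poly ([:-R, 2*R:] ^ b) (snd u) \<partial>M0)
          = mfun (%a b. m' a b / m' 0 0) ([:-R, 2*R:] ^ a) ([:-R, 2*R:] ^ b)"
        by (rule mfun_integral(2)[OF _ M0(2,3,4)]) (rule M0.finite_measure)
      also have "m' 0 0 * \<dots> = mfun m' ([:-R, 2*R:] ^ a) ([:-R, 2*R:] ^ b)"
        unfolding mfun_def sum_distrib_left using nz by (intro sum.cong) auto
      also have "\<dots> = m a b"
      proof -
        have "pcompose ([:-R, 2*R:]) T = [:0, 1:]" using R by (simp add: T_def pcompose_pCons)
        then show ?thesis unfolding mm[symmetric] by (simp add: pcp mfun_monom)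
      qed
      finally show ?thesis .
    qed
    ultimately show ?thesis using setsM by blast
  qed
qed

definition mfun1 :: "(nat => real) => real poly => real" where
  "mfun1 m p = (\<Sum>i\<le>degree p. coeff p i * m i)"

text \<open>The moments are tensored with those of the unit mass at 0 in a second variable, and the
  planar solution is projected back. Positivity is inherited because the constant coefficient of
  \<open>bernR R i j\<close> is R^(i + j).\<close>

theorem hausdorff1:
  assumes R: "0 < R" and pos: "!!k l. 0 \<le> mfun1 m (bernR R k l)"
  shows "\<exists>M. sets M = sets borel \<and> finite_measure M \<and> emeasure M (UNIV - {-(5*R)..5*R}) = 0 \<and>
      (\<forall>a. (\<integral>t. t ^ a \<partial>M) = m a)"
proof -
  define m2 where "m2 i j = (if j = 0 then m i else 0)" for i j :: nat
  have m2: "mfun m2 p q = coeff q 0 * mfun1 m p" for p q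
  proof -
    have "mfun m2 p q = (\<Sum>i\<le>degree p. \<Sum>j\<le>degree q. if j = 0 then coeff p i * coeff q 0 * m i else 0)"
      unfolding mfun_def m2_def by (intro sum.cong) auto
    then show ?thesis by (simp add: mfun1_def sum_distrib_left mult_ac)
  qed
  have "0 \<le> mfun m2 (bernR R k l) (bernR R i j)" for k l i j
    unfolding m2 using pos[of k l] R by (simp add: bernR_def coeff_mult coeff_0_power)
  from hausdorff2[OF R this] obtain M where
    M: "sets M = sets borel" "finite_measure M" "emeasure M (UNIV - sq (5 * R)) = 0"
      "!!a b. (\<integral>p. mono2 a b p \<partial>M) = m2 a b" by blast
  interpret M: finite_measure M by fact
  have mf: "fst \<in> measurable M (borel :: real measure)"
    unfolding measurable_cong_sets[OF M(1) refl] unfolding borel_prod[symmetric] by simp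
  show ?thesis
  proof (intro exI[of _ "distr M borel fst"] conjI allI)
    show "finite_measure (distr M borel fst)" by (rule M.finite_measure_distr[OF mf])
    have "fst -` (UNIV - {-(5*R)..5*R}) \<subseteq> UNIV - sq (5 * R)" by (auto simp: sq_def)
    then have "emeasure (distr M borel fst) (UNIV - {-(5*R)..5*R}) \<le> emeasure M (UNIV - sq (5 * R))"
      using M(1) sq_borel[of "5*R"] by (subst emeasure_distr[OF mf]) (auto intro!: emeasure_mono)
    then show "emeasure (distr M borel fst) (UNIV - {-(5*R)..5*R}) = 0" using M(3) by simp
    show "(\<integral>t. t ^ a \<partial>distr M borel fst) = m a" for a
      using M(4)[of a 0] by (subst integral_distr[OF mf]) (auto simp: mono2_def m2_def)
  qed simp
qed

section \<open>Measurable dependence of the measure on its moments\<close>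

definition mom_rep :: "(nat => complex) => real measure => bool" where
  "mom_rep m \<mu> \<longleftrightarrow> sets \<mu> = sets borel \<and> finite_measure \<mu> \<and>
      (\<exists>R. emeasure \<mu> (UNIV - {-R..R}) = 0) \<and>
      (\<forall>n. complex_of_real (\<integral>t. t ^ n \<partial>\<mu>) = m n)"

text \<open>The description in \<open>specmeas\<close> with its moments abstracted: the measure
  depends on the potential only through a sequence of numbers.\<close>

definition mom_measure :: "(nat => complex) => real measure" where
  "mom_measure m = (THE \<mu>. mom_rep m \<mu>)"

lemma mom_measure_eq:
  assumes "mom_rep m \<mu>" shows "mom_measure m = \<mu>"
  unfolding mom_measure_def
proof (rule the_equality)
  show "mom_rep m \<mu>" by (rule assms)
  fix \<nu> assume "mom_rep m \<nu>"
  with assms show "\<nu> = \<mu>" unfolding mom_rep_def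
    by (metis moment_unique1 of_real_eq_iff)
qed

lemma mfun1_integral:
  fixes M :: "real measure"
  assumes M: "finite_measure M" "sets M = sets borel" "emeasure M (UNIV - {-S..S}) = 0"
    and m: "!!a. (\<integral>t. t ^ a \<partial>M) = m a"
  shows "integrable M (poly p)" "(\<integral>t. poly p t \<partial>M) = mfun1 m p"
proof -
  have int: "integrable M (poly p)" for p
  proof -
    have c: "continuous_on UNIV (poly p)" by (auto intro!: continuous_intros)
    have meas: "poly p \<in> borel_measurable M"
      using borel_measurable_continuous_onI[OF c] measurable_cong_sets[OF M(2) refl] by blast
    have "UNIV - {-S..S} \<in> null_sets M" using M(2,3) by (auto simp: null_sets_def)
    from AE_not_in[OF this] show ?thesis
    proof (intro integrable_cong_AE_imp[OF integrable_bbm[OF M(1,2) bbm_continuous_compact[OF c compact_Icc[of "-S" S]]] meas])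
      show "AE x in M. poly p x * indicat_real {-S..S} x = poly p x"
        if "AE x in M. x \<notin> UNIV - {-S..S}" using that by eventually_elim auto
    qed
  qed
  then show "integrable M (poly p)" .
  have i: "integrable M (%t. t ^ i)" for i 
  proof -
    have "poly (monom 1 i) = (%t::real. t ^ i)" by (simp add: poly_monom fun_eq_iff)
    then show ?thesis using int[of "monom 1 i"] by simp
  qed
  show "(\<integral>t. poly p t \<partial>M) = mfun1 m p"
    unfolding poly_altdef mfun1_def by (subst Bochner_Integration.integral_sum) (auto simp: i m)
qed

text \<open>The support radius is rounded up to an integer so that solvability becomes a countable
  condition on the moments, hence a measurable one.\<close>

lemma mom_rep_positive:
  assumes "mom_rep m \<mu>"
  shows "\<exists>j::nat. (\<forall>n. Im (m n) = 0) \<and> (\<forall>k l. 0 \<le> mfun1 (%n. Re (m n)) (bernR (real (Suc j)) k l))"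
proof -
  obtain R where \<mu>: "sets \<mu> = sets borel" "finite_measure \<mu>" "emeasure \<mu> (UNIV - {-R..R}) = 0"
      "!!n. complex_of_real (\<integral>t. t ^ n \<partial>\<mu>) = m n"
    using assms unfolding mom_rep_def by blast
  obtain j :: nat where "R \<le> real j" using real_arch_simple[of R] by blast
  then have j: "R \<le> real (Suc j)" by simp
  have S: "emeasure \<mu> (UNIV - {-real (Suc j)..real (Suc j)}) = 0"
    by (rule emeasure_eq_0[OF _ \<mu>(3)]) (use \<mu>(1) j in auto)
  have re: "(\<integral>t. t ^ n \<partial>\<mu>) = Re (m n)" "Im (m n) = 0" for n
    using \<mu>(4)[of n] by (metis Re_complex_of_real, metis Im_complex_of_real)
  have "0 \<le> mfun1 (%n. Re (m n)) (bernR (real (Suc j)) k l)" for k l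
  proof -
    have "UNIV - {-real (Suc j)..real (Suc j)} \<in> null_sets \<mu>" using S \<mu>(1) by (auto simp: null_sets_def)
    from AE_not_in[OF this] have "AE t in \<mu>. 0 \<le> poly (bernR (real (Suc j)) k l) t"
      by eventually_elim (auto intro: poly_bernR_nonneg)
    then have "0 \<le> (\<integral>t. poly (bernR (real (Suc j)) k l) t \<partial>\<mu>)" by (rule integral_nonneg_AE)
    then show ?thesis using mfun1_integral(2)[OF \<mu>(2,1,3) re(1)] by simp
  qed
  then show ?thesis using re by blast
qed

lemma mom_rep_exists:
  assumes R: "0 < R" and im: "!!n. Im (m n) = 0" and pos: "!!k l. 0 \<le> mfun1 (%n. Re (m n)) (bernR R k l)"
  shows "\<exists>\<mu>. mom_rep m \<mu> \<and> emeasure \<mu> (UNIV - {-(5*R)..5*R}) = 0"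
proof -
  obtain M where M: "sets M = sets borel" "finite_measure M" "emeasure M (UNIV - {-(5*R)..5*R}) = 0"
      "!!a. (\<integral>t. t ^ a \<partial>M) = Re (m a)"
    using hausdorff1[OF R pos] by auto
  have "complex_of_real (Re (m n)) = m n" for n using im[of n] by (simp add: complex_eq_iff)
  then show ?thesis using M unfolding mom_rep_def by (intro exI[of _ M]) auto
qed

text \<open>Solvability is the union over j of the conditions \<open>good j\<close>. On each of them
  the class principle starts from the moments themselves, which are measurable by assumption; off
  their union no representing measure exists, \<open>mom_measure\<close> is one fixed default, and
  the integral is constant.\<close>

lemma mom_measurable:
  fixes m :: "'w => nat => complex"
  assumes m[measurable]: "!!n. (%V. m V n) \<in> borel_measurable N" and f: "bbm f"
  shows "(%V. \<integral>t. f t \<partial>mom_measure (m V)) \<in> borel_measurable N"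
proof -
  define good where "good j V \<longleftrightarrow> (\<forall>n. Im (m V n) = 0) \<and>
      (\<forall>k l. 0 \<le> mfun1 (%n. Re (m V n)) (bernR (real (Suc j)) k l))" for j V
  have gm[measurable]: "Measurable.pred N (good j)" for j
    unfolding good_def mfun1_def by measurable
  let ?F = "%f V. \<integral>t. f t \<partial>mom_measure (m V)"
  have rep: "mom_rep (m V) (mom_measure (m V))"
      "emeasure (mom_measure (m V)) (UNIV - {-(5*real (Suc j))..5*real (Suc j)}) = 0" if "good j V" for j V
  proof -
    have "0 < real (Suc j)" by simp
    from mom_rep_exists[OF this, of "m V"] that
    obtain \<mu> where "mom_rep (m V) \<mu>" "emeasure \<mu> (UNIV - {-(5*real (Suc j))..5*real (Suc j)}) = 0"
      unfolding good_def by blast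
    then show "mom_rep (m V) (mom_measure (m V))"
      "emeasure (mom_measure (m V)) (UNIV - {-(5*real (Suc j))..5*real (Suc j)}) = 0"
      using mom_measure_eq by auto
  qed
  have bad: "?F f V = (\<integral>t. f t \<partial>(THE \<mu>. False))" if "\<not> (\<exists>j. good j V)" for V f
  proof -
    have "\<not> mom_rep (m V) \<mu>" for \<mu> using mom_rep_positive that unfolding good_def by blast
    then show ?thesis by (simp add: mom_measure_def)
  qed
  have gF: "(%V. if good j V then ?F f V else 0) \<in> borel_measurable N" for j
  proof -
    let ?R = "5 * real (Suc j)"
    have fin: "finite_measure (mom_measure (m V))" "sets (mom_measure (m V)) = sets borel" if "good j V" for V
      using rep(1)[OF that] unfolding mom_rep_def by auto
    have "(%V. if good j V then ?F (%t. f t * indicator {-?R..?R} t) V else 0) \<in> borel_measurable N"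
    proof (rule bounded_borel_class1[where P="%f. (%V. if good j V then ?F f V else 0) \<in> borel_measurable N", OF _ _ _ _ f])
      fix n
      have "(if good j V then ?F (%t. t ^ n * indicator {-?R..?R} t) V else 0) = (if good j V then Re (m V n) else 0)" for V
      proof (cases "good j V")
        case True
        have "?F (%t. t ^ n * indicator {-?R..?R} t) V = ?F (%t. t ^ n) V"
          using integral_AE_indicator[OF rep(2)[OF True] _ fin(2)[OF True], of "%t. t ^ n"]
          by (simp add: mult.commute)
        also have "\<dots> = Re (m V n)"
          using rep(1)[OF True] unfolding mom_rep_def by (metis Re_complex_of_real)
        finally show ?thesis by simp
      qed simp
      then show "(%V. if good j V then ?F (%t. t ^ n * indicator {-?R..?R} t) V else 0) \<in> borel_measurable N"
        by simp
    next
      fix f g :: "real => real" assume fg: "bbm f" "bbm g"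
        and [measurable]: "(%V. if good j V then ?F f V else 0) \<in> borel_measurable N"
          "(%V. if good j V then ?F g V else 0) \<in> borel_measurable N"
      have "(%V. if good j V then ?F (%t. f t + g t) V else 0) =
        (%V. (if good j V then ?F f V else 0) + (if good j V then ?F g V else 0))"
        using integrable_bbm[OF fin fg(1)] integrable_bbm[OF fin fg(2)] by (auto simp: fun_eq_iff)
      then show "(%V. if good j V then ?F (%t. f t + g t) V else 0) \<in> borel_measurable N" by simp
    next
      fix f :: "real => real" and c assume fg: "bbm f"
        and [measurable]: "(%V. if good j V then ?F f V else 0) \<in> borel_measurable N"
      have "(%V. if good j V then ?F (%t. c * f t) V else 0) =
        (%V. c * (if good j V then ?F f V else 0))"
        by (auto simp: fun_eq_iff)
      then show "(%V. if good j V then ?F (%t. c * f t) V else 0) \<in> borel_measurable N" by simp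
    next
      fix F :: "nat => real => real" and f B
      assume F: "!!n. bbm (F n)" "!!n. (%V. if good j V then ?F (F n) V else 0) \<in> borel_measurable N"
        "!!n t. \<bar>F n t\<bar> \<le> B" "!!t. (%n. F n t) \<longlonglongrightarrow> f t"
      show "(%V. if good j V then ?F f V else 0) \<in> borel_measurable N"
      proof (rule borel_measurable_LIMSEQ_real[OF _ F(2)])
        fix V
        show "(%n. if good j V then ?F (F n) V else 0) \<longlonglongrightarrow> (if good j V then ?F f V else 0)"
          using integral_limit_bbm[OF fin F(1,3,4)] by auto
      qed
    qed
    moreover have "(if good j V then ?F (%t. f t * indicator {-?R..?R} t) V else 0) = (if good j V then ?F f V else 0)" for V
      using integral_AE_indicator[OF rep(2) _ fin(2) bbm_measurable[OF f], of j V]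
      by (auto simp: mult.commute)
    ultimately show ?thesis by simp
  qed
  show ?thesis
  proof (rule borel_measurableI)
    fix S :: "real set" assume S: "open S"
    let ?c = "\<integral>t. f t \<partial>(THE \<mu>. False)"
    have [measurable]: "S \<in> sets borel" using S by simp
    have "?F f -` S \<inter> space N = (\<Union>j. {V\<in>space N. good j V \<and> (if good j V then ?F f V else 0) \<in> S})
      \<union> {V\<in>space N. (\<forall>j. \<not> good j V) \<and> ?c \<in> S}"
      using bad by auto
    also have "\<dots> \<in> sets N"
    proof -
      have "{V\<in>space N. good j V \<and> (if good j V then ?F f V else 0) \<in> S} \<in> sets N" for j
        using gF[of j] by measurable
      moreover have "{V\<in>space N. (\<forall>j. \<not> good j V) \<and> ?c \<in> S} \<in> sets N" by measurable
      ultimately show ?thesis by (intro sets.Un sets.countable_nat_UN image_subsetI)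
    qed
    finally show "?F f -` S \<inter> space N \<in> sets N" .
  qed
qed

section \<open>Functional calculus for a bounded potential\<close>

type_synonym site = "nat => int"

text \<open>Since H is real symmetric, the whole calculus can be carried out with real vectors, on
  which \<open>Hop\<close> acts through this operator.\<close>

definition Hr :: "nat => (site => real) => (site => real) => site => real" where
  "Hr d V v x = (\<Sum>y\<in>nbrs d x. v y) + V x * v x"

definition dr :: "site => site => real" where
  "dr y = (%x. if x = y then 1 else 0)"

definition supp :: "('a => real) => 'a set" where "supp v = {x. v x \<noteq> 0}"

definition fs :: "nat => (site => real) => bool" where
  "fs d v \<longleftrightarrow> finite (supp v) \<and> supp v \<subseteq> Zd d"

text \<open>Summing over the support of the first argument alone keeps the sum finite for an
  arbitrary second argument.\<close>

definition ip :: "('a => real) => ('a => real) => real" where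
  "ip v w = (\<Sum>x\<in>supp v. v x * w x)"

lemma ip_superset: "finite S ==> supp v \<subseteq> S ==> ip v w = (\<Sum>x\<in>S. v x * w x)"
  unfolding ip_def by (rule sum.mono_neutral_left) (auto simp: supp_def)

lemma finite_nbrs: "finite (nbrs d x)"
  unfolding nbrs_def by simp

lemma nbrs_sym: "y \<in> nbrs d x \<longleftrightarrow> x \<in> nbrs d y"
proof -
  have "x \<in> nbrs d y" if "y \<in> nbrs d x" for x y
    using that unfolding nbrs_def
  proof (elim UnE)
    assume "y \<in> {x(i := x i + 1) |i. i < d}"
    then obtain i where i: "i < d" "y = x(i := x i + 1)" by auto
    then have "x = y(i := y i - 1)" by auto
    then show "x \<in> {y(i := y i + 1) |i. i < d} \<union> {y(i := y i - 1) |i. i < d}" using i(1) by blast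
  next
    assume "y \<in> {x(i := x i - 1) |i. i < d}"
    then obtain i where i: "i < d" "y = x(i := x i - 1)" by auto
    then have "x = y(i := y i + 1)" by auto
    then show "x \<in> {y(i := y i + 1) |i. i < d} \<union> {y(i := y i - 1) |i. i < d}" using i(1) by blast
  qed
  then show ?thesis by blast
qed

lemma nbrs_Zd: "x \<in> Zd d ==> nbrs d x \<subseteq> Zd d"
  unfolding nbrs_def Zd_def by auto

lemma card_nbrs: "card (nbrs d x) \<le> 2 * d"
proof -
  have "{x(i := x i + 1) |i. i < d} = (%i. x(i := x i + 1)) ` {..<d}"
    "{x(i := x i - 1) |i. i < d} = (%i. x(i := x i - 1)) ` {..<d}" by auto
  then have "card {x(i := x i + 1) |i. i < d} \<le> d" "card {x(i := x i - 1) |i. i < d} \<le> d"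
    using card_image_le[of "{..<d}"] by (metis card_lessThan finite_lessThan)+
  then show ?thesis unfolding nbrs_def using card_Un_le[of "{x(i := x i + 1) |i. i < d}" "{x(i := x i - 1) |i. i < d}"]
    by linarith
qed

lemma Hr_linear:
  "Hr d V (%x. a * v x + b * w x) = (%x. a * Hr d V v x + b * Hr d V w x)"
  unfolding Hr_def by (auto simp: sum.distrib sum_distrib_left algebra_simps)

lemma Hrn_linear:
  "(Hr d V ^^ n) (%x. a * v x + b * w x) = (%x. a * (Hr d V ^^ n) v x + b * (Hr d V ^^ n) w x)"
  by (induction n) (auto simp: Hr_linear)

lemma Hop_of_real: "Hop d V (%x. complex_of_real (v x)) = (%x. complex_of_real (Hr d V v x))"
  unfolding Hop_def Hr_def by auto

lemma Hopn_of_real: "(Hop d V ^^ n) (%x. complex_of_real (v x)) = (%x. complex_of_real ((Hr d V ^^ n) v x))"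
  by (induction n) (auto simp: Hop_of_real)

lemma fs_Hr: assumes "fs d v" shows "fs d (Hr d V v)"
proof -
  have "supp (Hr d V v) \<subseteq> supp v \<union> (\<Union>x\<in>supp v. nbrs d x)"
  proof
    fix x assume x: "x \<in> supp (Hr d V v)"
    show "x \<in> supp v \<union> (\<Union>x\<in>supp v. nbrs d x)"
    proof (rule ccontr)
      assume n: "x \<notin> supp v \<union> (\<Union>x\<in>supp v. nbrs d x)"
      then have "v y = 0" if "y \<in> nbrs d x" for y using that nbrs_sym[of y d x] by (auto simp: supp_def)
      then have "Hr d V v x = 0" using n unfolding Hr_def by (auto simp: supp_def)
      then show False using x by (simp add: supp_def)
    qed
  qed
  moreover have "finite (supp v \<union> (\<Union>x\<in>supp v. nbrs d x))" using assms finite_nbrs by (auto simp: fs_def)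
  moreover have "supp v \<union> (\<Union>x\<in>supp v. nbrs d x) \<subseteq> Zd d" using assms nbrs_Zd unfolding fs_def by blast
  ultimately show ?thesis unfolding fs_def by (meson finite_subset order_trans)
qed

lemma fs_Hrn: "fs d v ==> fs d ((Hr d V ^^ n) v)"
  by (induction n) (auto intro: fs_Hr)

lemma fs_lin: assumes "fs d v" "fs d w" shows "fs d (%x. a * v x + b * w x)"
proof -
  have "supp (%x. a * v x + b * w x) \<subseteq> supp v \<union> supp w" by (auto simp: supp_def)
  then show ?thesis using assms unfolding fs_def by (meson finite_Un finite_subset le_sup_iff order_trans)
qed

lemma fs_add: "fs d v ==> fs d w ==> fs d (%x. v x + w x)" using fs_lin[of d v w 1 1] by simp
lemma fs_diff: "fs d v ==> fs d w ==> fs d (%x. v x - w x)" using fs_lin[of d v w 1 "-1"] by simp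
lemma fs_scale: "fs d v ==> fs d (%x. c * v x)" using fs_lin[of d v v c 0] by simp
lemma fs_0: "fs d (%x. 0)" by (simp add: fs_def supp_def)
lemma fs_sum: "(!!i. i \<in> I ==> fs d (f i)) ==> fs d (%x. \<Sum>i\<in>I. f i x)"
  by (induction I rule: infinite_finite_induct) (auto intro: fs_0 fs_add)
lemma fs_dr: "x \<in> Zd d ==> fs d (dr x)" by (auto simp: fs_def supp_def dr_def)

lemma ip_commute: assumes "fs d v" "fs d w" shows "ip v w = ip w v"
proof -
  let ?S = "supp v \<union> supp w"
  have "finite ?S" using assms by (auto simp: fs_def)
  then show ?thesis by (simp add: ip_superset[of ?S] mult.commute)
qed

lemma ip_lin_right: "ip v (%x. a * w x + b * u x) = a * ip v w + b * ip v u"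
  unfolding ip_def by (simp add: sum.distrib sum_distrib_left algebra_simps)

lemma ip_sum_right: "ip v (%x. \<Sum>i\<in>I. f i x) = (\<Sum>i\<in>I. ip v (f i))"
  unfolding ip_def by (simp add: sum_distrib_left) (rule sum.swap)

lemma ip_lin_left:
  assumes "fs d v" "fs d w"
  shows "ip (%x. a * v x + b * w x) u = a * ip v u + b * ip w u"
proof -
  let ?S = "supp v \<union> supp w"
  have f: "finite ?S" using assms by (auto simp: fs_def)
  have s: "supp (%x. a * v x + b * w x) \<subseteq> ?S" by (auto simp: supp_def)
  show ?thesis
    by (simp add: ip_superset[OF f s] ip_superset[OF f, of v] ip_superset[OF f, of w] sum.distrib sum_distrib_left algebra_simps)
qed

lemma ip_nonneg: "0 \<le> ip v v" unfolding ip_def by (intro sum_nonneg) simp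

lemma ip_dr_left: "ip (dr x) w = w x"
  unfolding ip_def supp_def dr_def by simp

lemma ip_dr_dr: "ip (dr x) (dr y) = (if x = y then 1 else 0)"
  unfolding ip_dr_left by (simp add: dr_def)

lemma Hr_on_finite:
  assumes S: "finite S" "supp v \<subseteq> S"
  shows "Hr d V v x = (\<Sum>y\<in>S. (if y \<in> nbrs d x then 1 else 0) * v y) + V x * v x"
proof -
  have "(\<Sum>y\<in>nbrs d x. v y) = (\<Sum>y\<in>nbrs d x \<inter> S. v y)"
    using S finite_nbrs by (intro sum.mono_neutral_right) (auto simp: supp_def)
  also have "\<dots> = (\<Sum>y\<in>S. (if y \<in> nbrs d x then 1 else 0) * v y)"
    using S by (intro sum.mono_neutral_cong_left) auto
  finally show ?thesis by (simp add: Hr_def)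
qed

lemma ip_Hr_sym:
  assumes "fs d v" "fs d w"
  shows "ip (Hr d V v) w = ip v (Hr d V w)"
proof -
  let ?S = "supp v \<union> supp w"
  let ?n = "%x y. if y \<in> nbrs d x then 1 else (0::real)"
  have f: "finite ?S" using assms by (auto simp: fs_def)
  have "ip (Hr d V v) w = ip w (Hr d V v)" by (rule ip_commute[OF fs_Hr[OF assms(1)] assms(2)])
  also have "\<dots> = (\<Sum>x\<in>?S. w x * ((\<Sum>y\<in>?S. ?n x y * v y) + V x * v x))"
    using f by (subst ip_superset[of ?S]) (auto simp: Hr_on_finite[OF f])
  also have "\<dots> = (\<Sum>x\<in>?S. \<Sum>y\<in>?S. w x * (?n x y * v y)) + (\<Sum>x\<in>?S. w x * (V x * v x))"
    by (simp only: distrib_left sum.distrib sum_distrib_left)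
  also have "(\<Sum>x\<in>?S. \<Sum>y\<in>?S. w x * (?n x y * v y)) = (\<Sum>x\<in>?S. \<Sum>y\<in>?S. v x * (?n x y * w y))"
    by (subst sum.swap) (intro sum.cong refl, simp add: nbrs_sym mult_ac)
  also have "\<dots> + (\<Sum>x\<in>?S. w x * (V x * v x)) = (\<Sum>x\<in>?S. v x * ((\<Sum>y\<in>?S. ?n x y * w y) + V x * w x))"
    by (simp only: distrib_left sum.distrib sum_distrib_left mult_ac)
  also have "\<dots> = ip v (Hr d V w)"
    using f by (subst ip_superset[of ?S]) (auto simp: Hr_on_finite[OF f])
  finally show ?thesis .
qed

lemma ip_Hrn_sym:
  assumes "fs d v" "fs d w"
  shows "ip ((Hr d V ^^ n) v) w = ip v ((Hr d V ^^ n) w)"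
  using assms(2)
proof (induction n arbitrary: w)
  case (Suc n)
  have "ip ((Hr d V ^^ Suc n) v) w = ip ((Hr d V ^^ n) v) (Hr d V w)"
    using ip_Hr_sym[OF fs_Hrn[OF assms(1)] Suc.prems] by simp
  also have "\<dots> = ip v ((Hr d V ^^ n) (Hr d V w))" by (rule Suc.IH[OF fs_Hr[OF Suc.prems]])
  finally show ?case by (simp add: funpow_swap1)
qed simp

definition pop :: "nat => (site => real) => real poly => (site => real) => site => real" where
  "pop d V p v x = (\<Sum>i\<le>degree p. coeff p i * (Hr d V ^^ i) v x)"

lemma pop_altdef: "degree p \<le> N ==> pop d V p v x = (\<Sum>i\<le>N. coeff p i * (Hr d V ^^ i) v x)"
  unfolding pop_def by (rule sum.mono_neutral_left) (auto simp: coeff_eq_0)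

lemma fs_pop: "fs d v ==> fs d (pop d V p v)"
  unfolding pop_def[abs_def] by (intro fs_sum fs_scale fs_Hrn)

lemma pop_add: "pop d V (p + q) v = (%x. pop d V p v x + pop d V q v x)"
proof
  fix x
  let ?N = "max (degree p) (degree q)"
  have "degree (p + q) \<le> ?N" by (rule degree_add_le_max)
  then show "pop d V (p + q) v x = pop d V p v x + pop d V q v x"
    by (simp add: pop_altdef[of _ ?N] sum.distrib[symmetric] algebra_simps)
qed

lemma pop_smult: "pop d V (smult c p) v = (%x. c * pop d V p v x)"
  using degree_smult_le[of c p]
  by (auto simp: pop_altdef[of _ "degree p"] sum_distrib_left mult.assoc)

lemma Hr_sum: "Hr d V (%x. \<Sum>i\<in>I. c i * f i x) = (%x. \<Sum>i\<in>I. c i * Hr d V (f i) x)"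
proof (induction I rule: infinite_finite_induct)
  case (insert j F)
  then show ?case using Hr_linear[of d V "c j" "f j" 1 "%x. \<Sum>i\<in>F. c i * f i x"] by simp
qed (auto simp: Hr_def)

lemma pop_X: "pop d V (pCons 0 p) v = Hr d V (pop d V p v)"
proof
  fix x
  have "pop d V (pCons 0 p) v x = (\<Sum>i\<le>Suc (degree p). coeff (pCons 0 p) i * (Hr d V ^^ i) v x)"
    by (rule pop_altdef) (rule degree_pCons_le)
  also have "\<dots> = (\<Sum>i\<le>degree p. coeff p i * (Hr d V ^^ Suc i) v x)"
    by (subst sum.atMost_Suc_shift) simp
  also have "\<dots> = Hr d V (pop d V p v) x"
    unfolding pop_def[abs_def] Hr_sum by simp
  finally show "pop d V (pCons 0 p) v x = Hr d V (pop d V p v) x" .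
qed

lemma pop_mult: "pop d V (p * q) v = pop d V p (pop d V q v)"
proof (induction p)
  case 0 show ?case by (simp add: pop_def fun_eq_iff)
next
  case (pCons a p)
  have c: "pop d V [:a:] w = (%x. a * w x)" for w by (simp add: pop_def fun_eq_iff)
  have "pCons a p = [:a:] + pCons 0 p" by simp
  then have "pop d V (pCons a p) (pop d V q v) = (%x. a * pop d V q v x + Hr d V (pop d V p (pop d V q v)) x)"
    using pop_add[of d V "[:a:]" "pCons 0 p"] c pop_X by metis
  moreover have "pop d V (pCons a p * q) v = (%x. a * pop d V q v x + Hr d V (pop d V (p * q) v) x)"
    by (simp add: pop_add pop_smult pop_X)
  ultimately show ?case using pCons by simp
qed

lemma pop_const: "pop d V [:c:] v = (%x. c * v x)" by (simp add: pop_def fun_eq_iff)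

lemma pop_1: "pop d V 1 v = v" using pop_const[of d V 1 v] by (simp add: one_pCons)

lemma ip_pop: "ip v (pop d V p w) = (\<Sum>i\<le>degree p. coeff p i * ip v ((Hr d V ^^ i) w))"
  unfolding pop_def[abs_def] ip_sum_right
  using ip_lin_right[of v _ _ 0 "%_. 0"] by simp

lemma ip_pop_sym:
  assumes "fs d v" "fs d w"
  shows "ip (pop d V p v) w = ip v (pop d V p w)"
proof -
  have "ip (pop d V p v) w = ip w (pop d V p v)" by (rule ip_commute[OF fs_pop[OF assms(1)] assms(2)])
  also have "\<dots> = ip v (pop d V p w)"
    unfolding ip_pop using ip_Hrn_sym[OF assms] ip_commute[OF assms(2) fs_Hrn[OF assms(1)]] by simp
  finally show ?thesis .
qed

section \<open>Positivity of Bernstein polynomials of H for a bounded potential\<close>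

locale bounded_potential =
  fixes d :: nat and V :: "site => real" and R :: real
  assumes R0: "0 \<le> R" and bdd: "!!x. x \<in> Zd d ==> \<bar>V x\<bar> \<le> R"
begin

text \<open>A bound for the norm of H: R from the potential, 2d from the neighbours, and 1 to keep
  it positive.\<close>

definition rad :: real where "rad = R + 2 * real d + 1"

lemma rad_pos: "0 < rad" using R0 by (simp add: rad_def)

text \<open>In the hopping term each product v x v y is split into half squares; the two halves have
  equal sums by symmetry of the neighbour relation, and every site has at most 2d
  neighbours.\<close>

lemma form_bound:
  assumes v: "fs d v"
  shows "\<bar>ip v (Hr d V v)\<bar> \<le> rad * ip v v"
proof -
  let ?S = "supp v" let ?n = "%x y. if y \<in> nbrs d x then 1 else (0::real)"
  have f: "finite ?S" "?S \<subseteq> Zd d" using v by (auto simp: fs_def)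
  define Q where "Q = (\<Sum>x\<in>?S. \<Sum>y\<in>?S. ?n x y * (v x * v y)) + (\<Sum>x\<in>?S. V x * (v x * v x))"
  have eq: "ip v (Hr d V v) = Q"
    unfolding Q_def ip_def Hr_on_finite[OF f(1) order_refl] by (simp add: distrib_left sum.distrib sum_distrib_left mult_ac)
  have 1: "\<bar>Q\<bar> \<le> (\<Sum>x\<in>?S. \<Sum>y\<in>?S. ?n x y * ((v x)\<^sup>2 / 2 + (v y)\<^sup>2 / 2)) + (\<Sum>x\<in>?S. R * (v x)\<^sup>2)"
    unfolding Q_def
  proof (rule order_trans[OF abs_triangle_ineq], rule add_mono)
    have xy: "\<bar>a * b\<bar> \<le> a\<^sup>2 / 2 + b\<^sup>2 / 2" for a b :: real
      using sum_squares_bound[of "\<bar>a\<bar>" "\<bar>b\<bar>"] by (simp add: abs_mult)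
    show "\<bar>\<Sum>x\<in>?S. \<Sum>y\<in>?S. ?n x y * (v x * v y)\<bar> \<le> (\<Sum>x\<in>?S. \<Sum>y\<in>?S. ?n x y * ((v x)\<^sup>2 / 2 + (v y)\<^sup>2 / 2))"
      by (rule order_trans[OF sum_abs], rule sum_mono, rule order_trans[OF sum_abs], rule sum_mono)
        (use xy in auto)
    show "\<bar>\<Sum>x\<in>?S. V x * (v x * v x)\<bar> \<le> (\<Sum>x\<in>?S. R * (v x)\<^sup>2)"
      by (rule order_trans[OF sum_abs], rule sum_mono)
        (use f bdd in \<open>auto simp: abs_mult power2_eq_square intro!: mult_right_mono\<close>)
  qed
  have 2: "(\<Sum>x\<in>?S. \<Sum>y\<in>?S. ?n x y * ((v x)\<^sup>2 / 2 + (v y)\<^sup>2 / 2)) = (\<Sum>x\<in>?S. \<Sum>y\<in>?S. ?n x y * (v x)\<^sup>2)"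
  proof -
    have "(\<Sum>x\<in>?S. \<Sum>y\<in>?S. ?n x y * ((v x)\<^sup>2 / 2 + (v y)\<^sup>2 / 2))
      = (\<Sum>x\<in>?S. \<Sum>y\<in>?S. ?n x y * ((v x)\<^sup>2 / 2)) + (\<Sum>x\<in>?S. \<Sum>y\<in>?S. ?n x y * ((v y)\<^sup>2 / 2))"
      by (simp only: distrib_left sum.distrib)
    also have "(\<Sum>x\<in>?S. \<Sum>y\<in>?S. ?n x y * ((v y)\<^sup>2 / 2)) = (\<Sum>x\<in>?S. \<Sum>y\<in>?S. ?n x y * ((v x)\<^sup>2 / 2))"
      by (subst sum.swap) (intro sum.cong refl, simp add: nbrs_sym)
    also have "(\<Sum>x\<in>?S. \<Sum>y\<in>?S. ?n x y * ((v x)\<^sup>2 / 2)) + (\<Sum>x\<in>?S. \<Sum>y\<in>?S. ?n x y * ((v x)\<^sup>2 / 2))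
      = (\<Sum>x\<in>?S. \<Sum>y\<in>?S. ?n x y * (v x)\<^sup>2)"
      unfolding sum.distrib[symmetric] by (intro sum.cong refl) simp
    finally show ?thesis .
  qed
  have 3: "(\<Sum>x\<in>?S. \<Sum>y\<in>?S. ?n x y * (v x)\<^sup>2) \<le> (\<Sum>x\<in>?S. 2 * real d * (v x)\<^sup>2)"
  proof (rule sum_mono)
    fix x
    have "(\<Sum>y\<in>?S. ?n x y) = real (card (?S \<inter> nbrs d x))"
      using f(1) by (simp add: sum.inter_filter[symmetric] Int_def)
    also have "\<dots> \<le> 2 * real d"
    proof -
      have "card (?S \<inter> nbrs d x) \<le> card (nbrs d x)" by (intro card_mono finite_nbrs) auto
      then show ?thesis using card_nbrs[of d x] by linarith
    qed
    finally show "(\<Sum>y\<in>?S. ?n x y * (v x)\<^sup>2) \<le> 2 * real d * (v x)\<^sup>2"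
      unfolding sum_distrib_right[symmetric] by (rule mult_right_mono) simp
  qed
  have 4: "(\<Sum>x\<in>?S. 2 * real d * (v x)\<^sup>2) + (\<Sum>x\<in>?S. R * (v x)\<^sup>2) \<le> rad * ip v v"
    unfolding ip_def rad_def sum_distrib_left sum.distrib[symmetric]
    by (intro sum_mono) (simp add: algebra_simps power2_eq_square)
  show ?thesis unfolding eq using 1 2 3 4 by linarith
qed

lemma pop_lin: "pop d V [:a, b:] v = (%x. a * v x + b * Hr d V v x)"
proof -
  have 1: "pop d V [:0, b:] v = (%x. b * Hr d V v x)"
  proof -
    have "pop d V [:0, b:] v = Hr d V (pop d V [:b:] v)" by (rule pop_X)
    also have "\<dots> = (%x. b * Hr d V v x)" unfolding pop_const using Hr_linear[of d V b v 0 v] by simp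
    finally show ?thesis .
  qed
  have "[:a, b:] = [:a:] + [:0, b:]" by simp
  then show ?thesis using pop_add[of d V "[:a:]" "[:0, b:]" v] 1 pop_const by metis
qed

lemma ip_pop_add: "ip u (pop d V (p + q) w) = ip u (pop d V p w) + ip u (pop d V q w)"
  using ip_lin_right[of u 1 "pop d V p w" 1 "pop d V q w"] by (simp add: pop_add)

lemma ip_pop_smult: "ip u (pop d V (smult c p) w) = c * ip u (pop d V p w)"
  using ip_lin_right[of u c "pop d V p w" 0 w] by (simp add: pop_smult)

lemma pop_pos_lin:
  assumes v: "fs d v"
  shows "0 \<le> ip v (pop d V [:rad, 1:] v)" "0 \<le> ip v (pop d V [:rad, -1:] v)"
  unfolding pop_lin ip_lin_right using form_bound[OF v] by (auto simp: abs_le_iff)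

lemma pop_pos_square:
  assumes v: "fs d v"
  shows "ip v (pop d V (g * g * h) v) = ip (pop d V g v) (pop d V h (pop d V g v))"
proof -
  have eq: "g * g * h = g * (h * g)" by (simp add: mult_ac)
  have "ip v (pop d V (g * g * h) v) = ip v (pop d V g (pop d V (h * g) v))"
    unfolding eq by (simp only: pop_mult)
  also have "\<dots> = ip (pop d V g v) (pop d V (h * g) v)"
    by (rule ip_pop_sym[symmetric]) (intro fs_pop v)+
  finally show ?thesis by (simp add: pop_mult)
qed

text \<open>Even powers of rad + H and rad - H are distributed symmetrically over both vectors,
  which leaves exponents 0 or 1.\<close>

lemma pop_bernR_pos:
  assumes v: "fs d v"
  shows "0 \<le> ip v (pop d V (bernR rad k l) v)"
proof -
  let ?p = "[:rad, 1:]" and ?q = "[:rad, -1:]"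
  have h: "0 \<le> ip u (pop d V (?p ^ r * ?q ^ s) u)" if u: "fs d u" and rs: "r < 2" "s < 2" for u r s
  proof -
    consider "r = 0 \<and> s = 0" | "r = 1 \<and> s = 0" | "r = 0 \<and> s = 1" | "r = 1 \<and> s = 1" using rs by linarith
    then show ?thesis
    proof cases
      case 1 then show ?thesis by (simp add: pop_1 ip_nonneg)
    next
      case 2 then show ?thesis using pop_pos_lin[OF u] by simp
    next
      case 3 then show ?thesis using pop_pos_lin[OF u] by simp
    next
      case 4
      \<comment> \<open>As p + q = 2 rad, the product (rad + H)(rad - H) becomes a sum of two terms
        in which one positive linear factor stands between equal factors.\<close>
      have "smult (2 * rad) (?p * ?q) = ?p * ?p * ?q + ?q * ?q * ?p"
        by (simp add: algebra_simps)
      then have "2 * rad * ip u (pop d V (?p * ?q) u) = ip u (pop d V (?p * ?p * ?q + ?q * ?q * ?p) u)"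
        using ip_pop_smult[of u "2 * rad" "?p * ?q" u] by metis
      also have "\<dots> = ip u (pop d V (?p * ?p * ?q) u) + ip u (pop d V (?q * ?q * ?p) u)"
        by (rule ip_pop_add)
      also have "\<dots> \<ge> 0"
        unfolding pop_pos_square[OF u] by (intro add_nonneg_nonneg pop_pos_lin fs_pop u)
      finally have "0 \<le> 2 * rad * ip u (pop d V (?p * ?q) u)" .
      then have "0 \<le> ip u (pop d V (?p * ?q) u)" using rad_pos by (simp add: zero_le_mult_iff)
      then show ?thesis using 4 by (simp only: power_one_right)
    qed
  qed
  have eq: "bernR rad k l = (?p ^ (k div 2) * ?q ^ (l div 2)) * (?p ^ (k div 2) * ?q ^ (l div 2)) * (?p ^ (k mod 2) * ?q ^ (l mod 2))"
  proof -
    have e: "x ^ n = x ^ (n div 2) * x ^ (n div 2) * x ^ (n mod 2)" for x :: "real poly" and n :: nat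
    proof -
      have "n div 2 + n div 2 + n mod 2 = n" by presburger
      then show ?thesis by (metis power_add)
    qed
    show ?thesis unfolding bernR_def
      by (subst e[of ?p k], subst e[of ?q l]) (simp only: mult_ac)
  qed
  show ?thesis
    unfolding eq pop_pos_square[OF v] by (rule h[OF fs_pop[OF v]]) auto
qed

end

section \<open>Normal functionals and the spectral form\<close>

text \<open>Normal functionals on bounded Borel functions. These properties are what is needed for
  two functionals that agree on truncated powers to agree on all truncated functions.\<close>

definition adm :: "((real => real) => real) => bool" where
  "adm A \<longleftrightarrow> (\<forall>f g. bbm f \<longrightarrow> bbm g \<longrightarrow> A (%t. f t + g t) = A f + A g) \<and>
    (\<forall>c f. bbm f \<longrightarrow> A (%t. c * f t) = c * A f) \<and>
    (\<forall>F f B. (\<forall>n. bbm (F n)) \<longrightarrow> (\<forall>n t. \<bar>F n t\<bar> \<le> B) \<longrightarrow> (\<forall>t. (%n. F n t) \<longlonglongrightarrow> f t) \<longrightarrow> (%n. A (F n)) \<longlonglongrightarrow> A f)"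

lemma admI:
  fixes A :: "(real => real) => real"
  assumes "!!f g. bbm f ==> bbm g ==> A (%t. f t + g t) = A f + A g"
    "!!c f. bbm f ==> A (%t. c * f t) = c * A f"
    "!!F f B. (!!n. bbm (F n)) ==> (!!n t. \<bar>F n t\<bar> \<le> B) ==> (!!t. (%n. F n t) \<longlonglongrightarrow> f t) ==> (%n. A (F n)) \<longlonglongrightarrow> A f"
  shows "adm A"
  unfolding adm_def using assms by blast

lemma admD:
  assumes "adm A"
  shows "bbm f ==> bbm g ==> A (%t. f t + g t) = A f + A g"
    "bbm f ==> A (%t. c * f t) = c * A f"
    "(!!n. bbm (F n)) ==> (!!n t. \<bar>F n t\<bar> \<le> B) ==> (!!t. (%n. F n t) \<longlonglongrightarrow> f t) ==> (%n. A (F n)) \<longlonglongrightarrow> A f"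
  using assms unfolding adm_def by blast+

lemma adm_add:
  assumes A: "adm A" and B: "adm B" shows "adm (%f. A f + B f)"
proof (rule admI)
  fix F :: "nat => real => real" and f b assume F: "!!n. bbm (F n)" "!!n t. \<bar>F n t\<bar> \<le> b" "!!t. (%n. F n t) \<longlonglongrightarrow> f t"
  show "(%n. A (F n) + B (F n)) \<longlonglongrightarrow> A f + B f"
    by (rule tendsto_add[OF admD(3)[OF A F] admD(3)[OF B F]])
qed (simp_all add: admD(1,2)[OF A] admD(1,2)[OF B] distrib_left)

lemma adm_scale:
  assumes A: "adm A" shows "adm (%f. c * A f)"
proof (rule admI)
  fix F :: "nat => real => real" and f b assume F: "!!n. bbm (F n)" "!!n t. \<bar>F n t\<bar> \<le> b" "!!t. (%n. F n t) \<longlonglongrightarrow> f t"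
  show "(%n. c * A (F n)) \<longlonglongrightarrow> c * A f"
    by (rule tendsto_mult_left[OF admD(3)[OF A F]])
qed (simp_all add: admD(1,2)[OF A] distrib_left)

lemma adm_diff: "adm A ==> adm B ==> adm (%f. A f - B f)"
  using adm_add[OF _ adm_scale[of B "-1"], of A] by simp

lemma adm_integral: "finite_measure M ==> sets M = sets borel ==> adm (%f. \<integral>t. f t \<partial>M)"
proof (rule admI)
  fix F :: "nat => real => real" and f b assume M: "finite_measure M" "sets M = sets borel"
    and F: "!!n. bbm (F n)" "!!n t. \<bar>F n t\<bar> \<le> b" "!!t. (%n. F n t) \<longlonglongrightarrow> f t"
  show "(%n. integral\<^sup>L M (F n)) \<longlonglongrightarrow> integral\<^sup>L M f"
    by (rule integral_limit_bbm[OF M F])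
qed (simp_all add: integrable_bbm)

lemma adm_mult_fun:
  assumes A: "adm A" and g: "bbm g"
  shows "adm (%f. A (%t. f t * g t))"
proof (rule admI)
  fix f h :: "real => real" assume "bbm f" "bbm h"
  then show "A (%t. (f t + h t) * g t) = A (%t. f t * g t) + A (%t. h t * g t)"
    using admD(1)[OF A bbm_mult[OF _ g] bbm_mult[OF _ g], of f h] by (simp add: distrib_right)
next
  fix c and f :: "real => real" assume "bbm f"
  then show "A (%t. c * f t * g t) = c * A (%t. f t * g t)"
    using admD(2)[OF A bbm_mult[OF _ g], of f c] by (simp add: mult.assoc)
next
  fix F :: "nat => real => real" and f B assume F: "!!n. bbm (F n)" "!!n t. \<bar>F n t\<bar> \<le> B" "!!t. (%n. F n t) \<longlonglongrightarrow> f t"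
  obtain C where C: "0 \<le> C" "!!t. \<bar>g t\<bar> \<le> C" using bbm_bound[OF g] by metis
  show "(%n. A (%t. F n t * g t)) \<longlonglongrightarrow> A (%t. f t * g t)"
  proof (rule admD(3)[OF A, where B="B * C"])
    show "\<bar>F n t * g t\<bar> \<le> B * C" for n t
      unfolding abs_mult using F(2)[of n t] C by (intro mult_mono) auto
  qed (auto intro!: bbm_mult F g tendsto_mult_right)
qed

lemma adm_eqI:
  assumes A: "adm A" and B: "adm B"
    and mono: "!!n. A (%t. t ^ n * indicator {-R..R} t) = B (%t. t ^ n * indicator {-R..R} t)" and f: "bbm f"
  shows "A (%t. f t * indicator {-R..R} t) = B (%t. f t * indicator {-R..R} t)"
proof (rule bounded_borel_class1[where P="%f. A f = B f", OF mono _ _ _ f])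
  fix F :: "nat => real => real" and f c assume F: "!!n. bbm (F n)" "!!n. A (F n) = B (F n)" "!!n t. \<bar>F n t\<bar> \<le> c" "!!t. (%n. F n t) \<longlonglongrightarrow> f t"
  show "A f = B f"
    using admD(3)[OF A F(1,3,4)] admD(3)[OF B F(1,3,4)] F(2) by (auto intro: LIMSEQ_unique)
qed (auto simp: admD(1,2)[OF A] admD(1,2)[OF B])

section \<open>The spectral form of H on finitely supported vectors\<close>

definition sm :: "nat => (site => real) => (site => real) => real measure" where
  "sm d V v = specmeas d V (%x. complex_of_real (v x))"

text \<open>The form <v, f(H) w>, by polarization of spectral measures. Bilinearity is not built in;
  it is derived from the moments.\<close>

definition rf :: "nat => (site => real) => (real => real) => (site => real) => (site => real) => real" where
  "rf d V f v w = ((\<integral>t. f t \<partial>sm d V (%x. v x + w x)) - (\<integral>t. f t \<partial>sm d V (%x. v x - w x))) / 4"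

lemma specmeas_mom: "specmeas d V v = mom_measure (%n. innerZ d v ((Hop d V ^^ n) v))"
  unfolding specmeas_def mom_measure_def mom_rep_def ..

lemma innerZ_real:
  assumes "fs d v"
  shows "innerZ d (%x. complex_of_real (v x)) (%x. complex_of_real (w x)) = complex_of_real (ip v w)"
proof -
  have "innerZ d (%x. complex_of_real (v x)) (%x. complex_of_real (w x)) = infsum (%x. complex_of_real (v x * w x)) (supp v)"
    unfolding innerZ_def using assms by (intro infsum_cong_neutral) (auto simp: supp_def fs_def)
  also have "\<dots> = complex_of_real (ip v w)"
    using assms by (simp add: infsum_finite ip_def fs_def)
  finally show ?thesis .
qed

lemma sm_mom:
  assumes "fs d v"
  shows "sm d V v = mom_measure (%n. complex_of_real (ip v ((Hr d V ^^ n) v)))"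
  unfolding sm_def specmeas_mom Hopn_of_real innerZ_real[OF assms] ..

lemma fmat_real: "fmat d V (%t. complex_of_real (f t)) x y = complex_of_real (rf d V f (dr x) (dr y))"
proof -
  have "(%z. delta x z + delta y z) = (%z. complex_of_real (dr x z + dr y z))"
    "(%z. delta x z - delta y z) = (%z. complex_of_real (dr x z - dr y z))"
    by (auto simp: delta_def dr_def)
  then show ?thesis unfolding fmat_def rf_def sm_def by simp
qed

context bounded_potential
begin

text \<open>Five times \<open>rad\<close> because the solution of the moment problem is located only
  up to this factor; values of f outside [-C,C] are invisible to the form.\<close>

definition C :: real where "C = 5 * rad"

lemma C_pos: "0 < C" using rad_pos by (simp add: C_def)

lemma sm_rep:
  assumes v: "fs d v"
  shows "mom_rep (%n. complex_of_real (ip v ((Hr d V ^^ n) v))) (sm d V v)"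
    "emeasure (sm d V v) (UNIV - {-C..C}) = 0"
proof -
  have "0 \<le> mfun1 (%n. Re (complex_of_real (ip v ((Hr d V ^^ n) v)))) (bernR rad k l)" for k l
    using pop_bernR_pos[OF v, of k l] unfolding ip_pop mfun1_def by simp
  from mom_rep_exists[OF rad_pos _ this] obtain \<mu> where
    \<mu>: "mom_rep (%n. complex_of_real (ip v ((Hr d V ^^ n) v))) \<mu>" "emeasure \<mu> (UNIV - {-C..C}) = 0"
    unfolding C_def by auto
  then have "sm d V v = \<mu>" unfolding sm_mom[OF v] by (intro mom_measure_eq)
  then show "mom_rep (%n. complex_of_real (ip v ((Hr d V ^^ n) v))) (sm d V v)"
    "emeasure (sm d V v) (UNIV - {-C..C}) = 0" using \<mu> by auto
qed

lemma sm_finite: "fs d v ==> finite_measure (sm d V v)" and sm_sets: "fs d v ==> sets (sm d V v) = sets borel"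
  using sm_rep(1) unfolding mom_rep_def by auto

lemma sm_moment: "fs d v ==> (\<integral>t. t ^ n \<partial>sm d V v) = ip v ((Hr d V ^^ n) v)"
  using sm_rep(1) unfolding mom_rep_def by (metis of_real_eq_iff)

lemma sm_ind:
  fixes f :: "real => real"
  assumes "fs d v" "f \<in> borel_measurable borel"
  shows "(\<integral>t. f t * indicator {-C..C} t \<partial>sm d V v) = (\<integral>t. f t \<partial>sm d V v)"
  using integral_AE_indicator[where f=f, OF sm_rep(2)[OF assms(1)] _ sm_sets[OF assms(1)] assms(2)] by (simp add: mult.commute)

lemma sm_power_ind: "fs d v ==> (\<integral>t. t ^ n * indicator {-C..C} t \<partial>sm d V v) = ip v ((Hr d V ^^ n) v)"
  using sm_ind[of v "%t. t ^ n"] by (simp add: sm_moment)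

lemma adm_sm: "fs d v ==> adm (%f. \<integral>t. f t \<partial>sm d V v)"
  by (intro adm_integral sm_finite sm_sets)

lemma adm_rf: "fs d v ==> fs d w ==> adm (%f. rf d V f v w)"
proof -
  assume "fs d v" "fs d w"
  then have "adm (%f. (1/4) * ((\<integral>t. f t \<partial>sm d V (%x. v x + w x)) - (\<integral>t. f t \<partial>sm d V (%x. v x - w x))))"
    by (intro adm_scale adm_diff adm_sm fs_add fs_diff)
  then show ?thesis unfolding rf_def by simp
qed

lemma rf_ind:
  assumes "fs d v" "fs d w" "f \<in> borel_measurable borel"
  shows "rf d V (%t. f t * indicator {-C..C} t) v w = rf d V f v w"
  unfolding rf_def using assms by (simp add: sm_ind fs_add fs_diff)

lemma rf_power:
  assumes v: "fs d v" and w: "fs d w"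
  shows "rf d V (%t. t ^ n * indicator {-C..C} t) v w = ip v ((Hr d V ^^ n) w)"
proof -
  let ?H = "Hr d V ^^ n"
  have 1: "ip (%x. v x + w x) (?H (%x. v x + w x)) = ip v (?H v) + ip v (?H w) + ip w (?H v) + ip w (?H w)"
    using Hrn_linear[of n d V 1 v 1 w] ip_lin_left[OF v w, of 1 1 "%x. ?H v x + ?H w x"]
      ip_lin_right[of v 1 "?H v" 1 "?H w"] ip_lin_right[of w 1 "?H v" 1 "?H w"] by simp
  have 2: "ip (%x. v x - w x) (?H (%x. v x - w x)) = ip v (?H v) - ip v (?H w) - ip w (?H v) + ip w (?H w)"
    using Hrn_linear[of n d V 1 v "-1" w] ip_lin_left[OF v w, of 1 "-1" "%x. ?H v x - ?H w x"]
      ip_lin_right[of v 1 "?H v" "-1" "?H w"] ip_lin_right[of w 1 "?H v" "-1" "?H w"] by simp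
  have 3: "ip w (?H v) = ip v (?H w)"
    using ip_Hrn_sym[OF v w] ip_commute[OF w fs_Hrn[OF v]] by simp
  show ?thesis unfolding rf_def sm_power_ind[OF fs_add[OF v w]] sm_power_ind[OF fs_diff[OF v w]] 1 2 3 by simp
qed

text \<open>The scheme behind most identities for the form: both sides are normal in f, see f on
  [-C,C] only, and agree on powers.\<close>

lemma rf_eqI:
  assumes "adm A" "adm B" "bbm f"
    and "!!n. A (%t. t ^ n * indicator {-C..C} t) = B (%t. t ^ n * indicator {-C..C} t)"
    and "A (%t. f t * indicator {-C..C} t) = A f" "B (%t. f t * indicator {-C..C} t) = B f"
  shows "A f = B f"
  using adm_eqI[OF assms(1,2,4,3)] assms(5,6) by simp

lemma rf_diag:
  assumes v: "fs d v" and f: "bbm f" shows "rf d V f v v = (\<integral>t. f t \<partial>sm d V v)"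
  by (rule rf_eqI[OF adm_rf[OF v v] adm_sm[OF v] f])
    (simp_all add: rf_power sm_power_ind rf_ind sm_ind v f bbm_measurable)

lemma rf_sym:
  assumes v: "fs d v" and w: "fs d w" and f: "bbm f" shows "rf d V f v w = rf d V f w v"
  by (rule rf_eqI[OF adm_rf[OF v w] adm_rf[OF w v] f])
    (use ip_Hrn_sym[OF v w] ip_commute[OF w fs_Hrn[OF v]] in \<open>simp_all add: rf_power rf_ind v w f bbm_measurable\<close>)

lemma rf_lin_right:
  assumes v: "fs d v" and w: "fs d w" and u: "fs d u" and f: "bbm f"
  shows "rf d V f v (%x. a * w x + b * u x) = a * rf d V f v w + b * rf d V f v u"
  by (rule rf_eqI[OF adm_rf[OF v fs_lin[OF w u]] adm_add[OF adm_scale[OF adm_rf[OF v w]] adm_scale[OF adm_rf[OF v u]]] f])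
    (simp_all add: rf_power rf_ind v w u f bbm_measurable fs_lin Hrn_linear ip_lin_right)

lemma rf_lin_left:
  assumes v: "fs d v" and w: "fs d w" and u: "fs d u" and f: "bbm f"
  shows "rf d V f (%x. a * w x + b * u x) v = a * rf d V f w v + b * rf d V f u v"
  using rf_lin_right[OF v w u f] rf_sym[OF v _ f] w u fs_lin by simp

lemma rf_expand:
  assumes v: "fs d v" and f: "bbm f" and S: "finite S" "S \<subseteq> Zd d"
  shows "rf d V f v (%x. \<Sum>u\<in>S. c u * dr u x) = (\<Sum>u\<in>S. c u * rf d V f v (dr u))"
  using S
proof (induction S rule: finite_induct)
  case empty
  show ?case using rf_lin_right[OF v fs_0 fs_0 f, of 0 0] by simp
next
  case (insert u S)
  have "fs d (%x. \<Sum>u\<in>S. c u * dr u x)" using insert by (intro fs_sum fs_scale fs_dr) auto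
  then show ?case using insert rf_lin_right[OF v fs_dr[of u] _ f, of "%x. \<Sum>u\<in>S. c u * dr u x" "c u" 1] by simp
qed

lemma fs_as_sum: "fs d w ==> w = (%x. \<Sum>u\<in>supp w. w u * dr u x)"
proof
  fix x assume w: "fs d w"
  have "(\<Sum>u\<in>supp w. w u * dr u x) = (\<Sum>u\<in>supp w. if u = x then w x else 0)"
    by (intro sum.cong) (auto simp: dr_def)
  also have "\<dots> = w x" using w by (auto simp: supp_def fs_def)
  finally show "w x = (\<Sum>u\<in>supp w. w u * dr u x)" by simp
qed

lemma rf_expand_supp: "fs d v ==> fs d w ==> bbm f ==> rf d V f v w = (\<Sum>u\<in>supp w. w u * rf d V f v (dr u))"
  using rf_expand[of v f "supp w" w] fs_as_sum[of w] by (auto simp: fs_def)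

lemma rf_pos:
  assumes v: "fs d v" and f: "bbm f" "!!t. t \<in> {-C..C} ==> 0 \<le> f t"
  shows "0 \<le> rf d V f v v"
proof -
  have "rf d V f v v = (\<integral>t. f t * indicator {-C..C} t \<partial>sm d V v)"
    using rf_diag[OF v f(1)] sm_ind[OF v bbm_measurable[OF f(1)]] by simp
  also have "\<dots> \<ge> 0" by (intro Bochner_Integration.integral_nonneg) (use f(2) in \<open>auto simp: indicator_def\<close>)
  finally show ?thesis .
qed

lemma rf_one: "fs d v ==> fs d w ==> rf d V (%_. 1) v w = ip v w"
  using rf_power[of v w 0] rf_ind[of v w "%_. 1"] by simp

lemma rf_cmult: "fs d v ==> fs d w ==> bbm f ==> rf d V (%t. c * f t) v w = c * rf d V f v w"
  by (rule admD(2)[OF adm_rf])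

lemma rf_plus: "fs d v ==> fs d w ==> bbm f ==> bbm g ==> rf d V (%t. f t + g t) v w = rf d V f v w + rf d V g v w"
  by (rule admD(1)[OF adm_rf])

lemma rf_minus: "fs d v ==> fs d w ==> bbm f ==> bbm g ==> rf d V (%t. f t - g t) v w = rf d V f v w - rf d V g v w"
  using rf_plus[of v w f "%t. - 1 * g t"] rf_cmult[of v w g "-1"] bbm_scale[of g "-1"] by simp

lemma rf_mono:
  assumes v: "fs d v" and f: "bbm f" "bbm g" "!!t. t \<in> {-C..C} ==> f t \<le> g t"
  shows "rf d V f v v \<le> rf d V g v v"
  using rf_pos[OF v bbm_diff[OF f(2,1)]] f rf_minus[OF v v f(2,1)] by simp

lemma rf_le_norm:
  assumes v: "fs d v" and f: "bbm f" "!!t. t \<in> {-C..C} ==> f t \<le> c"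
  shows "rf d V f v v \<le> c * ip v v"
  using rf_mono[OF v f(1) bbm_const[of c]] f(2) rf_cmult[OF v v bbm_const[of 1], of c] rf_one[OF v v] by simp

lemma rf_CS:
  assumes v: "fs d v" and w: "fs d w" and f: "bbm f" "!!t. t \<in> {-C..C} ==> 0 \<le> f t"
  shows "(rf d V f v w)\<^sup>2 \<le> rf d V f v v * rf d V f w w"
proof -
  let ?a = "rf d V f v v" and ?b = "rf d V f v w" and ?c = "rf d V f w w"
  have q: "0 \<le> s\<^sup>2 * ?a + 2 * s * r * ?b + r\<^sup>2 * ?c" for s r
  proof -
    let ?u = "%x. s * v x + r * w x"
    have u: "fs d ?u" by (rule fs_lin[OF v w])
    have "rf d V f ?u ?u = s * rf d V f v ?u + r * rf d V f w ?u" by (rule rf_lin_left[OF u v w f(1)])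
    also have "rf d V f v ?u = s * ?a + r * ?b" by (rule rf_lin_right[OF v v w f(1)])
    also have "rf d V f w ?u = s * rf d V f w v + r * ?c" by (rule rf_lin_right[OF w v w f(1)])
    also have "rf d V f w v = ?b" by (rule rf_sym[OF w v f(1)])
    finally show ?thesis using rf_pos[OF u f] by (simp add: power2_eq_square algebra_simps)
  qed
  have a: "0 \<le> ?a" "0 \<le> ?c" using rf_pos f v w by auto
  show ?thesis
  proof (cases "?c = 0")
    case True
    have "?b = 0"
    proof (rule ccontr)
      assume b: "?b \<noteq> 0"
      have "0 \<le> ?a + 2 * r * ?b" for r using q[of 1 r] True by simp
      from this[of "- (?a + 1) / (2 * ?b)"] show False using b by (simp add: field_simps)
    qed
    then show ?thesis using True by simp
  next
    case False
    then have c: "0 < ?c" using a by simp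
    have "0 \<le> ?c * (?c * ?a - ?b\<^sup>2)" using q[of ?c "- ?b"] by (simp add: power2_eq_square algebra_simps)
    then show ?thesis using c by (simp add: zero_le_mult_iff mult.commute)
  qed
qed

end

section \<open>Products in the functional calculus\<close>

lemma has_sum_abs_le:
  fixes f :: "'a => real"
  assumes "(f has_sum s) A" "!!T. finite T ==> T \<subseteq> A ==> \<bar>sum f T\<bar> \<le> c"
  shows "\<bar>s\<bar> \<le> c"
proof -
  have "(sum f \<longlongrightarrow> s) (finite_subsets_at_top A)" using assms(1) by (simp add: has_sum_def)
  then have "((%T. \<bar>sum f T\<bar>) \<longlongrightarrow> \<bar>s\<bar>) (finite_subsets_at_top A)" by (rule tendsto_rabs)
  then show ?thesis
    by (rule tendsto_upperbound) (auto intro!: eventually_finite_subsets_at_top_weakI assms(2))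
qed

lemma l2_summable:
  fixes a b :: "'a => real"
  assumes "!!S. finite S ==> S \<subseteq> X ==> (\<Sum>u\<in>S. (a u)\<^sup>2) \<le> M"
    "!!S. finite S ==> S \<subseteq> X ==> (\<Sum>u\<in>S. (b u)\<^sup>2) \<le> N"
  shows "(%u. \<bar>a u * b u\<bar>) summable_on X" "(%u. a u * b u) summable_on X"
proof -
  show 1: "(%u. \<bar>a u * b u\<bar>) summable_on X"
  proof (rule nonneg_bdd_above_summable_on)
    show "bdd_above (sum (%u. \<bar>a u * b u\<bar>) ` {F. F \<subseteq> X \<and> finite F})"
    proof (rule bdd_aboveI2[where M="M/2 + N/2"])
      fix S assume S: "S \<in> {F. F \<subseteq> X \<and> finite F}"
      have "\<bar>x * y\<bar> \<le> x\<^sup>2 / 2 + y\<^sup>2 / 2" for x y :: real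
        using sum_squares_bound[of "\<bar>x\<bar>" "\<bar>y\<bar>"] by (simp add: abs_mult)
      then have "(\<Sum>u\<in>S. \<bar>a u * b u\<bar>) \<le> (\<Sum>u\<in>S. (a u)\<^sup>2 / 2 + (b u)\<^sup>2 / 2)" by (intro sum_mono)
      also have "\<dots> = (\<Sum>u\<in>S. (a u)\<^sup>2) / 2 + (\<Sum>u\<in>S. (b u)\<^sup>2) / 2" by (simp add: sum.distrib sum_divide_distrib)
      also have "\<dots> \<le> M/2 + N/2" using assms S by (intro add_mono divide_right_mono) auto
      finally show "(\<Sum>u\<in>S. \<bar>a u * b u\<bar>) \<le> M/2 + N/2" .
    qed
  qed simp
  show "(%u. a u * b u) summable_on X"
    by (rule abs_summable_summable) (use 1 in \<open>simp only: real_norm_def\<close>)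
qed

text \<open>Weak convergence in l2: the tail of the fixed vector \<open>a\<close> is small,
  uniformly in n by Cauchy-Schwarz, and on a finite set pointwise convergence suffices.\<close>

lemma l2_limit:
  fixes a :: "'a => real" and b :: "nat => 'a => real"
  assumes a: "!!S. finite S ==> S \<subseteq> X ==> (\<Sum>u\<in>S. (a u)\<^sup>2) \<le> M"
    and b: "!!n S. finite S ==> S \<subseteq> X ==> (\<Sum>u\<in>S. (b n u)\<^sup>2) \<le> N"
    and lim: "!!u. u \<in> X ==> (%n. b n u) \<longlonglongrightarrow> b' u"
  shows "(%n. infsum (%u. a u * b n u) X) \<longlonglongrightarrow> infsum (%u. a u * b' u) X"
proof -
  have b': "(\<Sum>u\<in>S. (b' u)\<^sup>2) \<le> N" if S: "finite S" "S \<subseteq> X" for S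
  proof (rule tendsto_upperbound[where f="%n. \<Sum>u\<in>S. (b n u)\<^sup>2" and F=sequentially])
    show "(%n. \<Sum>u\<in>S. (b n u)\<^sup>2) \<longlonglongrightarrow> (\<Sum>u\<in>S. (b' u)\<^sup>2)"
      using S lim by (intro tendsto_sum tendsto_power) auto
  qed (use b S in auto)
  have N0: "0 \<le> N" using b[of "{}" 0] by simp
  have asum: "(%u. (a u)\<^sup>2) summable_on X"
    by (rule nonneg_bdd_above_summable_on) (auto intro!: bdd_aboveI2[where M=M] a)
  have tail: "\<bar>infsum (%u. a u * c u) (X - S)\<bar> \<le> sqrt (infsum (%u. (a u)\<^sup>2) (X - S)) * sqrt N"
    if c: "!!S. finite S ==> S \<subseteq> X ==> (\<Sum>u\<in>S. (c u)\<^sup>2) \<le> N" for c S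
  proof (rule has_sum_abs_le)
    show "((%u. a u * c u) has_sum infsum (%u. a u * c u) (X - S)) (X - S)"
      by (rule has_sum_infsum, rule summable_on_subset_banach[OF l2_summable(2)[OF a c]]) auto
    fix T assume T: "finite T" "T \<subseteq> X - S"
    have "(\<Sum>u\<in>T. (a u)\<^sup>2) \<le> infsum (%u. (a u)\<^sup>2) (X - S)"
      using T by (intro finite_sum_le_infsum summable_on_subset_banach[OF asum]) auto
    moreover have "(\<Sum>u\<in>T. (c u)\<^sup>2) \<le> N" using T by (intro c) auto
    moreover have "\<bar>\<Sum>u\<in>T. a u * c u\<bar> \<le> sqrt (\<Sum>u\<in>T. (a u)\<^sup>2) * sqrt (\<Sum>u\<in>T. (c u)\<^sup>2)"
    proof -
      have "(\<Sum>u\<in>T. a u * c u)\<^sup>2 \<le> (\<Sum>u\<in>T. (a u)\<^sup>2) * (\<Sum>u\<in>T. (c u)\<^sup>2)"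
        by (rule Cauchy_Schwarz_ineq_sum)
      then have "sqrt ((\<Sum>u\<in>T. a u * c u)\<^sup>2) \<le> sqrt ((\<Sum>u\<in>T. (a u)\<^sup>2) * (\<Sum>u\<in>T. (c u)\<^sup>2))"
        by (rule real_sqrt_le_mono)
      then show ?thesis by (simp add: real_sqrt_mult)
    qed
    ultimately show "\<bar>\<Sum>u\<in>T. a u * c u\<bar> \<le> sqrt (infsum (%u. (a u)\<^sup>2) (X - S)) * sqrt N"
      by (meson mult_mono order_trans real_sqrt_ge_zero real_sqrt_le_mono sum_nonneg zero_le_power2)
  qed
  have split: "infsum (%u. a u * c u) X = (\<Sum>u\<in>S. a u * c u) + infsum (%u. a u * c u) (X - S)"
    if c: "!!S. finite S ==> S \<subseteq> X ==> (\<Sum>u\<in>S. (c u)\<^sup>2) \<le> N" and S: "finite S" "S \<subseteq> X" for c S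
  proof -
    have "infsum (%u. a u * c u) (S \<union> (X - S)) = infsum (%u. a u * c u) S + infsum (%u. a u * c u) (X - S)"
      by (rule infsum_Un_disjoint) (use S l2_summable(2)[OF a c] in \<open>auto intro: summable_on_subset_banach\<close>)
    moreover have "S \<union> (X - S) = X" using S by auto
    ultimately show ?thesis using S by simp
  qed
  show ?thesis
  proof (rule LIMSEQ_I)
    fix e :: real assume e: "0 < e"
    \<comment> \<open>Chosen so that the square root of e' times sqrt N + 1 equals e/3; the 1 avoids
      a division by zero.\<close>
    define e' where "e' = (e / (3 * (sqrt N + 1)))\<^sup>2"
    have e': "0 < e'" unfolding e'_def using e N0
      by (intro zero_less_power divide_pos_pos mult_pos_pos add_nonneg_pos) auto
    obtain S where S: "finite S" "S \<subseteq> X" "infsum (%u. (a u)\<^sup>2) (X - S) < e'"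
    proof -
      have "((%S. sum (%u. (a u)\<^sup>2) S) \<longlongrightarrow> infsum (%u. (a u)\<^sup>2) X) (finite_subsets_at_top X)"
        using has_sum_infsum[OF asum] by (simp add: has_sum_def)
      then have "eventually (%S. sum (%u. (a u)\<^sup>2) S > infsum (%u. (a u)\<^sup>2) X - e') (finite_subsets_at_top X)"
        using e' by (intro order_tendstoD) auto
      then obtain S where S: "finite S" "S \<subseteq> X" "sum (%u. (a u)\<^sup>2) S > infsum (%u. (a u)\<^sup>2) X - e'"
        by (auto simp: eventually_finite_subsets_at_top)
      moreover have "infsum (%u. (a u)\<^sup>2) X = sum (%u. (a u)\<^sup>2) S + infsum (%u. (a u)\<^sup>2) (X - S)"
      proof -
        have "infsum (%u. (a u)\<^sup>2) (S \<union> (X - S)) = infsum (%u. (a u)\<^sup>2) S + infsum (%u. (a u)\<^sup>2) (X - S)"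
          by (rule infsum_Un_disjoint) (use S asum in \<open>auto intro: summable_on_subset_banach\<close>)
        moreover have "S \<union> (X - S) = X" using S by auto
        ultimately show ?thesis using S by simp
      qed
      ultimately show ?thesis using that by force
    qed
    have tl: "sqrt (infsum (%u. (a u)\<^sup>2) (X - S)) * sqrt N \<le> e / 3"
    proof -
      have "sqrt (infsum (%u. (a u)\<^sup>2) (X - S)) \<le> sqrt e'" using S by (intro real_sqrt_le_mono) simp
      also have "sqrt e' = e / (3 * (sqrt N + 1))" unfolding e'_def using e N0 by simp
      finally have "sqrt (infsum (%u. (a u)\<^sup>2) (X - S)) * sqrt N \<le> e / (3 * (sqrt N + 1)) * (sqrt N + 1)"
        using N0 e by (intro mult_mono) (auto simp: infsum_nonneg)
      also have "\<dots> = e / 3" using N0 by (simp add: field_simps add_nonneg_eq_0_iff)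
      finally show ?thesis .
    qed
    have "(%n. \<Sum>u\<in>S. a u * b n u) \<longlonglongrightarrow> (\<Sum>u\<in>S. a u * b' u)"
      using S lim by (intro tendsto_sum tendsto_mult_left) auto
    from LIMSEQ_D[OF this, of "e/3"] e
    obtain n0 where n0: "!!n. n \<ge> n0 ==> \<bar>(\<Sum>u\<in>S. a u * b n u) - (\<Sum>u\<in>S. a u * b' u)\<bar> < e / 3"
      unfolding real_norm_def by auto
    have "norm (infsum (%u. a u * b n u) X - infsum (%u. a u * b' u) X) < e" if "n \<ge> n0" for n
      using n0[OF that] split[OF b[of _ n] S(1,2)] split[OF b' S(1,2)] tail[OF b[of _ n], of S] tail[OF b', of S] tl
      unfolding real_norm_def by linarith
    then show "\<exists>no. \<forall>n\<ge>no. norm (infsum (%u. a u * b n u) X - infsum (%u. a u * b' u) X) < e" by blast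
  qed
qed

context bounded_potential
begin

text \<open>This is the bound of f(H)v in l2 by c times the norm of v, without a vector f(H)v at
  hand. For the test vector w with coefficients <v, f(H) \<delta>_u> on \<open>S\<close>,
  Cauchy-Schwarz in the form of f gives s^2 \<le> (c <v,v>)(c s), where s is the sum to be
  bounded.\<close>

lemma bessel_pos:
  assumes v: "fs d v" and f: "bbm f" "!!t. 0 \<le> f t" "!!t. f t \<le> c" and S: "finite S" "S \<subseteq> Zd d"
  shows "(\<Sum>u\<in>S. (rf d V f v (dr u))\<^sup>2) \<le> c\<^sup>2 * ip v v"
proof -
  define a where "a u = rf d V f v (dr u)" for u
  define w where "w = (%x. \<Sum>u\<in>S. a u * dr u x)"
  have w: "fs d w" unfolding w_def using S by (intro fs_sum fs_scale fs_dr) auto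
  define s where "s = (\<Sum>u\<in>S. (a u)\<^sup>2)"
  have s0: "0 \<le> s" unfolding s_def by (intro sum_nonneg) simp
  have c0: "0 \<le> c" using f(2,3)[of 0] by linarith
  have wx: "w x = (if x \<in> S then a x else 0)" for x
    unfolding w_def dr_def using S by (simp add: if_distrib[of "%z. _ * z"] cong: if_cong)
  have ww: "ip w w = s"
    unfolding s_def by (subst ip_superset[of S]) (auto simp: S wx supp_def power2_eq_square)
  have "rf d V f v w = s"
    unfolding w_def rf_expand[OF v f(1) S] s_def a_def by (simp add: power2_eq_square)
  then have "s\<^sup>2 \<le> rf d V f v v * rf d V f w w" using rf_CS[OF v w f(1)] f(2) by simp
  also have "\<dots> \<le> (c * ip v v) * (c * s)"
    using rf_le_norm[OF v f(1), of c] rf_le_norm[OF w f(1), of c] f(2,3) ww c0 rf_pos[OF w f(1)] ip_nonneg[of v]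
    by (intro mult_mono) auto
  finally have "s * s \<le> (c\<^sup>2 * ip v v) * s" by (simp add: power2_eq_square mult_ac)
  then have "s \<le> c\<^sup>2 * ip v v" using s0 ip_nonneg[of v]
    by (cases "s = 0") (auto simp: mult_le_cancel_right)
  then show ?thesis by (simp add: s_def a_def)
qed

text \<open>Only finiteness matters for the applications, so a factor 4 may be lost in splitting f
  into positive and negative parts.\<close>

lemma bessel:
  assumes v: "fs d v" and f: "bbm f" "!!t. \<bar>f t\<bar> \<le> c" and S: "finite S" "S \<subseteq> Zd d"
  shows "(\<Sum>u\<in>S. (rf d V f v (dr u))\<^sup>2) \<le> 4 * c\<^sup>2 * ip v v"
proof -
  have c0: "0 \<le> c" using f(2)[of 0] by linarith
  define p n where "p t = max (f t) 0" and "n t = max (- f t) 0" for t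
  have bp: "bbm p" "bbm n"
    unfolding p_def n_def using f c0 bbm_measurable[OF f(1)]
    by (auto intro!: bbmI[where B=c] simp: max_def abs_le_iff)
  have pn: "f = (%t. p t - n t)" by (auto simp: p_def n_def max_def)
  have "(\<Sum>u\<in>S. (rf d V f v (dr u))\<^sup>2) \<le> (\<Sum>u\<in>S. 2 * (rf d V p v (dr u))\<^sup>2 + 2 * (rf d V n v (dr u))\<^sup>2)"
  proof (rule sum_mono)
    fix u assume "u \<in> S"
    then have "rf d V f v (dr u) = rf d V p v (dr u) - rf d V n v (dr u)"
      unfolding pn using S by (intro rf_minus v fs_dr bp) auto
    moreover have "(x - y)\<^sup>2 \<le> 2 * x\<^sup>2 + 2 * y\<^sup>2" for x y :: real
      using zero_le_power2[of "x + y"] by (simp add: power2_eq_square algebra_simps)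
    ultimately show "(rf d V f v (dr u))\<^sup>2 \<le> 2 * (rf d V p v (dr u))\<^sup>2 + 2 * (rf d V n v (dr u))\<^sup>2"
      by simp
  qed
  also have "\<dots> = 2 * (\<Sum>u\<in>S. (rf d V p v (dr u))\<^sup>2) + 2 * (\<Sum>u\<in>S. (rf d V n v (dr u))\<^sup>2)"
    by (simp add: sum.distrib sum_distrib_left)
  also have "\<dots> \<le> 2 * (c\<^sup>2 * ip v v) + 2 * (c\<^sup>2 * ip v v)"
    using f(2) by (intro add_mono mult_left_mono bessel_pos[OF v bp(1) _ _ S] bessel_pos[OF v bp(2) _ _ S])
      (auto simp: p_def n_def abs_le_iff c0)
  finally show ?thesis by (simp add: mult_ac)
qed

lemma rf_mult_power:
  assumes v: "fs d v" and w: "fs d w" and f: "bbm f"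
  shows "rf d V (%t. f t * (t ^ n * indicator {-C..C} t)) v w = rf d V f v ((Hr d V ^^ n) w)"
proof -
  have p: "bbm (%t. t ^ n * indicator {-C..C} t)" for n
    by (intro bbm_continuous_compact continuous_intros) auto
  show ?thesis
  proof (rule rf_eqI[OF adm_mult_fun[OF adm_rf[OF v w] p] adm_rf[OF v fs_Hrn[OF w]] f])
    fix m
    have "(%t. t ^ m * indicator {-C..C} t * (t ^ n * indicator {-C..C} t)) = (%t. t ^ (m + n) * indicator {-C..C} t)"
      by (auto simp: indicator_def power_add)
    then show "rf d V (%t. t ^ m * indicator {-C..C} t * (t ^ n * indicator {-C..C} t)) v w =
         rf d V (%t. t ^ m * indicator {-C..C} t) v ((Hr d V ^^ n) w)"
      using rf_power[OF v w] rf_power[OF v fs_Hrn[OF w]] by (simp add: funpow_add)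
    have "(%t. f t * indicator {-C..C} t * (t ^ n * indicator {-C..C} t)) = (%t. f t * (t ^ n * indicator {-C..C} t))"
      by (auto simp: indicator_def)
    then show "rf d V (%t. f t * indicator {-C..C} t * (t ^ n * indicator {-C..C} t)) v w =
      rf d V (%t. f t * (t ^ n * indicator {-C..C} t)) v w" by simp
    show "rf d V (%t. f t * indicator {-C..C} t) v ((Hr d V ^^ n) w) = rf d V f v ((Hr d V ^^ n) w)"
      by (rule rf_ind[OF v fs_Hrn[OF w] bbm_measurable[OF f]])
  qed
qed

lemma bessel_right:
  assumes w: "fs d w" and g: "bbm g" "!!t. \<bar>g t\<bar> \<le> c" and S: "finite S" "S \<subseteq> Zd d"
  shows "(\<Sum>u\<in>S. (rf d V g (dr u) w)\<^sup>2) \<le> 4 * c\<^sup>2 * ip w w"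
proof -
  have "rf d V g (dr u) w = rf d V g w (dr u)" if "u \<in> S" for u
    using that S by (intro rf_sym[OF _ w g(1)] fs_dr) auto
  then show ?thesis using bessel[OF w g S] by simp
qed

lemma adm_pairing:
  assumes a: "!!S. finite S ==> S \<subseteq> Zd d ==> (\<Sum>u\<in>S. (a u)\<^sup>2) \<le> M" and w: "fs d w"
  shows "adm (%g. infsum (%u. a u * rf d V g (dr u) w) (Zd d))"
proof (rule admI)
  have sumb: "(%u. a u * rf d V g (dr u) w) summable_on Zd d" if g: "bbm g" for g
  proof -
    obtain c where c: "!!t. \<bar>g t\<bar> \<le> c" using bbm_bound[OF g] by metis
    show ?thesis by (rule l2_summable(2)[OF a bessel_right[OF w g c]])
  qed
  fix f g :: "real => real" assume fg: "bbm f" "bbm g"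
  have "infsum (%u. a u * rf d V (%t. f t + g t) (dr u) w) (Zd d) =
      infsum (%u. a u * rf d V f (dr u) w + a u * rf d V g (dr u) w) (Zd d)"
    by (intro infsum_cong) (simp add: rf_plus fs_dr w fg distrib_left)
  also have "\<dots> = infsum (%u. a u * rf d V f (dr u) w) (Zd d) + infsum (%u. a u * rf d V g (dr u) w) (Zd d)"
    by (intro infsum_add sumb fg)
  finally show "infsum (%u. a u * rf d V (%t. f t + g t) (dr u) w) (Zd d) =
      infsum (%u. a u * rf d V f (dr u) w) (Zd d) + infsum (%u. a u * rf d V g (dr u) w) (Zd d)" .
next
  fix c and f :: "real => real" assume f: "bbm f"
  have "infsum (%u. a u * rf d V (%t. c * f t) (dr u) w) (Zd d) = infsum (%u. c * (a u * rf d V f (dr u) w)) (Zd d)"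
    by (intro infsum_cong) (simp add: rf_cmult fs_dr w f)
  also have "\<dots> = c * infsum (%u. a u * rf d V f (dr u) w) (Zd d)" by (rule infsum_cmult_right')
  finally show "infsum (%u. a u * rf d V (%t. c * f t) (dr u) w) (Zd d) = c * infsum (%u. a u * rf d V f (dr u) w) (Zd d)" .
next
  fix F :: "nat => real => real" and f B
  assume F: "!!n. bbm (F n)" "!!n t. \<bar>F n t\<bar> \<le> B" "!!t. (%n. F n t) \<longlonglongrightarrow> f t"
  show "(%n. infsum (%u. a u * rf d V (F n) (dr u) w) (Zd d)) \<longlonglongrightarrow> infsum (%u. a u * rf d V f (dr u) w) (Zd d)"
    by (rule l2_limit[OF a bessel_right[OF w F(1,2)]]) (auto intro!: admD(3)[OF adm_rf[OF fs_dr w] F])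
qed

text \<open>Against a power of H the sum over sites is finite, because H^n w is finitely supported.
  The other factor may belong to a different potential, as the comparison of two potentials
  requires.\<close>

lemma pairing_power:
  assumes w: "fs d w" and v: "fs d v" and "bounded_potential d V' R'" and f: "bbm f"
  shows "infsum (%u. rf d V' f v (dr u) * rf d V (%t. t ^ n * indicator {-C..C} t) (dr u) w) (Zd d)
     = rf d V' f v ((Hr d V ^^ n) w)"
proof -
  interpret b': bounded_potential d V' R' by fact
  let ?w = "(Hr d V ^^ n) w"
  have fw: "fs d ?w" by (rule fs_Hrn[OF w])
  have "infsum (%u. rf d V' f v (dr u) * rf d V (%t. t ^ n * indicator {-C..C} t) (dr u) w) (Zd d)
     = infsum (%u. ?w u * rf d V' f v (dr u)) (supp ?w)"
  proof (rule infsum_cong_neutral)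
    have eq: "rf d V (%t. t ^ n * indicator {-C..C} t) (dr u) w = ?w u" if "u \<in> Zd d" for u
      using rf_power[OF fs_dr[OF that] w] by (simp add: ip_dr_left)
    show "?w u * rf d V' f v (dr u) = 0" if "u \<in> supp ?w - Zd d" for u
      using that fw by (auto simp: fs_def)
    show "rf d V' f v (dr u) * rf d V (%t. t ^ n * indicator {-C..C} t) (dr u) w = 0" if "u \<in> Zd d - supp ?w" for u
      using that eq[of u] by (simp add: supp_def)
    show "rf d V' f v (dr u) * rf d V (%t. t ^ n * indicator {-C..C} t) (dr u) w = ?w u * rf d V' f v (dr u)"
      if "u \<in> Zd d \<inter> supp ?w" for u using that eq[of u] by simp
  qed
  also have "\<dots> = (\<Sum>u\<in>supp ?w. ?w u * rf d V' f v (dr u))" using fw by (simp add: fs_def)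
  also have "\<dots> = rf d V' f v ?w" by (rule b'.rf_expand_supp[OF v fw f, symmetric])
  finally show ?thesis .
qed

lemma bp: "bounded_potential d V R" by (rule bounded_potential_axioms)

lemma pairing_ind:
  assumes w: "fs d w" and f: "bbm f"
  shows "infsum (%u. a u * rf d V (%t. f t * indicator {-C..C} t) (dr u) w) (Zd d)
     = infsum (%u. a u * rf d V f (dr u) w) (Zd d)"
  by (intro infsum_cong) (simp add: rf_ind fs_dr w bbm_measurable[OF f])

text \<open>Matrix multiplication f(H) g(H) = (fg)(H). Both sides are normal in g, the left one by
  the Bessel bounds and \<open>l2_limit\<close>; on powers the sum is finite and
  \<open>rf_mult_power\<close> applies.\<close>

lemma rf_mult:
  assumes v: "fs d v" and w: "fs d w" and f: "bbm f" and g: "bbm g"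
  shows "((%u. rf d V f v (dr u) * rf d V g (dr u) w) has_sum rf d V (%t. f t * g t) v w) (Zd d)"
    "(%u. \<bar>rf d V f v (dr u) * rf d V g (dr u) w\<bar>) summable_on Zd d"
proof -
  obtain c where c: "!!t. \<bar>f t\<bar> \<le> c" using bbm_bound[OF f] by metis
  obtain e where e: "!!t. \<bar>g t\<bar> \<le> e" using bbm_bound[OF g] by metis
  note a = bessel[OF v f c]
  have gf: "(%t. f t * g t) = (%t. g t * f t)" by (simp add: mult.commute)
  have "infsum (%u. rf d V f v (dr u) * rf d V g (dr u) w) (Zd d) = rf d V (%t. g t * f t) v w"
  proof (rule rf_eqI[OF _ adm_mult_fun[OF adm_rf[OF v w] f] g])
    show "adm (%g. infsum (%u. rf d V f v (dr u) * rf d V g (dr u) w) (Zd d))"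
      by (rule adm_pairing[OF a w])
    fix n
    show "infsum (%u. rf d V f v (dr u) * rf d V (%t. t ^ n * indicator {-C..C} t) (dr u) w) (Zd d) =
        rf d V (%t. t ^ n * indicator {-C..C} t * f t) v w"
      using pairing_power[OF w v bp f, of n] rf_mult_power[OF v w f, of n] by (simp add: mult.commute)
    have "(%t. g t * indicator {-C..C} t * f t) = (%t. (g t * f t) * indicator {-C..C} t)" by auto
    then show "rf d V (%t. g t * indicator {-C..C} t * f t) v w = rf d V (%t. g t * f t) v w"
      using rf_ind[OF v w bbm_measurable[OF bbm_mult[OF g f]]] by simp
  qed (rule pairing_ind[OF w g])
  moreover have "(%u. rf d V f v (dr u) * rf d V g (dr u) w) summable_on Zd d"
    by (rule l2_summable(2)[OF a bessel_right[OF w g e]])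
  ultimately show "((%u. rf d V f v (dr u) * rf d V g (dr u) w) has_sum rf d V (%t. f t * g t) v w) (Zd d)"
    using has_sum_infsum unfolding gf by fastforce
  show "(%u. \<bar>rf d V f v (dr u) * rf d V g (dr u) w\<bar>) summable_on Zd d"
    by (rule l2_summable(1)[OF a bessel_right[OF w g e]])
qed

end

section \<open>Changing the potential at one site\<close>

lemma Hr_perturb:
  assumes "!!x. x \<noteq> k ==> V' x = V x"
  shows "Hr d V v = (%x. 1 * Hr d V' v x + ((V k - V' k) * v k) * dr k x)"
proof
  fix x show "Hr d V v x = 1 * Hr d V' v x + ((V k - V' k) * v k) * dr k x"
    unfolding Hr_def dr_def by (cases "x = k") (simp_all add: assms algebra_simps)
qed

locale two_potentials = bounded_potential d V R + b': bounded_potential d V' R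
  for d V V' R +
  fixes k assumes k: "k \<in> Zd d" and off: "!!x. x \<noteq> k ==> V' x = V x"
begin

text \<open>In operator terms this is f(H) (H - H') g(H') with H - H' = (V k - V' k) |k><k|. Both
  sides are normal in g, and on powers H - H' acts on a finitely supported vector. The factor t is
  cut off to [-C,C] in order to stay bounded.\<close>

lemma perturb_identity:
  assumes v: "fs d v" and w: "fs d w" and f: "bbm f" and g: "bbm g"
  shows "infsum (%u. rf d V (%t. f t * (t * indicator {-C..C} t)) v (dr u) * rf d V' g (dr u) w) (Zd d)
    - infsum (%u. rf d V f v (dr u) * rf d V' (%t. g t * (t * indicator {-C..C} t)) (dr u) w) (Zd d)
    = (V k - V' k) * rf d V f v (dr k) * rf d V' g (dr k) w"
proof -
  have pb: "bbm (%t. t * indicator {-C..C} t)"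
    using bbm_continuous_compact[of "%t. t" "{-C..C}"] by (simp add: continuous_on_id)
  let ?tf = "%t. f t * (t * indicator {-C..C} t)"
  have tf: "bbm ?tf" by (rule bbm_mult[OF f pb])
  obtain c where c: "!!t. \<bar>f t\<bar> \<le> c" using bbm_bound[OF f] by metis
  obtain c' where c': "!!t. \<bar>?tf t\<bar> \<le> c'" using bbm_bound[OF tf] by metis
  note a = bessel[OF v f c] and a' = bessel[OF v tf c']
  let ?A = "%g. infsum (%u. rf d V ?tf v (dr u) * rf d V' g (dr u) w) (Zd d)
    - infsum (%u. rf d V f v (dr u) * rf d V' (%t. g t * (t * indicator {-C..C} t)) (dr u) w) (Zd d)"
  let ?B = "%g. ((V k - V' k) * rf d V f v (dr k)) * rf d V' g (dr k) w"
  have "?A g = ?B g"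
  proof (rule b'.rf_eqI[where A="?A" and B="?B"])
    show "adm ?A"
      by (rule adm_diff[OF b'.adm_pairing[OF a' w] adm_mult_fun[OF b'.adm_pairing[OF a w] pb]])
    show "adm ?B" by (intro adm_scale b'.adm_rf fs_dr k w)
    show "bbm g" by fact
    show "?A (%t. g t * indicator {-C..C} t) = ?A g"
    proof -
      have m: "(%t. g t * indicator {-C..C} t * (t * indicator {-C..C} t)) = (%t. g t * (t * indicator {-C..C} t))"
        by (auto simp: indicator_def)
      have e: "infsum (%u. rf d V ?tf v (dr u) * rf d V' (%t. g t * indicator {-C..C} t) (dr u) w) (Zd d)
          = infsum (%u. rf d V ?tf v (dr u) * rf d V' g (dr u) w) (Zd d)"
        using b'.pairing_ind[OF w g, of "%u. rf d V ?tf v (dr u)"] .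
      show ?thesis unfolding m e ..
    qed
    show "?B (%t. g t * indicator {-C..C} t) = ?B g"
      using b'.rf_ind[OF fs_dr[OF k] w bbm_measurable[OF g]] by (simp only:)
    fix n
    let ?w = "(Hr d V' ^^ n) w"
    have fw: "fs d ?w" by (rule fs_Hrn[OF w])
    have m: "(%t. t ^ n * indicator {-C..C} t * (t * indicator {-C..C} t)) = (%t. t ^ Suc n * indicator {-C..C} t)"
      by (auto simp: indicator_def)
    have 1: "?A (%t. t ^ n * indicator {-C..C} t) = rf d V ?tf v ?w - rf d V f v (Hr d V' ?w)"
      unfolding m using b'.pairing_power[OF w v bp tf, of n] b'.pairing_power[OF w v bp f, of "Suc n"]
      by (simp only: funpow.simps o_apply)
    have 2: "rf d V ?tf v ?w = rf d V f v (Hr d V ?w)"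
    proof -
      have h: "(Hr d V ^^ 1) ?w = Hr d V ?w" by simp
      show ?thesis using rf_mult_power[OF v fw f, of 1] unfolding h power_one_right .
    qed
    have 3: "rf d V f v (Hr d V ?w) = 1 * rf d V f v (Hr d V' ?w) + ((V k - V' k) * ?w k) * rf d V f v (dr k)"
    proof -
      have h: "Hr d V ?w = (%x. 1 * Hr d V' ?w x + ((V k - V' k) * ?w k) * dr k x)"
        by (rule Hr_perturb) (rule off)
      show ?thesis unfolding h by (rule rf_lin_right[OF v fs_Hr[OF fw] fs_dr[OF k] f])
    qed
    have 4: "?w k = rf d V' (%t. t ^ n * indicator {-C..C} t) (dr k) w"
      using b'.rf_power[OF fs_dr[OF k] w, of n] unfolding ip_dr_left by (rule sym)
    show "?A (%t. t ^ n * indicator {-C..C} t) = ?B (%t. t ^ n * indicator {-C..C} t)"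
      unfolding 1 2 3 4 by (simp only: mult_ac mult_1_left mult_1_right add_diff_cancel_left')
  qed
  then show ?thesis .
qed

end

section \<open>The resolvent\<close>

text \<open>Real part of 1/(t - E - i\<eta>), with \<open>gi\<close> as the imaginary part; they are
  kept apart because the form is real.\<close>

definition gr :: "real => real => real => real" where
  "gr E \<eta> t = (t - E) / ((t - E)\<^sup>2 + \<eta>\<^sup>2)"

definition gi :: "real => real => real => real" where
  "gi E \<eta> t = \<eta> / ((t - E)\<^sup>2 + \<eta>\<^sup>2)"

lemma den_pos: "0 < \<eta> ==> 0 < (t - E)\<^sup>2 + (\<eta>::real)\<^sup>2"
  by (simp add: add_nonneg_pos)

lemma gi_pos: "0 < \<eta> ==> 0 < gi E \<eta> t"
  by (simp add: gi_def den_pos)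

lemma gi_le: "0 < \<eta> ==> gi E \<eta> t \<le> 1 / \<eta>"
proof -
  assume \<eta>: "0 < \<eta>"
  have "\<eta> / ((t - E)\<^sup>2 + \<eta>\<^sup>2) \<le> \<eta> / \<eta>\<^sup>2" using \<eta> by (intro divide_left_mono) (auto simp: add_nonneg_pos)
  then show ?thesis using \<eta> by (simp add: gi_def power2_eq_square)
qed

lemma gr_abs_le: "0 < \<eta> ==> \<bar>gr E \<eta> t\<bar> \<le> 1 / \<eta>"
proof -
  assume \<eta>: "0 < \<eta>"
  have "\<bar>t - E\<bar> * \<eta> \<le> (t - E)\<^sup>2 + \<eta>\<^sup>2"
  proof -
    have "2 * \<bar>t - E\<bar> * \<eta> \<le> \<bar>t - E\<bar>\<^sup>2 + \<eta>\<^sup>2" by (rule sum_squares_bound)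
    moreover have "0 \<le> \<bar>t - E\<bar> * \<eta>" using \<eta> by simp
    ultimately show ?thesis by simp
  qed
  then show ?thesis using \<eta> den_pos[OF \<eta>, of t E] by (simp add: gr_def field_simps)
qed

lemma bbm_gi: "0 < \<eta> ==> bbm (gi E \<eta>)"
  by (rule bbmI[where B="1/\<eta>"]) (use gi_pos[of \<eta>] gi_le[of \<eta>] in \<open>auto simp: abs_of_pos gi_def[abs_def]\<close>)

lemma bbm_gr: "0 < \<eta> ==> bbm (gr E \<eta>)"
  by (rule bbmI[where B="1/\<eta>"]) (use gr_abs_le[of \<eta>] in \<open>auto simp: gr_def[abs_def]\<close>)

lemma gr_times: "0 < \<eta> ==> gr E \<eta> t * t = 1 + E * gr E \<eta> t - \<eta> * gi E \<eta> t"
proof -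
  assume "0 < \<eta>"
  define D where "D = (t - E)\<^sup>2 + \<eta>\<^sup>2"
  have D: "D \<noteq> 0" unfolding D_def using den_pos[OF \<open>0 < \<eta>\<close>, of t E] by (rule less_imp_neq[symmetric])
  have "1 + E * ((t - E) / D) - \<eta> * (\<eta> / D) = (D + E * (t - E) - \<eta> * \<eta>) / D"
    using D by (simp add: field_simps)
  also have "D + E * (t - E) - \<eta> * \<eta> = (t - E) * t" by (simp add: D_def algebra_simps power2_eq_square)
  finally show ?thesis by (simp add: gr_def gi_def D_def)
qed

lemma gi_times: "0 < \<eta> ==> gi E \<eta> t * t = E * gi E \<eta> t + \<eta> * gr E \<eta> t"
  unfolding gr_def gi_def by (simp add: add_divide_distrib[symmetric] algebra_simps)

lemma resolvent_split: "0 < \<eta> ==> 1 / (complex_of_real t - Complex E \<eta>) = complex_of_real (gr E \<eta> t) + \<i> * complex_of_real (gi E \<eta> t)"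
proof -
  assume \<eta>: "0 < \<eta>"
  have "complex_of_real t - Complex E \<eta> = Complex (t - E) (- \<eta>)" by (simp add: complex_eq_iff)
  then have "1 / (complex_of_real t - Complex E \<eta>) = Complex (gr E \<eta> t) (gi E \<eta> t)"
    by (simp add: complex_eq_iff Re_divide Im_divide gr_def gi_def)
  then show ?thesis by (simp add: complex_eq_iff)
qed

definition Gc :: "nat => (site => real) => real => real => site => site => complex" where
  "Gc d V E \<eta> x y = Complex (rf d V (gr E \<eta>) (dr x) (dr y)) (rf d V (gi E \<eta>) (dr x) (dr y))"

definition gI :: "nat => (site => real) => real => real => site => site => real" where
  "gI d V E \<eta> x y = rf d V (gi E \<eta>) (dr x) (dr y)"

definition detI :: "nat => (site => real) => real => real => site => site => real" where
  "detI d V E \<eta> j k = gI d V E \<eta> j j * gI d V E \<eta> k k - (gI d V E \<eta> j k)\<^sup>2"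

lemma Im_Gc: "Im (Gc d V E \<eta> x y) = gI d V E \<eta> x y" by (simp add: Gc_def gI_def)

context bounded_potential
begin

lemma green_eq:
  assumes \<eta>: "0 < \<eta>" and x: "x \<in> Zd d" and y: "y \<in> Zd d"
  shows "green d V (Complex E \<eta>) x y = Gc d V E \<eta> x y"
proof -
  have int: "(\<integral>t. complex_of_real (gr E \<eta> t) + \<i> * complex_of_real (gi E \<eta> t) \<partial>sm d V v) =
      complex_of_real (\<integral>t. gr E \<eta> t \<partial>sm d V v) + \<i> * complex_of_real (\<integral>t. gi E \<eta> t \<partial>sm d V v)" if v: "fs d v" for v
    using integrable_bbm[OF sm_finite[OF v] sm_sets[OF v] bbm_gr[OF \<eta>, of E]]
      integrable_bbm[OF sm_finite[OF v] sm_sets[OF v] bbm_gi[OF \<eta>, of E]]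
    by (subst Bochner_Integration.integral_add) auto
  have e: "(%z. delta x z + delta y z) = (%z. complex_of_real (dr x z + dr y z))"
    "(%z. delta x z - delta y z) = (%z. complex_of_real (dr x z - dr y z))"
    by (auto simp: delta_def dr_def)
  show ?thesis
    unfolding green_def fmat_def resolvent_split[OF \<eta>] e sm_def[symmetric]
      int[OF fs_add[OF fs_dr[OF x] fs_dr[OF y]]] int[OF fs_diff[OF fs_dr[OF x] fs_dr[OF y]]]
    by (simp add: Gc_def rf_def complex_eq_iff)
qed

lemma Gc_sym: "0 < \<eta> ==> x \<in> Zd d ==> y \<in> Zd d ==> Gc d V E \<eta> x y = Gc d V E \<eta> y x"
  unfolding Gc_def using rf_sym[OF fs_dr fs_dr] bbm_gr bbm_gi by auto

text \<open>On [-C,C] the Lorentzian has a positive lower bound, and \<delta>_x has norm 1.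
  Strictness keeps the denominators of the rank one formulas away from zero.\<close>

lemma gI_pos:
  assumes \<eta>: "0 < \<eta>" and x: "x \<in> Zd d"
  shows "0 < gI d V E \<eta> x x"
proof -
  define m where "m = \<eta> / ((C + \<bar>E\<bar>)\<^sup>2 + \<eta>\<^sup>2)"
  have m: "0 < m" unfolding m_def using \<eta> by (simp add: add_nonneg_pos)
  have "m \<le> gi E \<eta> t" if "t \<in> {-C..C}" for t
  proof -
    have "\<bar>t - E\<bar> \<le> C + \<bar>E\<bar>" using that by auto
    then have "(t - E)\<^sup>2 \<le> (C + \<bar>E\<bar>)\<^sup>2" by (metis abs_ge_zero power2_abs power_mono)
    then show ?thesis unfolding m_def gi_def using \<eta> den_pos[OF \<eta>, of t E]
      by (intro divide_left_mono) (auto intro!: mult_pos_pos simp: add_nonneg_pos)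
  qed
  from rf_mono[OF fs_dr[OF x] bbm_const[of m] bbm_gi[OF \<eta>, of E] this]
  have "rf d V (%_. m) (dr x) (dr x) \<le> gI d V E \<eta> x x" by (simp add: gI_def)
  moreover have "rf d V (%_. m) (dr x) (dr x) = m"
    using rf_cmult[OF fs_dr[OF x] fs_dr[OF x] bbm_const[of 1], of m] rf_one[OF fs_dr[OF x] fs_dr[OF x]]
    by (simp add: ip_dr_dr)
  ultimately show ?thesis using m by simp
qed

lemma detI_nonneg: "0 < \<eta> ==> j \<in> Zd d ==> k \<in> Zd d ==> 0 \<le> detI d V E \<eta> j k"
  using rf_CS[OF fs_dr fs_dr bbm_gi, of j k \<eta> E] gi_pos[of \<eta> E] by (auto simp: detI_def gI_def less_imp_le)

end

section \<open>The second resolvent identity for a change of the potential at one site\<close>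

context two_potentials
begin

text \<open>Kernel of a(H) b(H'), a product of functions of two different operators.\<close>

definition S where "S a b x y = infsum (%u. rf d V a (dr x) (dr u) * rf d V' b (dr u) (dr y)) (Zd d)"

lemma S_sum:
  assumes "bbm a" "bbm b" "x \<in> Zd d" "y \<in> Zd d"
  shows "(%u. rf d V a (dr x) (dr u) * rf d V' b (dr u) (dr y)) summable_on Zd d"
proof -
  obtain c where c: "!!t. \<bar>a t\<bar> \<le> c" using bbm_bound[OF assms(1)] by metis
  obtain e where e: "!!t. \<bar>b t\<bar> \<le> e" using bbm_bound[OF assms(2)] by metis
  show ?thesis
    by (rule l2_summable(2)[OF bessel[OF fs_dr[OF assms(3)] assms(1) c] b'.bessel_right[OF fs_dr[OF assms(4)] assms(2) e]])
qed

lemma S_lin_left: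
  assumes a: "bbm a" "bbm a'" "bbm b" and x: "x \<in> Zd d" "y \<in> Zd d"
  shows "S (%t. \<alpha> * a t + \<beta> * a' t) b x y = \<alpha> * S a b x y + \<beta> * S a' b x y"
proof -
  have "S (%t. \<alpha> * a t + \<beta> * a' t) b x y = infsum (%u. \<alpha> * (rf d V a (dr x) (dr u) * rf d V' b (dr u) (dr y))
      + \<beta> * (rf d V a' (dr x) (dr u) * rf d V' b (dr u) (dr y))) (Zd d)"
    unfolding S_def by (intro infsum_cong)
      (simp add: rf_plus rf_cmult fs_dr x a bbm_scale distrib_right)
  also have "\<dots> = infsum (%u. \<alpha> * (rf d V a (dr x) (dr u) * rf d V' b (dr u) (dr y))) (Zd d)
     + infsum (%u. \<beta> * (rf d V a' (dr x) (dr u) * rf d V' b (dr u) (dr y))) (Zd d)"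
    by (intro infsum_add summable_on_cmult_right S_sum a x)
  finally show ?thesis unfolding S_def infsum_cmult_right' .
qed

lemma S_lin_right:
  assumes a: "bbm a" "bbm a'" "bbm b" and x: "x \<in> Zd d" "y \<in> Zd d"
  shows "S b (%t. \<alpha> * a t + \<beta> * a' t) x y = \<alpha> * S b a x y + \<beta> * S b a' x y"
proof -
  have "S b (%t. \<alpha> * a t + \<beta> * a' t) x y = infsum (%u. \<alpha> * (rf d V b (dr x) (dr u) * rf d V' a (dr u) (dr y))
      + \<beta> * (rf d V b (dr x) (dr u) * rf d V' a' (dr u) (dr y))) (Zd d)"
    unfolding S_def by (intro infsum_cong)
      (simp add: b'.rf_plus b'.rf_cmult fs_dr x a bbm_scale distrib_left mult_ac)
  also have "\<dots> = infsum (%u. \<alpha> * (rf d V b (dr x) (dr u) * rf d V' a (dr u) (dr y))) (Zd d)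
     + infsum (%u. \<beta> * (rf d V b (dr x) (dr u) * rf d V' a' (dr u) (dr y))) (Zd d)"
    by (intro infsum_add summable_on_cmult_right S_sum a x)
  finally show ?thesis unfolding S_def infsum_cmult_right' .
qed

lemma infsum_single: "x \<in> A ==> (!!u. u \<in> A ==> u \<noteq> x ==> f u = 0) ==> infsum f A = (f x :: real)"
  using infsum_cong_neutral[of A "{x}" f f] by simp

lemma S_one_left: "x \<in> Zd d ==> y \<in> Zd d ==> S (%_. 1) b x y = rf d V' b (dr x) (dr y)"
  unfolding S_def by (subst infsum_single[of x]) (auto simp: rf_one fs_dr ip_dr_dr)

lemma S_one_right: "x \<in> Zd d ==> y \<in> Zd d ==> S a (%_. 1) x y = rf d V a (dr x) (dr y)"
  unfolding S_def by (subst infsum_single[of y]) (auto simp: b'.rf_one fs_dr ip_dr_dr)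

lemma S_ind_left:
  assumes "bbm a" "x \<in> Zd d" "!!t. t \<in> {-C..C} ==> a t = a' t" "bbm a'"
  shows "S a b x y = S a' b x y"
proof -
  have i: "(%t. a t * indicator {-C..C} t) = (%t. a' t * indicator {-C..C} t)" using assms(3) by (auto simp: indicator_def)
  have "rf d V a (dr x) (dr u) = rf d V a' (dr x) (dr u)" if "u \<in> Zd d" for u
    using rf_ind[OF fs_dr[OF assms(2)] fs_dr[OF that] bbm_measurable[OF assms(1)]]
      rf_ind[OF fs_dr[OF assms(2)] fs_dr[OF that] bbm_measurable[OF assms(4)]] i by simp
  then show ?thesis unfolding S_def by (intro infsum_cong) simp
qed

lemma S_ind_right:
  assumes "bbm a" "y \<in> Zd d" "!!t. t \<in> {-C..C} ==> a t = a' t" "bbm a'"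
  shows "S b a x y = S b a' x y"
proof -
  have i: "(%t. a t * indicator {-C..C} t) = (%t. a' t * indicator {-C..C} t)" using assms(3) by (auto simp: indicator_def)
  have "rf d V' a (dr u) (dr y) = rf d V' a' (dr u) (dr y)" if "u \<in> Zd d" for u
    using b'.rf_ind[OF fs_dr[OF that] fs_dr[OF assms(2)] bbm_measurable[OF assms(1)]]
      b'.rf_ind[OF fs_dr[OF that] fs_dr[OF assms(2)] bbm_measurable[OF assms(4)]] i by simp
  then show ?thesis unfolding S_def by (intro infsum_cong) simp
qed

text \<open>The identity R' = R + (V k - V' k) R |k><k| R'. It is assembled from
  \<open>perturb_identity\<close> for the four combinations of real and imaginary parts, where
  multiplication by t is eliminated through \<open>gr_times\<close> and
  \<open>gi_times\<close>.\<close>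

lemma rank_one:
  assumes \<eta>: "0 < \<eta>" and x: "x \<in> Zd d" "y \<in> Zd d"
  shows "Gc d V' E \<eta> x y = Gc d V E \<eta> x y + complex_of_real (V k - V' k) * Gc d V E \<eta> x k * Gc d V' E \<eta> k y"
proof -
  let ?r = "gr E \<eta>" and ?i = "gi E \<eta>"
  note b = bbm_gr[OF \<eta>, of E] bbm_gi[OF \<eta>, of E] bbm_const[of 1]
  have pb: "bbm (%t. t * indicator {-C..C} t)"
    using bbm_continuous_compact[of "%t. t" "{-C..C}"] by (simp add: continuous_on_id)
  have er: "bbm (%t. 1 * 1 + 1 * (E * ?r t + (-\<eta>) * ?i t))" "bbm (%t. E * ?r t + (-\<eta>) * ?i t)" "bbm (%t. E * ?i t + \<eta> * ?r t)"
    by (intro bbm_add bbm_scale b)+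
  have tr: "S (%t. ?r t * (t * indicator {-C..C} t)) h x y = rf d V' h (dr x) (dr y) + (E * S ?r h x y - \<eta> * S ?i h x y)"
    if h: "bbm h" for h
  proof -
    have "S (%t. ?r t * (t * indicator {-C..C} t)) h x y = S (%t. 1 * 1 + 1 * (E * ?r t + (-\<eta>) * ?i t)) h x y"
      by (rule S_ind_left[OF bbm_mult[OF b(1) pb] x(1) _ er(1)]) (use gr_times[OF \<eta>, of E] in \<open>auto simp: indicator_def\<close>)
    also have "\<dots> = 1 * S (%_. 1) h x y + 1 * S (%t. E * ?r t + (-\<eta>) * ?i t) h x y"
      by (rule S_lin_left[OF b(3) er(2) h x])
    also have "S (%t. E * ?r t + (-\<eta>) * ?i t) h x y = E * S ?r h x y + (-\<eta>) * S ?i h x y"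
      by (rule S_lin_left[OF b(1,2) h x])
    finally show ?thesis using S_one_left[OF x] by simp
  qed
  have ti: "S (%t. ?i t * (t * indicator {-C..C} t)) h x y = E * S ?i h x y + \<eta> * S ?r h x y" if h: "bbm h" for h
  proof -
    have "S (%t. ?i t * (t * indicator {-C..C} t)) h x y = S (%t. E * ?i t + \<eta> * ?r t) h x y"
      by (rule S_ind_left[OF bbm_mult[OF b(2) pb] x(1) _ er(3)]) (use gi_times[OF \<eta>, of E] in \<open>auto simp: indicator_def\<close>)
    also have "\<dots> = E * S ?i h x y + \<eta> * S ?r h x y" by (rule S_lin_left[OF b(2,1) h x])
    finally show ?thesis .
  qed
  have tr': "S h (%t. ?r t * (t * indicator {-C..C} t)) x y = rf d V h (dr x) (dr y) + (E * S h ?r x y - \<eta> * S h ?i x y)"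
    if h: "bbm h" for h
  proof -
    have "S h (%t. ?r t * (t * indicator {-C..C} t)) x y = S h (%t. 1 * 1 + 1 * (E * ?r t + (-\<eta>) * ?i t)) x y"
      by (rule S_ind_right[OF bbm_mult[OF b(1) pb] x(2) _ er(1)]) (use gr_times[OF \<eta>, of E] in \<open>auto simp: indicator_def\<close>)
    also have "\<dots> = 1 * S h (%_. 1) x y + 1 * S h (%t. E * ?r t + (-\<eta>) * ?i t) x y"
      by (rule S_lin_right[OF b(3) er(2) h x])
    also have "S h (%t. E * ?r t + (-\<eta>) * ?i t) x y = E * S h ?r x y + (-\<eta>) * S h ?i x y"
      by (rule S_lin_right[OF b(1,2) h x])
    finally show ?thesis using S_one_right[OF x] by simp
  qed
  have ti': "S h (%t. ?i t * (t * indicator {-C..C} t)) x y = E * S h ?i x y + \<eta> * S h ?r x y" if h: "bbm h" for h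
  proof -
    have "S h (%t. ?i t * (t * indicator {-C..C} t)) x y = S h (%t. E * ?i t + \<eta> * ?r t) x y"
      by (rule S_ind_right[OF bbm_mult[OF b(2) pb] x(2) _ er(3)]) (use gi_times[OF \<eta>, of E] in \<open>auto simp: indicator_def\<close>)
    also have "\<dots> = E * S h ?i x y + \<eta> * S h ?r x y" by (rule S_lin_right[OF b(2,1) h x])
    finally show ?thesis .
  qed
  have P: "S (%t. f t * (t * indicator {-C..C} t)) g x y - S f (%t. g t * (t * indicator {-C..C} t)) x y
     = (V k - V' k) * rf d V f (dr x) (dr k) * rf d V' g (dr k) (dr y)" if "bbm f" "bbm g" for f g
    unfolding S_def by (rule perturb_identity[OF fs_dr[OF x(1)] fs_dr[OF x(2)] that])
  note P11 = P[OF b(1) b(1), unfolded tr[OF b(1)] tr'[OF b(1)]]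
  note P22 = P[OF b(2) b(2), unfolded ti[OF b(2)] ti'[OF b(2)]]
  note P12 = P[OF b(1) b(2), unfolded tr[OF b(2)] ti'[OF b(1)]]
  note P21 = P[OF b(2) b(1), unfolded ti[OF b(1)] tr'[OF b(2)]]
  show ?thesis
    unfolding Gc_def complex_eq_iff using P11 P22 P12 P21 by (simp add: algebra_simps)
qed

text \<open>If the denominator vanished, its imaginary part and the strict \<open>gI_pos\<close>
  would force V' k = V k, but then the denominator is 1.\<close>

lemma rank_one_solved:
  fixes E :: real
  assumes \<eta>: "0 < \<eta>" and y: "y \<in> Zd d"
  defines "s \<equiv> 1 + complex_of_real (V' k - V k) * Gc d V E \<eta> k k"
  shows "s \<noteq> 0" "Gc d V' E \<eta> k y = Gc d V E \<eta> k y / s"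
proof -
  have pos: "0 < gI d V E \<eta> k k" by (rule gI_pos[OF \<eta> k])
  show s: "s \<noteq> 0"
  proof
    assume "s = 0"
    then have "Im s = 0" "Re s = 0" by auto
    then have "(V' k - V k) * gI d V E \<eta> k k = 0" unfolding s_def using Im_Gc[of d V E \<eta> k k] by simp
    then have "V' k - V k = 0" using pos by simp
    then show False using \<open>s = 0\<close> unfolding s_def by simp
  qed
  have "Gc d V' E \<eta> k y * s = Gc d V E \<eta> k y"
    using rank_one[OF \<eta> k y, of E] unfolding s_def by (simp add: algebra_simps)
  then show "Gc d V' E \<eta> k y = Gc d V E \<eta> k y / s" using s by (simp add: field_simps)
qed

end

lemma Im_div_aux: "Im (z / s) = (Im z * Re s - Re z * Im s) / (cmod s)\<^sup>2"
  by (simp add: Im_divide cmod_power2)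

text \<open>The determinant of the imaginary part of a two-site block of the resolvent is multiplied by
  \<open>|1 + w r|\<^sup>-\<^sup>2\<close> under a change \<open>w\<close> of the potential at one of the sites.\<close>

lemma det_rank_one_algebra:
  fixes p q r :: complex and w :: real
  defines "s \<equiv> 1 + complex_of_real w * r"
  assumes s: "s \<noteq> 0"
  shows "Im (p - complex_of_real w * q * q / s) * Im (r / s) - (Im (q / s))\<^sup>2 = (Im p * Im r - (Im q)\<^sup>2) / (cmod s)\<^sup>2"
    "Im (r / s) = Im r / (cmod s)\<^sup>2"
proof -
  define N where "N = (cmod s)\<^sup>2"
  have N: "N = (1 + w * Re r)\<^sup>2 + (w * Im r)\<^sup>2" unfolding N_def s_def cmod_power2 by simp
  have N0: "N \<noteq> 0" using s by (simp add: N_def)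
  have ir: "Im (r / s) = Im r / N" unfolding Im_div_aux N_def[symmetric] by (simp add: s_def algebra_simps)
  have iq: "Im (q / s) = (Im q * (1 + w * Re r) - Re q * (w * Im r)) / N"
    unfolding Im_div_aux N_def[symmetric] by (simp add: s_def)
  have iqq: "Im (complex_of_real w * q * q / s) = w * (2 * Re q * Im q * (1 + w * Re r) - ((Re q)\<^sup>2 - (Im q)\<^sup>2) * (w * Im r)) / N"
    unfolding Im_div_aux N_def[symmetric] by (simp add: s_def algebra_simps power2_eq_square)
  have key: "w * (2 * Re q * Im q * (1 + w * Re r) - ((Re q)\<^sup>2 - (Im q)\<^sup>2) * (w * Im r)) * Im r
     + (Im q * (1 + w * Re r) - Re q * (w * Im r))\<^sup>2 = (Im q)\<^sup>2 * N"
    unfolding N by (simp add: algebra_simps power2_eq_square)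
  let ?A = "w * (2 * Re q * Im q * (1 + w * Re r) - ((Re q)\<^sup>2 - (Im q)\<^sup>2) * (w * Im r))"
  let ?B = "Im q * (1 + w * Re r) - Re q * (w * Im r)"
  have "(Im p - ?A / N) * (Im r / N) - (?B / N)\<^sup>2 = (Im p * Im r * N - (?A * Im r + ?B\<^sup>2)) / (N * N)"
    using N0 by (simp add: field_simps power2_eq_square)
  also have "\<dots> = (Im p * Im r - (Im q)\<^sup>2) / N"
    unfolding key using N0 by (simp add: field_simps)
  finally show "Im (p - complex_of_real w * q * q / s) * Im (r / s) - (Im (q / s))\<^sup>2 = (Im p * Im r - (Im q)\<^sup>2) / (cmod s)\<^sup>2"
    unfolding minus_complex.simps iqq ir iq N_def .
  show "Im (r / s) = Im r / (cmod s)\<^sup>2" unfolding ir N_def ..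
qed

context two_potentials
begin

lemma gI_perturb:
  assumes \<eta>: "0 < \<eta>"
  shows "gI d V' E \<eta> k k = gI d V E \<eta> k k / (cmod (1 + complex_of_real (V' k - V k) * Gc d V E \<eta> k k))\<^sup>2"
  using det_rank_one_algebra(2)[OF rank_one_solved(1)[OF \<eta> k]] rank_one_solved(2)[OF \<eta> k]
  unfolding Im_Gc[symmetric] by simp

lemma detI_perturb:
  assumes \<eta>: "0 < \<eta>" and j: "j \<in> Zd d"
  shows "detI d V' E \<eta> j k = detI d V E \<eta> j k / (cmod (1 + complex_of_real (V' k - V k) * Gc d V E \<eta> k k))\<^sup>2"
proof -
  let ?w = "V' k - V k" and ?p = "Gc d V E \<eta> j j" and ?q = "Gc d V E \<eta> k j" and ?r = "Gc d V E \<eta> k k"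
  let ?s = "1 + complex_of_real ?w * ?r"
  have s: "?s \<noteq> 0" by (rule rank_one_solved(1)[OF \<eta> k])
  have kk: "Gc d V' E \<eta> k k = ?r / ?s" by (rule rank_one_solved(2)[OF \<eta> k])
  have kj: "Gc d V' E \<eta> k j = ?q / ?s" by (rule rank_one_solved(2)[OF \<eta> j])
  have "Gc d V' E \<eta> j j = ?p + complex_of_real (V k - V' k) * Gc d V E \<eta> j k * Gc d V' E \<eta> k j"
    by (rule rank_one[OF \<eta> j j])
  then have jj: "Gc d V' E \<eta> j j = ?p - complex_of_real ?w * ?q * ?q / ?s"
  proof -
    assume a: "Gc d V' E \<eta> j j = ?p + complex_of_real (V k - V' k) * Gc d V E \<eta> j k * Gc d V' E \<eta> k j"
    have neg: "complex_of_real (V k - V' k) = - complex_of_real ?w" by simp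
    have gen: "p + (- W) * q * (q / s) = p - W * q * q / s" for p W q s :: complex by simp
    show ?thesis using a unfolding kj Gc_sym[OF \<eta> j k] neg gen .
  qed
  have jk: "gI d V E \<eta> j k = gI d V E \<eta> k j" "gI d V' E \<eta> j k = gI d V' E \<eta> k j"
    unfolding Im_Gc[symmetric] using Gc_sym[OF \<eta> j k] b'.Gc_sym[OF \<eta> j k] by auto
  show ?thesis
    unfolding detI_def jk unfolding Im_Gc[symmetric] jj kk kj by (rule det_rank_one_algebra(1)[OF s])
qed

end

section \<open>Spectral averaging\<close>

lemma nn_integral_lorentz:
  assumes e: "0 < e"
  shows "(\<integral>\<^sup>+x. ennreal (e / ((x - m)\<^sup>2 + e\<^sup>2)) \<partial>lborel) = ennreal pi"
proof -
  let ?f = "%x. e / ((x - m)\<^sup>2 + e\<^sup>2)" and ?F = "%x. arctan ((x - m) / e)"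
  have pos: "0 < (x - m)\<^sup>2 + e\<^sup>2" for x using e by (simp add: add_nonneg_pos)
  have D: "DERIV ?F x :> ?f x" for x
  proof -
    have "DERIV ?F x :> inverse (1 + ((x - m) / e)\<^sup>2) * (1 / e)"
      using e by (auto intro!: derivative_eq_intros)
    moreover have "inverse (1 + ((x - m) / e)\<^sup>2) * (1 / e) = ?f x"
      using e pos[of x] by (simp add: field_simps power2_eq_square)
    ultimately show ?thesis by simp
  qed
  have top: "(?F \<longlongrightarrow> pi/2) at_top"
  proof (rule filterlim_compose[OF tendsto_arctan_at_top])
    show "filterlim (%x. (x - m) / e) at_top at_top"
      using e by real_asymp
  qed
  have bot: "(?F \<longlongrightarrow> - (pi/2)) at_bot"
  proof (rule filterlim_compose[OF tendsto_arctan_at_bot])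
    show "filterlim (%x. (x - m) / e) at_bot at_bot"
      using e by real_asymp
  qed
  have ct: "isCont ?f x" for x using pos[of x] by (intro continuous_intros) auto
  have F: "set_integrable lborel (einterval (-\<infinity>) \<infinity>) ?f" "(LBINT x=-\<infinity>..\<infinity>. ?f x) = pi/2 - (-(pi/2))"
  proof -
    have A: "((?F \<circ> real_of_ereal) \<longlongrightarrow> - (pi/2)) (at_right (-\<infinity>))" using bot by (simp only: ereal_tendsto_simps)
    have B: "((?F \<circ> real_of_ereal) \<longlongrightarrow> pi/2) (at_left \<infinity>)" using top by (simp only: ereal_tendsto_simps)
    have f0: "0 \<le> ?f x" for x using pos[of x] e by (intro divide_nonneg_nonneg) auto
    show "set_integrable lborel (einterval (-\<infinity>) \<infinity>) ?f" "(LBINT x=-\<infinity>..\<infinity>. ?f x) = pi/2 - (-(pi/2))"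
      by (rule interval_integral_FTC_nonneg[OF _ D ct _ A B]; use f0 in simp)+
  qed
  have int: "integrable lborel ?f" using F(1) by (simp add: set_integrable_def)
  have "(\<integral>x. ?f x \<partial>lborel) = pi"
    using F(2) by (simp add: interval_lebesgue_integral_def set_lebesgue_integral_def)
  then show ?thesis using nn_integral_eq_integral[OF int] pos e by (simp add: less_imp_le)
qed

lemma nn_integral_mobius:
  assumes r: "0 < Im r"
  shows "(\<integral>\<^sup>+v. ennreal (1 / (cmod (1 + complex_of_real (v - v0) * r))\<^sup>2) \<partial>lborel) = ennreal (pi / Im r)"
proof -
  define n where "n = (cmod r)\<^sup>2"
  have n: "n = (Re r)\<^sup>2 + (Im r)\<^sup>2" by (simp add: n_def cmod_power2)
  have n0: "0 < n" unfolding n using r by (simp add: add_nonneg_pos)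
  \<comment> \<open>Completing the square: in v this is a multiple of the Lorentzian centred at v0 -
    Re r / |r|^2 with width Im r / |r|^2.\<close>
  have eq: "1 / (cmod (1 + complex_of_real (v - v0) * r))\<^sup>2 = (1 / Im r) * ((Im r / n) / ((v - (v0 - Re r / n))\<^sup>2 + (Im r / n)\<^sup>2))" for v
  proof -
    have "(cmod (1 + complex_of_real (v - v0) * r))\<^sup>2 = (1 + (v - v0) * Re r)\<^sup>2 + ((v - v0) * Im r)\<^sup>2"
      unfolding cmod_power2 by simp
    also have "\<dots> = n * ((v - (v0 - Re r / n))\<^sup>2 + (Im r / n)\<^sup>2)"
    proof -
      have "n * ((v - (v0 - Re r / n))\<^sup>2 + (Im r / n)\<^sup>2) = n * (v - v0)\<^sup>2 + 2 * (v - v0) * Re r + ((Re r)\<^sup>2 + (Im r)\<^sup>2) / n"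
        using n0 by (simp add: field_simps power2_eq_square)
      also have "((Re r)\<^sup>2 + (Im r)\<^sup>2) / n = 1" unfolding n[symmetric] using n0 by simp
      finally show ?thesis unfolding n by (simp add: algebra_simps power2_eq_square)
    qed
    finally have c: "(cmod (1 + complex_of_real (v - v0) * r))\<^sup>2 = n * ((v - (v0 - Re r / n))\<^sup>2 + (Im r / n)\<^sup>2)" .
    have gen: "1 / (n * X) = (1 / i) * ((i / n) / X)" if "i \<noteq> 0" for X i :: real using that by simp
    show ?thesis unfolding c by (rule gen) (use r in simp)
  qed
  have "(\<integral>\<^sup>+v. ennreal (1 / (cmod (1 + complex_of_real (v - v0) * r))\<^sup>2) \<partial>lborel) =
     (\<integral>\<^sup>+v. ennreal (1 / Im r) * ennreal ((Im r / n) / ((v - (v0 - Re r / n))\<^sup>2 + (Im r / n)\<^sup>2)) \<partial>lborel)"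
    unfolding eq using r n0 by (intro nn_integral_cong, subst ennreal_mult) (auto intro!: divide_nonneg_nonneg add_nonneg_nonneg)
  also have "\<dots> = ennreal (1 / Im r) * ennreal pi"
  proof -
    have e: "0 < Im r / n" using r n0 by simp
    show ?thesis unfolding nn_integral_lorentz[OF e, of "v0 - Re r / n", symmetric] by (intro nn_integral_cmult) auto
  qed
  finally show ?thesis using r by (simp add: ennreal_mult[symmetric])
qed

context bounded_potential
begin

lemma two_potentials_upd:
  assumes k: "k \<in> Zd d"
  shows "two_potentials d V (V (k := v)) (max R \<bar>v\<bar>) k"
  by unfold_locales (use R0 bdd k in \<open>auto simp: le_max_iff_disj\<close>)

text \<open>Spectral averaging: a single potential value enters only through the explicit factor of
  \<open>gI_perturb\<close>, whose integral \<pi> / Im G(k,k) cancels the prefactor.\<close>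

lemma average_gI:
  assumes \<eta>: "0 < \<eta>" and k: "k \<in> Zd d"
  shows "(\<integral>\<^sup>+v. ennreal (gI d (V (k := v)) E \<eta> k k) \<partial>lborel) = ennreal pi"
proof -
  let ?r = "Gc d V E \<eta> k k"
  have r: "0 < Im ?r" unfolding Im_Gc by (rule gI_pos[OF \<eta> k])
  have "gI d (V (k := v)) E \<eta> k k = Im ?r * (1 / (cmod (1 + complex_of_real (v - V k) * ?r))\<^sup>2)" for v
  proof -
    interpret tp: two_potentials d V "V (k := v)" "max R \<bar>v\<bar>" k by (rule two_potentials_upd[OF k])
    show ?thesis using tp.gI_perturb[OF \<eta>, of E] by (simp add: Im_Gc)
  qed
  then have "(\<integral>\<^sup>+v. ennreal (gI d (V (k := v)) E \<eta> k k) \<partial>lborel) =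
    (\<integral>\<^sup>+v. ennreal (Im ?r) * ennreal (1 / (cmod (1 + complex_of_real (v - V k) * ?r))\<^sup>2) \<partial>lborel)"
    using r by (intro nn_integral_cong) (simp add: ennreal_mult[symmetric])
  also have "\<dots> = ennreal (Im ?r) * ennreal (pi / Im ?r)"
    unfolding nn_integral_mobius[OF r, of "V k", symmetric] by (intro nn_integral_cmult) auto
  finally show ?thesis using r by (simp add: ennreal_mult[symmetric])
qed

text \<open>Averaging over the potential at k turns the determinant into \<pi> times the Schur
  complement det / Im G(k,k), which is at most Im G(j,j).\<close>

lemma average_detI:
  assumes \<eta>: "0 < \<eta>" and k: "k \<in> Zd d" and j: "j \<in> Zd d"
  shows "(\<integral>\<^sup>+v. ennreal (detI d (V (k := v)) E \<eta> j k) \<partial>lborel) \<le> ennreal (pi * gI d V E \<eta> j j)"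
proof -
  let ?r = "Gc d V E \<eta> k k"
  have r: "0 < Im ?r" unfolding Im_Gc by (rule gI_pos[OF \<eta> k])
  have d0: "0 \<le> detI d V E \<eta> j k" by (rule detI_nonneg[OF \<eta> j k])
  have "detI d (V (k := v)) E \<eta> j k = detI d V E \<eta> j k * (1 / (cmod (1 + complex_of_real (v - V k) * ?r))\<^sup>2)" for v
  proof -
    interpret tp: two_potentials d V "V (k := v)" "max R \<bar>v\<bar>" k by (rule two_potentials_upd[OF k])
    show ?thesis using tp.detI_perturb[OF \<eta> j, of E] by simp
  qed
  then have "(\<integral>\<^sup>+v. ennreal (detI d (V (k := v)) E \<eta> j k) \<partial>lborel) =
    (\<integral>\<^sup>+v. ennreal (detI d V E \<eta> j k) * ennreal (1 / (cmod (1 + complex_of_real (v - V k) * ?r))\<^sup>2) \<partial>lborel)"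
    using d0 by (intro nn_integral_cong) (simp add: ennreal_mult[symmetric])
  also have "\<dots> = ennreal (detI d V E \<eta> j k) * ennreal (pi / Im ?r)"
    unfolding nn_integral_mobius[OF r, of "V k", symmetric] by (intro nn_integral_cmult) auto
  also have "\<dots> = ennreal (pi * (detI d V E \<eta> j k / Im ?r))"
    using d0 r by (simp add: ennreal_mult[symmetric] mult.commute)
  also have "\<dots> \<le> ennreal (pi * gI d V E \<eta> j j)"
  proof (intro ennreal_leI mult_left_mono)
    have "detI d V E \<eta> j k \<le> gI d V E \<eta> j j * Im ?r" unfolding detI_def Im_Gc by simp
    then show "detI d V E \<eta> j k / Im ?r \<le> gI d V E \<eta> j j" using r by (simp add: field_simps)
  qed simp
  finally show ?thesis .
qed

text \<open>One site after the other: the inner integral leaves the integrand of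
  \<open>average_gI\<close> for the outer one, and each integration contributes \<pi>.\<close>

lemma average_detI_two:
  assumes \<eta>: "0 < \<eta>" and k: "k \<in> Zd d" and j: "j \<in> Zd d" and jk: "j \<noteq> k"
  shows "(\<integral>\<^sup>+v1. (\<integral>\<^sup>+v2. ennreal (detI d (V (j := v1, k := v2)) E \<eta> j k) \<partial>lborel) \<partial>lborel) \<le> ennreal (pi\<^sup>2)"
proof -
  have "(\<integral>\<^sup>+v2. ennreal (detI d (V (j := v1, k := v2)) E \<eta> j k) \<partial>lborel) \<le> ennreal pi * ennreal (gI d (V (j := v1)) E \<eta> j j)" for v1
  proof -
    interpret b: bounded_potential d "V (j := v1)" "max R \<bar>v1\<bar>"
      by unfold_locales (use R0 bdd in \<open>auto simp: le_max_iff_disj\<close>)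
    show ?thesis using b.average_detI[OF \<eta> k j, of E] b.gI_pos[OF \<eta> j, of E] by (simp add: ennreal_mult)
  qed
  then have "(\<integral>\<^sup>+v1. (\<integral>\<^sup>+v2. ennreal (detI d (V (j := v1, k := v2)) E \<eta> j k) \<partial>lborel) \<partial>lborel) \<le>
     (\<integral>\<^sup>+v1. ennreal pi * ennreal (gI d (V (j := v1)) E \<eta> j j) \<partial>lborel)"
    by (intro nn_integral_mono)
  also have "\<dots> = ennreal pi * ennreal pi"
  proof -
    have "(%v. gI d (V (j := v)) E \<eta> j j) \<in> borel_measurable borel"
    proof -
      have "gI d (V (j := v)) E \<eta> j j = gI d V E \<eta> j j / (cmod (1 + complex_of_real (v - V j) * Gc d V E \<eta> j j))\<^sup>2" for v
      proof -
        interpret tp: two_potentials d V "V (j := v)" "max R \<bar>v\<bar>" j by (rule two_potentials_upd[OF j])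
        show ?thesis using tp.gI_perturb[OF \<eta>, of E] by simp
      qed
      then show ?thesis by simp
    qed
    then show ?thesis by (subst nn_integral_cmult) (auto simp: average_gI[OF \<eta> j])
  qed
  finally show ?thesis by (simp add: ennreal_mult[symmetric] power2_eq_square)
qed

end

section \<open>The random potential\<close>

lemma countable_Zd: "countable (Zd d)"
proof -
  have "inj_on (%x. map x [0..<d]) (Zd d)"
  proof (rule inj_onI)
    fix x y assume x: "x \<in> Zd d" and y: "y \<in> Zd d" and e: "map x [0..<d] = map y [0..<d]"
    show "x = y"
    proof
      fix i show "x i = y i"
      proof (cases "i < d")
        case True then show ?thesis using e by (simp add: list_eq_iff_nth_eq)
      next
        case False then show ?thesis using x y by (simp add: Zd_def)
      qed
    qed
  qed
  moreover have "countable ((%x. map x [0..<d]) ` Zd d)" by (rule countableI_type)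
  ultimately show ?thesis by (rule countable_image_inj_on[rotated])
qed

definition sh :: "site => site => nat => int" where
  "sh a x = (%i. x i + a i)"

definition neg :: "site => nat => int" where "neg a = (%i. - a i)"

lemma sh_Zd: "a \<in> Zd d ==> x \<in> Zd d ==> sh a x \<in> Zd d" by (simp add: sh_def Zd_def)
lemma neg_Zd: "a \<in> Zd d ==> neg a \<in> Zd d" by (simp add: neg_def Zd_def)
lemma sh_neg[simp]: "sh a (sh (neg a) x) = x" "sh (neg a) (sh a x) = x" by (simp_all add: sh_def neg_def)
lemma zero_Zd: "(%_. 0) \<in> Zd d" by (simp add: Zd_def)
lemma inj_sh: "inj (sh a)" by (rule inj_on_inverseI[where g="sh (neg a)"]) simp

lemma sh_bij: "a \<in> Zd d ==> bij_betw (sh a) (Zd d) (Zd d)"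
  by (rule bij_betw_byWitness[where f'="sh (neg a)"]) (auto intro: sh_Zd neg_Zd)

lemma nbrs_sh: "nbrs d (sh a x) = sh a ` nbrs d x"
proof -
  have "sh a (x(i := x i + c)) = (sh a x)(i := sh a x i + c)" for i c by (auto simp: sh_def)
  moreover have "sh a (x(i := x i - 1)) = (sh a x)(i := sh a x i - 1)" for i by (auto simp: sh_def)
  ultimately have A: "(%i. (sh a x)(i := sh a x i + 1)) = (%i. sh a (x(i := x i + 1)))"
    "(%i. (sh a x)(i := sh a x i - 1)) = (%i. sh a (x(i := x i - 1)))" by auto
  have N: "nbrs d y = (%i. y(i := y i + 1)) ` {..<d} \<union> (%i. y(i := y i - 1)) ` {..<d}" for y
    unfolding nbrs_def by auto
  show ?thesis unfolding N[of "sh a x"] N[of x] image_Un image_image A ..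
qed

text \<open>Restricted to the lattice, so that the shifted potential lies in the space of the
  product measure.\<close>

definition tau :: "nat => site => (site => real) => site => real" where
  "tau d a V = (\<lambda>x\<in>Zd d. V (sh a x))"

lemma Hrn_tau:
  assumes a: "a \<in> Zd d" and z: "z \<in> Zd d"
  shows "(Hr d (tau d a V) ^^ n) (%z. v (sh a z)) z = (Hr d V ^^ n) v (sh a z)"
  using z
proof (induction n arbitrary: z)
  case (Suc n)
  have "(\<Sum>y\<in>nbrs d z. (Hr d (tau d a V) ^^ n) (%z. v (sh a z)) y) = (\<Sum>y\<in>nbrs d z. (Hr d V ^^ n) v (sh a y))"
    using nbrs_Zd[OF Suc.prems] by (intro sum.cong refl Suc.IH) auto
  also have "\<dots> = (\<Sum>y\<in>nbrs d (sh a z). (Hr d V ^^ n) v y)"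
    unfolding nbrs_sh by (subst sum.reindex) (auto intro: inj_on_subset[OF inj_sh])
  moreover have "tau d a V z = V (sh a z)" using Suc.prems by (simp add: tau_def)
  ultimately show ?case
    unfolding funpow.simps o_apply Hr_def[of d "tau d a V" _ z] Hr_def[of d V _ "sh a z"]
    using Suc.IH[OF Suc.prems] by simp
qed simp

text \<open>Covariance: shifting potential and vector together preserves all moments, hence the
  spectral measure.\<close>

lemma sm_tau:
  assumes a: "a \<in> Zd d" and v: "fs d v"
  shows "fs d (%z. v (sh a z))" "sm d (tau d a V) (%z. v (sh a z)) = sm d V v"
proof -
  have sp: "supp (%z. v (sh a z)) = sh (neg a) ` supp v"
  proof
    show "supp (%z. v (sh a z)) \<subseteq> sh (neg a) ` supp v"
      by (auto simp: supp_def intro!: image_eqI[of _ "sh (neg a)" "sh a _"])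
  qed (auto simp: supp_def)
  show f: "fs d (%z. v (sh a z))"
    unfolding fs_def sp using v a by (auto simp: fs_def intro!: sh_Zd neg_Zd)
  have "ip (%z. v (sh a z)) ((Hr d (tau d a V) ^^ n) (%z. v (sh a z))) = ip v ((Hr d V ^^ n) v)" for n
  proof -
    have "ip (%z. v (sh a z)) ((Hr d (tau d a V) ^^ n) (%z. v (sh a z))) = (\<Sum>z\<in>sh (neg a) ` supp v. v (sh a z) * (Hr d V ^^ n) v (sh a z))"
      unfolding ip_def sp
      by (intro sum.cong refl) (use v a in \<open>auto simp: fs_def Hrn_tau sh_Zd neg_Zd subset_iff\<close>)
    also have "\<dots> = ip v ((Hr d V ^^ n) v)"
      unfolding ip_def by (subst sum.reindex) (auto intro: inj_on_subset[OF inj_sh])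
    finally show ?thesis .
  qed
  then show "sm d (tau d a V) (%z. v (sh a z)) = sm d V v" unfolding sm_mom[OF f] sm_mom[OF v] by simp
qed

lemma rf_tau:
  assumes a: "a \<in> Zd d" and x: "x \<in> Zd d" and y: "y \<in> Zd d"
  shows "rf d (tau d a V) f (dr x) (dr y) = rf d V f (dr (sh a x)) (dr (sh a y))"
proof -
  have e: "(%z. dr (sh a x) (sh a z) + dr (sh a y) (sh a z)) = (%z. dr x z + dr y z)"
    "(%z. dr (sh a x) (sh a z) - dr (sh a y) (sh a z)) = (%z. dr x z - dr y z)"
    using inj_sh[of a] by (auto simp: dr_def inj_eq)
  have f: "fs d (%z. dr (sh a x) z + dr (sh a y) z)" "fs d (%z. dr (sh a x) z - dr (sh a y) z)"
    using a x y by (auto intro!: fs_add fs_diff fs_dr sh_Zd)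
  show ?thesis
    using sm_tau(2)[OF a f(1), of V] sm_tau(2)[OF a f(2), of V] unfolding e rf_def by simp
qed

section \<open>The random potential: boundedness, measurability, stationarity and resampling\<close>

locale anderson =
  fixes d :: nat and \<rho> :: "real => real"
  assumes d: "1 \<le> d" and dens: "single_site_density \<rho>"
begin

abbreviation "X \<equiv> Zd d"
abbreviation "M1 \<equiv> density lborel (%t. ennreal (\<rho> t))"
abbreviation "\<Omega> \<equiv> Omega d \<rho>"
abbreviation "EN F \<equiv> \<integral>\<^sup>+V. ennreal \<bar>F V\<bar> \<partial>\<Omega>"

lemma rho_meas[measurable]: "\<rho> \<in> borel_measurable borel" and rho_nonneg: "0 \<le> \<rho> t"
  using dens by (auto simp: single_site_density_def)

lemma prob_M1: "prob_space M1"
proof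
  show "emeasure M1 (space M1) = 1"
    using dens by (simp add: emeasure_density single_site_density_def)
qed

lemma sets_M1: "sets M1 = sets borel" by simp

sublocale P: prob_space \<Omega>
  unfolding Omega_def by (rule prob_space_PiM) (rule prob_M1)

definition Rad :: real where "Rad = (SOME R. 0 \<le> R \<and> (\<forall>t. R < \<bar>t\<bar> \<longrightarrow> \<rho> t = 0))"

lemma Rad: "0 \<le> Rad" "Rad < \<bar>t\<bar> ==> \<rho> t = 0"
proof -
  obtain R where R: "\<forall>t. R < \<bar>t\<bar> \<longrightarrow> \<rho> t = 0" using dens by (auto simp: single_site_density_def)
  then have "0 \<le> max R 0 \<and> (\<forall>t. max R 0 < \<bar>t\<bar> \<longrightarrow> \<rho> t = 0)" by auto
  then have "0 \<le> Rad \<and> (\<forall>t. Rad < \<bar>t\<bar> \<longrightarrow> \<rho> t = 0)" unfolding Rad_def by (rule someI)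
  then show "0 \<le> Rad" "Rad < \<bar>t\<bar> ==> \<rho> t = 0" by auto
qed

text \<open>An event of probability one on which the deterministic theory applies with a common
  bound.\<close>

definition good :: "(site => real) => bool" where
  "good V \<longleftrightarrow> (\<forall>x\<in>X. \<bar>V x\<bar> \<le> Rad)"

lemma good_bp: "good V ==> bounded_potential d V Rad"
  by unfold_locales (use Rad in \<open>auto simp: good_def\<close>)

lemma AE_good: "AE V in \<Omega>. good V"
  unfolding good_def
proof (rule AE_ball_countable[THEN iffD2, OF countable_Zd], rule ballI)
  fix x assume x: "x \<in> X"
  have "AE t in M1. \<bar>t\<bar> \<le> Rad"
  proof (subst AE_density)
    show "AE t in lborel. 0 < ennreal (\<rho> t) \<longrightarrow> \<bar>t\<bar> \<le> Rad"
    proof (rule AE_I2)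
      fix t show "0 < ennreal (\<rho> t) \<longrightarrow> \<bar>t\<bar> \<le> Rad"
        using Rad(2)[of t] by (cases "\<bar>t\<bar> \<le> Rad") auto
    qed
  qed simp
  from AE_PiM_component[of X "%_. M1", OF _ x this]
  show "AE V in \<Omega>. \<bar>V x\<bar> \<le> Rad" unfolding Omega_def by (simp add: prob_M1)
qed

lemma comp_meas: "x \<in> X ==> (%V. V x) \<in> borel_measurable \<Omega>"
proof -
  assume "x \<in> X"
  then have "(%V. V x) \<in> measurable \<Omega> M1" unfolding Omega_def by (rule measurable_component_singleton)
  then show ?thesis using measurable_cong_sets[OF refl sets_M1] by blast
qed

lemma Hrn_meas: "x \<in> X ==> (%V. (Hr d V ^^ n) v x) \<in> borel_measurable \<Omega>"
proof (induction n arbitrary: x)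
  case (Suc n)
  have [measurable]: "(%V. (Hr d V ^^ n) v y) \<in> borel_measurable \<Omega>" if "y \<in> nbrs d x" for y
    using nbrs_Zd[OF Suc.prems] that by (intro Suc.IH) auto
  note [measurable] = Suc.IH[OF Suc.prems] comp_meas[OF Suc.prems]
  show ?case unfolding funpow.simps o_apply Hr_def[where x=x] by measurable
qed simp

lemma sm_meas:
  assumes v: "fs d v" and f: "bbm f"
  shows "(%V. \<integral>t. f t \<partial>sm d V v) \<in> borel_measurable \<Omega>"
  unfolding sm_mom[OF v]
proof (rule mom_measurable[OF _ f])
  fix n
  have "(%V. ip v ((Hr d V ^^ n) v)) \<in> borel_measurable \<Omega>"
    unfolding ip_def using v by (intro borel_measurable_sum borel_measurable_times Hrn_meas) (auto simp: fs_def)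
  then show "(%V. complex_of_real (ip v ((Hr d V ^^ n) v))) \<in> borel_measurable \<Omega>" by simp
qed

lemma rf_meas:
  assumes "fs d v" "fs d w" "bbm f"
  shows "(%V. rf d V f v w) \<in> borel_measurable \<Omega>"
  unfolding rf_def using assms by (intro borel_measurable_divide borel_measurable_diff sm_meas fs_add fs_diff) auto

lemma rfx_meas: "bbm f ==> x \<in> X ==> y \<in> X ==> (%V. rf d V f (dr x) (dr y)) \<in> borel_measurable \<Omega>"
  by (intro rf_meas fs_dr)

lemma distr_tau:
  assumes a: "a \<in> X"
  shows "tau d a \<in> measurable \<Omega> \<Omega>" "distr \<Omega> \<Omega> (tau d a) = \<Omega>"
proof -
  have i: "inj_on (sh a) X" "sh a \<in> X \<rightarrow> X" using a by (auto intro: inj_on_subset[OF inj_sh] sh_Zd)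
  show "tau d a \<in> measurable \<Omega> \<Omega>"
    unfolding tau_def[abs_def] Omega_def
    using i(2) by (intro measurable_restrict measurable_component_singleton) auto
  show "distr \<Omega> \<Omega> (tau d a) = \<Omega>"
    using distr_PiM_reindex[OF _ i, of "%_. M1"] prob_M1 unfolding tau_def[abs_def] Omega_def by simp
qed

lemma space_upd: "V \<in> space \<Omega> ==> k \<in> X ==> V (k := v) \<in> space \<Omega>"
  unfolding Omega_def by (auto simp: space_PiM PiE_def extensional_def)

lemma upd_meas: "V \<in> space \<Omega> ==> k \<in> X ==> (%v. V (k := v)) \<in> measurable borel \<Omega>"
proof -
  assume w: "V \<in> space \<Omega>" and k: "k \<in> X"
  have "(%v. V (k := v)) \<in> measurable M1 (PiM X (%_. M1))"
    by (rule measurable_fun_upd[where J=X]) (use w k in \<open>auto simp: Omega_def\<close>)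
  then show ?thesis unfolding Omega_def using measurable_cong_sets[OF sets_M1 refl] by blast
qed

text \<open>One coordinate of a product measure may be replaced by an independent copy; as k already
  belongs to the index set, the product over \<open>insert k X\<close> is the product over
  \<open>X\<close>.\<close>

lemma resample:
  assumes k: "k \<in> X" and F[measurable]: "F \<in> borel_measurable \<Omega>"
  shows "(\<integral>\<^sup>+V. F V \<partial>\<Omega>) = (\<integral>\<^sup>+V. (\<integral>\<^sup>+v. F (V (k := v)) \<partial>M1) \<partial>\<Omega>)"
    "(%V. \<integral>\<^sup>+v. F (V (k := v)) \<partial>M1) \<in> borel_measurable \<Omega>"
proof -
  interpret M1: prob_space M1 by (rule prob_M1)
  interpret PP: pair_prob_space M1 \<Omega> ..
  have ins: "insert k X = X" using k by auto
  have um: "(%(f, y). f (k := y)) \<in> measurable (\<Omega> \<Otimes>\<^sub>M M1) \<Omega>"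
    using measurable_add_dim[of k X "%_. M1"] unfolding ins Omega_def by simp
  have um': "(%(x, Y). Y (k := x)) \<in> measurable (M1 \<Otimes>\<^sub>M \<Omega>) \<Omega>"
    using measurable_compose[OF measurable_pair_swap' um] by (simp add: split_def)
  have eq: "distr (M1 \<Otimes>\<^sub>M \<Omega>) \<Omega> (%(x, Y). Y (k := x)) = \<Omega>"
    using distr_pair_PiM_eq_PiM[of X "%_. M1" k] prob_M1 unfolding ins Omega_def by simp
  have mF: "(%(v, V). F (V (k := v))) \<in> borel_measurable (M1 \<Otimes>\<^sub>M \<Omega>)"
    using measurable_compose[OF um' F] by (simp add: split_def)
  have "(\<integral>\<^sup>+V. F V \<partial>\<Omega>) = (\<integral>\<^sup>+p. F ((%(x, Y). Y (k := x)) p) \<partial>(M1 \<Otimes>\<^sub>M \<Omega>))"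
  proof -
    have "(\<integral>\<^sup>+V. F V \<partial>\<Omega>) = (\<integral>\<^sup>+V. F V \<partial>distr (M1 \<Otimes>\<^sub>M \<Omega>) \<Omega> (%(x, Y). Y (k := x)))" by (simp only: eq)
    also have "\<dots> = (\<integral>\<^sup>+p. F ((%(x, Y). Y (k := x)) p) \<partial>(M1 \<Otimes>\<^sub>M \<Omega>))"
      by (rule nn_integral_distr[OF um']) (simp add: F)
    finally show ?thesis .
  qed
  also have "\<dots> = (\<integral>\<^sup>+p. (case p of (v, V) => F (V (k := v))) \<partial>(M1 \<Otimes>\<^sub>M \<Omega>))"
    by (simp add: split_def)
  also have "\<dots> = (\<integral>\<^sup>+V. (\<integral>\<^sup>+v. F (V (k := v)) \<partial>M1) \<partial>\<Omega>)"
    using PP.nn_integral_snd[OF mF] by simp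
  finally show "(\<integral>\<^sup>+V. F V \<partial>\<Omega>) = (\<integral>\<^sup>+V. (\<integral>\<^sup>+v. F (V (k := v)) \<partial>M1) \<partial>\<Omega>)" .
  have "(%(V, v). F (V (k := v))) \<in> borel_measurable (\<Omega> \<Otimes>\<^sub>M M1)"
    using measurable_compose[OF um F] by (simp add: split_def)
  then show "(%V. \<integral>\<^sup>+v. F (V (k := v)) \<partial>M1) \<in> borel_measurable \<Omega>"
    by (rule M1.borel_measurable_nn_integral)
qed

text \<open>The sup norm as a real number, which loses nothing because the density is
  bounded.\<close>

definition rb :: real where "rb = real_of_ereal (normInf \<rho>)"

lemma rb: "normInf \<rho> = ereal rb" "0 \<le> rb" "AE t in lborel. \<rho> t \<le> rb"
proof -
  have m: "(%t. ereal \<bar>\<rho> t\<bar>) \<in> borel_measurable lborel" by simp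
  obtain M where M: "!!t. \<rho> t \<le> M" using dens by (auto simp: single_site_density_def)
  have "normInf \<rho> \<le> ereal M" unfolding normInf_def
    by (rule esssup_I[OF m]) (use M rho_nonneg in auto)
  moreover have "0 \<le> normInf \<rho>"
  proof -
    have "esssup lborel (%t::real. 0 :: ereal) \<le> normInf \<rho>" unfolding normInf_def by (rule esssup_mono) auto
    moreover have "esssup lborel (%t::real. 0 :: ereal) = 0" by (rule esssup_const) simp
    ultimately show ?thesis by simp
  qed
  ultimately show e: "normInf \<rho> = ereal rb" "0 \<le> rb"
    unfolding rb_def by (cases "normInf \<rho>"; simp)+
  have "AE t in lborel. ereal \<bar>\<rho> t\<bar> \<le> normInf \<rho>" unfolding normInf_def by (rule esssup_AE)
  then show "AE t in lborel. \<rho> t \<le> rb" unfolding e by eventually_elim (use rho_nonneg in auto)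
qed

lemma nn_integral_M1_le:
  assumes f[measurable]: "f \<in> borel_measurable borel"
  shows "(\<integral>\<^sup>+v. f v \<partial>M1) \<le> ennreal rb * (\<integral>\<^sup>+v. f v \<partial>lborel)"
proof -
  have "(\<integral>\<^sup>+v. f v \<partial>M1) = (\<integral>\<^sup>+v. ennreal (\<rho> v) * f v \<partial>lborel)" by (subst nn_integral_density) auto
  also have "\<dots> \<le> (\<integral>\<^sup>+v. ennreal rb * f v \<partial>lborel)"
    by (rule nn_integral_mono_AE) (use rb(3) in \<open>eventually_elim, auto intro!: mult_right_mono ennreal_leI\<close>)
  finally show ?thesis by (simp add: nn_integral_cmult)
qed

lemma detI_meas:
  assumes "0 < \<eta>" "j \<in> X" "k \<in> X"
  shows "(%V. ennreal (detI d V E \<eta> j k)) \<in> borel_measurable \<Omega>"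
proof -
  note [measurable] = rfx_meas[OF bbm_gi[OF assms(1)] assms(2) assms(2), of E] rfx_meas[OF bbm_gi[OF assms(1)] assms(3) assms(3), of E]
    rfx_meas[OF bbm_gi[OF assms(1)] assms(2) assms(3), of E]
  show ?thesis unfolding detI_def gI_def by measurable
qed

text \<open>Both potentials are resampled and each density is replaced by its sup norm; then
  \<open>average_detI_two\<close> applies for almost every remaining configuration. For j = k the
  determinant vanishes.\<close>

lemma minami_detI:
  assumes \<eta>: "0 < \<eta>" and j: "j \<in> X" and k: "k \<in> X"
  shows "(\<integral>\<^sup>+V. ennreal (detI d V E \<eta> j k) \<partial>\<Omega>) \<le> ennreal (rb\<^sup>2 * pi\<^sup>2)"
proof (cases "j = k")
  case True
  then show ?thesis by (simp add: detI_def power2_eq_square)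
next
  case False
  let ?F = "%V. ennreal (detI d V E \<eta> j k)"
  note F = detI_meas[OF \<eta> j k, of E]
  note G = resample(2)[OF k F]
  have "(\<integral>\<^sup>+V. ?F V \<partial>\<Omega>) = (\<integral>\<^sup>+V. (\<integral>\<^sup>+v1. (\<integral>\<^sup>+v2. ?F (V (j := v1, k := v2)) \<partial>M1) \<partial>M1) \<partial>\<Omega>)"
    unfolding resample(1)[OF k F] by (rule resample(1)[OF j G])
  also have "\<dots> \<le> (\<integral>\<^sup>+V. ennreal (rb\<^sup>2 * pi\<^sup>2) \<partial>\<Omega>)"
  proof (rule nn_integral_mono_AE)
    show "AE V in \<Omega>. (\<integral>\<^sup>+v1. (\<integral>\<^sup>+v2. ?F (V (j := v1, k := v2)) \<partial>M1) \<partial>M1) \<le> ennreal (rb\<^sup>2 * pi\<^sup>2)"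
      using AE_good AE_space
    proof eventually_elim
      case (elim V)
      interpret bounded_potential d V Rad by (rule good_bp) fact
      have m2: "(%v2. ?F (V (j := v1, k := v2))) \<in> borel_measurable borel" for v1
        by (rule measurable_compose[OF upd_meas[OF space_upd[OF elim(2) j] k] F])
      have m1: "(%v1. \<integral>\<^sup>+v2. ?F (V (j := v1, k := v2)) \<partial>M1) \<in> borel_measurable borel"
        by (rule measurable_compose[OF upd_meas[OF elim(2) j] G])
      have m1': "(%v1. \<integral>\<^sup>+v2. ?F (V (j := v1, k := v2)) \<partial>lborel) \<in> borel_measurable borel"
      proof -
        have "(%p. ?F (V (j := fst p, k := snd p))) \<in> borel_measurable (borel \<Otimes>\<^sub>M lborel)"
        proof -
          have "(%p. V (j := fst p, k := snd p)) \<in> measurable (borel \<Otimes>\<^sub>M borel) (PiM X (%_. M1))"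
          proof (rule measurable_fun_upd[where J=X])
            show "(%p. V (j := fst p)) \<in> measurable (borel \<Otimes>\<^sub>M borel) (PiM X (%_. M1))"
              by (rule measurable_compose[OF measurable_fst upd_meas[OF elim(2) j], unfolded Omega_def])
            show "snd \<in> measurable (borel \<Otimes>\<^sub>M borel :: (real \<times> real) measure) M1"
              using measurable_snd[of borel borel] measurable_cong_sets[OF refl sets_M1] by blast
          qed (use k in auto)
          then have "(%p. V (j := fst p, k := snd p)) \<in> measurable (borel \<Otimes>\<^sub>M lborel) \<Omega>"
            unfolding Omega_def using measurable_cong_sets[OF sets_pair_measure_cong[OF refl sets_lborel] refl] by blast
          from measurable_compose[OF this F] show ?thesis .
        qed
        then show ?thesis using lborel.borel_measurable_nn_integral[of "%v1 v2. ?F (V (j := v1, k := v2))" borel]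
          by (simp add: split_def)
      qed
      have "(\<integral>\<^sup>+v1. (\<integral>\<^sup>+v2. ?F (V (j := v1, k := v2)) \<partial>M1) \<partial>M1)
          \<le> ennreal rb * (\<integral>\<^sup>+v1. (\<integral>\<^sup>+v2. ?F (V (j := v1, k := v2)) \<partial>M1) \<partial>lborel)"
        by (rule nn_integral_M1_le[OF m1])
      also have "\<dots> \<le> ennreal rb * (\<integral>\<^sup>+v1. ennreal rb * (\<integral>\<^sup>+v2. ?F (V (j := v1, k := v2)) \<partial>lborel) \<partial>lborel)"
        by (intro mult_left_mono nn_integral_mono nn_integral_M1_le m2) auto
      also have "\<dots> = ennreal rb * (ennreal rb * (\<integral>\<^sup>+v1. (\<integral>\<^sup>+v2. ?F (V (j := v1, k := v2)) \<partial>lborel) \<partial>lborel))"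
        using m1' by (subst nn_integral_cmult) auto
      also have "\<dots> \<le> ennreal rb * (ennreal rb * ennreal (pi\<^sup>2))"
        by (intro mult_left_mono average_detI_two[OF \<eta> k j False]) auto
      also have "\<dots> = ennreal (rb\<^sup>2 * pi\<^sup>2)"
        using rb(2) by (simp add: ennreal_mult[symmetric] power2_eq_square mult_ac)
      finally show ?case .
    qed
  qed
  also have "\<dots> = ennreal (rb\<^sup>2 * pi\<^sup>2)" by (simp add: P.emeasure_space_1)
  finally show ?thesis .
qed

definition detF :: "(site => real) => (real => real) => site => site => real" where
  "detF V f j k = rf d V f (dr j) (dr j) * rf d V f (dr k) (dr k) - (rf d V f (dr j) (dr k))\<^sup>2"

end

text \<open>Besides the two determinants the expansion contains az + cx - 2by, which is nonnegative:
  (by)^2 \<le> (az)(cx), and the geometric mean is at most the arithmetic one.\<close>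

lemma psd_det_mono:
  fixes a b c x y z :: real
  assumes "0 \<le> a" "0 \<le> c" "b\<^sup>2 \<le> a * c" "0 \<le> x" "0 \<le> z" "y\<^sup>2 \<le> x * z"
  shows "a * c - b\<^sup>2 \<le> (a + x) * (c + z) - (b + y)\<^sup>2"
proof -
  have "(2 * (b * y))\<^sup>2 \<le> (a * z + c * x)\<^sup>2"
  proof -
    have "(b * y)\<^sup>2 \<le> (a * c) * (x * z)"
      unfolding power_mult_distrib using assms by (intro mult_mono) auto
    moreover have "4 * ((a * c) * (x * z)) \<le> (a * z + c * x)\<^sup>2"
      using zero_le_power2[of "a * z - c * x"] by (simp add: power2_eq_square algebra_simps)
    ultimately show ?thesis by (simp add: power_mult_distrib)
  qed
  moreover have "0 \<le> a * z + c * x" using assms by simp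
  ultimately have "2 * (b * y) \<le> a * z + c * x" by (rule power2_le_imp_le)
  then show ?thesis using assms by (simp add: algebra_simps power2_eq_square)
qed

context anderson
begin

text \<open>Minami's estimate for two sites: \<open>\<chi>\<^bsub>(E-\<nu>,E+\<nu>]\<^esub> \<le> 2\<nu> Im (t - E - i\<nu>)\<^sup>-\<^sup>1\<close>.\<close>

lemma minami:
  fixes E \<nu> :: real
  assumes \<nu>: "0 < \<nu>" and j: "j \<in> X" and k: "k \<in> X"
  defines "f \<equiv> indicator {E - \<nu><..E + \<nu>} :: real => real"
  shows "(\<integral>\<^sup>+V. ennreal (detF V f j k) \<partial>\<Omega>) \<le> ennreal (4 * \<nu>\<^sup>2 * pi\<^sup>2 * rb\<^sup>2)"
proof -
  have bf: "bbm f" unfolding f_def by (rule bbm_indicator) simp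
  have le: "f t \<le> 2 * \<nu> * gi E \<nu> t" for t
  proof (cases "t \<in> {E - \<nu><..E + \<nu>}")
    case True
    then have "\<bar>t - E\<bar> \<le> \<nu>" by auto
    then have "(t - E)\<^sup>2 \<le> \<nu>\<^sup>2" using \<nu> by (metis abs_ge_zero power2_abs power_mono)
    then have "(t - E)\<^sup>2 + \<nu>\<^sup>2 \<le> 2 * \<nu> * \<nu>" by (simp add: power2_eq_square)
    then have "1 \<le> 2 * \<nu> * \<nu> / ((t - E)\<^sup>2 + \<nu>\<^sup>2)" using den_pos[OF \<nu>, of t E] by (simp add: le_divide_eq_1)
    then show ?thesis using True by (simp add: f_def gi_def)
  next
    case False
    then show ?thesis using \<nu> gi_pos[OF \<nu>, of E t] by (simp add: f_def)
  qed
  have "AE V in \<Omega>. ennreal (detF V f j k) \<le> ennreal (4 * \<nu>\<^sup>2) * ennreal (detI d V E \<nu> j k)"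
    using AE_good
  proof eventually_elim
    case (elim V)
    interpret bounded_potential d V Rad by (rule good_bp) fact
    let ?g = "%t. 2 * \<nu> * gi E \<nu> t" and ?h = "%t. 2 * \<nu> * gi E \<nu> t - f t"
    have bg: "bbm ?g" by (rule bbm_scale[OF bbm_gi[OF \<nu>]])
    have bh: "bbm ?h" by (rule bbm_diff[OF bg bf])
    have f0: "0 \<le> f t" for t by (simp add: f_def)
    have h0: "0 \<le> ?h t" for t using le[of t] by simp
    have s: "2 * \<nu> * gI d V E \<nu> x y = rf d V f (dr x) (dr y) + rf d V ?h (dr x) (dr y)" if "x \<in> X" "y \<in> X" for x y
      using rf_minus[OF fs_dr[OF that(1)] fs_dr[OF that(2)] bg bf] rf_cmult[OF fs_dr[OF that(1)] fs_dr[OF that(2)] bbm_gi[OF \<nu>, of E], of "2 * \<nu>"]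
      by (simp add: gI_def)
    have "detF V f j k \<le> (2 * \<nu> * gI d V E \<nu> j j) * (2 * \<nu> * gI d V E \<nu> k k) - (2 * \<nu> * gI d V E \<nu> j k)\<^sup>2"
      unfolding detF_def s[OF j j] s[OF k k] s[OF j k]
      by (intro psd_det_mono rf_pos rf_CS fs_dr bf bh f0 h0 j k)
    also have "\<dots> = 4 * \<nu>\<^sup>2 * detI d V E \<nu> j k" by (simp add: detI_def power2_eq_square algebra_simps)
    finally show ?case using detI_nonneg[OF \<nu> j k, of E] \<nu> by (simp add: ennreal_mult[symmetric] ennreal_leI)
  qed
  then have "(\<integral>\<^sup>+V. ennreal (detF V f j k) \<partial>\<Omega>) \<le> (\<integral>\<^sup>+V. ennreal (4 * \<nu>\<^sup>2) * ennreal (detI d V E \<nu> j k) \<partial>\<Omega>)"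
    by (rule nn_integral_mono_AE)
  also have "\<dots> = ennreal (4 * \<nu>\<^sup>2) * (\<integral>\<^sup>+V. ennreal (detI d V E \<nu> j k) \<partial>\<Omega>)"
    by (rule nn_integral_cmult[OF detI_meas[OF \<nu> j k]])
  also have "\<dots> \<le> ennreal (4 * \<nu>\<^sup>2) * ennreal (rb\<^sup>2 * pi\<^sup>2)"
    by (intro mult_left_mono minami_detI[OF \<nu> j k]) auto
  also have "\<dots> = ennreal (4 * \<nu>\<^sup>2 * pi\<^sup>2 * rb\<^sup>2)" by (simp add: ennreal_mult[symmetric] mult_ac)
  finally show ?thesis .
qed

end

section \<open>Exponential decay of the Fermi projection\<close>

lemma lorentz_integral:
  assumes e: "0 < e"
  shows "integrable lborel (%x. e / (x\<^sup>2 + e\<^sup>2))" "(\<integral>x. e / (x\<^sup>2 + e\<^sup>2) \<partial>lborel) = pi"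
proof -
  have nn: "(\<integral>\<^sup>+x. ennreal (e / (x\<^sup>2 + e\<^sup>2)) \<partial>lborel) = ennreal pi"
    using nn_integral_lorentz[OF e, of 0] by simp
  have pos: "0 \<le> e / (x\<^sup>2 + e\<^sup>2)" for x using e by simp
  show i: "integrable lborel (%x. e / (x\<^sup>2 + e\<^sup>2))"
    by (rule integrableI_nonneg) (use nn pos in auto)
  show "(\<integral>x. e / (x\<^sup>2 + e\<^sup>2) \<partial>lborel) = pi"
    by (subst integral_eq_nn_integral) (use nn pos in auto)
qed

text \<open>For t \<noteq> E the integrand is sgn (t - E) times a Lorentzian of width |t - E| in the
  variable \<eta>. This is how the resolvent on a vertical line produces a spectral
  projection.\<close>

lemma gr_integral:
  "integrable lborel (%\<eta>. gr E \<eta> t)" "(\<integral>\<eta>. gr E \<eta> t \<partial>lborel) = pi * sgn (t - E)"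
  "(\<integral>\<eta>. \<bar>gr E \<eta> t\<bar> \<partial>lborel) = pi * \<bar>sgn (t - E)\<bar>"
proof -
  let ?u = "t - E"
  have eq: "gr E \<eta> t = sgn ?u * (\<bar>?u\<bar> / (\<eta>\<^sup>2 + \<bar>?u\<bar>\<^sup>2))" for \<eta>
    unfolding gr_def by (simp add: mult_sgn_abs add.commute)
  have eqa: "\<bar>gr E \<eta> t\<bar> = \<bar>sgn ?u\<bar> * (\<bar>?u\<bar> / (\<eta>\<^sup>2 + \<bar>?u\<bar>\<^sup>2))" for \<eta>
    unfolding eq abs_mult by simp
  have *: "integrable lborel (%\<eta>. gr E \<eta> t) \<and> (\<integral>\<eta>. gr E \<eta> t \<partial>lborel) = pi * sgn ?u \<and> (\<integral>\<eta>. \<bar>gr E \<eta> t\<bar> \<partial>lborel) = pi * \<bar>sgn ?u\<bar>"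
  proof (cases "?u = 0")
    case True
    then show ?thesis by (simp add: gr_def)
  next
    case False
    then have u: "0 < \<bar>?u\<bar>" by simp
    note L = lorentz_integral[OF u]
    show ?thesis unfolding eqa unfolding eq
      by (intro conjI integrable_mult_right L(1)) (simp_all only: integral_mult_right_zero L(2) mult.commute)
  qed
  then show "integrable lborel (%\<eta>. gr E \<eta> t)" "(\<integral>\<eta>. gr E \<eta> t \<partial>lborel) = pi * sgn (t - E)"
    "(\<integral>\<eta>. \<bar>gr E \<eta> t\<bar> \<partial>lborel) = pi * \<bar>sgn (t - E)\<bar>" by auto
qed

lemma bbm_sgn: "bbm (%t. sgn (t - E))"
  by (rule bbmI[where B=1]) (auto simp: sgn_if)

lemma sgn_integral:
  assumes \<mu>: "finite_measure \<mu>" "sets \<mu> = sets borel"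
  shows "integrable lborel (%\<eta>. \<integral>t. gr E \<eta> t \<partial>\<mu>)"
    "(\<integral>\<eta>. (\<integral>t. gr E \<eta> t \<partial>\<mu>) \<partial>lborel) = pi * (\<integral>t. sgn (t - E) \<partial>\<mu>)"
proof -
  interpret \<mu>: finite_measure \<mu> by fact
  interpret pair_sigma_finite \<mu> lborel ..
  note [measurable_cong] = \<mu>(2)
  have m: "(%p. gr E (snd p) (fst p)) \<in> borel_measurable (\<mu> \<Otimes>\<^sub>M lborel)" unfolding gr_def by measurable
  have bs: "bbm (%t. pi * \<bar>sgn (t - E)\<bar>)"
    by (rule bbmI[where B=pi]) (auto simp: sgn_if)
  have int: "integrable (\<mu> \<Otimes>\<^sub>M lborel) (%p. gr E (snd p) (fst p))"
  proof (rule Fubini_integrable[OF m])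
    show "integrable \<mu> (%x. \<integral>y. norm (gr E (snd (x, y)) (fst (x, y))) \<partial>lborel)"
      using integrable_bbm[OF \<mu> bs] by (simp only: fst_conv snd_conv real_norm_def gr_integral(3))
  qed (simp add: gr_integral(1))
  then have int': "integrable (\<mu> \<Otimes>\<^sub>M lborel) (case_prod (%t \<eta>. gr E \<eta> t))" by (simp add: split_def)
  show "integrable lborel (%\<eta>. \<integral>t. gr E \<eta> t \<partial>\<mu>)" using integrable_snd[OF int'] .
  show "(\<integral>\<eta>. (\<integral>t. gr E \<eta> t \<partial>\<mu>) \<partial>lborel) = pi * (\<integral>t. sgn (t - E) \<partial>\<mu>)"
    using Fubini_integral[OF int'] by (simp add: gr_integral)
qed

context bounded_potential
begin

lemma rf_sgn:
  assumes v: "fs d v" and w: "fs d w"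
  shows "integrable lborel (%\<eta>. rf d V (gr E \<eta>) v w)"
    "(\<integral>\<eta>. rf d V (gr E \<eta>) v w \<partial>lborel) = pi * rf d V (%t. sgn (t - E)) v w"
proof -
  note a = sgn_integral[OF sm_finite[OF fs_add[OF v w]] sm_sets[OF fs_add[OF v w]], of E]
  note b = sgn_integral[OF sm_finite[OF fs_diff[OF v w]] sm_sets[OF fs_diff[OF v w]], of E]
  show "integrable lborel (%\<eta>. rf d V (gr E \<eta>) v w)" unfolding rf_def using a(1) b(1) by simp
  show "(\<integral>\<eta>. rf d V (gr E \<eta>) v w \<partial>lborel) = pi * rf d V (%t. sgn (t - E)) v w"
    unfolding rf_def using a b by (simp add: right_diff_distrib diff_divide_distrib)
qed

text \<open>Polarization loses nothing here, because the squared norms of \<delta>_x + \<delta>_y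
  and \<delta>_x - \<delta>_y always add up to 4, also for x = y.\<close>

lemma rf_abs_le:
  assumes f: "bbm f" "!!t. t \<in> {-C..C} ==> \<bar>f t\<bar> \<le> c" and x: "x \<in> Zd d" "y \<in> Zd d"
  shows "\<bar>rf d V f (dr x) (dr y)\<bar> \<le> c"
proof -
  note v = fs_dr[OF x(1)] and w = fs_dr[OF x(2)]
  let ?p = "%z. dr x z + dr y z" and ?m = "%z. dr x z - dr y z"
  have fp: "fs d ?p" and fm: "fs d ?m" using fs_add[OF v w] fs_diff[OF v w] by auto
  have b: "\<bar>rf d V f u u\<bar> \<le> c * ip u u" if u: "fs d u" for u
  proof -
    have "rf d V f u u \<le> c * ip u u" by (rule rf_le_norm[OF u f(1)]) (use f(2) in \<open>auto simp: abs_le_iff\<close>)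
    moreover have "rf d V (%t. - 1 * f t) u u \<le> c * ip u u"
      by (rule rf_le_norm[OF u bbm_scale[OF f(1)]]) (use f(2) in \<open>auto simp: abs_le_iff\<close>)
    moreover have "rf d V (%t. - 1 * f t) u u = - 1 * rf d V f u u" by (rule rf_cmult[OF u u f(1)])
    ultimately show ?thesis by (simp add: abs_le_iff)
  qed
  have pol: "rf d V f (dr x) (dr y) = (rf d V f ?p ?p - rf d V f ?m ?m) / 4"
    unfolding rf_diag[OF fp f(1)] rf_diag[OF fm f(1)] by (simp add: rf_def)
  have n: "ip ?p ?p + ip ?m ?m = 4"
  proof -
    have "ip ?p ?p = ip (dr x) ?p + ip (dr y) ?p" using ip_lin_left[OF v w, of 1 1 ?p] by simp
    moreover have "ip ?m ?m = ip (dr x) ?m - ip (dr y) ?m" using ip_lin_left[OF v w, of 1 "-1" ?m] by simp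
    ultimately show ?thesis unfolding ip_dr_left by (simp add: dr_def)
  qed
  have "\<bar>rf d V f ?p ?p - rf d V f ?m ?m\<bar> \<le> c * ip ?p ?p + c * ip ?m ?m"
    using b[OF fp] b[OF fm] by linarith
  also have "\<dots> = c * 4" unfolding distrib_left[symmetric] n ..
  finally show ?thesis unfolding pol by simp
qed

end

lemma AE_nonzero: "AE \<eta> in lborel. \<eta> \<noteq> (0::real)"
  using AE_lborel_singleton[of 0] by simp

text \<open>Near 0 the weight is at most |\<eta>|^(-p), integrable for p < 1; at infinity it decays
  like |\<eta>|^(-2p), integrable for p > 1/2.\<close>

lemma weight_integral:
  fixes B p :: real
  assumes p: "1/2 < p" "p < 1" and B: "0 < B"
  shows "\<exists>W>0. (\<integral>\<^sup>+\<eta>. ennreal ((min (1 / \<bar>\<eta>\<bar>) (B / \<eta>\<^sup>2)) powr p) \<partial>lborel) \<le> ennreal W"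
proof -
  define \<phi> where "\<phi> t = (if t \<in> {0..1} then t powr (-p) else 0) + (B powr p) * (if t \<in> {1..} then t powr (-2*p) else 0)" for t :: real
  have m: "\<phi> \<in> borel_measurable borel" unfolding \<phi>_def by measurable
  have \<phi>0: "0 \<le> \<phi> t" for t unfolding \<phi>_def by auto
  obtain I where I: "(\<phi> has_integral I) UNIV"
  proof -
    have "((%t. t powr (-p)) has_integral (1 powr (-p+1) / (-p+1))) {0..1}"
      by (rule has_integral_powr_from_0) (use p in auto)
    moreover have "((%t. t powr (-2*p)) has_integral -(1 powr (-2*p+1)) / (-2*p+1)) {1..}"
      by (rule has_integral_powr_to_inf) (use p in auto)
    ultimately have "(\<phi> has_integral (1 powr (-p+1) / (-p+1) + B powr p * (-(1 powr (-2*p+1)) / (-2*p+1)))) UNIV"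
      unfolding \<phi>_def by (intro has_integral_add has_integral_mult_right has_integral_restrict_UNIV[THEN iffD2])
    then show ?thesis by (rule that)
  qed
  have nn: "(\<integral>\<^sup>+t. ennreal (\<phi> t) \<partial>lborel) = ennreal I" by (rule nn_integral_has_integral_lborel[OF m \<phi>0 I])
  have pt: "ennreal ((min (1 / \<bar>\<eta>\<bar>) (B / \<eta>\<^sup>2)) powr p) \<le> ennreal (\<phi> \<eta>) + ennreal (\<phi> (- \<eta>))" if \<eta>: "\<eta> \<noteq> 0" for \<eta>
  proof -
    have t: "(min (1 / t) (B / t\<^sup>2)) powr p \<le> \<phi> t" if t: "0 < t" for t
    proof (cases "t \<le> 1")
      case True
      have "(min (1 / t) (B / t\<^sup>2)) powr p \<le> (1 / t) powr p" using t B p by (intro powr_mono2) auto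
      also have "\<dots> = t powr (-p)" using t by (simp add: powr_divide powr_minus_divide)
      also have "\<dots> \<le> \<phi> t" unfolding \<phi>_def using True t by simp
      finally show ?thesis .
    next
      case False
      have "(min (1 / t) (B / t\<^sup>2)) powr p \<le> (B / t\<^sup>2) powr p" using t B p by (intro powr_mono2) auto
      also have "\<dots> = B powr p * t powr (-2*p)"
      proof -
        have "(t\<^sup>2) powr p = t powr (2 * p)" using t by (simp add: powr_powr flip: powr_numeral)
        then show ?thesis using t B by (simp add: powr_divide powr_minus_divide)
      qed
      also have "\<dots> \<le> \<phi> t" unfolding \<phi>_def using False t by simp
      finally show ?thesis .
    qed
    have "(min (1 / \<bar>\<eta>\<bar>) (B / \<eta>\<^sup>2)) powr p \<le> \<phi> \<eta> + \<phi> (- \<eta>)"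
    proof (cases "0 < \<eta>")
      case True then show ?thesis using t[OF True] \<phi>0[of "-\<eta>"] by simp
    next
      case False
      then show ?thesis using t[of "-\<eta>"] \<eta> \<phi>0[of \<eta>] by simp
    qed
    then show ?thesis using \<phi>0 by (simp add: ennreal_plus[symmetric] ennreal_leI del: ennreal_plus)
  qed
  have "(\<integral>\<^sup>+\<eta>. ennreal ((min (1 / \<bar>\<eta>\<bar>) (B / \<eta>\<^sup>2)) powr p) \<partial>lborel) \<le> (\<integral>\<^sup>+\<eta>. ennreal (\<phi> \<eta>) + ennreal (\<phi> (- \<eta>)) \<partial>lborel)"
  proof (rule nn_integral_mono_AE)
    show "AE \<eta> in lborel. ennreal ((min (1 / \<bar>\<eta>\<bar>) (B / \<eta>\<^sup>2)) powr p) \<le> ennreal (\<phi> \<eta>) + ennreal (\<phi> (- \<eta>))"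
      using AE_nonzero by eventually_elim (rule pt)
  qed
  also have "\<dots> = (\<integral>\<^sup>+\<eta>. ennreal (\<phi> \<eta>) \<partial>lborel) + (\<integral>\<^sup>+\<eta>. ennreal (\<phi> (- \<eta>)) \<partial>lborel)"
    using m by (intro nn_integral_add) auto
  also have "(\<integral>\<^sup>+\<eta>. ennreal (\<phi> (- \<eta>)) \<partial>lborel) = (\<integral>\<^sup>+\<eta>. ennreal (\<phi> \<eta>) \<partial>lborel)"
    using nn_integral_real_affine[of "%t. ennreal (\<phi> t)" "-1" 0] m by simp
  also have "(\<integral>\<^sup>+\<eta>. ennreal (\<phi> \<eta>) \<partial>lborel) + (\<integral>\<^sup>+\<eta>. ennreal (\<phi> \<eta>) \<partial>lborel) \<le> ennreal (2 * \<bar>I\<bar> + 1)"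
  proof -
    have "ennreal I \<le> ennreal \<bar>I\<bar>" by (rule ennreal_leI) simp
    then have "ennreal I + ennreal I \<le> ennreal \<bar>I\<bar> + ennreal \<bar>I\<bar>" by (intro add_mono)
    also have "\<dots> = ennreal (2 * \<bar>I\<bar>)" by (simp add: ennreal_plus[symmetric] del: ennreal_plus)
    also have "\<dots> \<le> ennreal (2 * \<bar>I\<bar> + 1)" by (rule ennreal_leI) simp
    finally show ?thesis unfolding nn .
  qed
  finally show ?thesis by (intro exI[of _ "2 * \<bar>I\<bar> + 1"]) auto
qed

section \<open>Fractional moments, absence of atoms and decay of the projection\<close>

locale anderson_loc = anderson +
  fixes a b s K l :: real
  assumes s: "0 < s" "s < 1" and l: "0 < l" and loc: "loc_estimate d \<rho> a b s K l"
begin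

lemma good_pred: "Measurable.pred \<Omega> good"
proof -
  have "Measurable.pred \<Omega> (%V. \<bar>V x\<bar> \<le> Rad)" if "x \<in> X" for x using comp_meas[OF that] by measurable
  then have "(\<Inter>x\<in>X. {V \<in> space \<Omega>. \<bar>V x\<bar> \<le> Rad}) \<in> sets \<Omega>"
    unfolding pred_def using zero_Zd by (intro sets.countable_INT' countable_Zd) auto
  moreover have "(\<Inter>x\<in>X. {V \<in> space \<Omega>. \<bar>V x\<bar> \<le> Rad}) = {V \<in> space \<Omega>. good V}"
    using zero_Zd by (auto simp: good_def)
  ultimately show ?thesis by (simp add: pred_def)
qed

lemma Gc_meas: "0 < \<eta> ==> x \<in> X ==> y \<in> X ==> (%V. cmod (Gc d V E \<eta> x y)) \<in> borel_measurable \<Omega>"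
proof -
  assume h: "0 < \<eta>" "x \<in> X" "y \<in> X"
  note [measurable] = rfx_meas[OF bbm_gr[OF h(1)] h(2,3), of E] rfx_meas[OF bbm_gi[OF h(1)] h(2,3), of E]
  show ?thesis unfolding Gc_def cmod_def by simp
qed

lemma fractional:
  assumes E: "E \<in> {a<..<b}" and \<eta>: "0 < \<eta>" and x: "x \<in> X" and y: "y \<in> X"
  shows "(\<integral>\<^sup>+V. ennreal (cmod (Gc d V E \<eta> x y) powr s) \<partial>\<Omega>) \<le> ennreal (max K 0 * exp (- zdist d x y / l))"
proof -
  have "(\<integral>\<^sup>+V. ennreal (cmod (Gc d V E \<eta> x y) powr s) \<partial>\<Omega>) = (\<integral>\<^sup>+V. ennreal (cmod (green d V (Complex E \<eta>) x y) powr s) \<partial>\<Omega>)"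
    by (rule nn_integral_cong_AE)
      (use AE_good in \<open>eventually_elim, simp add: bounded_potential.green_eq[OF good_bp \<eta> x y]\<close>)
  also have "\<dots> \<le> ennreal (K * exp (- zdist d x y / l))"
    using loc E \<eta> x y unfolding loc_estimate_def by auto
  also have "\<dots> \<le> ennreal (max K 0 * exp (- zdist d x y / l))" by (intro ennreal_leI mult_right_mono) auto
  finally show ?thesis .
qed

text \<open>Pointwise g^(s/2) \<le> (L/2) g^s + 1/(2L) for every L > 0; with L = exp(|x-y|/(2l)) the
  means of both terms decay at rate 1/(2l). The halved exponent makes \<open>weight_integral\<close>
  applicable in \<open>PF_decay\<close>.\<close>

lemma half_fractional:
  assumes E: "E \<in> {a<..<b}" and \<eta>: "0 < \<eta>" and x: "x \<in> X" and y: "y \<in> X"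
  shows "(\<integral>\<^sup>+V. ennreal (cmod (Gc d V E \<eta> x y) powr (s/2)) \<partial>\<Omega>) \<le> ennreal ((max K 0 + 1) / 2 * exp (- zdist d x y / (2 * l)))"
proof -
  define L where "L = exp (zdist d x y / (2 * l))"
  have L: "0 < L" by (simp add: L_def)
  note [measurable] = Gc_meas[OF \<eta> x y, of E]
  have pt: "ennreal (g powr (s/2)) \<le> ennreal (L/2) * ennreal (g powr s) + ennreal (1 / (2 * L))" if g: "0 \<le> g" for g
  proof -
    have sq: "g powr s = (g powr (s/2))\<^sup>2" using g by (simp add: power2_eq_square powr_add[symmetric])
    have "0 \<le> (L * g powr (s/2) - 1)\<^sup>2 / (2 * L)" using L by simp
    also have "\<dots> = L/2 * (g powr (s/2))\<^sup>2 + 1 / (2 * L) - g powr (s/2)" using L by (simp add: power2_eq_square field_simps)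
    finally have "g powr (s/2) \<le> L/2 * g powr s + 1 / (2 * L)" unfolding sq by simp
    then have "ennreal (g powr (s/2)) \<le> ennreal (L/2 * g powr s + 1 / (2 * L))" by (rule ennreal_leI)
    also have "\<dots> = ennreal (L/2 * g powr s) + ennreal (1 / (2 * L))" using L by (intro ennreal_plus) auto
    also have "ennreal (L/2 * g powr s) = ennreal (L/2) * ennreal (g powr s)" using L by (intro ennreal_mult) auto
    finally show ?thesis .
  qed
  have "(\<integral>\<^sup>+V. ennreal (cmod (Gc d V E \<eta> x y) powr (s/2)) \<partial>\<Omega>) \<le>
     (\<integral>\<^sup>+V. ennreal (L/2) * ennreal (cmod (Gc d V E \<eta> x y) powr s) + ennreal (1 / (2 * L)) \<partial>\<Omega>)"
    by (intro nn_integral_mono pt) simp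
  also have "\<dots> = ennreal (L/2) * (\<integral>\<^sup>+V. ennreal (cmod (Gc d V E \<eta> x y) powr s) \<partial>\<Omega>) + ennreal (1 / (2 * L))"
    by (subst nn_integral_add) (auto simp: nn_integral_cmult P.emeasure_space_1)
  also have "\<dots> \<le> ennreal (L/2) * ennreal (max K 0 * exp (- zdist d x y / l)) + ennreal (1 / (2 * L))"
    by (intro add_mono mult_left_mono fractional E \<eta> x y order_refl) auto
  also have "\<dots> = ennreal (L/2 * (max K 0 * exp (- zdist d x y / l)) + 1 / (2 * L))"
    using L by (subst ennreal_mult[symmetric]) (auto simp: ennreal_plus[symmetric] simp del: ennreal_plus)
  also have "L/2 * (max K 0 * exp (- zdist d x y / l)) + 1 / (2 * L) = (max K 0 + 1) / 2 * exp (- zdist d x y / (2 * l))"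
  proof -
    have e1: "L * exp (- zdist d x y / l) = exp (- zdist d x y / (2 * l))"
      unfolding L_def exp_add[symmetric] using l by (simp add: field_simps)
    have e2: "1 / L = exp (- zdist d x y / (2 * l))" unfolding L_def by (simp add: exp_minus inverse_eq_divide)
    have "L/2 * (max K 0 * exp (- zdist d x y / l)) + 1 / (2 * L) = max K 0 / 2 * (L * exp (- zdist d x y / l)) + (1/2) * (1 / L)"
      by simp
    then show ?thesis unfolding e1 e2 by (simp add: algebra_simps add_divide_distrib)
  qed
  finally show ?thesis .
qed

text \<open>The indicator of {E} is at most \<eta> times the Lorentzian, so q = \<eta> Im G(x,x)
  dominates the weight of the atom. As 0 < q \<le> 1, also q \<le> q^s, whose mean is at most
  \<eta>^s times the fractional moment bound and tends to 0 with \<eta>.\<close>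

lemma no_atom:
  assumes E: "E \<in> {a<..<b}" and x: "x \<in> X"
  shows "AE V in \<Omega>. rf d V (indicator {E}) (dr x) (dr x) = 0"
proof -
  have bf: "bbm (indicator {E} :: real => real)" by (rule bbm_indicator) simp
  note [measurable] = rfx_meas[OF bf x x]
  let ?I = "\<integral>\<^sup>+V. ennreal (rf d V (indicator {E}) (dr x) (dr x)) \<partial>\<Omega>"
  have b: "?I \<le> ennreal (\<eta> powr s * max K 0)" if \<eta>: "0 < \<eta>" for \<eta>
  proof -
    note [measurable] = Gc_meas[OF \<eta> x x, of E]
    have "?I \<le> (\<integral>\<^sup>+V. ennreal (\<eta> powr s) * ennreal (cmod (Gc d V E \<eta> x x) powr s) \<partial>\<Omega>)"
    proof (rule nn_integral_mono_AE)
      show "AE V in \<Omega>. ennreal (rf d V (indicator {E}) (dr x) (dr x)) \<le> ennreal (\<eta> powr s) * ennreal (cmod (Gc d V E \<eta> x x) powr s)"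
        using AE_good
      proof eventually_elim
        case (elim V)
        interpret bounded_potential d V Rad by (rule good_bp) fact
        have le: "indicator {E} t \<le> \<eta> * gi E \<eta> t" for t
          using \<eta> gi_pos[OF \<eta>, of E t] by (auto simp: indicator_def gi_def power2_eq_square)
        have 1: "rf d V (indicator {E}) (dr x) (dr x) \<le> \<eta> * gI d V E \<eta> x x"
          using rf_mono[OF fs_dr[OF x] bf bbm_scale[OF bbm_gi[OF \<eta>]] le] rf_cmult[OF fs_dr[OF x] fs_dr[OF x] bbm_gi[OF \<eta>]]
          by (simp add: gI_def)
        have 2: "\<bar>gI d V E \<eta> x x\<bar> \<le> 1 / \<eta>"
          unfolding gI_def by (rule rf_abs_le[OF bbm_gi[OF \<eta>] _ x x]) (use gi_pos[OF \<eta>, of E] gi_le[OF \<eta>, of E] in \<open>auto simp: abs_of_pos\<close>)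
        have g0: "0 < gI d V E \<eta> x x" by (rule gI_pos[OF \<eta> x])
        let ?q = "\<eta> * gI d V E \<eta> x x"
        have q: "0 < ?q" "?q \<le> 1" using g0 2 \<eta> by (auto simp: field_simps)
        have "?q powr 1 \<le> ?q powr s" using q s by (intro powr_mono') auto
        also have "\<dots> = \<eta> powr s * gI d V E \<eta> x x powr s" using \<eta> g0 by (simp add: powr_mult)
        also have "\<dots> \<le> \<eta> powr s * cmod (Gc d V E \<eta> x x) powr s"
          using g0 s abs_Im_le_cmod[of "Gc d V E \<eta> x x"] by (intro mult_left_mono powr_mono2) (auto simp: Im_Gc)
        finally show ?case using 1 q by (simp add: ennreal_mult[symmetric] ennreal_leI)
      qed
    qed
    also have "\<dots> = ennreal (\<eta> powr s) * (\<integral>\<^sup>+V. ennreal (cmod (Gc d V E \<eta> x x) powr s) \<partial>\<Omega>)"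
      by (subst nn_integral_cmult) auto
    also have "\<dots> \<le> ennreal (\<eta> powr s) * ennreal (max K 0 * exp (- zdist d x x / l))"
      by (intro mult_left_mono fractional E \<eta> x) auto
    also have "\<dots> = ennreal (\<eta> powr s * max K 0)"
    proof -
      have z: "zdist d x x = 0" by (simp add: zdist_def)
      show ?thesis by (subst ennreal_mult[symmetric]) (auto simp: z)
    qed
    finally show ?thesis .
  qed
  have "?I \<le> ennreal 0"
  proof (rule tendsto_lowerbound[where F="at_right 0" and f="%\<eta>. ennreal (\<eta> powr s * max K 0)"])
    have "((%\<eta>. \<eta> powr s) \<longlongrightarrow> 0) (at_right 0)"
      using tendsto_zero_powrI[of "%x. x" "at_right 0" "%_. s" s] s
      by (auto simp: tendsto_ident_at eventually_at_right_less[THEN eventually_mono])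
    then have "((%\<eta>. \<eta> powr s * max K 0) \<longlongrightarrow> 0 * max K 0) (at_right 0)" by (intro tendsto_mult_right)
    then show "((%\<eta>. ennreal (\<eta> powr s * max K 0)) \<longlongrightarrow> ennreal 0) (at_right 0)" by (intro tendsto_ennrealI) simp
    show "eventually (%\<eta>. ?I \<le> ennreal (\<eta> powr s * max K 0)) (at_right 0)"
      using eventually_at_right_less[of 0] by eventually_elim (rule b)
  qed simp
  then have "?I = 0" by simp
  then have "AE V in \<Omega>. ennreal (rf d V (indicator {E}) (dr x) (dr x)) = 0"
    by (subst (asm) nn_integral_0_iff_AE) auto
  with AE_good show ?thesis
  proof eventually_elim
    case (elim V)
    interpret bounded_potential d V Rad by (rule good_bp) fact
    have "0 \<le> rf d V (indicator {E}) (dr x) (dr x)" by (rule rf_pos[OF fs_dr[OF x] bf]) simp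
    with elim(2) show ?case by (simp add: ennreal_eq_0_iff)
  qed
qed

definition PF :: "real => (site => real) => site => site => real" where
  "PF E V x y = rf d V (indicator {..E}) (dr x) (dr y)"

lemma fermiP_PF: "fermiP d V E x y = complex_of_real (PF E V x y)"
proof -
  have "(%t. if t \<le> E then 1 else 0) = (%t. complex_of_real (indicator {..E} t))" by (auto simp: indicator_def)
  then show ?thesis unfolding fermiP_def PF_def using fmat_real[of d V "indicator {..E}" x y] by simp
qed

lemma bbm_atMost: "bbm (indicator {..E} :: real => real)" by (rule bbm_indicator) simp

lemma PF_meas: "x \<in> X ==> y \<in> X ==> (%V. PF E V x y) \<in> borel_measurable \<Omega>"
  unfolding PF_def by (rule rfx_meas[OF bbm_atMost])

lemma PF_le: "good V ==> x \<in> X ==> y \<in> X ==> \<bar>PF E V x y\<bar> \<le> 1"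
  unfolding PF_def
  by (rule bounded_potential.rf_abs_le[OF good_bp bbm_atMost]) (auto simp: indicator_def)

text \<open>The indicator of (-\<infinity>,E] is (1 - sgn (t - E))/2 plus half the indicator of {E}.
  Off the diagonal the constant drops out and the atom is almost surely absent, which leaves the
  sign; the factor 1/(2\<pi>) of the exact formula is given away.\<close>

lemma PF_bound:
  assumes E: "E \<in> {a<..<b}" and x: "x \<in> X" and y: "y \<in> X" and xy: "x \<noteq> y"
  shows "AE V in \<Omega>. ennreal \<bar>PF E V x y\<bar> \<le> (\<integral>\<^sup>+\<eta>. ennreal \<bar>rf d V (gr E \<eta>) (dr x) (dr y)\<bar> \<partial>lborel)"
  using AE_good no_atom[OF E x]
proof eventually_elim
  case (elim V)
  interpret bounded_potential d V Rad by (rule good_bp) fact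
  note v = fs_dr[OF x] and w = fs_dr[OF y]
  have bf: "bbm (indicator {E} :: real => real)" by (rule bbm_indicator) simp
  let ?s = "rf d V (%t. sgn (t - E)) (dr x) (dr y)"
  have "(rf d V (indicator {E}) (dr x) (dr y))\<^sup>2 \<le> 0"
    using rf_CS[OF v w bf] elim(2) by simp
  then have at: "rf d V (indicator {E}) (dr x) (dr y) = 0" by simp
  have e: "indicator {..E} t = (1/2) * ((1 - sgn (t - E)) + indicator {E} t)" for t :: real
    by (auto simp: indicator_def sgn_if)
  have "PF E V x y = rf d V (%t. (1/2) * ((1 - sgn (t - E)) + indicator {E} t)) (dr x) (dr y)"
    unfolding PF_def e[symmetric] by simp
  also have "\<dots> = (1/2) * ((rf d V (%_. 1) (dr x) (dr y) - ?s) + rf d V (indicator {E}) (dr x) (dr y))"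
    unfolding rf_cmult[OF v w bbm_add[OF bbm_diff[OF bbm_const[of 1] bbm_sgn[of E]] bf]]
      rf_plus[OF v w bbm_diff[OF bbm_const[of 1] bbm_sgn[of E]] bf] rf_minus[OF v w bbm_const[of 1] bbm_sgn[of E]] ..
  also have "\<dots> = - ?s / 2" using at rf_one[OF v w] xy by (simp add: ip_dr_dr)
  finally have P: "\<bar>PF E V x y\<bar> = \<bar>?s\<bar> / 2" by simp
  have "ennreal (norm (\<integral>\<eta>. rf d V (gr E \<eta>) (dr x) (dr y) \<partial>lborel)) \<le> (\<integral>\<^sup>+\<eta>. ennreal (norm (rf d V (gr E \<eta>) (dr x) (dr y))) \<partial>lborel)"
    by (rule integral_norm_bound_ennreal[OF rf_sgn(1)[OF v w]])
  then have "ennreal (pi * \<bar>?s\<bar>) \<le> (\<integral>\<^sup>+\<eta>. ennreal \<bar>rf d V (gr E \<eta>) (dr x) (dr y)\<bar> \<partial>lborel)"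
    unfolding rf_sgn(2)[OF v w] by (simp add: abs_mult)
  moreover have "ennreal \<bar>PF E V x y\<bar> \<le> ennreal (pi * \<bar>?s\<bar>)"
  proof (rule ennreal_leI)
    have "1/2 * \<bar>?s\<bar> \<le> pi * \<bar>?s\<bar>" by (rule mult_right_mono) (use pi_gt3 in auto)
    then show "\<bar>PF E V x y\<bar> \<le> pi * \<bar>?s\<bar>" unfolding P by simp
  qed
  ultimately show ?case by (rule order_trans[rotated])
qed

text \<open>Joint measurability is required for exchanging the expectation with the integral over
  \<eta>. The modulus of \<eta> is approximated by grid points, which reduces the claim to countably
  many functions of V; off the event \<open>good\<close> the value 0 makes the limit hold
  everywhere.\<close>

lemma gr_joint_meas:
  assumes x: "x \<in> X" and y: "y \<in> X"
  shows "(%(V, \<eta>). if good V \<and> \<eta> \<noteq> 0 then \<bar>rf d V (gr E \<eta>) (dr x) (dr y)\<bar> else 0) \<in> borel_measurable (\<Omega> \<Otimes>\<^sub>M lborel)"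
proof -
  \<comment> \<open>The smallest multiple of 1/(n+1) strictly above |\<eta>|: it is positive, and
    1/|\<eta>| bounds the functions along the whole sequence.\<close>
  define q where "q n \<eta> = real_of_int (\<lfloor>real (Suc n) * \<bar>\<eta>\<bar>\<rfloor> + 1) / real (Suc n)" for n and \<eta> :: real
  note [measurable] = good_pred
  have qm: "(%p. if good (fst p) \<and> snd p \<noteq> 0 then \<bar>rf d (fst p) (gr E (q n (snd p))) (dr x) (dr y)\<bar> else 0) \<in> borel_measurable (\<Omega> \<Otimes>\<^sub>M lborel)" for n
  proof -
    have "(%p. rf d (fst p) (gr E (real_of_int ((\<lfloor>real (Suc n) * \<bar>snd p\<bar>\<rfloor> + 1)) / real (Suc n))) (dr x) (dr y)) \<in> borel_measurable (\<Omega> \<Otimes>\<^sub>M lborel)"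
    proof (rule measurable_compose_countable'[where I="{1..}" and g="%p. \<lfloor>real (Suc n) * \<bar>snd p\<bar>\<rfloor> + 1"
          and f="%i p. rf d (fst p) (gr E (real_of_int i / real (Suc n))) (dr x) (dr y)"])
      fix i :: int assume "i \<in> {1..}"
      then have "0 < real_of_int i / real (Suc n)" by simp
      from measurable_compose[OF measurable_fst rfx_meas[OF bbm_gr[OF this] x y]]
      show "(%p. rf d (fst p) (gr E (real_of_int i / real (Suc n))) (dr x) (dr y)) \<in> borel_measurable (\<Omega> \<Otimes>\<^sub>M lborel)" .
    next
      have "(%p. \<lfloor>real (Suc n) * \<bar>snd p\<bar>\<rfloor> + 1) \<in> measurable (\<Omega> \<Otimes>\<^sub>M lborel) (count_space UNIV)" by measurable
      then show "(%p. \<lfloor>real (Suc n) * \<bar>snd p\<bar>\<rfloor> + 1) \<in> measurable (\<Omega> \<Otimes>\<^sub>M lborel) (count_space {1..})"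
        by (rule measurable_count_space_extend[rotated 2]) auto
    qed auto
    then have [measurable]: "(%p. rf d (fst p) (gr E (q n (snd p))) (dr x) (dr y)) \<in> borel_measurable (\<Omega> \<Otimes>\<^sub>M lborel)"
      unfolding q_def .
    show ?thesis by measurable
  qed
  have lim: "(%n. if good (fst p) \<and> snd p \<noteq> 0 then \<bar>rf d (fst p) (gr E (q n (snd p))) (dr x) (dr y)\<bar> else 0)
     \<longlonglongrightarrow> (if good (fst p) \<and> snd p \<noteq> 0 then \<bar>rf d (fst p) (gr E (snd p)) (dr x) (dr y)\<bar> else 0)" for p
  proof (cases "good (fst p) \<and> snd p \<noteq> 0")
    case True
    define V \<eta> where "V = fst p" and "\<eta> = snd p"
    interpret bounded_potential d V Rad by (rule good_bp) (use True V_def in simp)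
    have \<eta>: "0 < \<bar>\<eta>\<bar>" using True \<eta>_def by simp
    have q1: "\<bar>\<eta>\<bar> < q n \<eta>" "q n \<eta> \<le> \<bar>\<eta>\<bar> + 1 / real (Suc n)" for n
    proof -
      have "real (Suc n) * \<bar>\<eta>\<bar> < real_of_int (\<lfloor>real (Suc n) * \<bar>\<eta>\<bar>\<rfloor> + 1)" by linarith
      then show "\<bar>\<eta>\<bar> < q n \<eta>" unfolding q_def by (subst pos_less_divide_eq) (auto simp: mult.commute)
      have "real_of_int (\<lfloor>real (Suc n) * \<bar>\<eta>\<bar>\<rfloor> + 1) \<le> real (Suc n) * \<bar>\<eta>\<bar> + 1" by linarith
      then have "q n \<eta> \<le> (real (Suc n) * \<bar>\<eta>\<bar> + 1) / real (Suc n)" unfolding q_def by (intro divide_right_mono) auto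
      also have "\<dots> = \<bar>\<eta>\<bar> + 1 / real (Suc n)" by (simp add: add_divide_distrib)
      finally show "q n \<eta> \<le> \<bar>\<eta>\<bar> + 1 / real (Suc n)" .
    qed
    have ql: "(%n. q n \<eta>) \<longlonglongrightarrow> \<bar>\<eta>\<bar>"
    proof (rule tendsto_sandwich[where f="%_. \<bar>\<eta>\<bar>" and h="%n. \<bar>\<eta>\<bar> + 1 / real (Suc n)"])
      show "(%n. \<bar>\<eta>\<bar> + 1 / real (Suc n)) \<longlonglongrightarrow> \<bar>\<eta>\<bar>"
        using tendsto_add[OF tendsto_const LIMSEQ_Suc[OF lim_1_over_n], of "\<bar>\<eta>\<bar>"] by simp
      show "eventually (%n. \<bar>\<eta>\<bar> \<le> q n \<eta>) sequentially" using q1(1) by (intro always_eventually allI less_imp_le)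
      show "eventually (%n. q n \<eta> \<le> \<bar>\<eta>\<bar> + 1 / real (Suc n)) sequentially" using q1(2) by (intro always_eventually allI)
    qed simp
    have "(%n. rf d V (gr E (q n \<eta>)) (dr x) (dr y)) \<longlonglongrightarrow> rf d V (gr E \<bar>\<eta>\<bar>) (dr x) (dr y)"
    proof (rule admD(3)[OF adm_rf[OF fs_dr[OF x] fs_dr[OF y]], where B="1 / \<bar>\<eta>\<bar>"])
      have qp: "0 < q n \<eta>" for n using q1(1)[of n] \<eta> by linarith
      show "bbm (gr E (q n \<eta>))" for n by (rule bbm_gr[OF qp])
      show "\<bar>gr E (q n \<eta>) t\<bar> \<le> 1 / \<bar>\<eta>\<bar>" for n t
      proof -
        have "1 / q n \<eta> \<le> 1 / \<bar>\<eta>\<bar>" using q1(1)[of n] \<eta> by (intro divide_left_mono) (auto intro: mult_pos_pos qp)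
        then show ?thesis using gr_abs_le[OF qp[of n], of E t] by linarith
      qed
      show "(%n. gr E (q n \<eta>) t) \<longlonglongrightarrow> gr E \<bar>\<eta>\<bar> t" for t
        unfolding gr_def using den_pos[OF \<eta>, of t E] by (intro tendsto_intros ql) auto
    qed
    moreover have "gr E \<bar>\<eta>\<bar> = gr E \<eta>" by (simp add: gr_def fun_eq_iff)
    ultimately have "(%n. \<bar>rf d V (gr E (q n \<eta>)) (dr x) (dr y)\<bar>) \<longlonglongrightarrow> \<bar>rf d V (gr E \<eta>) (dr x) (dr y)\<bar>"
      by (intro tendsto_rabs) simp
    then show ?thesis using True by (simp add: V_def \<eta>_def)
  qed auto
  have "(%p. if good (fst p) \<and> snd p \<noteq> 0 then \<bar>rf d (fst p) (gr E (snd p)) (dr x) (dr y)\<bar> else 0) \<in> borel_measurable (\<Omega> \<Otimes>\<^sub>M lborel)"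
    by (rule borel_measurable_LIMSEQ_real[OF lim qm])
  then show ?thesis by (simp add: split_def)
qed

text \<open>In |Re G| = |Re G|^(1-s/2) |Re G|^(s/2) the first factor has a deterministic bound,
  integrable in \<eta> since 1 - s/2 > 1/2, and the mean of the second decays. The constant is
  uniform in E because the energies E_F + \<nu> and E_F - \<nu> occur later; being at least 1 it
  also covers the diagonal.\<close>

theorem PF_decay:
  "\<exists>K1\<ge>1. \<forall>E\<in>{a<..<b}. \<forall>x\<in>X. \<forall>y\<in>X.
     EN (%V. PF E V x y) \<le> ennreal (K1 * exp (- zdist d x y / (2 * l)))"
proof -
  \<comment> \<open>Bounds |t - E| for t in [-C,C] and E in (a,b), which improves the decay of Re G
    in \<eta> from 1/|\<eta>| to B/\<eta>^2.\<close>
  define B where "B = bounded_potential.C d Rad + \<bar>a\<bar> + \<bar>b\<bar>"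
  have good0: "good (%_. 0)" using Rad(1) by (simp add: good_def)
  interpret b0: bounded_potential d "%_. 0" Rad by (rule good_bp[OF good0])
  have B: "0 < B" unfolding B_def using b0.C_pos by linarith
  obtain W where W: "0 < W" "(\<integral>\<^sup>+\<eta>. ennreal ((min (1 / \<bar>\<eta>\<bar>) (B / \<eta>\<^sup>2)) powr (1 - s/2)) \<partial>lborel) \<le> ennreal W"
    using weight_integral[of "1 - s/2" B] s B by auto
  define K1 where "K1 = max 1 (W * ((max K 0 + 1) / 2))"
  have "EN (%V. PF E V x y) \<le> ennreal (K1 * exp (- zdist d x y / (2 * l)))"
    if E: "E \<in> {a<..<b}" and x: "x \<in> X" and y: "y \<in> X" for E x y
  proof (cases "x = y")
    case True
    have "EN (%V. PF E V x y) \<le> (\<integral>\<^sup>+V. 1 \<partial>\<Omega>)"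
      by (rule nn_integral_mono_AE) (use AE_good PF_le[OF _ x y] in \<open>auto elim!: eventually_mono\<close>)
    also have "\<dots> = ennreal 1" by (simp add: P.emeasure_space_1)
    also have "\<dots> \<le> ennreal (K1 * exp (- zdist d x y / (2 * l)))"
      using True by (intro ennreal_leI) (simp add: zdist_def K1_def)
    finally show ?thesis .
  next
    case False
    let ?e = "exp (- zdist d x y / (2 * l))"
    let ?w = "%\<eta>. (min (1 / \<bar>\<eta>\<bar>) (B / \<eta>\<^sup>2)) powr (1 - s/2)"
    let ?H = "%V \<eta>. if good V \<and> \<eta> \<noteq> 0 then \<bar>rf d V (gr E \<eta>) (dr x) (dr y)\<bar> else 0"
    interpret pair_sigma_finite \<Omega> lborel ..
    have Hm: "(%(V, \<eta>). ennreal (?H V \<eta>)) \<in> borel_measurable (\<Omega> \<Otimes>\<^sub>M lborel)"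
      using measurable_compose[OF gr_joint_meas[OF x y, of E] measurable_ennreal] by (simp add: split_def)
    have "EN (%V. PF E V x y) \<le> (\<integral>\<^sup>+V. (\<integral>\<^sup>+\<eta>. ennreal (?H V \<eta>) \<partial>lborel) \<partial>\<Omega>)"
    proof (rule nn_integral_mono_AE)
      show "AE V in \<Omega>. ennreal \<bar>PF E V x y\<bar> \<le> (\<integral>\<^sup>+\<eta>. ennreal (?H V \<eta>) \<partial>lborel)"
        using PF_bound[OF E x y False] AE_good
      proof eventually_elim
        case (elim V)
        have "(\<integral>\<^sup>+\<eta>. ennreal \<bar>rf d V (gr E \<eta>) (dr x) (dr y)\<bar> \<partial>lborel) = (\<integral>\<^sup>+\<eta>. ennreal (?H V \<eta>) \<partial>lborel)"
        proof (rule nn_integral_cong_AE)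
          show "AE \<eta> in lborel. ennreal \<bar>rf d V (gr E \<eta>) (dr x) (dr y)\<bar> = ennreal (?H V \<eta>)"
            using AE_nonzero by eventually_elim (simp add: elim(2))
        qed
        then show ?case using elim(1) by simp
      qed
    qed
    also have "\<dots> = (\<integral>\<^sup>+\<eta>. (\<integral>\<^sup>+V. ennreal (?H V \<eta>) \<partial>\<Omega>) \<partial>lborel)"
      using Fubini[OF Hm] by simp
    also have "\<dots> \<le> (\<integral>\<^sup>+\<eta>. ennreal (?w \<eta>) * ennreal ((max K 0 + 1) / 2 * ?e) \<partial>lborel)"
    proof (rule nn_integral_mono_AE)
      show "AE \<eta> in lborel. (\<integral>\<^sup>+V. ennreal (?H V \<eta>) \<partial>\<Omega>) \<le> ennreal (?w \<eta>) * ennreal ((max K 0 + 1) / 2 * ?e)"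
        using AE_nonzero
      proof eventually_elim
        case (elim \<eta>)
        then have \<eta>: "0 < \<bar>\<eta>\<bar>" by simp
        have ge: "gr E \<bar>\<eta>\<bar> = gr E \<eta>" by (simp add: gr_def fun_eq_iff)
        note [measurable] = Gc_meas[OF \<eta> x y, of E]
        have "(\<integral>\<^sup>+V. ennreal (?H V \<eta>) \<partial>\<Omega>) \<le> (\<integral>\<^sup>+V. ennreal (?w \<eta>) * ennreal (cmod (Gc d V E \<bar>\<eta>\<bar> x y) powr (s/2)) \<partial>\<Omega>)"
        proof (rule nn_integral_mono_AE)
          show "AE V in \<Omega>. ennreal (?H V \<eta>) \<le> ennreal (?w \<eta>) * ennreal (cmod (Gc d V E \<bar>\<eta>\<bar> x y) powr (s/2))"
            using AE_good
          proof eventually_elim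
            case (elim V)
            interpret bounded_potential d V Rad by (rule good_bp) fact
            let ?g = "\<bar>rf d V (gr E \<eta>) (dr x) (dr y)\<bar>"
            have g1: "?g \<le> 1 / \<bar>\<eta>\<bar>"
              unfolding ge[symmetric] by (rule rf_abs_le[OF bbm_gr[OF \<eta>] gr_abs_le[OF \<eta>] x y])
            have g2: "?g \<le> B / \<eta>\<^sup>2"
              unfolding ge[symmetric]
            proof (rule rf_abs_le[OF bbm_gr[OF \<eta>] _ x y])
              fix t assume t: "t \<in> {-C..C}"
              have "\<bar>t - E\<bar> \<le> B" unfolding B_def using t E by auto
              then have "\<bar>t - E\<bar> / ((t - E)\<^sup>2 + \<bar>\<eta>\<bar>\<^sup>2) \<le> B / \<eta>\<^sup>2"
                using \<eta> B by (intro frac_le) auto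
              then show "\<bar>gr E \<bar>\<eta>\<bar> t\<bar> \<le> B / \<eta>\<^sup>2" by (simp add: gr_def abs_divide)
            qed
            have g3: "?g \<le> cmod (Gc d V E \<bar>\<eta>\<bar> x y)"
              using abs_Re_le_cmod[of "Gc d V E \<bar>\<eta>\<bar> x y"] unfolding ge[symmetric] by (simp add: Gc_def)
            have "?g = ?g powr (1 - s/2) * ?g powr (s/2)" by (simp add: powr_add[symmetric])
            also have "\<dots> \<le> ?w \<eta> * cmod (Gc d V E \<bar>\<eta>\<bar> x y) powr (s/2)"
              using g1 g2 g3 s by (intro mult_mono powr_mono2) auto
            finally show ?case using elim by (simp add: ennreal_mult[symmetric] ennreal_leI)
          qed
        qed
        also have "\<dots> = ennreal (?w \<eta>) * (\<integral>\<^sup>+V. ennreal (cmod (Gc d V E \<bar>\<eta>\<bar> x y) powr (s/2)) \<partial>\<Omega>)"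
          by (subst nn_integral_cmult) auto
        also have "\<dots> \<le> ennreal (?w \<eta>) * ennreal ((max K 0 + 1) / 2 * ?e)"
          by (intro mult_left_mono half_fractional[OF E \<eta> x y]) auto
        finally show ?case .
      qed
    qed
    also have "\<dots> = (\<integral>\<^sup>+\<eta>. ennreal (?w \<eta>) \<partial>lborel) * ennreal ((max K 0 + 1) / 2 * ?e)"
      by (subst nn_integral_multc) auto
    also have "\<dots> \<le> ennreal W * ennreal ((max K 0 + 1) / 2 * ?e)" by (intro mult_right_mono W) auto
    also have "\<dots> = ennreal (W * ((max K 0 + 1) / 2) * ?e)" using W(1) by (simp add: ennreal_mult[symmetric] mult.assoc)
    also have "\<dots> \<le> ennreal (K1 * ?e)" unfolding K1_def by (intro ennreal_leI mult_right_mono) auto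
    finally show ?thesis .
  qed
  then show ?thesis unfolding K1_def by (intro exI[of _ "max 1 (W * ((max K 0 + 1) / 2))"]) auto
qed

end

section \<open>Lattice sums\<close>

lemma zdist_L2: "zdist d x y = L2_set (%i. real_of_int (x i - y i)) {..<d}"
  by (simp add: zdist_def L2_set_def)

lemma zdist_nonneg: "0 \<le> zdist d x y" by (simp add: zdist_def sum_nonneg)

lemma zdist_commute: "zdist d x y = zdist d y x"
  unfolding zdist_def by (intro arg_cong[where f=sqrt] sum.cong refl) (simp add: power2_commute)

lemma zdist_coord: "i < d ==> \<bar>real_of_int (x i - y i)\<bar> \<le> zdist d x y"
  unfolding zdist_L2 using member_le_L2_set[of "{..<d}" i "%i. \<bar>real_of_int (x i - y i)\<bar>"]
  by (simp add: L2_set_def)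

lemma zdist_triangle: "zdist d x z \<le> zdist d x y + zdist d y z"
proof -
  have "zdist d x z = L2_set (%i. real_of_int (x i - y i) + real_of_int (y i - z i)) {..<d}"
    unfolding zdist_L2 by (intro L2_set_cong) auto
  also have "\<dots> \<le> zdist d x y + zdist d y z" unfolding zdist_L2 by (rule L2_set_triangle_ineq)
  finally show ?thesis .
qed

lemma zdist_sh: "zdist d (sh a x) (sh a y) = zdist d x y" by (simp add: zdist_def sh_def)

lemma zdist_self: "zdist d x x = 0" by (simp add: zdist_def)

lemma zdist_nbr: "y \<in> nbrs d x ==> zdist d x y \<le> 1"
proof -
  have gen: "zdist d x (x(i := x i + c)) \<le> 1" if "i < d" "\<bar>c\<bar> = 1" for i c
  proof -
    have "(\<Sum>j<d. (real_of_int (x j - (x(i := x i + c)) j))\<^sup>2) = (\<Sum>j<d. if j = i then 1 else 0)"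
      using that(2) by (intro sum.cong refl) (auto simp: power2_eq_square abs_if split: if_splits)
    then show ?thesis using that(1) by (simp add: zdist_def)
  qed
  assume "y \<in> nbrs d x"
  then show ?thesis unfolding nbrs_def using gen[of _ 1] gen[of _ "-1"] by auto
qed

lemma finite_box: "finite (box d n)" and card_box: "card (box d n) \<le> (2 * n + 1) ^ d"
proof -
  let ?A = "PiE {..<d} (%_. {- int n..int n})"
  have img: "box d n \<subseteq> (%f i. if i < d then f i else 0) ` ?A"
  proof
    fix x assume x: "x \<in> box d n"
    have "x = (%i. if i < d then (restrict x {..<d}) i else 0)" using x by (auto simp: box_def)
    moreover have "restrict x {..<d} \<in> ?A" using x by (auto simp: box_def abs_le_iff)
    ultimately show "x \<in> (%f i. if i < d then f i else 0) ` ?A" by blast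
  qed
  have fin: "finite ?A" by (intro finite_PiE) auto
  show "finite (box d n)" using finite_subset[OF img] fin by blast
  have "card (box d n) \<le> card ?A" using surj_card_le[OF fin img] .
  also have "card ?A = (2 * n + 1) ^ d"
  proof -
    have "card {- int n..int n} = 2 * n + 1" by simp
    then show ?thesis by (simp only: card_PiE finite_lessThan prod_constant card_lessThan)
  qed
  finally show "card (box d n) \<le> (2 * n + 1) ^ d" .
qed

lemma box_sub_Zd: "box d n \<subseteq> Zd d" by (auto simp: box_def Zd_def)

lemma box_mono: "m \<le> n ==> box d m \<subseteq> box d n" by (force simp: box_def)

lemma box_0: "box d 0 = {%_. 0}"
  by (auto simp: box_def fun_eq_iff) (metis leI)

lemma Zd_box: "x \<in> Zd d ==> \<exists>n. x \<in> box d n"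
proof -
  assume x: "x \<in> Zd d"
  define n where "n = (\<Sum>i<d. nat \<bar>x i\<bar>)"
  have "\<bar>x i\<bar> \<le> int n" if "i < d" for i
  proof -
    have "nat \<bar>x i\<bar> \<le> n" unfolding n_def using that by (intro member_le_sum) auto
    then show ?thesis by linarith
  qed
  then show ?thesis using x by (auto simp: box_def Zd_def)
qed

lemma not_box_zdist: "x \<in> Zd d ==> x \<notin> box d n ==> real n + 1 \<le> zdist d x (%_. 0)"
proof -
  assume x: "x \<in> Zd d" "x \<notin> box d n"
  then obtain i where i: "i < d" "int n < \<bar>x i\<bar>" by (auto simp: box_def Zd_def not_le)
  then have "real n + 1 \<le> \<bar>real_of_int (x i - 0)\<bar>" by linarith
  also have "\<dots> \<le> zdist d x (%_. 0)" using zdist_coord[OF i(1), of x "%_. 0"] by simp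
  finally show ?thesis .
qed

lemma zdist_in_box: "x \<in> box d n ==> i < d ==> \<bar>real_of_int (x i)\<bar> \<le> real n"
proof -
  assume "x \<in> box d n" "i < d"
  then have "\<bar>x i\<bar> \<le> int n" by (auto simp: box_def)
  then show ?thesis by linarith
qed

text \<open>Half of the exponential rate absorbs the volume, through (1 + y/d)^d \<le> exp y with y
  = \<kappa>n/2; \<open>q\<close> is so small that q(2n + 1) \<le> 1 + y/d.\<close>

lemma exp_box_summable:
  assumes k: "0 < \<kappa>" and d: "1 \<le> d"
  shows "summable (%n. real ((2 * n + 1) ^ d) * exp (- \<kappa> * real n))"
proof -
  define q where "q = min 1 (\<kappa> / (4 * real d))"
  have q: "0 < q" "q \<le> 1" "2 * q \<le> \<kappa> / (2 * real d)" using k d by (auto simp: q_def)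
  have bd: "real ((2 * n + 1) ^ d) \<le> (1 / q) ^ d * exp (\<kappa> / 2 * real n)" for n
  proof -
    have "q * (2 * real n + 1) \<le> 1 + (\<kappa> / 2 * real n) / real d"
    proof -
      have "2 * q * real n \<le> \<kappa> / (2 * real d) * real n" using q by (intro mult_right_mono) auto
      then show ?thesis using q by (simp add: algebra_simps)
    qed
    then have "(q * (2 * real n + 1)) ^ d \<le> (1 + (\<kappa> / 2 * real n) / real d) ^ d" using q by (intro power_mono) auto
    also have "\<dots> \<le> exp (\<kappa> / 2 * real n)"
    proof (rule exp_ge_one_plus_x_over_n_power_n)
      have "0 \<le> \<kappa> / 2 * real n" using k by simp
      then show "- real d \<le> \<kappa> / 2 * real n" by linarith
    qed (use d in simp)
    finally have "q ^ d * real ((2 * n + 1) ^ d) \<le> exp (\<kappa> / 2 * real n)" by (simp add: power_mult_distrib add.commute)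
    then show ?thesis using q by (simp add: power_divide field_simps)
  qed
  have geo: "summable (%n. (1 / q) ^ d * exp (- (\<kappa> / 2)) ^ n)"
    by (intro summable_mult summable_geometric) (use k in auto)
  show ?thesis
  proof (rule summable_comparison_test'[OF geo, of 0])
    fix n
    have "norm (real ((2 * n + 1) ^ d) * exp (- \<kappa> * real n)) = real ((2 * n + 1) ^ d) * exp (- \<kappa> * real n)" by simp
    also have "\<dots> \<le> ((1 / q) ^ d * exp (\<kappa> / 2 * real n)) * exp (- \<kappa> * real n)" by (rule mult_right_mono[OF bd]) simp
    also have "\<dots> = (1 / q) ^ d * exp (- (\<kappa> / 2)) ^ n"
      by (simp add: exp_of_nat_mult[symmetric] exp_add[symmetric] mult.assoc del: exp_of_nat_mult)
    finally show "norm (real ((2 * n + 1) ^ d) * exp (- \<kappa> * real n)) \<le> (1 / q) ^ d * exp (- (\<kappa> / 2)) ^ n" .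
  qed
qed

text \<open>Infinite sums are treated as integrals over counting measure, so that Fubini and
  dominated convergence apply jointly to sums and expectations.\<close>

lemma integrable_count_summable:
  fixes f :: "'a => real"
  shows "integrable (count_space A) f \<longleftrightarrow> (%x. \<bar>f x\<bar>) summable_on A"
  using abs_summable_equivalent[of f A] by (simp add: abs_summable_on_def)

lemma infsum_integral:
  fixes f :: "'a => real"
  shows "infsum f A = (\<integral>x. f x \<partial>count_space A)"
proof (cases "integrable (count_space A) f")
  case True
  then show ?thesis using infsetsum_infsum[of f A] by (simp add: abs_summable_on_def infsetsum_def)
next
  case False
  then have "\<not> f summable_on A"
    using abs_summable_equivalent[of f A] summable_on_iff_abs_summable_on_real[of f A] by (simp add: abs_summable_on_def)
  then show ?thesis using False by (simp add: infsum_not_exists not_integrable_integral_eq)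
qed

definition Sk :: "nat => real => real" where
  "Sk d \<kappa> = (\<integral>x. exp (- \<kappa> * zdist d x (%_. 0)) \<partial>count_space (Zd d))"

text \<open>Sum over the shells between consecutive boxes: a site outside the box of radius N has
  distance at least N + 1 from the origin.\<close>

lemma exp_zdist_integrable:
  assumes k: "0 < \<kappa>" and d: "1 \<le> d"
  shows "integrable (count_space (Zd d)) (%x. exp (- \<kappa> * zdist d x (%_. 0)))"
proof -
  let ?g = "%x. exp (- \<kappa> * zdist d x (%_. 0))" and ?u = "%n. real ((2 * n + 1) ^ d) * exp (- \<kappa> * real n)"
  have b: "(\<Sum>x\<in>box d N. ?g x) \<le> (\<Sum>n\<le>N. ?u n)" for N
  proof (induction N)
    case 0 show ?case by (simp add: box_0 zdist_self)
  next
    case (Suc N)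
    have "(\<Sum>x\<in>box d (Suc N). ?g x) = (\<Sum>x\<in>box d (Suc N) - box d N. ?g x) + (\<Sum>x\<in>box d N. ?g x)"
      by (rule sum.subset_diff[OF box_mono finite_box]) simp
    also have "(\<Sum>x\<in>box d (Suc N) - box d N. ?g x) \<le> (\<Sum>x\<in>box d (Suc N) - box d N. exp (- \<kappa> * real (Suc N)))"
    proof (rule sum_mono)
      fix x assume "x \<in> box d (Suc N) - box d N"
      then have "x \<in> Zd d" "x \<notin> box d N" using box_sub_Zd[of d "Suc N"] by blast+
      from not_box_zdist[OF this] have "real (Suc N) \<le> zdist d x (%_. 0)" by simp
      then show "?g x \<le> exp (- \<kappa> * real (Suc N))" using k by simp
    qed
    also have "\<dots> = real (card (box d (Suc N) - box d N)) * exp (- \<kappa> * real (Suc N))" by simp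
    also have "\<dots> \<le> ?u (Suc N)"
    proof (rule mult_right_mono)
      have "card (box d (Suc N) - box d N) \<le> card (box d (Suc N))" by (intro card_mono finite_box) auto
      also have "\<dots> \<le> (2 * Suc N + 1) ^ d" by (rule card_box)
      finally show "real (card (box d (Suc N) - box d N)) \<le> real ((2 * Suc N + 1) ^ d)" by (rule of_nat_mono)
    qed simp
    finally show ?case using Suc by simp
  qed
  have "?g summable_on Zd d"
  proof (rule nonneg_bdd_above_summable_on)
    show "bdd_above (sum ?g ` {F. F \<subseteq> Zd d \<and> finite F})"
    proof (rule bdd_aboveI2[where M="suminf ?u"])
      fix F assume F: "F \<in> {F. F \<subseteq> Zd d \<and> finite F}"
      obtain N where N: "F \<subseteq> box d N"
      proof -
        have "\<forall>x\<in>F. \<exists>n. x \<in> box d n" using F Zd_box by auto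
        then obtain n where n: "!!x. x \<in> F ==> x \<in> box d (n x)" by metis
        have "F \<subseteq> box d (\<Sum>x\<in>F. n x)"
        proof
          fix x assume x: "x \<in> F"
          have "n x \<le> (\<Sum>x\<in>F. n x)" using F x by (intro member_le_sum) auto
          then show "x \<in> box d (\<Sum>x\<in>F. n x)" using n[OF x] box_mono by blast
        qed
        then show ?thesis by (rule that)
      qed
      have "sum ?g F \<le> sum ?g (box d N)" using N by (intro sum_mono2 finite_box) auto
      also have "\<dots> \<le> (\<Sum>n\<le>N. ?u n)" by (rule b)
      also have "\<dots> \<le> suminf ?u" by (rule sum_le_suminf[OF exp_box_summable[OF k d]]) auto
      finally show "sum ?g F \<le> suminf ?u" .
    qed
  qed simp
  then show ?thesis unfolding integrable_count_summable by simp
qed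

lemma Sk_nonneg: "0 \<le> Sk d \<kappa>" unfolding Sk_def by (intro Bochner_Integration.integral_nonneg) simp

lemma nn_exp_zdist:
  assumes k: "0 < \<kappa>" and d: "1 \<le> d" and y: "y \<in> Zd d"
  shows "(\<integral>\<^sup>+x. ennreal (exp (- \<kappa> * zdist d y x)) \<partial>count_space (Zd d)) = ennreal (Sk d \<kappa>)"
    "(\<integral>\<^sup>+x. ennreal (exp (- \<kappa> * zdist d x y)) \<partial>count_space (Zd d)) = ennreal (Sk d \<kappa>)"
proof -
  have z: "zdist d (sh y x) y = zdist d x (%_. 0)" for x
    using zdist_sh[of d y x "%_. 0"] by (simp add: sh_def)
  have "(\<integral>\<^sup>+x. ennreal (exp (- \<kappa> * zdist d x y)) \<partial>count_space (Zd d)) = (\<integral>\<^sup>+x. ennreal (exp (- \<kappa> * zdist d (sh y x) y)) \<partial>count_space (Zd d))"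
    by (rule nn_integral_bij_count_space[OF sh_bij[OF y], symmetric])
  also have "\<dots> = (\<integral>\<^sup>+x. ennreal (exp (- \<kappa> * zdist d x (%_. 0))) \<partial>count_space (Zd d))" unfolding z ..
  also have "\<dots> = ennreal (Sk d \<kappa>)"
    unfolding Sk_def by (rule nn_integral_eq_integral[OF exp_zdist_integrable[OF k d]]) simp
  finally show r: "(\<integral>\<^sup>+x. ennreal (exp (- \<kappa> * zdist d x y)) \<partial>count_space (Zd d)) = ennreal (Sk d \<kappa>)" .
  show "(\<integral>\<^sup>+x. ennreal (exp (- \<kappa> * zdist d y x)) \<partial>count_space (Zd d)) = ennreal (Sk d \<kappa>)"
    using r unfolding zdist_commute[of d y] .
qed

lemma nn_count_prod:
  assumes "countable A" "countable B"
  shows "(\<integral>\<^sup>+p. f p \<partial>count_space (A \<times> B)) = (\<integral>\<^sup>+x. (\<integral>\<^sup>+y. f (x, y) \<partial>count_space B) \<partial>count_space A)"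
proof -
  interpret B: sigma_finite_measure "count_space B" using assms by (intro sigma_finite_measure_count_space_countable)
  show ?thesis unfolding pair_measure_countable[OF assms, symmetric]
    by (subst B.nn_integral_fst[symmetric]) (auto simp: pair_measure_countable assms)
qed

lemma integral_count_prod:
  fixes f :: "'a \<times> 'b => real"
  assumes "countable A" "countable B" "integrable (count_space (A \<times> B)) f"
  shows "(\<integral>p. f p \<partial>count_space (A \<times> B)) = (\<integral>x. (\<integral>y. f (x, y) \<partial>count_space B) \<partial>count_space A)"
    "(\<integral>p. f p \<partial>count_space (A \<times> B)) = (\<integral>y. (\<integral>x. f (x, y) \<partial>count_space A) \<partial>count_space B)"
    "integrable (count_space A) (%x. \<integral>y. f (x, y) \<partial>count_space B)"
proof -
  interpret A: sigma_finite_measure "count_space A" using assms by (intro sigma_finite_measure_count_space_countable)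
  interpret B: sigma_finite_measure "count_space B" using assms by (intro sigma_finite_measure_count_space_countable)
  interpret pair_sigma_finite "count_space A" "count_space B" ..
  have i: "integrable (count_space A \<Otimes>\<^sub>M count_space B) (case_prod (%x y. f (x, y)))"
    using assms by (simp add: pair_measure_countable)
  show "(\<integral>p. f p \<partial>count_space (A \<times> B)) = (\<integral>x. (\<integral>y. f (x, y) \<partial>count_space B) \<partial>count_space A)"
    using integral_fst[OF i] by (simp add: pair_measure_countable assms)
  show "(\<integral>p. f p \<partial>count_space (A \<times> B)) = (\<integral>y. (\<integral>x. f (x, y) \<partial>count_space A) \<partial>count_space B)"
    using integral_snd[OF i] by (simp add: pair_measure_countable assms)
  show "integrable (count_space A) (%x. \<integral>y. f (x, y) \<partial>count_space B)" using integrable_fst[OF i] .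
qed

lemma integrable_count_nn:
  fixes f :: "'a => real"
  shows "integrable (count_space A) f \<longleftrightarrow> (\<integral>\<^sup>+x. ennreal \<bar>f x\<bar> \<partial>count_space A) < \<infinity>"
  by (simp add: integrable_iff_bounded)

section \<open>The velocity kernel and its joint moments\<close>

lemma nn_count_prod2:
  assumes "countable A" "countable B"
  shows "(\<integral>\<^sup>+p. f p \<partial>count_space (A \<times> B)) = (\<integral>\<^sup>+y. (\<integral>\<^sup>+x. f (x, y) \<partial>count_space A) \<partial>count_space B)"
proof -
  have "bij_betw prod.swap (B \<times> A) (A \<times> B)" by (auto simp: bij_betw_def)
  from nn_integral_bij_count_space[OF this, of f]
  have "(\<integral>\<^sup>+p. f p \<partial>count_space (A \<times> B)) = (\<integral>\<^sup>+p. f (prod.swap p) \<partial>count_space (B \<times> A))" by simp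
  also have "\<dots> = (\<integral>\<^sup>+y. (\<integral>\<^sup>+x. f (x, y) \<partial>count_space A) \<partial>count_space B)"
    by (subst nn_count_prod) (use assms in auto)
  finally show ?thesis .
qed

text \<open>Finite propagation: each application of H reaches only nearest neighbours.\<close>

lemma Hrn_range: "(Hr d V ^^ n) (dr y) x \<noteq> 0 ==> zdist d x y \<le> real n"
proof (induction n arbitrary: x)
  case 0 then show ?case by (auto simp: dr_def zdist_self split: if_splits)
next
  case (Suc n)
  show ?case
  proof (rule ccontr)
    assume n: "\<not> zdist d x y \<le> real (Suc n)"
    have 1: "(Hr d V ^^ n) (dr y) u = 0" if "u \<in> nbrs d x" for u
    proof (rule ccontr)
      assume "(Hr d V ^^ n) (dr y) u \<noteq> 0"
      then have "zdist d u y \<le> real n" by (rule Suc.IH)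
      then show False using zdist_triangle[of d x y u] zdist_nbr[OF that] n by simp
    qed
    have 2: "(Hr d V ^^ n) (dr y) x = 0" using Suc.IH[of x] n by fastforce
    have "(Hr d V ^^ Suc n) (dr y) x = 0"
      unfolding funpow.simps o_apply Hr_def[where x=x] using 1 2 by simp
    then show False using Suc.prems by simp
  qed
qed

lemma Hrn_range_box:
  assumes "x \<in> Zd d" "(Hr d V ^^ n) (dr (%_. 0)) x \<noteq> 0"
  shows "x \<in> box d n"
  using Hrn_range[OF assms(2)] not_box_zdist[OF assms(1), of n] by force

section \<open>Kernels with exponential decay in mean\<close>

locale fermi = anderson_loc +
  fixes EF :: real
  assumes EF: "a < EF" "EF < b"
begin

definition c0 :: real where "c0 = 1 / (2 * l)"

lemma c0: "0 < c0" using l by (simp add: c0_def)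

definition CC :: real where "CC = bounded_potential.C d Rad"

lemma CC: "0 < CC"
proof -
  have "good (%_. 0)" using Rad(1) by (simp add: good_def)
  then interpret b0: bounded_potential d "%_. 0" Rad by (rule good_bp)
  show ?thesis unfolding CC_def by (rule b0.C_pos)
qed

text \<open>Set to zero off the almost sure event, so that bounds and algebraic rules hold for every
  configuration.\<close>

definition kg :: "(real => real) => (site => real) => site => site => real" where
  "kg f V x y = (if good V then rf d V f (dr x) (dr y) else 0)"

lemma kg_measurable: "bbm f ==> x \<in> X ==> y \<in> X ==> (%V. kg f V x y) \<in> borel_measurable \<Omega>"
proof -
  assume h: "bbm f" "x \<in> X" "y \<in> X"
  note [measurable] = rfx_meas[OF h] good_pred
  show ?thesis unfolding kg_def by measurable
qed

lemma kg_bound: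
  assumes f: "bbm f" "!!t. t \<in> {-CC..CC} ==> \<bar>f t\<bar> \<le> c" and c: "0 \<le> c" and x: "x \<in> X" "y \<in> X"
  shows "\<bar>kg f V x y\<bar> \<le> c"
proof (cases "good V")
  case True
  interpret bounded_potential d V Rad by (rule good_bp) fact
  show ?thesis unfolding kg_def using True rf_abs_le[OF f[unfolded CC_def] x] by simp
qed (simp add: kg_def c)

lemma kg_add: "bbm f ==> bbm g ==> x \<in> X ==> y \<in> X ==> kg (%t. f t + g t) V x y = kg f V x y + kg g V x y"
  unfolding kg_def using bounded_potential.rf_plus[OF good_bp fs_dr fs_dr] by auto

lemma kg_diff: "bbm f ==> bbm g ==> x \<in> X ==> y \<in> X ==> kg (%t. f t - g t) V x y = kg f V x y - kg g V x y"
  unfolding kg_def using bounded_potential.rf_minus[OF good_bp fs_dr fs_dr] by auto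

lemma kg_scale: "bbm f ==> x \<in> X ==> y \<in> X ==> kg (%t. c * f t) V x y = c * kg f V x y"
  unfolding kg_def using bounded_potential.rf_cmult[OF good_bp fs_dr fs_dr] by auto

lemma kg_lim:
  assumes F: "!!n. bbm (F n)" "!!n t. \<bar>F n t\<bar> \<le> B" "!!t. (%n. F n t) \<longlonglongrightarrow> f t" and x: "x \<in> X" "y \<in> X"
  shows "(%n. kg (F n) V x y) \<longlonglongrightarrow> kg f V x y"
proof (cases "good V")
  case True
  interpret bounded_potential d V Rad by (rule good_bp) fact
  show ?thesis unfolding kg_def using True admD(3)[OF adm_rf[OF fs_dr[OF x(1)] fs_dr[OF x(2)]] F] by simp
qed (simp add: kg_def)

lemma kg_sym: "bbm f ==> x \<in> X ==> y \<in> X ==> kg f V x y = kg f V y x"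
  unfolding kg_def using bounded_potential.rf_sym[OF good_bp fs_dr fs_dr] by auto

lemma kg_ind: "bbm f ==> x \<in> X ==> y \<in> X ==> kg (%t. f t * indicator {-CC..CC} t) V x y = kg f V x y"
  unfolding kg_def CC_def using bounded_potential.rf_ind[OF good_bp fs_dr fs_dr bbm_measurable] by auto

definition pw :: "nat => real => real" where "pw n t = t ^ n * indicator {-CC..CC} t"

lemma bbm_pw: "bbm (pw n)"
  unfolding pw_def by (intro bbm_continuous_compact continuous_intros) auto

lemma kg_pw: "good V ==> x \<in> X ==> y \<in> X ==> kg (pw n) V x y = (Hr d V ^^ n) (dr y) x"
  unfolding kg_def pw_def[abs_def] CC_def using bounded_potential.rf_power[OF good_bp fs_dr fs_dr] by (simp add: ip_dr_left)

text \<open>The class for which the sums over lattice sites converge. It contains truncated powers,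
  by finite range, and Fermi projections at energies in (a,b); for a general bounded Borel function
  no decay is available, so only one argument of \<open>Lf\<close> is taken from this class.\<close>

definition dec :: "(real => real) => bool" where
  "dec f \<longleftrightarrow> bbm f \<and> (\<exists>A\<ge>0. \<forall>x\<in>X. \<forall>y\<in>X. EN (%V. kg f V x y) \<le> ennreal (A * exp (- c0 * zdist d x y)))"

lemma dec_bbm: "dec f ==> bbm f" by (simp add: dec_def)

lemma decE:
  assumes "dec f"
  obtains A where "0 \<le> A" "!!x y. x \<in> X ==> y \<in> X ==> EN (%V. kg f V x y) \<le> ennreal (A * exp (- c0 * zdist d x y))"
  using assms unfolding dec_def by blast

lemma dec_lin: assumes f: "dec f" and g: "dec g" shows "dec (%t. \<alpha> * f t + \<beta> * g t)"
proof -
  obtain A where A: "0 \<le> A" "!!x y. x \<in> X ==> y \<in> X ==> EN (%V. kg f V x y) \<le> ennreal (A * exp (- c0 * zdist d x y))"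
    using decE[OF f] by blast
  obtain B where B: "0 \<le> B" "!!x y. x \<in> X ==> y \<in> X ==> EN (%V. kg g V x y) \<le> ennreal (B * exp (- c0 * zdist d x y))"
    using decE[OF g] by blast
  note bf = dec_bbm[OF f] dec_bbm[OF g]
  have "EN (%V. kg (%t. \<alpha> * f t + \<beta> * g t) V x y) \<le> ennreal ((\<bar>\<alpha>\<bar> * A + \<bar>\<beta>\<bar> * B) * exp (- c0 * zdist d x y))" if x: "x \<in> X" "y \<in> X" for x y
  proof -
    note [measurable] = kg_measurable[OF bf(1) x] kg_measurable[OF bf(2) x]
    have k: "kg (%t. \<alpha> * f t + \<beta> * g t) V x y = \<alpha> * kg f V x y + \<beta> * kg g V x y" for V
      by (simp add: kg_add bbm_scale bf kg_scale x)
    have "\<bar>\<alpha> * kg f V x y + \<beta> * kg g V x y\<bar> \<le> \<bar>\<alpha>\<bar> * \<bar>kg f V x y\<bar> + \<bar>\<beta>\<bar> * \<bar>kg g V x y\<bar>" for V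
      using abs_triangle_ineq[of "\<alpha> * kg f V x y" "\<beta> * kg g V x y"] by (simp add: abs_mult)
    then have "EN (%V. kg (%t. \<alpha> * f t + \<beta> * g t) V x y) \<le> (\<integral>\<^sup>+V. ennreal \<bar>\<alpha>\<bar> * ennreal \<bar>kg f V x y\<bar> + ennreal \<bar>\<beta>\<bar> * ennreal \<bar>kg g V x y\<bar> \<partial>\<Omega>)"
      unfolding k by (intro nn_integral_mono) (simp add: ennreal_plus[symmetric] ennreal_mult[symmetric] ennreal_leI del: ennreal_plus)
    also have "\<dots> = ennreal \<bar>\<alpha>\<bar> * EN (%V. kg f V x y) + ennreal \<bar>\<beta>\<bar> * EN (%V. kg g V x y)"
      by (simp add: nn_integral_add nn_integral_cmult)
    also have "\<dots> \<le> ennreal \<bar>\<alpha>\<bar> * ennreal (A * exp (- c0 * zdist d x y)) + ennreal \<bar>\<beta>\<bar> * ennreal (B * exp (- c0 * zdist d x y))"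
      by (intro add_mono mult_left_mono A B x) auto
    also have "\<dots> = ennreal ((\<bar>\<alpha>\<bar> * A + \<bar>\<beta>\<bar> * B) * exp (- c0 * zdist d x y))" using A B
      by (simp add: ennreal_plus[symmetric] ennreal_mult[symmetric] distrib_right mult.assoc del: ennreal_plus)
    finally show ?thesis .
  qed
  then show ?thesis unfolding dec_def using A(1) B(1) bbm_add[OF bbm_scale bbm_scale, OF bf]
    by (intro conjI exI[of _ "\<bar>\<alpha>\<bar> * A + \<bar>\<beta>\<bar> * B"]) auto
qed

lemma dec_diff: "dec f ==> dec g ==> dec (%t. f t - g t)" using dec_lin[of f g 1 "-1"] by simp

text \<open>The kernel is at most CC^n in modulus and vanishes beyond distance n, so that the factor
  exp(c0 n) pays for the exponential.\<close>

lemma dec_pw: "dec (pw n)"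
proof -
  have "EN (%V. kg (pw n) V x y) \<le> ennreal (CC ^ n * exp (c0 * real n) * exp (- c0 * zdist d x y))" if x: "x \<in> X" "y \<in> X" for x y
  proof -
    have "\<bar>kg (pw n) V x y\<bar> \<le> CC ^ n * exp (c0 * real n) * exp (- c0 * zdist d x y)" for V
    proof (cases "good V \<and> zdist d x y \<le> real n")
      case True
      have "\<bar>kg (pw n) V x y\<bar> \<le> CC ^ n"
        by (rule kg_bound[OF bbm_pw _ _ x]) (use CC in \<open>auto simp: pw_def power_abs intro!: power_mono\<close>)
      moreover have "1 \<le> exp (c0 * real n) * exp (- c0 * zdist d x y)"
      proof -
        have "0 \<le> c0 * (real n - zdist d x y)" using True c0 by simp
        then have "1 \<le> exp (c0 * (real n - zdist d x y))" by simp
        then show ?thesis by (simp add: exp_add[symmetric] algebra_simps)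
      qed
      then have "CC ^ n * 1 \<le> CC ^ n * (exp (c0 * real n) * exp (- c0 * zdist d x y))" using CC by (intro mult_left_mono) auto
      ultimately show ?thesis by (simp add: mult.assoc)
    next
      case False
      then have "kg (pw n) V x y = 0"
        using kg_pw[OF _ x, of V n] Hrn_range[of n d V y x] by (cases "good V") (auto simp: kg_def)
      then show ?thesis using CC by simp
    qed
    then have "EN (%V. kg (pw n) V x y) \<le> (\<integral>\<^sup>+V. ennreal (CC ^ n * exp (c0 * real n) * exp (- c0 * zdist d x y)) \<partial>\<Omega>)"
      by (intro nn_integral_mono ennreal_leI)
    then show ?thesis by (simp add: P.emeasure_space_1)
  qed
  then show ?thesis unfolding dec_def using CC bbm_pw by (intro conjI exI[of _ "CC ^ n * exp (c0 * real n)"]) auto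
qed

definition Kd :: real where
  "Kd = (SOME K1. 1 \<le> K1 \<and> (\<forall>E\<in>{a<..<b}. \<forall>x\<in>X. \<forall>y\<in>X.
     EN (%V. PF E V x y) \<le> ennreal (K1 * exp (- zdist d x y / (2 * l)))))"

lemma Kd:
  "1 \<le> Kd"
  "E \<in> {a<..<b} ==> x \<in> X ==> y \<in> X ==> EN (%V. kg (indicator {..E}) V x y) \<le> ennreal (Kd * exp (- c0 * zdist d x y))"
proof -
  have K: "1 \<le> Kd \<and> (\<forall>E\<in>{a<..<b}. \<forall>x\<in>X. \<forall>y\<in>X.
     EN (%V. PF E V x y) \<le> ennreal (Kd * exp (- zdist d x y / (2 * l))))"
    unfolding Kd_def by (rule someI_ex) (use PF_decay in auto)
  then show "1 \<le> Kd" by simp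
  assume h: "E \<in> {a<..<b}" "x \<in> X" "y \<in> X"
  have "EN (%V. kg (indicator {..E}) V x y) = EN (%V. PF E V x y)"
    by (rule nn_integral_cong_AE) (use AE_good in \<open>eventually_elim, simp add: kg_def PF_def\<close>)
  also have "\<dots> \<le> ennreal (Kd * exp (- zdist d x y / (2 * l)))" using K h by auto
  finally show "EN (%V. kg (indicator {..E}) V x y) \<le> ennreal (Kd * exp (- c0 * zdist d x y))"
    by (simp add: c0_def)
qed

lemma dec_atMost: "E \<in> {a<..<b} ==> dec (indicator {..E})"
  unfolding dec_def using Kd bbm_atMost by (intro conjI exI[of _ Kd]) auto

text \<open>The factors may be dependent. Each of the three means bounds the mean of the product
  once the other two factors are replaced by their suprema; the largest distance is at least the
  average of the three, whence c0/3.\<close>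

lemma E3:
  assumes m: "Z1 \<in> borel_measurable \<Omega>" "Z2 \<in> borel_measurable \<Omega>" "Z3 \<in> borel_measurable \<Omega>"
    and M: "!!V. \<bar>Z1 V\<bar> \<le> N1" "!!V. \<bar>Z2 V\<bar> \<le> N2" "!!V. \<bar>Z3 V\<bar> \<le> N3"
    and A: "0 \<le> A1" "0 \<le> A2" "0 \<le> A3"
    and E: "EN (%V. Z1 V) \<le> ennreal (A1 * exp (- c0 * d1))"
      "EN (%V. Z2 V) \<le> ennreal (A2 * exp (- c0 * d2))"
      "EN (%V. Z3 V) \<le> ennreal (A3 * exp (- c0 * d3))"
  shows "EN (%V. Z1 V * Z2 V * Z3 V) \<le> ennreal ((A1 * N2 * N3 + N1 * A2 * N3 + N1 * N2 * A3) * exp (- (c0 / 3) * (d1 + d2 + d3)))"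
proof -
  let ?A = "A1 * N2 * N3 + N1 * A2 * N3 + N1 * N2 * A3"
  have M0: "0 \<le> N1" "0 \<le> N2" "0 \<le> N3" using M[of undefined] by (meson abs_ge_zero order_trans)+
  have step: "EN (%V. Z1 V * Z2 V * Z3 V) \<le> ennreal (?A * exp (- c0 * D))"
    if Z: "Z \<in> borel_measurable \<Omega>" "!!V. \<bar>Z1 V * Z2 V * Z3 V\<bar> \<le> m * \<bar>Z V\<bar>"
      "EN (%V. Z V) \<le> ennreal (B * exp (- c0 * D))" and mB: "0 \<le> m" "0 \<le> B" "m * B \<le> ?A" for Z m B D
  proof -
    have "EN (%V. Z1 V * Z2 V * Z3 V) \<le> (\<integral>\<^sup>+V. ennreal m * ennreal \<bar>Z V\<bar> \<partial>\<Omega>)"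
      using Z(2) mB by (intro nn_integral_mono) (simp add: ennreal_mult[symmetric] ennreal_leI)
    also have "\<dots> = ennreal m * EN (%V. Z V)" using Z(1) by (intro nn_integral_cmult) auto
    also have "\<dots> \<le> ennreal m * ennreal (B * exp (- c0 * D))" by (intro mult_left_mono Z(3)) auto
    also have "\<dots> = ennreal (m * B * exp (- c0 * D))" using mB by (simp add: ennreal_mult[symmetric] mult.assoc)
    also have "\<dots> \<le> ennreal (?A * exp (- c0 * D))" by (intro ennreal_leI mult_right_mono mB) auto
    finally show ?thesis .
  qed
  have p1: "0 \<le> A1 * N2 * N3" "0 \<le> N1 * A2 * N3" "0 \<le> N1 * N2 * A3" using M0 A by auto
  have s1: "EN (%V. Z1 V * Z2 V * Z3 V) \<le> ennreal (?A * exp (- c0 * d1))"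
  proof (rule step[OF m(1) _ E(1), of "N2 * N3"])
    show "\<bar>Z1 V * Z2 V * Z3 V\<bar> \<le> N2 * N3 * \<bar>Z1 V\<bar>" for V
    proof -
      have "\<bar>Z2 V\<bar> * \<bar>Z3 V\<bar> \<le> N2 * N3" using M M0 by (intro mult_mono) auto
      then have "\<bar>Z2 V\<bar> * \<bar>Z3 V\<bar> * \<bar>Z1 V\<bar> \<le> N2 * N3 * \<bar>Z1 V\<bar>" by (intro mult_right_mono) auto
      then show ?thesis by (simp add: abs_mult mult_ac)
    qed
  qed (use M0 A p1 in \<open>auto simp: mult_ac\<close>)
  have s2: "EN (%V. Z1 V * Z2 V * Z3 V) \<le> ennreal (?A * exp (- c0 * d2))"
  proof (rule step[OF m(2) _ E(2), of "N1 * N3"])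
    show "\<bar>Z1 V * Z2 V * Z3 V\<bar> \<le> N1 * N3 * \<bar>Z2 V\<bar>" for V
    proof -
      have "\<bar>Z1 V\<bar> * \<bar>Z3 V\<bar> \<le> N1 * N3" using M M0 by (intro mult_mono) auto
      then have "\<bar>Z1 V\<bar> * \<bar>Z3 V\<bar> * \<bar>Z2 V\<bar> \<le> N1 * N3 * \<bar>Z2 V\<bar>" by (intro mult_right_mono) auto
      then show ?thesis by (simp add: abs_mult mult_ac)
    qed
  qed (use M0 A p1 in \<open>auto simp: mult_ac\<close>)
  have s3: "EN (%V. Z1 V * Z2 V * Z3 V) \<le> ennreal (?A * exp (- c0 * d3))"
  proof (rule step[OF m(3) _ E(3), of "N1 * N2"])
    show "\<bar>Z1 V * Z2 V * Z3 V\<bar> \<le> N1 * N2 * \<bar>Z3 V\<bar>" for V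
    proof -
      have "\<bar>Z1 V\<bar> * \<bar>Z2 V\<bar> \<le> N1 * N2" using M M0 by (intro mult_mono) auto
      then have "\<bar>Z1 V\<bar> * \<bar>Z2 V\<bar> * \<bar>Z3 V\<bar> \<le> N1 * N2 * \<bar>Z3 V\<bar>" by (intro mult_right_mono) auto
      then show ?thesis by (simp add: abs_mult mult_ac)
    qed
  qed (use M0 A p1 in \<open>auto simp: mult_ac\<close>)
  define D where "D = max d1 (max d2 d3)"
  have "EN (%V. Z1 V * Z2 V * Z3 V) \<le> ennreal (?A * exp (- c0 * D))"
    unfolding D_def max_def using s1 s2 s3 by auto
  also have "\<dots> \<le> ennreal (?A * exp (- (c0 / 3) * (d1 + d2 + d3)))"
  proof (intro ennreal_leI mult_left_mono)
    have "(d1 + d2 + d3) / 3 \<le> D" unfolding D_def by (auto simp: max_def)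
    then have "c0 * ((d1 + d2 + d3) / 3) \<le> c0 * D" using c0 by (intro mult_left_mono) auto
    then show "exp (- c0 * D) \<le> exp (- (c0 / 3) * (d1 + d2 + d3))" by simp
  qed (use p1 in auto)
  finally show ?thesis .
qed

abbreviation "o0 \<equiv> (%_. 0) :: nat => int"

definition pk :: "(site => real) => site => site => real" where
  "pk = kg (indicator {..EF})"

text \<open>Kernel of the commutator of X_1 and P without the factor i, which keeps it real; in <<Y,
  f(H_L) g(H_R) Y>> the two factors i cancel.\<close>

definition yk :: "(site => real) => site => site => real" where
  "yk V x y = real_of_int (x 0 - y 0) * pk V x y"

lemma EF_in: "EF \<in> {a<..<b}" using EF by simp

lemma pk_measurable: "x \<in> X ==> y \<in> X ==> (%V. pk V x y) \<in> borel_measurable \<Omega>"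
  unfolding pk_def by (rule kg_measurable[OF bbm_atMost])

lemma yk_measurable: "x \<in> X ==> y \<in> X ==> (%V. yk V x y) \<in> borel_measurable \<Omega>"
  unfolding yk_def using pk_measurable by measurable

lemma pk_bound: "x \<in> X ==> y \<in> X ==> \<bar>pk V x y\<bar> \<le> 1"
  unfolding pk_def by (rule kg_bound[OF bbm_atMost]) (auto simp: indicator_def)

text \<open>Half of the rate c0/3 from \<open>E3\<close>; the other half absorbs the coordinate
  weights through \<open>weight_le\<close>.\<close>

definition \<kappa> :: real where "\<kappa> = c0 / 6"

lemma \<kappa>: "0 < \<kappa>" using c0 by (simp add: \<kappa>_def)

lemma nn_ez:
  assumes "x \<in> X"
  shows "(\<integral>\<^sup>+u. ennreal (exp (- (\<kappa> * zdist d x u))) \<partial>count_space X) = ennreal (Sk d \<kappa>)"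
    "(\<integral>\<^sup>+u. ennreal (exp (- (\<kappa> * zdist d u x))) \<partial>count_space X) = ennreal (Sk d \<kappa>)"
  using nn_exp_zdist[OF \<kappa> d assms] by simp_all

lemma weight_le: "\<bar>real_of_int (x 0 - y 0)\<bar> \<le> 1 / \<kappa> * exp (\<kappa> * zdist d x y)"
proof -
  have "\<bar>real_of_int (x 0 - y 0)\<bar> \<le> zdist d x y" by (rule zdist_coord) (use d in simp)
  also have "\<dots> = 1 / \<kappa> * (\<kappa> * zdist d x y)" using \<kappa> by simp
  also have "\<dots> \<le> 1 / \<kappa> * exp (\<kappa> * zdist d x y)"
  proof (rule mult_left_mono)
    show "\<kappa> * zdist d x y \<le> exp (\<kappa> * zdist d x y)" using exp_ge_add_one_self[of "\<kappa> * zdist d x y"] by linarith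
  qed (use \<kappa> in simp)
  finally show ?thesis .
qed

text \<open>By \<open>E3\<close> each distance comes with rate 2\<kappa>. The two commutator kernels
  spend \<kappa> on their weights, and the middle factor gives up its surplus so that all rates are
  equal.\<close>

lemma weighted_three:
  assumes f: "dec f"
  shows "\<exists>A\<ge>0. \<forall>x\<in>X. \<forall>y\<in>X. \<forall>u\<in>X. \<forall>v\<in>X. \<forall>z\<in>X. \<forall>w\<in>X.
     EN (%V. yk V x y * kg f V u v * yk V z w) \<le> ennreal (A * (exp (- \<kappa> * zdist d x y) * (exp (- \<kappa> * zdist d u v) * exp (- \<kappa> * zdist d z w))))"
proof -
  obtain A where A: "0 \<le> A" "!!x y. x \<in> X ==> y \<in> X ==> EN (%V. kg f V x y) \<le> ennreal (A * exp (- c0 * zdist d x y))"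
    using decE[OF f] by blast
  note bf = dec_bbm[OF f]
  obtain M where M: "0 \<le> M" "!!t. \<bar>f t\<bar> \<le> M" using bbm_bound[OF bf] by metis
  define B where "B = Kd * M * 1 + 1 * A * 1 + 1 * M * Kd"
  have B: "0 \<le> B" unfolding B_def using Kd(1) M A by simp
  have "EN (%V. yk V x y * kg f V u v * yk V z w) \<le> ennreal ((1/\<kappa>)\<^sup>2 * B * (exp (- \<kappa> * zdist d x y) * (exp (- \<kappa> * zdist d u v) * exp (- \<kappa> * zdist d z w))))"
    if h: "x \<in> X" "y \<in> X" "u \<in> X" "v \<in> X" "z \<in> X" "w \<in> X" for x y u v z w
  proof -
    let ?W = "\<bar>real_of_int (x 0 - y 0)\<bar> * \<bar>real_of_int (z 0 - w 0)\<bar>"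
    note [measurable] = pk_measurable[OF h(1,2)] pk_measurable[OF h(5,6)] kg_measurable[OF bf h(3,4)]
    have "EN (%V. yk V x y * kg f V u v * yk V z w) = (\<integral>\<^sup>+V. ennreal ?W * ennreal \<bar>pk V x y * kg f V u v * pk V z w\<bar> \<partial>\<Omega>)"
      unfolding yk_def by (intro nn_integral_cong) (simp add: ennreal_mult[symmetric] abs_mult mult_ac)
    also have "\<dots> = ennreal ?W * EN (%V. pk V x y * kg f V u v * pk V z w)"
      by (intro nn_integral_cmult) measurable
    also have "\<dots> \<le> ennreal ?W * ennreal (B * exp (- (c0 / 3) * (zdist d x y + zdist d u v + zdist d z w)))"
      unfolding B_def
    proof (intro mult_left_mono E3)
      show "\<bar>kg f V u v\<bar> \<le> M" for V by (rule kg_bound[OF bf M(2) M(1) h(3,4)])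
      show "EN (%V. pk V x y) \<le> ennreal (Kd * exp (- c0 * zdist d x y))"
        "EN (%V. pk V z w) \<le> ennreal (Kd * exp (- c0 * zdist d z w))"
        unfolding pk_def using Kd(2)[OF EF_in] h by auto
    qed (use A h pk_bound Kd(1) in auto)
    also have "\<dots> = ennreal (?W * (B * exp (- (c0 / 3) * (zdist d x y + zdist d u v + zdist d z w))))"
      using B by (simp add: ennreal_mult[symmetric])
    also have "\<dots> \<le> ennreal ((1/\<kappa>)\<^sup>2 * B * (exp (- \<kappa> * zdist d x y) * (exp (- \<kappa> * zdist d u v) * exp (- \<kappa> * zdist d z w))))"
    proof (rule ennreal_leI)
      have ex: "exp (p + q - r) = exp p * exp q * exp (- r)" for p q r :: real by (simp add: exp_add[symmetric])
      have "?W \<le> (1 / \<kappa> * exp (\<kappa> * zdist d x y)) * (1 / \<kappa> * exp (\<kappa> * zdist d z w))"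
        by (intro mult_mono weight_le) (use \<kappa> in auto)
      then have "?W * (B * exp (- (c0 / 3) * (zdist d x y + zdist d u v + zdist d z w))) \<le>
        (1 / \<kappa> * exp (\<kappa> * zdist d x y)) * (1 / \<kappa> * exp (\<kappa> * zdist d z w)) * (B * exp (- (c0 / 3) * (zdist d x y + zdist d u v + zdist d z w)))"
        using B by (intro mult_right_mono) auto
      also have "\<dots> = (1/\<kappa>)\<^sup>2 * B * exp (\<kappa> * zdist d x y + \<kappa> * zdist d z w - (c0 / 3) * (zdist d x y + zdist d u v + zdist d z w))"
        by (simp only: ex mult_minus_left power2_eq_square mult_ac)
      also have "\<dots> \<le> (1/\<kappa>)\<^sup>2 * B * exp (- \<kappa> * zdist d x y + (- \<kappa> * zdist d u v + - \<kappa> * zdist d z w))"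
      proof (intro mult_left_mono)
        have "0 \<le> c0 * zdist d u v" using c0 zdist_nonneg[of d u v] by simp
        then show "exp (\<kappa> * zdist d x y + \<kappa> * zdist d z w - (c0 / 3) * (zdist d x y + zdist d u v + zdist d z w)) \<le> exp (- \<kappa> * zdist d x y + (- \<kappa> * zdist d u v + - \<kappa> * zdist d z w))"
          by (simp add: \<kappa>_def field_simps)
      qed (use B in auto)
      finally show "?W * (B * exp (- (c0 / 3) * (zdist d x y + zdist d u v + zdist d z w))) \<le> (1/\<kappa>)\<^sup>2 * B * (exp (- \<kappa> * zdist d x y) * (exp (- \<kappa> * zdist d u v) * exp (- \<kappa> * zdist d z w)))"
        by (simp only: exp_add)
    qed
    finally show ?thesis .
  qed
  then show ?thesis using B by (intro exI[of _ "(1/\<kappa>)\<^sup>2 * B"]) auto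
qed

abbreviation "T3 \<equiv> X \<times> X \<times> X"
abbreviation "TS \<equiv> count_space T3 \<Otimes>\<^sub>M \<Omega>"

lemma countable_T3: "countable T3" by (intro countable_SIGMA countable_Zd)

lemma integrable_count_pair:
  fixes \<Psi> :: "'c => (site => real) => real"
  assumes A: "countable A" and m: "!!t. t \<in> A ==> \<Psi> t \<in> borel_measurable \<Omega>"
    and b: "(\<integral>\<^sup>+t. EN (%V. \<Psi> t V) \<partial>count_space A) < \<infinity>"
  shows "integrable (count_space A \<Otimes>\<^sub>M \<Omega>) (%p. \<Psi> (fst p) (snd p))"
proof (rule integrableI_bounded)
  show me: "(%p. \<Psi> (fst p) (snd p)) \<in> borel_measurable (count_space A \<Otimes>\<^sub>M \<Omega>)"
    by (rule measurable_pair_measure_countable1[OF A]) (simp add: m)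
  have "(\<integral>\<^sup>+p. ennreal (norm (\<Psi> (fst p) (snd p))) \<partial>(count_space A \<Otimes>\<^sub>M \<Omega>)) = (\<integral>\<^sup>+t. EN (%V. \<Psi> t V) \<partial>count_space A)"
    using P.nn_integral_fst[of "%p. ennreal (norm (\<Psi> (fst p) (snd p)))" "count_space A"] me by simp
  then show "(\<integral>\<^sup>+p. ennreal (norm (\<Psi> (fst p) (snd p))) \<partial>(count_space A \<Otimes>\<^sub>M \<Omega>)) < \<infinity>" using b by simp
qed

text \<open>The factors form the path 0, x, x', u, so the three exponentials can be summed starting
  from the far end. Times a bound for g this is a majorant of \<open>\<Phi>\<close>.\<close>

lemma base1:
  assumes f: "dec f"
  shows "integrable TS (%p. case fst p of (x, x', u) => yk (snd p) x o0 * kg f (snd p) x x' * yk (snd p) x' u)"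
proof (rule integrable_count_pair[OF countable_T3, where \<Psi>="%t V. case t of (x, x', u) => yk V x o0 * kg f V x x' * yk V x' u"])
  obtain A where A: "0 \<le> A" "!!x y u v z w. x \<in> X ==> y \<in> X ==> u \<in> X ==> v \<in> X ==> z \<in> X ==> w \<in> X ==>
     EN (%V. yk V x y * kg f V u v * yk V z w) \<le> ennreal (A * (exp (- \<kappa> * zdist d x y) * (exp (- \<kappa> * zdist d u v) * exp (- \<kappa> * zdist d z w))))"
    using weighted_three[OF f] by blast
  have "(\<integral>\<^sup>+t. EN (%V. case t of (x, x', u) => yk V x o0 * kg f V x x' * yk V x' u) \<partial>count_space T3)
      \<le> (\<integral>\<^sup>+t. (case t of (x, x', u) => ennreal A * (ennreal (exp (- \<kappa> * zdist d x o0)) * (ennreal (exp (- \<kappa> * zdist d x x')) * ennreal (exp (- \<kappa> * zdist d x' u))))) \<partial>count_space T3)"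
    by (rule nn_integral_mono) (use A(1) in \<open>auto simp: ennreal_mult[symmetric] intro!: order_trans[OF A(2)] zero_Zd\<close>)
  also have "\<dots> = (\<integral>\<^sup>+x. (\<integral>\<^sup>+x'. (\<integral>\<^sup>+u. ennreal A * (ennreal (exp (- \<kappa> * zdist d x o0)) * (ennreal (exp (- \<kappa> * zdist d x x')) * ennreal (exp (- \<kappa> * zdist d x' u)))) \<partial>count_space X) \<partial>count_space X) \<partial>count_space X)"
    by (simp add: nn_count_prod countable_Zd)
  also have "\<dots> = (\<integral>\<^sup>+x. (\<integral>\<^sup>+x'. ennreal A * (ennreal (exp (- \<kappa> * zdist d x o0)) * (ennreal (exp (- \<kappa> * zdist d x x')) * ennreal (Sk d \<kappa>))) \<partial>count_space X) \<partial>count_space X)"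
    by (intro nn_integral_cong) (simp add: nn_integral_cmult nn_ez)
  also have "\<dots> = (\<integral>\<^sup>+x. ennreal A * (ennreal (exp (- \<kappa> * zdist d x o0)) * (ennreal (Sk d \<kappa>) * ennreal (Sk d \<kappa>))) \<partial>count_space X)"
    by (intro nn_integral_cong) (simp add: nn_integral_cmult nn_integral_multc nn_ez)
  also have "\<dots> = ennreal A * (ennreal (Sk d \<kappa>) * (ennreal (Sk d \<kappa>) * ennreal (Sk d \<kappa>)))"
    by (simp add: nn_integral_cmult nn_integral_multc nn_ez zero_Zd)
  also have "\<dots> < \<infinity>" by (simp add: ennreal_mult_less_top)
  finally show "(\<integral>\<^sup>+t. EN (%V. case t of (x, x', u) => yk V x o0 * kg f V x x' * yk V x' u) \<partial>count_space T3) < \<infinity>" .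
next
  fix t assume "t \<in> T3"
  then show "(%V. case t of (x, x', u) => yk V x o0 * kg f V x x' * yk V x' u) \<in> borel_measurable \<Omega>"
    using dec_bbm[OF f] by (auto intro!: borel_measurable_times yk_measurable kg_measurable zero_Zd)
qed

text \<open>Here the links are x to 0, u to 0 and x' to u: decay of g replaces decay of f, and x' is
  summed before u.\<close>

lemma base2:
  assumes g: "dec g"
  shows "integrable TS (%p. case fst p of (x, x', u) => yk (snd p) x o0 * kg g (snd p) u o0 * yk (snd p) x' u)"
proof (rule integrable_count_pair[OF countable_T3, where \<Psi>="%t V. case t of (x, x', u) => yk V x o0 * kg g V u o0 * yk V x' u"])
  obtain A where A: "0 \<le> A" "!!x y u v z w. x \<in> X ==> y \<in> X ==> u \<in> X ==> v \<in> X ==> z \<in> X ==> w \<in> X ==>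
     EN (%V. yk V x y * kg g V u v * yk V z w) \<le> ennreal (A * (exp (- \<kappa> * zdist d x y) * (exp (- \<kappa> * zdist d u v) * exp (- \<kappa> * zdist d z w))))"
    using weighted_three[OF g] by blast
  have "(\<integral>\<^sup>+t. EN (%V. case t of (x, x', u) => yk V x o0 * kg g V u o0 * yk V x' u) \<partial>count_space T3)
      \<le> (\<integral>\<^sup>+t. (case t of (x, x', u) => ennreal A * (ennreal (exp (- \<kappa> * zdist d x o0)) * (ennreal (exp (- \<kappa> * zdist d u o0)) * ennreal (exp (- \<kappa> * zdist d x' u))))) \<partial>count_space T3)"
    by (rule nn_integral_mono) (use A(1) in \<open>auto simp: ennreal_mult[symmetric] intro!: order_trans[OF A(2)] zero_Zd\<close>)
  also have "\<dots> = (\<integral>\<^sup>+x. (\<integral>\<^sup>+q. (case q of (x', u) => ennreal A * (ennreal (exp (- \<kappa> * zdist d x o0)) * (ennreal (exp (- \<kappa> * zdist d u o0)) * ennreal (exp (- \<kappa> * zdist d x' u))))) \<partial>count_space (X \<times> X)) \<partial>count_space X)"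
    by (subst nn_count_prod) (auto simp: countable_Zd)
  also have "\<dots> = (\<integral>\<^sup>+x. (\<integral>\<^sup>+u. (\<integral>\<^sup>+x'. ennreal A * (ennreal (exp (- \<kappa> * zdist d x o0)) * (ennreal (exp (- \<kappa> * zdist d u o0)) * ennreal (exp (- \<kappa> * zdist d x' u)))) \<partial>count_space X) \<partial>count_space X) \<partial>count_space X)"
    by (simp add: nn_count_prod2 countable_Zd)
  also have "\<dots> = (\<integral>\<^sup>+x. (\<integral>\<^sup>+u. ennreal A * (ennreal (exp (- \<kappa> * zdist d x o0)) * (ennreal (exp (- \<kappa> * zdist d u o0)) * ennreal (Sk d \<kappa>))) \<partial>count_space X) \<partial>count_space X)"
    by (intro nn_integral_cong) (simp add: nn_integral_cmult nn_ez)
  also have "\<dots> = (\<integral>\<^sup>+x. ennreal A * (ennreal (exp (- \<kappa> * zdist d x o0)) * (ennreal (Sk d \<kappa>) * ennreal (Sk d \<kappa>))) \<partial>count_space X)"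
    by (intro nn_integral_cong) (simp add: nn_integral_cmult nn_integral_multc nn_ez zero_Zd)
  also have "\<dots> = ennreal A * (ennreal (Sk d \<kappa>) * (ennreal (Sk d \<kappa>) * ennreal (Sk d \<kappa>)))"
    by (simp add: nn_integral_cmult nn_integral_multc nn_ez zero_Zd)
  also have "\<dots> < \<infinity>" by (simp add: ennreal_mult_less_top)
  finally show "(\<integral>\<^sup>+t. EN (%V. case t of (x, x', u) => yk V x o0 * kg g V u o0 * yk V x' u) \<partial>count_space T3) < \<infinity>" .
next
  fix t assume "t \<in> T3"
  then show "(%V. case t of (x, x', u) => yk V x o0 * kg g V u o0 * yk V x' u) \<in> borel_measurable \<Omega>"
    using dec_bbm[OF g] by (auto intro!: borel_measurable_times yk_measurable kg_measurable zero_Zd)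
qed

end

lemma infsum_complex_of_real: "infsum (%x. complex_of_real (f x)) A = complex_of_real (infsum f A)"
proof (cases "f summable_on A")
  case True
  then show ?thesis using has_sum_of_real[OF has_sum_infsum[OF True], where 'a=complex] by (simp add: infsumI)
next
  case False
  then have "\<not> (%x. complex_of_real (f x)) summable_on A" using summable_on_Re by fastforce
  then show ?thesis using False by (simp add: infsum_not_exists)
qed

lemma ip_Hr_sym_general:
  assumes v: "fs d v"
  shows "ip (Hr d V v) w = ip v (Hr d V w)"
proof -
  define S where "S = supp v \<union> supp (Hr d V v) \<union> (\<Union>x\<in>supp v. nbrs d x)"
  define w' where "w' x = (if x \<in> S then w x else 0)" for x
  have S: "finite S" "S \<subseteq> Zd d"
    using v fs_Hr[OF v, of V] finite_nbrs nbrs_Zd unfolding S_def fs_def by (auto, blast)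
  have w': "fs d w'" unfolding fs_def
  proof
    have "supp w' \<subseteq> S" by (auto simp: supp_def w'_def)
    then show "finite (supp w')" "supp w' \<subseteq> Zd d" using S by (auto intro: finite_subset)
  qed
  have "ip (Hr d V v) w = ip (Hr d V v) w'"
    unfolding ip_def by (intro sum.cong) (auto simp: w'_def S_def)
  also have "\<dots> = ip v (Hr d V w')" by (rule ip_Hr_sym[OF v w'])
  also have "\<dots> = ip v (Hr d V w)"
    unfolding ip_def
  proof (intro sum.cong refl arg_cong2[where f="(*)"])
    fix x assume x: "x \<in> supp v"
    have 1: "w' x = w x" using x by (auto simp: w'_def S_def)
    have 2: "(\<Sum>y\<in>nbrs d x. w' y) = (\<Sum>y\<in>nbrs d x. w y)" by (rule sum.cong) (use x in \<open>auto simp: w'_def S_def\<close>)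
    show "Hr d V w' x = Hr d V w x" unfolding Hr_def[of d V _ x] 1 2 ..
  qed
  finally show ?thesis .
qed

lemma ip_Hrn_sym_general: "fs d v ==> ip ((Hr d V ^^ n) v) w = ip v ((Hr d V ^^ n) w)"
proof (induction n arbitrary: v)
  case (Suc n)
  have "ip ((Hr d V ^^ Suc n) v) w = ip ((Hr d V ^^ n) (Hr d V v)) w" by (simp add: funpow_swap1)
  also have "\<dots> = ip v ((Hr d V ^^ Suc n) w)" using Suc.IH[OF fs_Hr[OF Suc.prems]] ip_Hr_sym_general[OF Suc.prems] by simp
  finally show ?case .
qed simp

lemma integral_count_finite_support:
  fixes f :: "'a => real"
  assumes "finite S" "S \<subseteq> A" "!!x. x \<in> A ==> x \<notin> S ==> f x = 0"
  shows "(\<integral>x. f x \<partial>count_space A) = (\<Sum>x\<in>S. f x)"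
proof -
  have "(\<Sum>x\<in>S. f x) = infsum f S" using assms(1) by simp
  also have "\<dots> = infsum f A" by (rule infsum_cong_neutral) (use assms in auto)
  finally show ?thesis by (simp add: infsum_integral)
qed

lemma integrable_count_section:
  fixes f :: "'a \<times> 'b => real"
  assumes "integrable (count_space (A \<times> B)) f" "x \<in> A"
  shows "integrable (count_space B) (%y. f (x, y))"
proof -
  have "(%y. \<bar>f (x, y)\<bar>) summable_on B"
    using assms summable_on_reindex[of "Pair x" B "%t. \<bar>f t\<bar>"]
    by (auto simp: integrable_count_summable inj_on_def o_def intro: summable_on_subset_banach)
  then show ?thesis by (simp add: integrable_count_summable)
qed

lemma Hopn_scale: "(Hop d V ^^ n) (%x. c * f x) = (%x. c * (Hop d V ^^ n) f x)"
proof (induction n)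
  case (Suc n)
  have "Hop d V (%x. c * g x) = (%x. c * Hop d V g x)" for g
    by (auto simp: Hop_def fun_eq_iff sum_distrib_left algebra_simps)
  then show ?case using Suc by simp
qed simp

section \<open>The form <<Y, f(H_L) g(H_R) Y>> and its moments\<close>

context fermi
begin

text \<open>Summand of <Y\<delta>_0, f(H) Y g(H) \<delta>_0> over the intermediate sites.\<close>

definition \<Phi> :: "(real => real) => (real => real) => site \<times> site \<times> site => (site => real) => real" where
  "\<Phi> f g t V = (case t of (x, x', u) => yk V x o0 * kg f V x x' * yk V x' u * kg g V u o0)"

definition Lf :: "(real => real) => (real => real) => real" where
  "Lf f g = (\<integral>p. \<Phi> f g (fst p) (snd p) \<partial>TS)"

lemma TS_meas:
  assumes "!!t. t \<in> T3 ==> \<Psi> t \<in> borel_measurable \<Omega>"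
  shows "(%p. \<Psi> (fst p) (snd p)) \<in> borel_measurable TS"
  by (rule measurable_pair_measure_countable1[OF countable_T3]) (simp add: assms)

lemma \<Phi>_meas: "bbm f ==> bbm g ==> t \<in> T3 ==> \<Phi> f g t \<in> borel_measurable \<Omega>"
  unfolding \<Phi>_def[abs_def] by (auto intro!: borel_measurable_times yk_measurable kg_measurable zero_Zd)

lemmas \<Phi>_TS = TS_meas[OF \<Phi>_meas]

lemma \<Phi>_dom1:
  assumes g: "bbm g" "!!s. \<bar>g s\<bar> \<le> M" and t: "t \<in> T3"
  shows "\<bar>\<Phi> f g t V\<bar> \<le> M * \<bar>case t of (x, x', u) => yk V x o0 * kg f V x x' * yk V x' u\<bar>"
proof -
  obtain x x' u where tt: "t = (x, x', u)" "x \<in> X" "x' \<in> X" "u \<in> X" using t by auto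
  have M: "0 \<le> M" using g(2)[of 0] by linarith
  have "\<bar>kg g V u o0\<bar> \<le> M" by (rule kg_bound[OF g M tt(4) zero_Zd])
  then have "\<bar>yk V x o0 * kg f V x x' * yk V x' u\<bar> * \<bar>kg g V u o0\<bar> \<le> \<bar>yk V x o0 * kg f V x x' * yk V x' u\<bar> * M"
    by (intro mult_left_mono) auto
  then show ?thesis unfolding \<Phi>_def tt by (simp add: abs_mult mult_ac)
qed

lemma \<Phi>_dom2:
  assumes f: "bbm f" "!!s. \<bar>f s\<bar> \<le> M" and t: "t \<in> T3"
  shows "\<bar>\<Phi> f g t V\<bar> \<le> M * \<bar>case t of (x, x', u) => yk V x o0 * kg g V u o0 * yk V x' u\<bar>"
proof -
  obtain x x' u where tt: "t = (x, x', u)" "x \<in> X" "x' \<in> X" "u \<in> X" using t by auto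
  have M: "0 \<le> M" using f(2)[of 0] by linarith
  have "\<bar>kg f V x x'\<bar> \<le> M" by (rule kg_bound[OF f M tt(2,3)])
  then have "\<bar>yk V x o0 * kg g V u o0 * yk V x' u\<bar> * \<bar>kg f V x x'\<bar> \<le> \<bar>yk V x o0 * kg g V u o0 * yk V x' u\<bar> * M"
    by (intro mult_left_mono) auto
  then show ?thesis unfolding \<Phi>_def tt by (simp add: abs_mult mult_ac)
qed

lemma \<Phi>_dom:
  assumes "(dec f \<and> bbm g) \<or> (bbm f \<and> dec g)"
  obtains W where "integrable TS W" "!!p. p \<in> space TS ==> \<bar>\<Phi> f g (fst p) (snd p)\<bar> \<le> W p"
proof -
  consider "dec f" "bbm g" | "bbm f" "dec g" using assms by blast
  then show ?thesis
  proof cases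
    case 1
    obtain M where "0 \<le> M" "!!s. \<bar>g s\<bar> \<le> M" using bbm_bound[OF 1(2)] by metis
    then show ?thesis
      by (intro that[OF integrable_mult_right[OF integrable_abs[OF base1[OF 1(1)]]]] \<Phi>_dom1 1) (auto simp: space_pair_measure)
  next
    case 2
    obtain M where "0 \<le> M" "!!s. \<bar>f s\<bar> \<le> M" using bbm_bound[OF 2(1)] by metis
    then show ?thesis
      by (intro that[OF integrable_mult_right[OF integrable_abs[OF base2[OF 2(2)]]]] \<Phi>_dom2 2) (auto simp: space_pair_measure)
  qed
qed

lemma \<Phi>_int:
  assumes "(dec f \<and> bbm g) \<or> (bbm f \<and> dec g)"
  shows "integrable TS (%p. \<Phi> f g (fst p) (snd p))"
proof -
  obtain W where W: "integrable TS W" "!!p. p \<in> space TS ==> \<bar>\<Phi> f g (fst p) (snd p)\<bar> \<le> W p" using \<Phi>_dom[OF assms] by blast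
  have b: "bbm f" "bbm g" using assms dec_bbm by auto
  show ?thesis
  proof (rule Bochner_Integration.integrable_bound[OF W(1) \<Phi>_TS[OF b]])
    show "AE p in TS. norm (\<Phi> f g (fst p) (snd p)) \<le> norm (W p)"
      using W(2) by (intro AE_I2) (fastforce intro: order_trans)
  qed
qed

text \<open>Normality in g is dominated convergence: the majorant from \<open>base1\<close> involves
  g only through a uniform bound.\<close>

lemma adm_Lf_right: assumes f: "dec f" shows "adm (Lf f)"
proof (rule admI)
  note bf = dec_bbm[OF f]
  fix g h :: "real => real" and c assume gh: "bbm g" "bbm h"
  show "Lf f (%t. g t + h t) = Lf f g + Lf f h"
    unfolding Lf_def
    by (subst Bochner_Integration.integral_add[symmetric, OF \<Phi>_int \<Phi>_int])
      (use f gh in \<open>auto intro!: Bochner_Integration.integral_cong simp: \<Phi>_def kg_add zero_Zd space_pair_measure algebra_simps\<close>)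
next
  fix c :: real and g :: "real => real" assume g: "bbm g"
  show "Lf f (%t. c * g t) = c * Lf f g"
    unfolding Lf_def integral_mult_right_zero[symmetric]
    by (rule Bochner_Integration.integral_cong) (auto simp: \<Phi>_def kg_scale g zero_Zd space_pair_measure)
next
  fix F :: "nat => real => real" and g B
  assume F: "!!n. bbm (F n)" "!!n t. \<bar>F n t\<bar> \<le> B" "!!t. (%n. F n t) \<longlonglongrightarrow> g t"
  have g: "bbm g" using bbm_LIMSEQ(1)[OF F] .
  show "(%n. Lf f (F n)) \<longlonglongrightarrow> Lf f g"
    unfolding Lf_def
  proof (rule integral_dominated_convergence)
    show "integrable TS (%p. B * \<bar>case fst p of (x, x', u) => yk (snd p) x o0 * kg f (snd p) x x' * yk (snd p) x' u\<bar>)"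
      by (intro integrable_mult_right integrable_abs base1 f)
    show "AE p in TS. norm (\<Phi> f (F n) (fst p) (snd p)) \<le> B * \<bar>case fst p of (x, x', u) => yk (snd p) x o0 * kg f (snd p) x x' * yk (snd p) x' u\<bar>" for n
      unfolding real_norm_def by (rule AE_I2, rule \<Phi>_dom1[OF F(1,2)]) (auto simp: space_pair_measure)
    show "AE p in TS. (%n. \<Phi> f (F n) (fst p) (snd p)) \<longlonglongrightarrow> \<Phi> f g (fst p) (snd p)"
      by (rule AE_I2) (auto simp: \<Phi>_def space_pair_measure intro!: tendsto_intros kg_lim F zero_Zd)
  qed (use F(1) g dec_bbm[OF f] in \<open>auto intro!: \<Phi>_TS\<close>)
qed

lemma adm_Lf_left: assumes g: "dec g" shows "adm (%f. Lf f g)"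
proof (rule admI)
  note bg = dec_bbm[OF g]
  fix f h :: "real => real" and c assume gh: "bbm f" "bbm h"
  show "Lf (%t. f t + h t) g = Lf f g + Lf h g"
    unfolding Lf_def
    by (subst Bochner_Integration.integral_add[symmetric, OF \<Phi>_int \<Phi>_int])
      (use g gh in \<open>auto intro!: Bochner_Integration.integral_cong simp: \<Phi>_def kg_add zero_Zd space_pair_measure algebra_simps\<close>)
next
  fix c :: real and f :: "real => real" assume f: "bbm f"
  show "Lf (%t. c * f t) g = c * Lf f g"
    unfolding Lf_def integral_mult_right_zero[symmetric]
    by (rule Bochner_Integration.integral_cong) (auto simp: \<Phi>_def kg_scale f zero_Zd space_pair_measure)
next
  fix F :: "nat => real => real" and f B
  assume F: "!!n. bbm (F n)" "!!n t. \<bar>F n t\<bar> \<le> B" "!!t. (%n. F n t) \<longlonglongrightarrow> f t"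
  have f: "bbm f" using bbm_LIMSEQ(1)[OF F] .
  have bg: "bbm g" using dec_bbm[OF g] .
  show "(%n. Lf (F n) g) \<longlonglongrightarrow> Lf f g"
    unfolding Lf_def
  proof (rule integral_dominated_convergence)
    show "integrable TS (%p. B * \<bar>case fst p of (x, x', u) => yk (snd p) x o0 * kg g (snd p) u o0 * yk (snd p) x' u\<bar>)"
      by (intro integrable_mult_right integrable_abs base2 g)
    show "AE p in TS. norm (\<Phi> (F n) g (fst p) (snd p)) \<le> B * \<bar>case fst p of (x, x', u) => yk (snd p) x o0 * kg g (snd p) u o0 * yk (snd p) x' u\<bar>" for n
      unfolding real_norm_def by (rule AE_I2, rule \<Phi>_dom2[OF F(1,2)]) (auto simp: space_pair_measure)
    show "AE p in TS. (%n. \<Phi> (F n) g (fst p) (snd p)) \<longlonglongrightarrow> \<Phi> f g (fst p) (snd p)"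
      by (rule AE_I2) (auto simp: \<Phi>_def space_pair_measure intro!: tendsto_intros kg_lim F zero_Zd)
  qed (use F(1) f bg in \<open>auto intro!: \<Phi>_TS\<close>)
qed

lemma pair_count:
  fixes A :: "'c set"
  assumes "countable A" shows "pair_sigma_finite (count_space A) \<Omega>"
  by (intro pair_sigma_finite.intro sigma_finite_measure_count_space_countable assms P.sigma_finite_measure_axioms)

lemma Fubini_count:
  fixes A :: "'c set"
  assumes A: "countable A" and i: "integrable (count_space A \<Otimes>\<^sub>M \<Omega>) (%p. \<Psi> (fst p) (snd p) :: real)"
  shows "AE V in \<Omega>. integrable (count_space A) (%t. \<Psi> t V)"
    "(\<integral>p. \<Psi> (fst p) (snd p) \<partial>(count_space A \<Otimes>\<^sub>M \<Omega>)) = (\<integral>V. (\<integral>t. \<Psi> t V \<partial>count_space A) \<partial>\<Omega>)"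
    "integrable \<Omega> (%V. \<integral>t. \<Psi> t V \<partial>count_space A)"
    "(\<integral>p. \<Psi> (fst p) (snd p) \<partial>(count_space A \<Otimes>\<^sub>M \<Omega>)) = (\<integral>t. (\<integral>V. \<Psi> t V \<partial>\<Omega>) \<partial>count_space A)"
proof -
  interpret pp: pair_sigma_finite "count_space A" \<Omega> by (rule pair_count[OF A])
  have "integrable (count_space A \<Otimes>\<^sub>M \<Omega>) (case_prod \<Psi>)" using i by (simp add: case_prod_beta')
  from pp.AE_integrable_snd[OF this] pp.integral_snd[OF this] pp.integrable_snd[OF this] pp.integral_fst[OF this]
  show "AE V in \<Omega>. integrable (count_space A) (%t. \<Psi> t V)"
    "(\<integral>p. \<Psi> (fst p) (snd p) \<partial>(count_space A \<Otimes>\<^sub>M \<Omega>)) = (\<integral>V. (\<integral>t. \<Psi> t V \<partial>count_space A) \<partial>\<Omega>)"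
    "integrable \<Omega> (%V. \<integral>t. \<Psi> t V \<partial>count_space A)"
    "(\<integral>p. \<Psi> (fst p) (snd p) \<partial>(count_space A \<Otimes>\<^sub>M \<Omega>)) = (\<integral>t. (\<integral>V. \<Psi> t V \<partial>\<Omega>) \<partial>count_space A)"
    by (simp_all add: case_prod_beta')
qed

text \<open>The commutator kernel as it occurs in \<open>Ymoment\<close>, whose integrand is defined
  for all configurations and not only for those in \<open>good\<close>.\<close>

definition yr :: "(site => real) => site => site => real" where
  "yr V x y = real_of_int (x 0 - y 0) * PF EF V x y"

text \<open>The vector Y H^n \<delta>_0; the box of radius n contains the support of H^n
  \<delta>_0.\<close>

definition zr :: "nat => (site => real) => site => real" where
  "zr n V x = (\<Sum>u\<in>box d n. (Hr d V ^^ n) (dr o0) u * yr V x u)"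

lemma yr_yk: "good V ==> yr V x y = yk V x y"
  by (simp add: yr_def yk_def pk_def kg_def PF_def)

lemma yr_meas: "x \<in> X ==> y \<in> X ==> (%V. yr V x y) \<in> borel_measurable \<Omega>"
  unfolding yr_def using PF_meas by measurable

lemma zr_meas: "x \<in> X ==> (%V. zr n V x) \<in> borel_measurable \<Omega>"
  unfolding zr_def using box_sub_Zd[of d n] by (intro borel_measurable_sum borel_measurable_times Hrn_meas yr_meas) auto

lemma Hrn_zr_meas: "x \<in> X ==> (%V. (Hr d V ^^ m) (zr n V) x) \<in> borel_measurable \<Omega>"
proof (induction m arbitrary: x)
  case 0 then show ?case using zr_meas by simp
next
  case (Suc m)
  have [measurable]: "(%V. (Hr d V ^^ m) (zr n V) y) \<in> borel_measurable \<Omega>" if "y \<in> nbrs d x" for y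
    using nbrs_Zd[OF Suc.prems] that by (intro Suc.IH) auto
  note [measurable] = Suc.IH[OF Suc.prems] comp_meas[OF Suc.prems]
  show ?case unfolding funpow.simps o_apply Hr_def[where x=x] by measurable
qed

lemma Yapply_eq: "Yapply d V EF n (%x. complex_of_real (v x)) = (%x. \<i> * complex_of_real (\<Sum>u\<in>box d n. v u * yr V x u))"
  by (auto simp: Yapply_def yr_def fermiP_PF fun_eq_iff sum_distrib_left mult_ac intro!: sum.cong)

lemma delta_dr: "delta y = (%x. complex_of_real (dr y x))" by (auto simp: delta_def dr_def)

lemma Ymoment_integrand:
  "innerZ d (Yapply d V EF 0 (delta o0)) ((Hop d V ^^ m) (Yapply d V EF n ((Hop d V ^^ n) (delta o0))))
    = complex_of_real (\<integral>x. yr V x o0 * (Hr d V ^^ m) (zr n V) x \<partial>count_space X)"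
proof -
  have 1: "Yapply d V EF 0 (delta o0) = (%x. \<i> * complex_of_real (yr V x o0))"
    unfolding delta_dr Yapply_eq box_0 by (simp add: dr_def)
  have 2: "(Hop d V ^^ m) (Yapply d V EF n ((Hop d V ^^ n) (delta o0))) = (%x. \<i> * complex_of_real ((Hr d V ^^ m) (zr n V) x))"
    unfolding delta_dr Hopn_of_real Yapply_eq zr_def[symmetric] Hopn_scale ..
  have 3: "cnj (\<i> * complex_of_real a) * (\<i> * complex_of_real b) = complex_of_real (a * b)" for a b by (simp add: complex_eq_iff)
  show ?thesis unfolding 1 2 innerZ_def 3 infsum_complex_of_real infsum_integral ..
qed

text \<open>For almost every potential the triple sum collapses, since powers of H have finite
  range: u runs over a box and x' over a finite set depending on x. Measurability of the original
  integrand is shown separately because the two integrands agree only almost surely.\<close>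

lemma Ymoment_eq: "Ymoment d \<rho> EF m n = complex_of_real (Lf (pw m) (pw n))"
proof -
  have mes: "(%V. \<integral>x. yr V x o0 * (Hr d V ^^ m) (zr n V) x \<partial>count_space X) \<in> borel_measurable \<Omega>"
  proof -
    interpret cs: sigma_finite_measure "count_space X" by (rule sigma_finite_measure_count_space_countable[OF countable_Zd])
    have "(%p. yr (snd p) (fst p) o0 * (Hr d (snd p) ^^ m) (zr n (snd p)) (fst p)) \<in> borel_measurable (count_space X \<Otimes>\<^sub>M \<Omega>)"
      by (rule measurable_pair_measure_countable1[OF countable_Zd]) (simp, intro borel_measurable_times yr_meas Hrn_zr_meas zero_Zd)
    then have "(%(V, x). yr V x o0 * (Hr d V ^^ m) (zr n V) x) \<in> borel_measurable (\<Omega> \<Otimes>\<^sub>M count_space X)"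
      by (subst measurable_pair_swap_iff) (simp add: case_prod_beta')
    then show ?thesis by (rule cs.borel_measurable_lebesgue_integral)
  qed
  have ip: "integrable TS (%p. \<Phi> (pw m) (pw n) (fst p) (snd p))" by (rule \<Phi>_int) (simp add: dec_pw bbm_pw)
  note F = Fubini_count[OF countable_T3 ip]
  have "Ymoment d \<rho> EF m n = complex_of_real (\<integral>V. (\<integral>x. yr V x o0 * (Hr d V ^^ m) (zr n V) x \<partial>count_space X) \<partial>\<Omega>)"
    unfolding Ymoment_def Ymoment_integrand by simp
  also have "(\<integral>V. (\<integral>x. yr V x o0 * (Hr d V ^^ m) (zr n V) x \<partial>count_space X) \<partial>\<Omega>) = (\<integral>V. (\<integral>t. \<Phi> (pw m) (pw n) t V \<partial>count_space T3) \<partial>\<Omega>)"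
  proof (rule integral_cong_AE[OF mes borel_measurable_integrable[OF F(3)]])
    show "AE V in \<Omega>. (\<integral>x. yr V x o0 * (Hr d V ^^ m) (zr n V) x \<partial>count_space X) = (\<integral>t. \<Phi> (pw m) (pw n) t V \<partial>count_space T3)"
      using F(1) AE_good
    proof eventually_elim
      fix V assume i: "integrable (count_space T3) (%t. \<Phi> (pw m) (pw n) t V)" and g: "good V"
      note AEi = integrable_count_section[OF i]
      have z: "zr n V x' = (\<integral>u. yk V x' u * kg (pw n) V u o0 \<partial>count_space X)" if "x' \<in> X" for x'
      proof -
        have "(\<integral>u. yk V x' u * kg (pw n) V u o0 \<partial>count_space X) = (\<Sum>u\<in>box d n. yk V x' u * kg (pw n) V u o0)"
          by (rule integral_count_finite_support[OF finite_box box_sub_Zd])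
            (use Hrn_range_box[of _ d n V] kg_pw[OF g _ zero_Zd] in fastforce)
        also have "\<dots> = zr n V x'" unfolding zr_def
          by (intro sum.cong refl) (use box_sub_Zd[of d n] kg_pw[OF g _ zero_Zd] in \<open>auto simp: yr_yk[OF g]\<close>)
        finally show ?thesis by simp
      qed
      have h: "(Hr d V ^^ m) (zr n V) x = (\<integral>x'. kg (pw m) V x x' * zr n V x' \<partial>count_space X)" if x: "x \<in> X" for x
      proof -
        let ?S = "supp ((Hr d V ^^ m) (dr x))"
        have fsS: "fs d ((Hr d V ^^ m) (dr x))" by (intro fs_Hrn fs_dr x)
        have k: "kg (pw m) V x x' = (Hr d V ^^ m) (dr x) x'" if "x' \<in> X" for x'
          using kg_pw[OF g that x] kg_sym[OF bbm_pw x that] by simp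
        have "(\<integral>x'. kg (pw m) V x x' * zr n V x' \<partial>count_space X) = (\<Sum>x'\<in>?S. kg (pw m) V x x' * zr n V x')"
          by (rule integral_count_finite_support) (use fsS k in \<open>auto simp: fs_def supp_def\<close>)
        also have "\<dots> = ip ((Hr d V ^^ m) (dr x)) (zr n V)"
          unfolding ip_def by (intro sum.cong refl) (use fsS k in \<open>auto simp: fs_def\<close>)
        also have "\<dots> = (Hr d V ^^ m) (zr n V) x" by (simp add: ip_Hrn_sym_general[OF fs_dr[OF x]] ip_dr_left)
        finally show ?thesis by simp
      qed
      have "(\<integral>t. \<Phi> (pw m) (pw n) t V \<partial>count_space T3) = (\<integral>x. (\<integral>q. \<Phi> (pw m) (pw n) (x, q) V \<partial>count_space (X \<times> X)) \<partial>count_space X)"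
        by (rule integral_count_prod(1)[OF countable_Zd _ i]) (intro countable_SIGMA countable_Zd)
      also have "\<dots> = (\<integral>x. (\<integral>x'. (\<integral>u. \<Phi> (pw m) (pw n) (x, x', u) V \<partial>count_space X) \<partial>count_space X) \<partial>count_space X)"
        by (intro Bochner_Integration.integral_cong refl integral_count_prod(1)[OF countable_Zd countable_Zd AEi]) simp
      also have "\<dots> = (\<integral>x. yr V x o0 * (Hr d V ^^ m) (zr n V) x \<partial>count_space X)"
      proof (intro Bochner_Integration.integral_cong refl)
        fix x assume "x \<in> space (count_space X)" then have x: "x \<in> X" by simp
        have "(\<integral>u. \<Phi> (pw m) (pw n) (x, x', u) V \<partial>count_space X) = yk V x o0 * (kg (pw m) V x x' * zr n V x')" if "x' \<in> X" for x'
          by (simp add: \<Phi>_def z[OF that] mult.assoc)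
        then have "(\<integral>x'. (\<integral>u. \<Phi> (pw m) (pw n) (x, x', u) V \<partial>count_space X) \<partial>count_space X) = (\<integral>x'. yk V x o0 * (kg (pw m) V x x' * zr n V x') \<partial>count_space X)"
          by (intro Bochner_Integration.integral_cong) auto
        then show "(\<integral>x'. (\<integral>u. \<Phi> (pw m) (pw n) (x, x', u) V \<partial>count_space X) \<partial>count_space X) = yr V x o0 * (Hr d V ^^ m) (zr n V) x"
          by (simp add: h[OF x] yr_yk[OF g])
      qed
      finally show "(\<integral>x. yr V x o0 * (Hr d V ^^ m) (zr n V) x \<partial>count_space X) = (\<integral>t. \<Phi> (pw m) (pw n) t V \<partial>count_space T3)" ..
    qed
  qed
  also have "\<dots> = Lf (pw m) (pw n)" unfolding Lf_def F(2) ..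
  finally show ?thesis .
qed

end

section \<open>Positivity through the trace per unit volume\<close>

lemma nn_count_le:
  fixes f :: "'a => real"
  assumes "!!x. x \<in> A ==> 0 \<le> f x" "!!S. finite S ==> S \<subseteq> A ==> sum f S \<le> B"
  shows "(\<integral>\<^sup>+x. ennreal (f x) \<partial>count_space A) \<le> ennreal B"
proof -
  have s: "f summable_on A" by (rule nonneg_bdd_above_summable_on) (use assms in \<open>auto intro!: bdd_aboveI[of _ B]\<close>)
  then have "(%x. \<bar>f x\<bar>) summable_on A" by (rule summable_on_cong[THEN iffD1, rotated]) (simp add: assms)
  then have i: "integrable (count_space A) f" by (simp add: integrable_count_summable)
  have "(\<integral>\<^sup>+x. ennreal (f x) \<partial>count_space A) = ennreal (infsum f A)"
    unfolding infsum_integral by (rule nn_integral_eq_integral[OF i]) (simp add: AE_count_space assms)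
  also have "\<dots> \<le> ennreal B" by (intro ennreal_leI infsum_le_finite_sums s assms(2))
  finally show ?thesis .
qed

lemma integral_count_prod_factor:
  fixes A B :: "'a => real"
  assumes "countable S" and i: "integrable (count_space (S \<times> S)) (%p. c * (A (fst p) * B (snd p)))"
  shows "(\<integral>p. c * (A (fst p) * B (snd p)) \<partial>count_space (S \<times> S)) = c * ((\<integral>x. A x \<partial>count_space S) * (\<integral>y. B y \<partial>count_space S))"
  unfolding integral_count_prod(1)[OF assms(1,1) i] by simp

context bounded_potential
begin

lemma bessel_pair:
  assumes x: "x \<in> Zd d" "y \<in> Zd d" and f: "bbm f" "!!t. \<bar>f t\<bar> \<le> c" and g: "bbm g" "!!t. \<bar>g t\<bar> \<le> c"
  shows "(\<integral>\<^sup>+u. ennreal \<bar>rf d V f (dr x) (dr u) * rf d V g (dr u) (dr y)\<bar> \<partial>count_space (Zd d)) \<le> ennreal (4 * c\<^sup>2)"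
proof (rule nn_count_le)
  fix S assume S: "finite S" "S \<subseteq> Zd d"
  have "(\<Sum>u\<in>S. \<bar>rf d V f (dr x) (dr u) * rf d V g (dr u) (dr y)\<bar>) \<le> (\<Sum>u\<in>S. ((rf d V f (dr x) (dr u))\<^sup>2 + (rf d V g (dr u) (dr y))\<^sup>2) / 2)"
  proof (rule sum_mono)
    fix u
    have "2 * (\<bar>rf d V f (dr x) (dr u)\<bar> * \<bar>rf d V g (dr u) (dr y)\<bar>) \<le> \<bar>rf d V f (dr x) (dr u)\<bar>\<^sup>2 + \<bar>rf d V g (dr u) (dr y)\<bar>\<^sup>2"
      using sum_squares_bound[of "\<bar>rf d V f (dr x) (dr u)\<bar>" "\<bar>rf d V g (dr u) (dr y)\<bar>"] by (simp add: mult.assoc)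
    then show "\<bar>rf d V f (dr x) (dr u) * rf d V g (dr u) (dr y)\<bar> \<le> ((rf d V f (dr x) (dr u))\<^sup>2 + (rf d V g (dr u) (dr y))\<^sup>2) / 2"
      by (simp add: abs_mult)
  qed
  also have "\<dots> = ((\<Sum>u\<in>S. (rf d V f (dr x) (dr u))\<^sup>2) + (\<Sum>u\<in>S. (rf d V g (dr u) (dr y))\<^sup>2)) / 2"
    by (simp add: sum.distrib sum_divide_distrib[symmetric])
  also have "\<dots> \<le> (4 * c\<^sup>2 * 1 + 4 * c\<^sup>2 * 1) / 2"
    using bessel[OF fs_dr[OF x(1)] f S] bessel_right[OF fs_dr[OF x(2)] g S] by (simp add: ip_dr_dr)
  finally show "(\<Sum>u\<in>S. \<bar>rf d V f (dr x) (dr u) * rf d V g (dr u) (dr y)\<bar>) \<le> 4 * c\<^sup>2" by simp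
qed simp

lemma rf_double_sum:
  assumes f: "bbm f" "!!t. t \<in> {-C..C} ==> 0 \<le> f t" and S: "finite S" "S \<subseteq> Zd d"
  shows "0 \<le> (\<Sum>(x, y)\<in>S \<times> S. rf d V f (dr x) (dr y) * (c x * c y))"
proof -
  define v where "v = (%z. \<Sum>u\<in>S. c u * dr u z)"
  have fv: "fs d v" unfolding v_def using S by (intro fs_sum fs_scale fs_dr) auto
  have "rf d V f v v = (\<Sum>x\<in>S. c x * rf d V f v (dr x))"
    using rf_expand[OF fv f(1) S, of c] by (simp add: v_def)
  also have "\<dots> = (\<Sum>x\<in>S. c x * (\<Sum>y\<in>S. c y * rf d V f (dr x) (dr y)))"
  proof (intro sum.cong refl arg_cong2[where f="(*)"])
    fix x assume "x \<in> S" then have x: "fs d (dr x)" using S fs_dr by auto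
    show "rf d V f v (dr x) = (\<Sum>y\<in>S. c y * rf d V f (dr x) (dr y))"
      using rf_expand[OF x f(1) S, of c] rf_sym[OF x fv f(1)] by (simp add: v_def)
  qed
  also have "\<dots> = (\<Sum>(x, y)\<in>S \<times> S. rf d V f (dr x) (dr y) * (c x * c y))"
    by (simp add: sum_distrib_left sum.cartesian_product[symmetric] mult_ac)
  finally show ?thesis using rf_pos[OF fv f] by simp
qed

end

context fermi
begin

lemma good_tau: "a' \<in> X ==> good (tau d a' V) \<longleftrightarrow> good V"
proof
  assume a: "a' \<in> X" and g: "good (tau d a' V)"
  show "good V" unfolding good_def
  proof
    fix x assume x: "x \<in> X"
    have "sh (neg a') x \<in> X" by (intro sh_Zd neg_Zd a x)
    then show "\<bar>V x\<bar> \<le> Rad" using g unfolding good_def tau_def by (metis restrict_apply' sh_neg(1))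
  qed
qed (auto simp: good_def tau_def sh_Zd)

lemma kg_tau: "a' \<in> X ==> x \<in> X ==> y \<in> X ==> kg f (tau d a' V) x y = kg f V (sh a' x) (sh a' y)"
  by (simp add: kg_def good_tau rf_tau)

lemma yk_tau: "a' \<in> X ==> x \<in> X ==> y \<in> X ==> yk (tau d a' V) x y = yk V (sh a' x) (sh a' y)"
  by (simp add: yk_def pk_def kg_tau sh_def)

lemma integral_tau:
  fixes F :: "(site => real) => real"
  assumes a: "a' \<in> X" and F: "F \<in> borel_measurable \<Omega>"
  shows "(\<integral>V. F (tau d a' V) \<partial>\<Omega>) = (\<integral>V. F V \<partial>\<Omega>)" "EN (%V. F (tau d a' V)) = EN (%V. F V)"
proof -
  have "(\<integral>V. F (tau d a' V) \<partial>\<Omega>) = (\<integral>V. F V \<partial>distr \<Omega> \<Omega> (tau d a'))"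
    by (rule integral_distr[symmetric, OF distr_tau(1)[OF a] F])
  then show "(\<integral>V. F (tau d a' V) \<partial>\<Omega>) = (\<integral>V. F V \<partial>\<Omega>)" by (simp add: distr_tau(2)[OF a])
  have m: "(%V. ennreal \<bar>F V\<bar>) \<in> borel_measurable \<Omega>" using F by measurable
  have "EN (%V. F (tau d a' V)) = (\<integral>\<^sup>+V. ennreal \<bar>F V\<bar> \<partial>distr \<Omega> \<Omega> (tau d a'))"
    by (rule nn_integral_distr[symmetric, OF distr_tau(1)[OF a]]) (use m in simp)
  then show "EN (%V. F (tau d a' V)) = EN (%V. F V)" by (simp add: distr_tau(2)[OF a])
qed

abbreviation "T4 \<equiv> T3 \<times> X"

lemma countable_T4: "countable T4" by (intro countable_SIGMA countable_Zd)

text \<open>The expansion of \<open>Lf\<close> at f and the square of h, with the kernel of h(H)^2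
  from u to 0 written out through an intermediate site v.\<close>

definition Fq :: "(real => real) => (real => real) => (site \<times> site \<times> site) \<times> site => (site => real) => real" where
  "Fq f h t V = (case t of ((x, x', u), v) => yk V x o0 * kg f V x x' * yk V x' u * (kg h V u v * kg h V v o0))"

text \<open>What \<open>Fq\<close> becomes when v is translated to the origin: one factor h now
  stands on each side, as in <Yh\<delta>_0, f Yh\<delta>_0>. This is cyclicity of the trace per unit
  volume.\<close>

definition Gq :: "(real => real) => (real => real) => (site \<times> site \<times> site) \<times> site => (site => real) => real" where
  "Gq f h t V = (case t of ((x, x', u), v) => yk V x v * kg f V x x' * yk V x' u * (kg h V u o0 * kg h V o0 v))"

text \<open>Translation by -v, with the old origin relabelled as -v. It is an involution, hence a
  bijection of the index set.\<close>

definition sg :: "(site \<times> site \<times> site) \<times> site => (site \<times> site \<times> site) \<times> site" where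
  "sg t = (case t of ((x, x', u), v) => ((sh (neg v) x, sh (neg v) x', sh (neg v) u), neg v))"

lemma neg_neg: "neg (neg v) = v" by (simp add: neg_def)

lemma sg_bij: "bij_betw sg T4 T4"
  by (rule bij_betw_byWitness[where f'=sg]) (auto simp: sg_def neg_neg sh_Zd neg_Zd)

lemma Fq_meas: "bbm f ==> bbm h ==> t \<in> T4 ==> Fq f h t \<in> borel_measurable \<Omega>"
  unfolding Fq_def[abs_def] by (auto intro!: borel_measurable_times yk_measurable kg_measurable zero_Zd)

lemma Gq_meas: "bbm f ==> bbm h ==> t \<in> T4 ==> Gq f h t \<in> borel_measurable \<Omega>"
  unfolding Gq_def[abs_def] by (auto intro!: borel_measurable_times yk_measurable kg_measurable zero_Zd)

lemma Fq_tau: "t \<in> T4 ==> Fq f h t (tau d (neg (snd t)) V) = Gq f h (sg t) V"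
proof -
  have "sh (neg v) v = o0" "sh v o0 = v" for v :: "nat => int" by (simp_all add: sh_def neg_def)
  then show "t \<in> T4 ==> Fq f h t (tau d (neg (snd t)) V) = Gq f h (sg t) V"
    by (auto simp: Fq_def Gq_def sg_def kg_tau yk_tau neg_Zd zero_Zd)
qed

lemma TQ_meas:
  assumes "!!t. t \<in> T4 ==> \<Psi> t \<in> borel_measurable \<Omega>"
  shows "(%p. \<Psi> (fst p) (snd p)) \<in> borel_measurable (count_space T4 \<Otimes>\<^sub>M \<Omega>)"
  by (rule measurable_pair_measure_countable1[OF countable_T4]) (simp add: assms)

lemma Fq_int:
  assumes f: "dec f" and h: "bbm h"
  shows "integrable (count_space T4 \<Otimes>\<^sub>M \<Omega>) (%p. Fq f h (fst p) (snd p))"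
proof (rule integrableI_bounded)
  note bf = dec_bbm[OF f]
  obtain c where c: "0 \<le> c" "!!t. \<bar>h t\<bar> \<le> c" using bbm_bound[OF h] by metis
  show m: "(%p. Fq f h (fst p) (snd p)) \<in> borel_measurable (count_space T4 \<Otimes>\<^sub>M \<Omega>)" by (intro TQ_meas Fq_meas bf h)
  interpret pp: pair_sigma_finite "count_space T4" \<Omega> by (rule pair_count[OF countable_T4])
  interpret p3: pair_sigma_finite "count_space T3" \<Omega> by (rule pair_count[OF countable_T3])
  let ?b = "%t V. \<bar>case t of (x, x', u) => yk V x o0 * kg f V x x' * yk V x' u\<bar>"
  have in3: "(\<integral>\<^sup>+v. ennreal \<bar>Fq f h (t, v) V\<bar> \<partial>count_space X) \<le> ennreal (4 * c\<^sup>2) * ennreal (?b t V)" if t: "t \<in> T3" for t V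
  proof -
    obtain x x' u where tt: "t = (x, x', u)" "x \<in> X" "x' \<in> X" "u \<in> X" using t by auto
    have k: "(\<integral>\<^sup>+v. ennreal \<bar>kg h V u v * kg h V v o0\<bar> \<partial>count_space X) \<le> ennreal (4 * c\<^sup>2)"
    proof (cases "good V")
      case True
      then show ?thesis using bounded_potential.bessel_pair[OF good_bp[OF True] tt(4) zero_Zd h c(2) h c(2)] by (simp add: kg_def)
    qed (simp add: kg_def)
    have "(\<integral>\<^sup>+v. ennreal \<bar>Fq f h (t, v) V\<bar> \<partial>count_space X) = (\<integral>\<^sup>+v. ennreal (?b t V) * ennreal \<bar>kg h V u v * kg h V v o0\<bar> \<partial>count_space X)"
      by (simp add: Fq_def tt abs_mult ennreal_mult[symmetric] mult_ac)
    also have "\<dots> = ennreal (?b t V) * (\<integral>\<^sup>+v. ennreal \<bar>kg h V u v * kg h V v o0\<bar> \<partial>count_space X)" by (rule nn_integral_cmult) simp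
    also have "\<dots> \<le> ennreal (?b t V) * ennreal (4 * c\<^sup>2)" by (intro mult_left_mono k) simp
    finally show ?thesis by (simp add: mult.commute)
  qed
  have b1: "integrable TS (%p. ?b (fst p) (snd p))" using integrable_abs[OF base1[OF f]] by simp
  have "(\<integral>\<^sup>+p. ennreal (norm (Fq f h (fst p) (snd p))) \<partial>(count_space T4 \<Otimes>\<^sub>M \<Omega>))
      = (\<integral>\<^sup>+V. (\<integral>\<^sup>+t. ennreal \<bar>Fq f h t V\<bar> \<partial>count_space T4) \<partial>\<Omega>)"
    using pp.nn_integral_snd[of "%p. ennreal (norm (Fq f h (fst p) (snd p)))"] m by simp
  also have "\<dots> = (\<integral>\<^sup>+V. (\<integral>\<^sup>+t. (\<integral>\<^sup>+v. ennreal \<bar>Fq f h (t, v) V\<bar> \<partial>count_space X) \<partial>count_space T3) \<partial>\<Omega>)"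
    by (simp add: nn_count_prod[OF countable_T3 countable_Zd])
  also have "\<dots> \<le> (\<integral>\<^sup>+V. (\<integral>\<^sup>+t. ennreal (4 * c\<^sup>2) * ennreal (?b t V) \<partial>count_space T3) \<partial>\<Omega>)"
    by (intro nn_integral_mono in3) simp
  also have "\<dots> = (\<integral>\<^sup>+p. ennreal (4 * c\<^sup>2) * ennreal (?b (fst p) (snd p)) \<partial>TS)"
    using p3.nn_integral_snd[of "%p. ennreal (4 * c\<^sup>2) * ennreal (?b (fst p) (snd p))"] borel_measurable_integrable[OF b1] by simp
  also have "\<dots> = ennreal (4 * c\<^sup>2) * (\<integral>\<^sup>+p. ennreal (?b (fst p) (snd p)) \<partial>TS)"
    by (rule nn_integral_cmult) (use borel_measurable_integrable[OF b1] in measurable)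
  also have "\<dots> < \<infinity>"
    using b1 unfolding integrable_iff_bounded by (simp add: ennreal_mult_less_top)
  finally show "(\<integral>\<^sup>+p. ennreal (norm (Fq f h (fst p) (snd p))) \<partial>(count_space T4 \<Otimes>\<^sub>M \<Omega>)) < \<infinity>" .
qed

text \<open>The shift -v varies with the summation index, but the expectation of each single summand
  is invariant; so absolute convergence and the value of the sum pass from \<open>Fq\<close> to
  \<open>Gq\<close> term by term.\<close>

lemma Gq_int:
  assumes f: "dec f" and h: "bbm h"
  shows "integrable (count_space T4 \<Otimes>\<^sub>M \<Omega>) (%p. Gq f h (fst p) (snd p))"
    "(\<integral>p. Gq f h (fst p) (snd p) \<partial>(count_space T4 \<Otimes>\<^sub>M \<Omega>)) = (\<integral>p. Fq f h (fst p) (snd p) \<partial>(count_space T4 \<Otimes>\<^sub>M \<Omega>))"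
proof -
  note bf = dec_bbm[OF f]
  note Fi = Fq_int[OF f h]
  have m: "(%p. Gq f h (fst p) (snd p)) \<in> borel_measurable (count_space T4 \<Otimes>\<^sub>M \<Omega>)" by (intro TQ_meas Gq_meas bf h)
  have mF: "(%p. Fq f h (fst p) (snd p)) \<in> borel_measurable (count_space T4 \<Otimes>\<^sub>M \<Omega>)" by (intro TQ_meas Fq_meas bf h)
  have s: "snd t \<in> X ==> neg (snd t) \<in> X" for t :: "(site \<times> site \<times> site) \<times> site" by (rule neg_Zd)
  have e: "(\<integral>V. Gq f h (sg t) V \<partial>\<Omega>) = (\<integral>V. Fq f h t V \<partial>\<Omega>)"
    "EN (%V. Gq f h (sg t) V) = EN (%V. Fq f h t V)" if t: "t \<in> T4" for t
    using integral_tau[OF _ Fq_meas[OF bf h t], of "neg (snd t)"] s[of t] t Fq_tau[OF t] by auto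
  have "(\<integral>\<^sup>+p. ennreal (norm (Gq f h (fst p) (snd p))) \<partial>(count_space T4 \<Otimes>\<^sub>M \<Omega>)) = (\<integral>\<^sup>+t. EN (%V. Gq f h t V) \<partial>count_space T4)"
    using P.nn_integral_fst[of "%p. ennreal (norm (Gq f h (fst p) (snd p)))" "count_space T4"] m by simp
  also have "\<dots> = (\<integral>\<^sup>+t. EN (%V. Gq f h (sg t) V) \<partial>count_space T4)"
    by (rule nn_integral_bij_count_space[OF sg_bij, symmetric])
  also have "\<dots> = (\<integral>\<^sup>+t. EN (%V. Fq f h t V) \<partial>count_space T4)" by (intro nn_integral_cong e(2)) simp
  also have "\<dots> = (\<integral>\<^sup>+p. ennreal (norm (Fq f h (fst p) (snd p))) \<partial>(count_space T4 \<Otimes>\<^sub>M \<Omega>))"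
    using P.nn_integral_fst[of "%p. ennreal (norm (Fq f h (fst p) (snd p)))" "count_space T4"] mF by simp
  also have "\<dots> < \<infinity>" using Fi unfolding integrable_iff_bounded by simp
  finally show i: "integrable (count_space T4 \<Otimes>\<^sub>M \<Omega>) (%p. Gq f h (fst p) (snd p))" using m by (intro integrableI_bounded)
  have "(\<integral>p. Gq f h (fst p) (snd p) \<partial>(count_space T4 \<Otimes>\<^sub>M \<Omega>)) = (\<integral>t. (\<integral>V. Gq f h t V \<partial>\<Omega>) \<partial>count_space T4)"
    by (rule Fubini_count(4)[OF countable_T4 i])
  also have "\<dots> = (\<integral>t. (\<integral>V. Gq f h (sg t) V \<partial>\<Omega>) \<partial>count_space T4)" by (rule integral_bij_count_space[OF sg_bij, symmetric])
  also have "\<dots> = (\<integral>t. (\<integral>V. Fq f h t V \<partial>\<Omega>) \<partial>count_space T4)" by (intro Bochner_Integration.integral_cong refl e(1)) simp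
  also have "\<dots> = (\<integral>p. Fq f h (fst p) (snd p) \<partial>(count_space T4 \<Otimes>\<^sub>M \<Omega>))" by (rule Fubini_count(4)[OF countable_T4 Fi, symmetric])
  finally show "(\<integral>p. Gq f h (fst p) (snd p) \<partial>(count_space T4 \<Otimes>\<^sub>M \<Omega>)) = (\<integral>p. Fq f h (fst p) (snd p) \<partial>(count_space T4 \<Otimes>\<^sub>M \<Omega>))" .
qed

lemma kg_square:
  assumes h: "bbm h" and x: "x \<in> X" "y \<in> X"
  shows "kg (%t. h t * h t) V x y = (\<integral>v. kg h V x v * kg h V v y \<partial>count_space X)"
proof (cases "good V")
  case True
  from bounded_potential.rf_mult(1)[OF good_bp[OF True] fs_dr[OF x(1)] fs_dr[OF x(2)] h h]
  show ?thesis unfolding infsum_integral[symmetric] by (simp add: kg_def True infsumI)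
qed (simp add: kg_def)

text \<open>The vector Y h(H) \<delta>_0, on which \<open>Q\<close> evaluates the quadratic form of
  f(H).\<close>

definition \<psi> :: "(real => real) => (site => real) => site => real" where
  "\<psi> h V x = (\<integral>u. yk V x u * kg h V u o0 \<partial>count_space X)"

definition Q :: "(real => real) => (real => real) => (site => real) => real" where
  "Q f h V = (\<integral>p. kg f V (fst p) (snd p) * (\<psi> h V (fst p) * \<psi> h V (snd p)) \<partial>count_space (X \<times> X))"

text \<open>Grouping the indices as (x, x') and (v, u) makes the inner sum a product of two separate
  sums, each of them a value of \<open>\<psi>\<close>.\<close>

lemma Gq_Q:
  assumes h: "bbm h" and i: "integrable (count_space T4) (%t. Gq f h t V)"
  shows "(\<integral>t. Gq f h t V \<partial>count_space T4) = Q f h V"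
    "integrable (count_space (X \<times> X)) (%p. kg f V (fst p) (snd p) * (\<psi> h V (fst p) * \<psi> h V (snd p)))"
proof -
  define k where "k = (%p q. kg f V (fst p) (snd p) * ((yk V (fst p) (fst q) * kg h V (fst q) o0) * (yk V (snd p) (snd q) * kg h V (snd q) o0)))"
  let ?r = "%(p, q). ((fst p, snd p, snd q), fst q)"
  have cXX: "countable (X \<times> X)" by (intro countable_SIGMA countable_Zd)
  have bij: "bij_betw ?r ((X \<times> X) \<times> (X \<times> X)) T4"
    by (rule bij_betw_byWitness[where f'="%((x, x', u), v). ((x, x'), (v, u))"]) auto
  have r: "Gq f h (?r t) V = k (fst t) (snd t)" if "t \<in> (X \<times> X) \<times> (X \<times> X)" for t
    using that kg_sym[OF h, of _ o0 V] zero_Zd by (auto simp: Gq_def k_def)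
  have i2: "integrable (count_space ((X \<times> X) \<times> (X \<times> X))) (%t. k (fst t) (snd t))"
    using i integrable_bij_count_space[OF bij, of "%t. Gq f h t V"] r
    by (subst Bochner_Integration.integrable_cong[OF refl, of _ _ "%t. Gq f h (?r t) V"]) auto
  have inn: "(\<integral>q. k p q \<partial>count_space (X \<times> X)) = kg f V (fst p) (snd p) * (\<psi> h V (fst p) * \<psi> h V (snd p))" if "p \<in> X \<times> X" for p
    unfolding k_def \<psi>_def
    by (rule integral_count_prod_factor[OF countable_Zd]) (use integrable_count_section[OF i2 that] in \<open>simp add: k_def\<close>)
  have "(\<integral>t. Gq f h t V \<partial>count_space T4) = (\<integral>t. Gq f h (?r t) V \<partial>count_space ((X \<times> X) \<times> (X \<times> X)))"
    by (rule integral_bij_count_space[OF bij, symmetric])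
  also have "\<dots> = (\<integral>t. k (fst t) (snd t) \<partial>count_space ((X \<times> X) \<times> (X \<times> X)))"
    by (rule Bochner_Integration.integral_cong[OF refl r]) simp
  also have "\<dots> = (\<integral>p. (\<integral>q. k p q \<partial>count_space (X \<times> X)) \<partial>count_space (X \<times> X))"
    using integral_count_prod(1)[OF cXX cXX i2] by simp
  also have "\<dots> = Q f h V" unfolding Q_def by (intro Bochner_Integration.integral_cong refl inn) simp
  finally show "(\<integral>t. Gq f h t V \<partial>count_space T4) = Q f h V" .
  have "integrable (count_space (X \<times> X)) (%p. \<integral>q. k p q \<partial>count_space (X \<times> X))"
    using integral_count_prod(3)[OF cXX cXX i2] by simp
  then show "integrable (count_space (X \<times> X)) (%p. kg f V (fst p) (snd p) * (\<psi> h V (fst p) * \<psi> h V (snd p)))"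
    by (rule Bochner_Integration.integrable_cong[THEN iffD1, OF refl, rotated]) (rule inn, simp)
qed

text \<open>Summation over v restores the square of h in \<open>Fq\<close>, stationarity leads from
  \<open>Fq\<close> to \<open>Gq\<close>, and \<open>Gq_Q\<close> reads off the quadratic
  form.\<close>

theorem Lf_trace:
  assumes f: "dec f" and h: "bbm h"
  shows "Lf f (%t. h t * h t) = (\<integral>V. (\<integral>t. Gq f h t V \<partial>count_space T4) \<partial>\<Omega>)"
    "AE V in \<Omega>. (\<integral>t. Gq f h t V \<partial>count_space T4) = Q f h V \<and> integrable (count_space (X \<times> X)) (%p. kg f V (fst p) (snd p) * (\<psi> h V (fst p) * \<psi> h V (snd p)))"
    "integrable \<Omega> (%V. \<integral>t. Gq f h t V \<partial>count_space T4)"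
proof -
  have hh: "bbm (%t. h t * h t)" by (rule bbm_mult[OF h h])
  note F = Fubini_count[OF countable_T4 Fq_int[OF f h]] and G = Fubini_count[OF countable_T4 Gq_int(1)[OF f h]]
  have ip: "integrable TS (%p. \<Phi> f (%t. h t * h t) (fst p) (snd p))" by (rule \<Phi>_int) (simp add: f hh)
  note L = Fubini_count[OF countable_T3 ip]
  have "Lf f (%t. h t * h t) = (\<integral>V. (\<integral>t. \<Phi> f (%t. h t * h t) t V \<partial>count_space T3) \<partial>\<Omega>)" unfolding Lf_def L(2) ..
  also have "\<dots> = (\<integral>V. (\<integral>t. Fq f h t V \<partial>count_space T4) \<partial>\<Omega>)"
  proof (rule integral_cong_AE[OF borel_measurable_integrable[OF L(3)] borel_measurable_integrable[OF F(3)]])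
    show "AE V in \<Omega>. (\<integral>t. \<Phi> f (%t. h t * h t) t V \<partial>count_space T3) = (\<integral>t. Fq f h t V \<partial>count_space T4)"
      using F(1)
    proof eventually_elim
      fix V assume i: "integrable (count_space T4) (%t. Fq f h t V)"
      have "(\<integral>t. Fq f h t V \<partial>count_space T4) = (\<integral>t. (\<integral>v. Fq f h (t, v) V \<partial>count_space X) \<partial>count_space T3)"
        by (rule integral_count_prod(1)[OF countable_T3 countable_Zd i])
      also have "\<dots> = (\<integral>t. \<Phi> f (%t. h t * h t) t V \<partial>count_space T3)"
        by (intro Bochner_Integration.integral_cong refl) (auto simp: Fq_def \<Phi>_def kg_square[OF h _ zero_Zd])
      finally show "(\<integral>t. \<Phi> f (%t. h t * h t) t V \<partial>count_space T3) = (\<integral>t. Fq f h t V \<partial>count_space T4)" ..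
    qed
  qed
  also have "\<dots> = (\<integral>V. (\<integral>t. Gq f h t V \<partial>count_space T4) \<partial>\<Omega>)"
    unfolding F(2)[symmetric] G(2)[symmetric] by (rule Gq_int(2)[OF f h, symmetric])
  finally show "Lf f (%t. h t * h t) = (\<integral>V. (\<integral>t. Gq f h t V \<partial>count_space T4) \<partial>\<Omega>)" .
  show "AE V in \<Omega>. (\<integral>t. Gq f h t V \<partial>count_space T4) = Q f h V \<and> integrable (count_space (X \<times> X)) (%p. kg f V (fst p) (snd p) * (\<psi> h V (fst p) * \<psi> h V (snd p)))"
    using G(1) by eventually_elim (simp add: Gq_Q[OF h])
  show "integrable \<Omega> (%V. \<integral>t. Gq f h t V \<partial>count_space T4)" by (rule G(3))
qed

text \<open>On finite boxes the sign comes from \<open>rf_double_sum\<close>; absolute summability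
  permits the limit.\<close>

lemma Q_nonneg:
  assumes f: "bbm f" "!!t. t \<in> {-CC..CC} ==> 0 \<le> f t"
    and i: "integrable (count_space (X \<times> X)) (%p. kg f V (fst p) (snd p) * (\<psi> h V (fst p) * \<psi> h V (snd p)))"
  shows "0 \<le> Q f h V"
proof (cases "good V")
  case True
  interpret bounded_potential d V Rad by (rule good_bp) fact
  let ?k = "%p. kg f V (fst p) (snd p) * (\<psi> h V (fst p) * \<psi> h V (snd p))"
  have lim: "(%n. \<integral>p. ?k p * indicator (box d n \<times> box d n) p \<partial>count_space (X \<times> X)) \<longlonglongrightarrow> Q f h V"
    unfolding Q_def
  proof (rule integral_dominated_convergence[where w="%p. \<bar>?k p\<bar>"])
    show "AE p in count_space (X \<times> X). (%n. ?k p * indicator (box d n \<times> box d n) p) \<longlonglongrightarrow> ?k p"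
    proof (subst AE_count_space, intro ballI)
      fix p assume "p \<in> X \<times> X"
      then obtain n1 n2 where n: "fst p \<in> box d n1" "snd p \<in> box d n2" using Zd_box by (metis mem_Times_iff)
      have "?k p * indicator (box d n \<times> box d n) p = ?k p" if "n \<ge> max n1 n2" for n
        using n box_mono[of n1 n d] box_mono[of n2 n d] that by (auto simp: indicator_def mem_Times_iff)
      then show "(%n. ?k p * indicator (box d n \<times> box d n) p) \<longlonglongrightarrow> ?k p"
        by (intro tendsto_eventually eventually_sequentiallyI[of "max n1 n2"]) auto
    qed
  qed (use i in \<open>auto simp: indicator_def\<close>)
  have "0 \<le> (\<integral>p. ?k p * indicator (box d n \<times> box d n) p \<partial>count_space (X \<times> X))" for n
  proof -
    have "(\<integral>p. ?k p * indicator (box d n \<times> box d n) p \<partial>count_space (X \<times> X)) = (\<Sum>p\<in>box d n \<times> box d n. ?k p * indicator (box d n \<times> box d n) p)"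
      by (rule integral_count_finite_support) (use finite_box box_sub_Zd[of d n] in auto)
    also have "\<dots> = (\<Sum>(x, y)\<in>box d n \<times> box d n. rf d V f (dr x) (dr y) * (\<psi> h V x * \<psi> h V y))"
      by (intro sum.cong refl) (auto simp: kg_def True)
    also have "\<dots> \<ge> 0" by (rule rf_double_sum) (use f finite_box box_sub_Zd in \<open>auto simp: CC_def\<close>)
    finally show ?thesis .
  qed
  then show ?thesis by (intro LIMSEQ_le_const[OF lim]) auto
qed (simp add: Q_def kg_def)

lemma Lf_nonneg:
  assumes f: "dec f" "!!t. t \<in> {-CC..CC} ==> 0 \<le> f t" and h: "bbm h"
  shows "0 \<le> Lf f (%t. h t * h t)"
  unfolding Lf_trace(1)[OF f(1) h]
proof (rule integral_nonneg_AE)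
  show "AE V in \<Omega>. 0 \<le> (\<integral>t. Gq f h t V \<partial>count_space T4)"
    using Lf_trace(2)[OF f(1) h] by eventually_elim (use Q_nonneg[OF dec_bbm[OF f(1)] f(2)] in auto)
qed

end

section \<open>The joint spectral measure of left and right multiplication\<close>

lemma bbm_fst_snd:
  fixes f g :: "real => real"
  assumes f: "bbm f" and g: "bbm g"
  shows "bbm (%p. f (fst p) * g (snd p))"
proof -
  have m: "fst \<in> measurable borel borel" "snd \<in> measurable borel (borel :: real measure)" for a :: "real \<times> real"
    by (auto intro!: borel_measurable_continuous_onI continuous_intros)
  obtain B where B: "!!x. \<bar>f x\<bar> \<le> B" using bbm_bound[OF f] by metis
  obtain D where D: "!!x. \<bar>g x\<bar> \<le> D" using bbm_bound[OF g] by metis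
  have "bbm (%p :: real \<times> real. f (fst p))"
    by (rule bbmI[OF measurable_compose[OF m(1) bbm_measurable[OF f]] B])
  moreover have "bbm (%p :: real \<times> real. g (snd p))"
    by (rule bbmI[OF measurable_compose[OF m(2) bbm_measurable[OF g]] D])
  ultimately show ?thesis by (rule bbm_mult)
qed

lemma adm_integral2:
  assumes M: "finite_measure M" "sets M = sets (borel :: (real \<times> real) measure)" and k: "bbm k"
  shows "adm (%f. \<integral>p. f (fst p) * k (snd p) \<partial>M)" "adm (%f. \<integral>p. k (fst p) * f (snd p) \<partial>M)"
proof -
  obtain B where B: "0 \<le> B" "!!x. \<bar>k x\<bar> \<le> B" using bbm_bound[OF k] by metis
  note i1 = integrable_bbm[OF M bbm_fst_snd[OF _ k]] and i2 = integrable_bbm[OF M bbm_fst_snd[OF k]]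
  show "adm (%f. \<integral>p. f (fst p) * k (snd p) \<partial>M)"
  proof (rule admI)
    fix F :: "nat => real => real" and f D
    assume F: "!!n. bbm (F n)" "!!n t. \<bar>F n t\<bar> \<le> D" "!!t. (%n. F n t) \<longlonglongrightarrow> f t"
    have "0 \<le> D" using F(2)[of 0 0] by linarith
    then have "\<bar>F n (fst p) * k (snd p)\<bar> \<le> D * B" for n p unfolding abs_mult using F(2) B by (intro mult_mono) auto
    then show "(%n. \<integral>p. F n (fst p) * k (snd p) \<partial>M) \<longlonglongrightarrow> (\<integral>p. f (fst p) * k (snd p) \<partial>M)"
      by (rule integral_limit_bbm[OF M bbm_fst_snd[OF F(1) k]]) (intro tendsto_intros F)
  qed (simp_all add: distrib_right i1 mult.assoc)
  show "adm (%f. \<integral>p. k (fst p) * f (snd p) \<partial>M)"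
  proof (rule admI)
    fix F :: "nat => real => real" and f D
    assume F: "!!n. bbm (F n)" "!!n t. \<bar>F n t\<bar> \<le> D" "!!t. (%n. F n t) \<longlonglongrightarrow> f t"
    have "0 \<le> D" using F(2)[of 0 0] by linarith
    then have "\<bar>k (fst p) * F n (snd p)\<bar> \<le> B * D" for n p unfolding abs_mult using F(2) B by (intro mult_mono) auto
    then show "(%n. \<integral>p. k (fst p) * F n (snd p) \<partial>M) \<longlonglongrightarrow> (\<integral>p. k (fst p) * f (snd p) \<partial>M)"
      by (rule integral_limit_bbm[OF M bbm_fst_snd[OF k F(1)]]) (intro tendsto_intros F)
  qed (simp_all add: distrib_left i2 mult.left_commute)
qed

lemma adm_lincomb:
  fixes n :: nat
  assumes A: "adm A" and f: "!!i. bbm (f i)"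
  shows "A (%t. \<Sum>i\<le>n. c i * f i t) = (\<Sum>i\<le>n. c i * A (f i))"
proof (induction n)
  case 0 show ?case by (simp add: admD(2)[OF A f])
next
  case (Suc n)
  have "A (%t. (\<Sum>i\<le>n. c i * f i t) + c (Suc n) * f (Suc n) t) = A (%t. \<Sum>i\<le>n. c i * f i t) + A (%t. c (Suc n) * f (Suc n) t)"
    by (intro admD(1)[OF A] bbm_sum bbm_scale f)
  then show ?case using Suc by (simp add: admD(2)[OF A f])
qed

context fermi
begin

definition plp :: "real poly => real => real" where
  "plp p t = (\<Sum>i\<le>degree p. coeff p i * pw i t)"

lemma plp_eq: "plp p t = poly p t * indicator {-CC..CC} t"
  by (simp add: plp_def pw_def poly_altdef sum_distrib_right mult.assoc)

lemma dec_plp: "dec (plp p)"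
proof -
  have "dec (%t. \<Sum>i\<le>n. c i * pw i t)" for n c
  proof (induction n)
    case 0 show ?case using dec_lin[OF dec_pw[of 0] dec_pw[of 0], of "c 0" 0] by simp
  next
    case (Suc n) show ?case using dec_lin[OF Suc dec_pw[of "Suc n"], of 1 "c (Suc n)"] by simp
  qed
  then show ?thesis unfolding plp_def[abs_def] .
qed

lemma Lf_plp: "Lf (plp p) (plp q) = mfun (%m n. Lf (pw m) (pw n)) p q"
proof -
  have "Lf (plp p) (plp q) = (\<Sum>j\<le>degree q. coeff q j * Lf (plp p) (pw j))"
    using adm_lincomb[OF adm_Lf_right[OF dec_plp[of p]] bbm_pw] by (simp add: plp_def[of q, abs_def])
  also have "\<dots> = (\<Sum>j\<le>degree q. coeff q j * (\<Sum>i\<le>degree p. coeff p i * Lf (pw i) (pw j)))"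
    unfolding plp_def[of p, abs_def] by (intro sum.cong refl arg_cong2[where f="(*)"] adm_lincomb[OF adm_Lf_left[OF dec_pw], of pw] bbm_pw)
  also have "\<dots> = mfun (%m n. Lf (pw m) (pw n)) p q"
    unfolding mfun_def by (subst sum.swap) (simp add: sum_distrib_left mult_ac)
  finally show ?thesis .
qed

text \<open>Positivity has to be tested on products of Bernstein polynomials. The truncated right
  factor is nonnegative, so it has a bounded Borel square root h, and \<open>Lf_nonneg\<close> gives
  the sign. No decay is known for h, which is why \<open>Lf\<close> admits any bounded Borel right
  argument.\<close>

lemma Yjoint_ex:
  "\<exists>M. sets M = sets borel \<and> finite_measure M \<and> emeasure M (UNIV - sq (5 * CC)) = 0 \<and>
      (\<forall>a b. (\<integral>p. mono2 a b p \<partial>M) = Lf (pw a) (pw b))"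
proof (rule hausdorff2[OF CC])
  fix k l i j
  let ?f = "plp (bernR CC k l)" and ?g = "plp (bernR CC i j)"
  let ?h = "%t. sqrt (?g t)"
  have g: "0 \<le> ?g t" for t by (cases "t \<in> {-CC..CC}") (auto simp: plp_eq poly_bernR_nonneg)
  have bg: "bbm ?g" by (rule dec_bbm[OF dec_plp])
  obtain B where B: "0 \<le> B" "!!t. \<bar>?g t\<bar> \<le> B" using bbm_bound[OF bg] by metis
  have "\<bar>?h t\<bar> \<le> sqrt B" for t using B(2)[of t] g[of t] by simp
  then have bh: "bbm ?h" using bbm_measurable[OF bg] by (intro bbmI) measurable
  have "0 \<le> Lf ?f (%t. ?h t * ?h t)"
    by (rule Lf_nonneg[OF dec_plp _ bh]) (auto simp: plp_eq poly_bernR_nonneg)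
  also have "(%t. ?h t * ?h t) = ?g" using g by auto
  finally show "0 \<le> mfun (%m n. Lf (pw m) (pw n)) (bernR CC k l) (bernR CC i j)" by (simp add: Lf_plp)
qed

abbreviation "YJ \<equiv> Yjoint d \<rho> EF"

lemma Yjoint:
  "sets YJ = sets borel" "finite_measure YJ" "emeasure YJ (UNIV - sq (5 * CC)) = 0" "(\<integral>p. mono2 m n p \<partial>YJ) = Lf (pw m) (pw n)"
proof -
  obtain M where M: "sets M = sets borel" "finite_measure M" "emeasure M (UNIV - sq (5 * CC)) = 0"
      "!!a b. (\<integral>p. mono2 a b p \<partial>M) = Lf (pw a) (pw b)" using Yjoint_ex by blast
  have "YJ = M"
    unfolding Yjoint_def
  proof (rule the_equality)
    show "sets M = sets borel \<and> finite_measure M \<and> (\<exists>R. emeasure M (UNIV - {- R..R} \<times> {- R..R}) = 0) \<and>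
        (\<forall>m n. complex_of_real (\<integral>p. fst p ^ m * snd p ^ n \<partial>M) = Ymoment d \<rho> EF m n)"
      using M by (auto simp: Ymoment_eq mono2_def sq_def)
    fix N :: "(real \<times> real) measure"
    assume N: "sets N = sets borel \<and> finite_measure N \<and> (\<exists>R. emeasure N (UNIV - {- R..R} \<times> {- R..R}) = 0) \<and>
        (\<forall>m n. complex_of_real (\<integral>p. fst p ^ m * snd p ^ n \<partial>N) = Ymoment d \<rho> EF m n)"
    then obtain R where R: "emeasure N (UNIV - sq R) = 0" unfolding sq_def by blast
    have "(\<integral>p. mono2 m n p \<partial>N) = (\<integral>p. mono2 m n p \<partial>M)" for m n
      using N M(4) by (auto simp: Ymoment_eq mono2_def)
    then show "N = M" using N by (intro moment_unique2[OF _ _ R M(2,1,3)]) auto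
  qed
  with M show "sets YJ = sets borel" "finite_measure YJ" "emeasure YJ (UNIV - sq (5 * CC)) = 0" "(\<integral>p. mono2 m n p \<partial>YJ) = Lf (pw m) (pw n)" by auto
qed

lemma Lf_cong_ind:
  assumes "bbm f" "bbm f'" "bbm g" "bbm g'" "!!t. t \<in> {-CC..CC} ==> f t = f' t" "!!t. t \<in> {-CC..CC} ==> g t = g' t"
  shows "Lf f g = Lf f' g'"
proof -
  have k: "kg f1 V x y = kg f2 V x y" if "bbm f1" "bbm f2" "!!t. t \<in> {-CC..CC} ==> f1 t = f2 t" "x \<in> X" "y \<in> X" for f1 f2 V x y
  proof -
    have "(%t. f1 t * indicator {-CC..CC} t) = (%t. f2 t * indicator {-CC..CC} t :: real)" using that(3) by (auto simp: indicator_def)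
    then show ?thesis using kg_ind[of f1 x y V] kg_ind[of f2 x y V] that by simp
  qed
  show ?thesis unfolding Lf_def
    by (rule Bochner_Integration.integral_cong[OF refl])
      (use k[OF assms(1,2,5)] k[OF assms(3,4,6) _ zero_Zd] in \<open>auto simp: \<Phi>_def space_pair_measure\<close>)
qed

text \<open>Two extensions in turn: with a power on the right, the left argument passes from powers
  to f; with f fixed, the right argument passes to g. The measure is located on the square of
  half-side 5 CC while \<open>Lf\<close> sees only [-CC,CC], and \<open>Lf_cong_ind\<close>
  reconciles the two.\<close>

theorem Yjoint_integral:
  assumes f: "dec f" and g: "bbm g"
  shows "(\<integral>p. f (fst p) * g (snd p) \<partial>YJ) = Lf f g"
proof -
  note M = Yjoint(2,1)
  note bf = dec_bbm[OF f]
  let ?I = "{-(5*CC)..5*CC}"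
  let ?q = "%n t. t ^ n * indicator ?I t :: real"
  have bq: "bbm (?q n)" for n by (intro bbm_continuous_compact continuous_intros) auto
  have bI: "bbm (indicator ?I :: real => real)" by (rule bbm_indicator) simp
  have sub: "{-CC..CC} \<subseteq> ?I" using CC by auto
  have sqm: "sq (5 * CC) \<in> sets borel" by simp
  have ind: "indicator (sq (5 * CC)) p = (indicator ?I (fst p) * indicator ?I (snd p) :: real)" for p :: "real \<times> real"
    by (auto simp: sq_def indicator_def mem_Times_iff)
  have step1: "(\<integral>p. (f (fst p) * indicator ?I (fst p)) * ?q n (snd p) \<partial>YJ) = Lf (%t. f t * indicator ?I t) (pw n)" for n
  proof (rule adm_eqI[OF adm_integral2(1)[OF M bq] adm_Lf_left[OF dec_pw] _ bf])
    fix m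
    have mm: "mono2 m n \<in> borel_measurable borel" by (rule borel_measurable_continuous_onI[OF continuous_mono2])
    have "(\<integral>p. ?q m (fst p) * ?q n (snd p) \<partial>YJ) = (\<integral>p. indicator (sq (5 * CC)) p *\<^sub>R mono2 m n p \<partial>YJ)"
      by (rule Bochner_Integration.integral_cong[OF refl]) (simp add: ind mono2_def)
    also have "\<dots> = (\<integral>p. mono2 m n p \<partial>YJ)" by (rule integral_AE_indicator[OF Yjoint(3) sqm Yjoint(1) mm, symmetric])
    also have "\<dots> = Lf (?q m) (pw n)"
      unfolding Yjoint(4) using sub by (intro Lf_cong_ind bbm_pw bq refl) (auto simp: pw_def indicator_def)
    finally show "(\<integral>p. ?q m (fst p) * ?q n (snd p) \<partial>YJ) = Lf (?q m) (pw n)" .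
  qed
  have bfI: "bbm (%t. f t * indicator ?I t)" by (rule bbm_mult[OF bf bI])
  have "(\<integral>p. (f (fst p) * indicator ?I (fst p)) * (g (snd p) * indicator ?I (snd p)) \<partial>YJ) = Lf f (%t. g t * indicator ?I t)"
  proof (rule adm_eqI[OF adm_integral2(2)[OF M bfI] adm_Lf_right[OF f] _ g])
    fix n
    have "Lf (%t. f t * indicator ?I t) (pw n) = Lf f (?q n)"
      using sub by (intro Lf_cong_ind bfI bf bbm_pw bq) (auto simp: pw_def indicator_def)
    then show "(\<integral>p. (f (fst p) * indicator ?I (fst p)) * ?q n (snd p) \<partial>YJ) = Lf f (?q n)" using step1 by simp
  qed
  also have "Lf f (%t. g t * indicator ?I t) = Lf f g"
    using sub by (intro Lf_cong_ind bf bbm_mult[OF g bI] g) (auto simp: indicator_def)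
  also have "(\<integral>p. (f (fst p) * indicator ?I (fst p)) * (g (snd p) * indicator ?I (snd p)) \<partial>YJ) = (\<integral>p. indicator (sq (5 * CC)) p *\<^sub>R (f (fst p) * g (snd p)) \<partial>YJ)"
    by (rule Bochner_Integration.integral_cong[OF refl]) (simp add: ind)
  also have "\<dots> = (\<integral>p. f (fst p) * g (snd p) \<partial>YJ)"
    by (rule integral_AE_indicator[OF Yjoint(3) sqm Yjoint(1) bbm_measurable[OF bbm_fst_snd[OF bf g]], symmetric])
  finally show ?thesis by simp
qed

definition Fp :: "real => real => real" where "Fp \<nu> = indicator {EF<..EF + \<nu>}"
definition Fm :: "real => real => real" where "Fm \<nu> = indicator {EF - \<nu><..EF}"

lemma Fp_diff: "0 \<le> \<nu> ==> Fp \<nu> = (%t. indicator {..EF + \<nu>} t - indicator {..EF} t)"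
  and Fm_diff: "0 \<le> \<nu> ==> Fm \<nu> = (%t. indicator {..EF} t - indicator {..EF - \<nu>} t)"
  by (auto simp: Fp_def Fm_def indicator_def fun_eq_iff)

lemma bbm_Fp: "bbm (Fp \<nu>)" and bbm_Fm: "bbm (Fm \<nu>)"
  unfolding Fp_def Fm_def by (auto intro!: bbm_indicator)

lemma dec_Fp: "0 \<le> \<nu> ==> EF + \<nu> < b ==> dec (Fp \<nu>)"
  unfolding Fp_diff using EF by (intro dec_diff dec_atMost) auto

text \<open>A nonzero difference of projections puts E_F between the two energies, with \<lambda>2
  \<le> E_F < \<lambda>1 because \<lambda>1 - \<lambda>2 is nonnegative on the set in question. The
  bound \<nu> for the density cancels the 1/\<nu> of the average.\<close>

lemma sigma_in_le:
  assumes \<nu>: "0 < \<nu>" "EF + \<nu> < b" "a < EF - \<nu>"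
  shows "sigma_in d \<rho> EF \<nu> \<le> pi * Lf (Fp \<nu>) (%t. Fm \<nu> t * Fm \<nu> t)"
proof -
  note M = Yjoint(2,1)
  note [measurable_cong] = M(2)
  let ?c = "%p :: real \<times> real. indicator {q. fst q - snd q \<in> {0..\<nu>}} p *
       (- (fst p - snd p) * ((if fst p \<le> EF then 1 else 0) - (if snd p \<le> EF then 1 else 0)))"
  have dp: "dec (Fp \<nu>)" by (rule dec_Fp) (use \<nu> in auto)
  have i: "integrable YJ (%p. \<nu> * (Fp \<nu> (fst p) * (Fm \<nu> (snd p))))"
    by (intro integrable_mult_right integrable_bbm[OF M] bbm_fst_snd bbm_Fp bbm_Fm)
  have le: "0 \<le> ?c p" "?c p \<le> \<nu> * (Fp \<nu> (fst p) * (Fm \<nu> (snd p)))" for p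
    using \<nu> by (auto simp: Fp_def Fm_def indicator_def)
  have "(\<integral>p. ?c p \<partial>YJ) \<le> (\<integral>p. \<nu> * (Fp \<nu> (fst p) * (Fm \<nu> (snd p))) \<partial>YJ)"
    by (rule integral_mono') (use i le in \<open>auto simp: less_imp_le[OF \<nu>(1)] Fp_def Fm_def\<close>)
  also have "\<dots> = \<nu> * Lf (Fp \<nu>) (Fm \<nu>)" using Yjoint_integral[OF dp bbm_Fm, of \<nu>] by simp
  also have "Fm \<nu> = (%t. Fm \<nu> t * Fm \<nu> t)" by (auto simp: Fm_def indicator_def)
  finally have "(\<integral>p. ?c p \<partial>YJ) \<le> \<nu> * Lf (Fp \<nu>) (%t. Fm \<nu> t * Fm \<nu> t)" .
  then have "pi * (\<integral>p. ?c p \<partial>YJ) / \<nu> \<le> pi * (\<nu> * Lf (Fp \<nu>) (%t. Fm \<nu> t * Fm \<nu> t)) / \<nu>"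
    using \<nu>(1) by (intro divide_right_mono mult_left_mono) auto
  then show ?thesis using \<nu>(1) by (simp add: sigma_in_def cond_measure_def)
qed

end

section \<open>Reduction of the quadratic form to two-site determinants\<close>

lemma integrable_count_kernel:
  fixes A B :: "'a => real"
  assumes S: "countable S" and A: "integrable (count_space S) A" and B: "integrable (count_space S) B"
    and k: "!!x y. x \<in> S ==> y \<in> S ==> \<bar>k x y\<bar> \<le> 1"
  shows "integrable (count_space (S \<times> S)) (%p. k (fst p) (snd p) * (A (fst p) * B (snd p)))"
proof -
  have fin: "(\<integral>\<^sup>+x. ennreal \<bar>A x\<bar> \<partial>count_space S) < \<infinity>" "(\<integral>\<^sup>+x. ennreal \<bar>B x\<bar> \<partial>count_space S) < \<infinity>"
    using A B by (simp_all add: integrable_count_nn)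
  have "(\<integral>\<^sup>+p. ennreal \<bar>k (fst p) (snd p) * (A (fst p) * B (snd p))\<bar> \<partial>count_space (S \<times> S))
     \<le> (\<integral>\<^sup>+p. ennreal \<bar>A (fst p)\<bar> * ennreal \<bar>B (snd p)\<bar> \<partial>count_space (S \<times> S))"
  proof (rule nn_integral_mono)
    fix p assume "p \<in> space (count_space (S \<times> S))"
    then have "\<bar>k (fst p) (snd p)\<bar> \<le> 1" using k by auto
    then have "\<bar>k (fst p) (snd p)\<bar> * (\<bar>A (fst p)\<bar> * \<bar>B (snd p)\<bar>) \<le> 1 * (\<bar>A (fst p)\<bar> * \<bar>B (snd p)\<bar>)" by (rule mult_right_mono) simp
    then show "ennreal \<bar>k (fst p) (snd p) * (A (fst p) * B (snd p))\<bar> \<le> ennreal \<bar>A (fst p)\<bar> * ennreal \<bar>B (snd p)\<bar>"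
      by (simp add: ennreal_mult[symmetric] ennreal_leI abs_mult)
  qed
  also have "\<dots> = (\<integral>\<^sup>+x. (\<integral>\<^sup>+y. ennreal \<bar>A x\<bar> * ennreal \<bar>B y\<bar> \<partial>count_space S) \<partial>count_space S)"
    by (simp add: nn_count_prod S)
  also have "\<dots> = (\<integral>\<^sup>+x. ennreal \<bar>A x\<bar> \<partial>count_space S) * (\<integral>\<^sup>+x. ennreal \<bar>B x\<bar> \<partial>count_space S)"
    by (simp add: nn_integral_cmult nn_integral_multc)
  also have "\<dots> < \<infinity>" using fin by (simp add: ennreal_mult_less_top)
  finally show ?thesis by (simp add: integrable_count_nn)
qed

lemma integrable_count_bound:
  fixes f g :: "'a => real"
  assumes "integrable (count_space A) g" "!!x. x \<in> A ==> \<bar>f x\<bar> \<le> \<bar>g x\<bar>"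
  shows "integrable (count_space A) f"
  by (rule Bochner_Integration.integrable_bound[OF assms(1)]) (auto simp: AE_count_space assms(2))

lemma integral_count_split:
  fixes f :: "'a => real"
  assumes i: "integrable (count_space A) f" and S: "finite S" "S \<subseteq> A"
  shows "(\<integral>x. f x \<partial>count_space A) = (\<Sum>x\<in>S. f x) + (\<integral>x. f x \<partial>count_space (A - S))" "integrable (count_space (A - S)) f"
proof -
  have "(%x. \<bar>f x\<bar>) summable_on A" using i by (simp add: integrable_count_summable)
  then have "f summable_on A" by (subst summable_on_iff_abs_summable_on_real) simp
  then have "infsum f (A - S) = infsum f A - infsum f S" by (rule infsum_Diff) (use S in auto)
  then show "(\<integral>x. f x \<partial>count_space A) = (\<Sum>x\<in>S. f x) + (\<integral>x. f x \<partial>count_space (A - S))"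
    using S by (simp add: infsum_integral[symmetric])
  show "integrable (count_space (A - S)) f"
    using i by (auto simp: integrable_count_summable intro: summable_on_subset_banach)
qed

context fermi
begin

lemma kg_rf: "good V ==> kg f V x y = rf d V f (dr x) (dr y)" by (simp add: kg_def)

lemma kg_mult:
  assumes f: "bbm f" and h: "bbm h" and x: "x \<in> X" "y \<in> X"
  shows "(\<integral>v. kg f V x v * kg h V v y \<partial>count_space X) = kg (%t. f t * h t) V x y"
    "integrable (count_space X) (%v. kg f V x v * kg h V v y)"
proof -
  have "(\<integral>v. kg f V x v * kg h V v y \<partial>count_space X) = kg (%t. f t * h t) V x y \<and> integrable (count_space X) (%v. kg f V x v * kg h V v y)"
  proof (cases "good V")
    case True
    note m = bounded_potential.rf_mult[OF good_bp[OF True] fs_dr[OF x(1)] fs_dr[OF x(2)] f h]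
    show ?thesis using m unfolding infsum_integral[symmetric] by (simp add: kg_def True infsumI integrable_count_summable)
  qed (simp add: kg_def)
  then show "(\<integral>v. kg f V x v * kg h V v y \<partial>count_space X) = kg (%t. f t * h t) V x y"
    "integrable (count_space X) (%v. kg f V x v * kg h V v y)" by auto
qed

lemma kg_zero: "x \<in> X ==> y \<in> X ==> kg (%t. 0) V x y = 0"
  using kg_scale[OF bbm_const[of 0], of x y 0 V] by simp

lemma kg_nonneg: "bbm f ==> (!!t. 0 \<le> f t) ==> x \<in> X ==> 0 \<le> kg f V x x"
  using bounded_potential.rf_pos[OF good_bp fs_dr] by (auto simp: kg_def)

lemma kg_CS: "bbm f ==> (!!t. 0 \<le> f t) ==> x \<in> X ==> y \<in> X ==> (kg f V x y)\<^sup>2 \<le> kg f V x x * kg f V y y"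
  using bounded_potential.rf_CS[OF good_bp fs_dr fs_dr] by (auto simp: kg_def)

lemma Fp_range: "0 \<le> Fp \<nu> t" "\<bar>Fp \<nu> t\<bar> \<le> 1" and Fm_range: "0 \<le> Fm \<nu> t" "\<bar>Fm \<nu> t\<bar> \<le> 1"
  by (auto simp: Fp_def Fm_def indicator_def)

lemma Fp_bound: "x \<in> X ==> y \<in> X ==> \<bar>kg (Fp \<nu>) V x y\<bar> \<le> 1"
  by (rule kg_bound[OF bbm_Fp Fp_range(2)]) auto

lemma Fm_bound: "x \<in> X ==> y \<in> X ==> \<bar>kg (Fm \<nu>) V x y\<bar> \<le> 1"
  by (rule kg_bound[OF bbm_Fm Fm_range(2)]) auto

text \<open>The vector X_1 F_- \<delta>_0.\<close>

definition \<phi> :: "real => (site => real) => site => real" where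
  "\<phi> \<nu> V x = real_of_int (x 0) * kg (Fm \<nu>) V x o0"

lemma kernel_le_sqrt:
  assumes "x \<in> X" "y \<in> X"
  shows "\<bar>kg (Fp \<nu>) V x y\<bar> \<le> sqrt (kg (Fp \<nu>) V x x) * sqrt (kg (Fp \<nu>) V y y)"
  using real_sqrt_le_mono[OF kg_CS[OF bbm_Fp Fp_range(1) assms, of \<nu> V]] by (simp add: real_sqrt_mult)

lemma weight_integrable:
  assumes fi: "integrable (count_space X) (\<phi> \<nu> V)"
  shows "integrable (count_space X) (%x. \<bar>\<phi> \<nu> V x\<bar> * sqrt (kg (Fp \<nu>) V x x))"
proof (rule integrable_count_bound[OF fi])
  fix x assume x: "x \<in> X"
  have "0 \<le> kg (Fp \<nu>) V x x" "kg (Fp \<nu>) V x x \<le> 1" using kg_nonneg[OF bbm_Fp Fp_range(1) x] Fp_bound[OF x x, of \<nu> V] by (auto simp: abs_le_iff)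
  then have "\<bar>\<phi> \<nu> V x\<bar> * \<bar>sqrt (kg (Fp \<nu>) V x x)\<bar> \<le> \<bar>\<phi> \<nu> V x\<bar> * 1" by (intro mult_left_mono) auto
  then show "\<bar>\<bar>\<phi> \<nu> V x\<bar> * sqrt (kg (Fp \<nu>) V x x)\<bar> \<le> \<bar>\<phi> \<nu> V x\<bar>" by (simp add: abs_mult)
qed

text \<open>Since \<open>P F\<^sub>- = F\<^sub>-\<close> and \<open>F\<^sub>+ P = 0\<close>, the commutator with \<open>P\<close> may be replaced by multiplication
  with the coordinate: \<open>F\<^sub>+ [X, P] F\<^sub>- = F\<^sub>+ X F\<^sub>-\<close>.\<close>

lemma Q_le_square:
  assumes g: "good V" and fi: "integrable (count_space X) (\<phi> \<nu> V)"
    and yi: "integrable (count_space (X \<times> X)) (%p. yk V (fst p) (snd p) * kg (Fm \<nu>) V (snd p) o0)"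
  shows "Q (Fp \<nu>) (Fm \<nu>) V \<le> (\<integral>x. \<bar>\<phi> \<nu> V x\<bar> * sqrt (kg (Fp \<nu>) V x x) \<partial>count_space X)\<^sup>2"
proof -
  let ?F = "kg (Fp \<nu>) V" and ?\<psi> = "\<psi> (Fm \<nu>) V" and ?\<phi> = "\<phi> \<nu> V"
  note cX = countable_Zd[of d]
  interpret bounded_potential d V Rad by (rule good_bp[OF g])
  have psi_int: "integrable (count_space X) ?\<psi>"
    using integral_count_prod(3)[OF cX cX yi] by (simp add: \<psi>_def[abs_def])
  have pphi: "integrable (count_space X) (%u. pk V x u * ?\<phi> u)" if "x \<in> X" for x
  proof (rule integrable_count_bound[OF fi])
    fix u assume "u \<in> X"
    then have "\<bar>pk V x u\<bar> * \<bar>?\<phi> u\<bar> \<le> 1 * \<bar>?\<phi> u\<bar>" by (intro mult_right_mono pk_bound that) auto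
    then show "\<bar>pk V x u * ?\<phi> u\<bar> \<le> \<bar>?\<phi> u\<bar>" by (simp add: abs_mult)
  qed
  have psi: "?\<psi> x = ?\<phi> x - (\<integral>u. pk V x u * ?\<phi> u \<partial>count_space X)" if x: "x \<in> X" for x
  proof -
    have pf: "(%t. indicator {..EF} t * Fm \<nu> t) = Fm \<nu>" by (auto simp: Fm_def indicator_def)
    note km = kg_mult[OF bbm_atMost[of EF] bbm_Fm[of \<nu>] x zero_Zd, of V, folded pk_def, unfolded pf]
    have "?\<psi> x = (\<integral>u. real_of_int (x 0) * (pk V x u * kg (Fm \<nu>) V u o0) - pk V x u * ?\<phi> u \<partial>count_space X)"
      unfolding \<psi>_def yk_def \<phi>_def by (simp add: algebra_simps)
    also have "\<dots> = real_of_int (x 0) * kg (Fm \<nu>) V x o0 - (\<integral>u. pk V x u * ?\<phi> u \<partial>count_space X)"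
      using km by (subst Bochner_Integration.integral_diff[OF _ pphi[OF x]]) auto
    finally show ?thesis by (simp add: \<phi>_def)
  qed
  have Fpsi: "(\<integral>x. ?F x' x * ?\<psi> x \<partial>count_space X) = (\<integral>x. ?F x' x * ?\<phi> x \<partial>count_space X)" if x': "x' \<in> X" for x'
  proof -
    \<comment> \<open>Absolute convergence is needed to exchange the sums: for each u the sum over x
      is at most 4 by the Bessel bounds, and \<open>\<phi>\<close> is summable.\<close>
    let ?h = "%p. (?F x' (fst p) * pk V (fst p) (snd p)) * ?\<phi> (snd p)"
    have "(\<integral>\<^sup>+p. ennreal \<bar>?h p\<bar> \<partial>count_space (X \<times> X)) = (\<integral>\<^sup>+u. (\<integral>\<^sup>+x. ennreal \<bar>?F x' x * pk V x u\<bar> * ennreal \<bar>?\<phi> u\<bar> \<partial>count_space X) \<partial>count_space X)"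
      by (simp add: nn_count_prod2[OF cX cX] abs_mult ennreal_mult[symmetric])
    also have "\<dots> = (\<integral>\<^sup>+u. (\<integral>\<^sup>+x. ennreal \<bar>?F x' x * pk V x u\<bar> \<partial>count_space X) * ennreal \<bar>?\<phi> u\<bar> \<partial>count_space X)"
      by (simp add: nn_integral_multc)
    also have "\<dots> \<le> (\<integral>\<^sup>+u. ennreal (4 * 1\<^sup>2) * ennreal \<bar>?\<phi> u\<bar> \<partial>count_space X)"
    proof (intro nn_integral_mono mult_right_mono)
      fix u assume "u \<in> space (count_space X)"
      then have u: "u \<in> X" by simp
      have i1: "\<bar>indicator {..EF} t\<bar> \<le> (1 :: real)" for t by (auto simp: indicator_def)
      show "(\<integral>\<^sup>+x. ennreal \<bar>?F x' x * pk V x u\<bar> \<partial>count_space X) \<le> ennreal (4 * 1\<^sup>2)"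
        unfolding pk_def kg_rf[OF g] by (rule bessel_pair[OF x' u bbm_Fp Fp_range(2) bbm_atMost i1])
    qed simp
    also have "\<dots> = ennreal 4 * (\<integral>\<^sup>+u. ennreal \<bar>?\<phi> u\<bar> \<partial>count_space X)" by (subst nn_integral_cmult) auto
    also have "\<dots> < \<infinity>" using fi by (simp add: integrable_count_nn ennreal_mult_less_top)
    finally have hi: "integrable (count_space (X \<times> X)) ?h" by (simp add: integrable_count_nn)
    have e1: "(\<integral>p. ?h p \<partial>count_space (X \<times> X)) = (\<integral>x. ?F x' x * (\<integral>u. pk V x u * ?\<phi> u \<partial>count_space X) \<partial>count_space X)"
      using integral_count_prod(1)[OF cX cX hi] by (simp add: mult.assoc)
    have i3: "integrable (count_space X) (%x. ?F x' x * (\<integral>u. pk V x u * ?\<phi> u \<partial>count_space X))"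
      using integral_count_prod(3)[OF cX cX hi] by (simp add: mult.assoc)
    have "(\<integral>p. ?h p \<partial>count_space (X \<times> X)) = (\<integral>u. (\<integral>x. ?F x' x * pk V x u \<partial>count_space X) * ?\<phi> u \<partial>count_space X)"
      using integral_count_prod(2)[OF cX cX hi] by simp
    also have "\<dots> = (\<integral>u. 0 \<partial>count_space X)"
    proof (intro Bochner_Integration.integral_cong refl)
      fix u assume "u \<in> space (count_space X)"
      then have u: "u \<in> X" by simp
      have z: "(%t. Fp \<nu> t * indicator {..EF} t) = (%t. 0)" by (auto simp: Fp_def indicator_def)
      show "(\<integral>x. ?F x' x * pk V x u \<partial>count_space X) * ?\<phi> u = 0"
        using kg_mult(1)[OF bbm_Fp bbm_atMost x' u, of \<nu> V EF] kg_zero[OF x' u] by (simp add: pk_def z)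
    qed
    finally have z: "(\<integral>x. ?F x' x * (\<integral>u. pk V x u * ?\<phi> u \<partial>count_space X) \<partial>count_space X) = 0" using e1 by simp
    have i4: "integrable (count_space X) (%x. ?F x' x * ?\<phi> x)"
    proof (rule integrable_count_bound[OF fi])
      fix u assume "u \<in> X"
      then have "\<bar>?F x' u\<bar> * \<bar>?\<phi> u\<bar> \<le> 1 * \<bar>?\<phi> u\<bar>" by (intro mult_right_mono Fp_bound x') auto
      then show "\<bar>?F x' u * ?\<phi> u\<bar> \<le> \<bar>?\<phi> u\<bar>" by (simp add: abs_mult)
    qed
    have "(\<integral>x. ?F x' x * ?\<psi> x \<partial>count_space X) = (\<integral>x. ?F x' x * ?\<phi> x - ?F x' x * (\<integral>u. pk V x u * ?\<phi> u \<partial>count_space X) \<partial>count_space X)"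
      by (rule Bochner_Integration.integral_cong) (simp_all add: psi right_diff_distrib)
    also have "\<dots> = (\<integral>x. ?F x' x * ?\<phi> x \<partial>count_space X)" using Bochner_Integration.integral_diff[OF i4 i3] z by simp
    finally show ?thesis .
  qed
  have ker: "integrable (count_space (X \<times> X)) (%p. ?F (fst p) (snd p) * (A (fst p) * B (snd p)))"
    if "integrable (count_space X) A" "integrable (count_space X) B" for A B
    by (rule integrable_count_kernel[OF cX that]) (rule Fp_bound)
  note wi = weight_integrable[OF fi]
  have sym: "?F x y = ?F y x" if "x \<in> X" "y \<in> X" for x y by (rule kg_sym[OF bbm_Fp that])
  have "Q (Fp \<nu>) (Fm \<nu>) V = (\<integral>x. ?\<psi> x * (\<integral>y. ?F x y * ?\<psi> y \<partial>count_space X) \<partial>count_space X)"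
    unfolding Q_def using integral_count_prod(1)[OF cX cX ker[OF psi_int psi_int]] by (simp add: mult.left_commute)
  also have "\<dots> = (\<integral>x. ?\<psi> x * (\<integral>y. ?F x y * ?\<phi> y \<partial>count_space X) \<partial>count_space X)"
    by (rule Bochner_Integration.integral_cong) (simp_all add: Fpsi)
  also have "\<dots> = (\<integral>p. ?F (fst p) (snd p) * (?\<psi> (fst p) * ?\<phi> (snd p)) \<partial>count_space (X \<times> X))"
    using integral_count_prod(1)[OF cX cX ker[OF psi_int fi]] by (simp add: mult.left_commute)
  also have "\<dots> = (\<integral>y. (\<integral>x. ?F x y * ?\<psi> x \<partial>count_space X) * ?\<phi> y \<partial>count_space X)"
    using integral_count_prod(2)[OF cX cX ker[OF psi_int fi]] by (simp add: mult.assoc[symmetric])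
  also have "\<dots> = (\<integral>y. ?\<phi> y * (\<integral>x. ?F y x * ?\<phi> x \<partial>count_space X) \<partial>count_space X)"
  proof (rule Bochner_Integration.integral_cong[OF refl])
    fix y assume "y \<in> space (count_space X)"
    then have y: "y \<in> X" by simp
    have "(\<integral>x. ?F x y * ?\<psi> x \<partial>count_space X) = (\<integral>x. ?F y x * ?\<psi> x \<partial>count_space X)"
      by (rule Bochner_Integration.integral_cong[OF refl]) (use sym[OF _ y] in simp)
    then show "(\<integral>x. ?F x y * ?\<psi> x \<partial>count_space X) * ?\<phi> y = ?\<phi> y * (\<integral>x. ?F y x * ?\<phi> x \<partial>count_space X)"
      unfolding Fpsi[OF y] by (simp only: mult.commute)
  qed
  also have "\<dots> = (\<integral>p. ?F (fst p) (snd p) * (?\<phi> (fst p) * ?\<phi> (snd p)) \<partial>count_space (X \<times> X))"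
    using integral_count_prod(1)[OF cX cX ker[OF fi fi]] by (simp add: mult.left_commute)
  \<comment> \<open>The bound of |F_+(x,y)| by the square roots of F_+(x,x) and F_+(y,y) separates
    the variables and turns the form into a square.\<close>
  also have "\<dots> \<le> (\<integral>p. 1 * ((\<bar>?\<phi> (fst p)\<bar> * sqrt (?F (fst p) (fst p))) * (\<bar>?\<phi> (snd p)\<bar> * sqrt (?F (snd p) (snd p)))) \<partial>count_space (X \<times> X))"
  proof (rule integral_mono[OF ker[OF fi fi]])
    show "integrable (count_space (X \<times> X)) (%p. 1 * ((\<bar>?\<phi> (fst p)\<bar> * sqrt (?F (fst p) (fst p))) * (\<bar>?\<phi> (snd p)\<bar> * sqrt (?F (snd p) (snd p)))))"
      by (rule integrable_count_kernel[OF cX wi wi]) simp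
    fix p assume "p \<in> space (count_space (X \<times> X))"
    then have p: "fst p \<in> X" "snd p \<in> X" by auto
    have "?F (fst p) (snd p) * (?\<phi> (fst p) * ?\<phi> (snd p)) \<le> \<bar>?F (fst p) (snd p)\<bar> * (\<bar>?\<phi> (fst p)\<bar> * \<bar>?\<phi> (snd p)\<bar>)"
      by (metis abs_ge_self abs_mult)
    also have "\<dots> \<le> (sqrt (?F (fst p) (fst p)) * sqrt (?F (snd p) (snd p))) * (\<bar>?\<phi> (fst p)\<bar> * \<bar>?\<phi> (snd p)\<bar>)"
      by (intro mult_right_mono kernel_le_sqrt p) auto
    finally show "?F (fst p) (snd p) * (?\<phi> (fst p) * ?\<phi> (snd p)) \<le> 1 * ((\<bar>?\<phi> (fst p)\<bar> * sqrt (?F (fst p) (fst p))) * (\<bar>?\<phi> (snd p)\<bar> * sqrt (?F (snd p) (snd p))))"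
      by (simp add: mult_ac)
  qed
  also have "\<dots> = (\<integral>x. \<bar>?\<phi> x\<bar> * sqrt (?F x x) \<partial>count_space X)\<^sup>2"
  proof -
    have "integrable (count_space (X \<times> X)) (%p. 1 * ((\<bar>?\<phi> (fst p)\<bar> * sqrt (?F (fst p) (fst p))) * (\<bar>?\<phi> (snd p)\<bar> * sqrt (?F (snd p) (snd p)))))"
      by (rule integrable_count_kernel[OF cX wi wi]) simp
    from integral_count_prod_factor[OF cX this] show ?thesis by (simp add: power2_eq_square)
  qed
  finally show ?thesis .
qed

abbreviation "Fb \<nu> \<equiv> indicator {EF - \<nu><..EF + \<nu>} :: real => real"

text \<open>Expanding the determinant of F_+ + F_- gives, besides the wanted product and -2 F_+(j,k)
  F_-(j,k), the two separate determinants and F_-(j,j) F_+(k,k), all of them nonnegative.\<close>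

lemma two_level_le:
  assumes g: "good V" and \<nu>: "0 \<le> \<nu>" and j: "j \<in> X" "k \<in> X"
  shows "kg (Fp \<nu>) V j j * kg (Fm \<nu>) V k k \<le> detF V (Fb \<nu>) j k + 2 * (kg (Fp \<nu>) V j k * kg (Fm \<nu>) V j k)"
    "0 \<le> detF V (Fb \<nu>) j k"
proof -
  have Fb: "Fb \<nu> = (%t. Fp \<nu> t + Fm \<nu> t)" using \<nu> by (auto simp: Fp_def Fm_def indicator_def fun_eq_iff)
  have e: "rf d V (Fb \<nu>) (dr x) (dr y) = kg (Fp \<nu>) V x y + kg (Fm \<nu>) V x y" if "x \<in> X" "y \<in> X" for x y
    using kg_add[OF bbm_Fp bbm_Fm that, of \<nu> \<nu> V] by (simp add: Fb kg_rf[OF g])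
  have cs: "(kg (Fp \<nu>) V j k)\<^sup>2 \<le> kg (Fp \<nu>) V j j * kg (Fp \<nu>) V k k" "(kg (Fm \<nu>) V j k)\<^sup>2 \<le> kg (Fm \<nu>) V j j * kg (Fm \<nu>) V k k"
    by (intro kg_CS bbm_Fp bbm_Fm Fp_range Fm_range j)+
  have "0 \<le> kg (Fm \<nu>) V j j * kg (Fp \<nu>) V k k"
    by (intro mult_nonneg_nonneg kg_nonneg bbm_Fp bbm_Fm Fp_range Fm_range j)
  then show "kg (Fp \<nu>) V j j * kg (Fm \<nu>) V k k \<le> detF V (Fb \<nu>) j k + 2 * (kg (Fp \<nu>) V j k * kg (Fm \<nu>) V j k)"
    using cs unfolding detF_def e[OF j(1,1)] e[OF j(2,2)] e[OF j] by (simp add: algebra_simps power2_eq_square)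
  have bb: "bbm (Fb \<nu>)" by (rule bbm_indicator) simp
  show "0 \<le> detF V (Fb \<nu>) j k"
    using kg_CS[OF bb _ j, of V] unfolding detF_def kg_rf[OF g] by simp
qed

text \<open>The sum from \<open>Q_le_square\<close> is split at the box. Inside, the coordinate is
  at most L, and Cauchy-Schwarz separates the sum of |F_-(x,0)|^2, at most F_-(0,0) as F_- is a
  projection, from the sum of F_+(x,x).\<close>

lemma Q_le:
  assumes g: "good V" and \<nu>: "0 \<le> \<nu>" and fi: "integrable (count_space X) (\<phi> \<nu> V)"
    and yi: "integrable (count_space (X \<times> X)) (%p. yk V (fst p) (snd p) * kg (Fm \<nu>) V (snd p) o0)"
  shows "Q (Fp \<nu>) (Fm \<nu>) V \<le> 2 * (real L)\<^sup>2 * (\<Sum>j\<in>box d L. detF V (Fb \<nu>) j o0)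
     + 4 * (real L)\<^sup>2 * (\<integral>j. \<bar>kg (Fp \<nu>) V o0 j * kg (Fm \<nu>) V j o0\<bar> \<partial>count_space (X - box d L))
     + 2 * (\<integral>x. \<bar>\<phi> \<nu> V x\<bar> \<partial>count_space (X - box d L))\<^sup>2"
proof -
  let ?p = "kg (Fp \<nu>) V" and ?m = "kg (Fm \<nu>) V" and ?\<phi> = "\<phi> \<nu> V" and ?B = "box d L"
  let ?w = "%x. \<bar>?\<phi> x\<bar> * sqrt (?p x x)"
  let ?T = "\<integral>j. \<bar>?p o0 j * ?m j o0\<bar> \<partial>count_space (X - ?B)"
  note wi = weight_integrable[OF fi]
  note fin = finite_box[of d L] box_sub_Zd[of d L]
  note split = integral_count_split[OF wi fin]
  have p01: "0 \<le> ?p x x" "?p x x \<le> 1" if "x \<in> X" for x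
    using kg_nonneg[OF bbm_Fp Fp_range(1) that] Fp_bound[OF that that, of \<nu> V] by (auto simp: abs_le_iff)
  have m0: "0 \<le> ?m o0 o0" by (intro kg_nonneg bbm_Fm Fm_range zero_Zd)
  have tail: "(\<integral>x. ?w x \<partial>count_space (X - ?B)) \<le> (\<integral>x. \<bar>?\<phi> x\<bar> \<partial>count_space (X - ?B))"
  proof (rule integral_mono[OF split(2)])
    show "integrable (count_space (X - ?B)) (%x. \<bar>?\<phi> x\<bar>)" by (rule integrable_abs[OF integral_count_split(2)[OF fi fin]])
    fix x assume "x \<in> space (count_space (X - ?B))"
    then have "sqrt (?p x x) \<le> 1" using p01 by simp
    then show "?w x \<le> \<bar>?\<phi> x\<bar>" using mult_left_mono[of "sqrt (?p x x)" 1 "\<bar>?\<phi> x\<bar>"] by simp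
  qed
  have tail0: "0 \<le> (\<integral>x. ?w x \<partial>count_space (X - ?B))" using p01 by (intro integral_nonneg_AE) (simp add: AE_count_space)
  have "(\<Sum>x\<in>?B. ?w x) \<le> (\<Sum>x\<in>?B. real L * (\<bar>?m x o0\<bar> * sqrt (?p x x)))"
  proof (rule sum_mono)
    fix x assume x: "x \<in> ?B"
    have "\<bar>real_of_int (x 0)\<bar> \<le> real L" using zdist_in_box[OF x, of 0] d by simp
    then have "\<bar>real_of_int (x 0)\<bar> * (\<bar>?m x o0\<bar> * sqrt (?p x x)) \<le> real L * (\<bar>?m x o0\<bar> * sqrt (?p x x))"
      using p01(1)[of x] x fin by (intro mult_right_mono) auto
    then show "?w x \<le> real L * (\<bar>?m x o0\<bar> * sqrt (?p x x))" by (simp add: \<phi>_def abs_mult mult.assoc)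
  qed
  then have "(\<Sum>x\<in>?B. ?w x)\<^sup>2 \<le> (real L * (\<Sum>x\<in>?B. \<bar>?m x o0\<bar> * sqrt (?p x x)))\<^sup>2"
    using p01 fin by (intro power_mono) (auto simp: sum_distrib_left intro!: sum_nonneg)
  also have "\<dots> \<le> (real L)\<^sup>2 * ((\<Sum>x\<in>?B. \<bar>?m x o0\<bar>\<^sup>2) * (\<Sum>x\<in>?B. (sqrt (?p x x))\<^sup>2))"
    unfolding power_mult_distrib by (intro mult_left_mono Cauchy_Schwarz_ineq_sum) simp
  also have "(\<Sum>x\<in>?B. (sqrt (?p x x))\<^sup>2) = (\<Sum>x\<in>?B. ?p x x)" using p01 fin by (intro sum.cong) auto
  also have "(real L)\<^sup>2 * ((\<Sum>x\<in>?B. \<bar>?m x o0\<bar>\<^sup>2) * (\<Sum>x\<in>?B. ?p x x)) \<le> (real L)\<^sup>2 * (?m o0 o0 * (\<Sum>x\<in>?B. ?p x x))"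
  proof (intro mult_left_mono mult_right_mono)
    have ff: "(%t. Fm \<nu> t * Fm \<nu> t) = Fm \<nu>" by (auto simp: Fm_def indicator_def)
    note km = kg_mult[OF bbm_Fm[of \<nu>] bbm_Fm[of \<nu>] zero_Zd zero_Zd, of V, unfolded ff]
    have s: "?m o0 x * ?m x o0 = \<bar>?m x o0\<bar>\<^sup>2" if "x \<in> X" for x
      using kg_sym[OF bbm_Fm zero_Zd that, of \<nu> V] by (simp add: power2_eq_square)
    have "(\<Sum>x\<in>?B. \<bar>?m x o0\<bar>\<^sup>2) = (\<Sum>x\<in>?B. ?m o0 x * ?m x o0)" using s fin by (intro sum.cong) auto
    also have "\<dots> \<le> (\<Sum>x\<in>?B. ?m o0 x * ?m x o0) + (\<integral>x. ?m o0 x * ?m x o0 \<partial>count_space (X - ?B))"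
      using s by (simp add: integral_nonneg_AE AE_count_space)
    also have "\<dots> = ?m o0 o0" using integral_count_split(1)[OF km(2) fin] km(1) by simp
    finally show "(\<Sum>x\<in>?B. \<bar>?m x o0\<bar>\<^sup>2) \<le> ?m o0 o0" .
  qed (use p01 fin in \<open>auto intro!: sum_nonneg\<close>)
  also have "?m o0 o0 * (\<Sum>x\<in>?B. ?p x x) \<le> (\<Sum>j\<in>?B. detF V (Fb \<nu>) j o0) + 2 * ?T"
  proof -
    have "?m o0 o0 * (\<Sum>x\<in>?B. ?p x x) = (\<Sum>j\<in>?B. ?p j j * ?m o0 o0)" by (simp add: sum_distrib_left mult.commute)
    also have "\<dots> \<le> (\<Sum>j\<in>?B. detF V (Fb \<nu>) j o0 + 2 * (?p o0 j * ?m j o0))"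
    proof (rule sum_mono)
      fix j assume "j \<in> ?B"
      then have j: "j \<in> X" using fin by auto
      show "?p j j * ?m o0 o0 \<le> detF V (Fb \<nu>) j o0 + 2 * (?p o0 j * ?m j o0)"
        using two_level_le(1)[OF g \<nu> j zero_Zd] kg_sym[OF bbm_Fp zero_Zd j, of \<nu> V] by simp
    qed
    also have "\<dots> = (\<Sum>j\<in>?B. detF V (Fb \<nu>) j o0) + 2 * (\<Sum>j\<in>?B. ?p o0 j * ?m j o0)" by (simp add: sum.distrib sum_distrib_left)
    also have "(\<Sum>j\<in>?B. ?p o0 j * ?m j o0) \<le> ?T"
    proof -
      have ff: "(%t. Fp \<nu> t * Fm \<nu> t) = (%t. 0)" by (auto simp: Fp_def Fm_def indicator_def)
      note km = kg_mult[OF bbm_Fp[of \<nu>] bbm_Fm[of \<nu>] zero_Zd zero_Zd, of V, unfolded ff kg_zero[OF zero_Zd zero_Zd]]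
      \<comment> \<open>Over all sites this sum is a diagonal entry of F_+ F_- = 0, so inside the
        box it is minus the tail.\<close>
      have "(\<Sum>j\<in>?B. ?p o0 j * ?m j o0) = - (\<integral>j. ?p o0 j * ?m j o0 \<partial>count_space (X - ?B))"
        using integral_count_split(1)[OF km(2) fin] km(1) by simp
      also have "\<dots> \<le> ?T" using integral_abs_bound[of "count_space (X - ?B)" "%j. ?p o0 j * ?m j o0"] by linarith
      finally show ?thesis .
    qed
    finally show ?thesis by simp
  qed
  finally have head: "(\<Sum>x\<in>?B. ?w x)\<^sup>2 \<le> (real L)\<^sup>2 * ((\<Sum>j\<in>?B. detF V (Fb \<nu>) j o0) + 2 * ?T)"
    by (auto simp: mult_left_mono)
  have "Q (Fp \<nu>) (Fm \<nu>) V \<le> ((\<Sum>x\<in>?B. ?w x) + (\<integral>x. ?w x \<partial>count_space (X - ?B)))\<^sup>2"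
    using Q_le_square[OF g fi yi] unfolding split(1) .
  also have "\<dots> \<le> 2 * (\<Sum>x\<in>?B. ?w x)\<^sup>2 + 2 * (\<integral>x. ?w x \<partial>count_space (X - ?B))\<^sup>2"
    using sum_squares_bound[of "\<Sum>x\<in>?B. ?w x" "\<integral>x. ?w x \<partial>count_space (X - ?B)"] by (simp only: power2_sum)
  also have "\<dots> \<le> 2 * ((real L)\<^sup>2 * ((\<Sum>j\<in>?B. detF V (Fb \<nu>) j o0) + 2 * ?T)) + 2 * (\<integral>x. \<bar>?\<phi> x\<bar> \<partial>count_space (X - ?B))\<^sup>2"
    by (intro add_mono mult_left_mono head power_mono tail tail0) auto
  finally show ?thesis by (simp add: algebra_simps)
qed

section \<open>Expected size of the tails outside the box\<close>

lemma Tonelli_count: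
  fixes A :: "'c set" and \<Psi> :: "'c => (site => real) => ennreal"
  assumes A: "countable A" and m: "!!t. t \<in> A ==> \<Psi> t \<in> borel_measurable \<Omega>"
  shows "(\<integral>\<^sup>+V. (\<integral>\<^sup>+t. \<Psi> t V \<partial>count_space A) \<partial>\<Omega>) = (\<integral>\<^sup>+t. (\<integral>\<^sup>+V. \<Psi> t V \<partial>\<Omega>) \<partial>count_space A)"
    "(%V. \<integral>\<^sup>+t. \<Psi> t V \<partial>count_space A) \<in> borel_measurable \<Omega>"
proof -
  interpret pp: pair_sigma_finite "count_space A" \<Omega> by (rule pair_count[OF A])
  have me: "(%p. \<Psi> (fst p) (snd p)) \<in> borel_measurable (count_space A \<Otimes>\<^sub>M \<Omega>)"
    by (rule measurable_pair_measure_countable1[OF A]) (simp add: m)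
  show "(\<integral>\<^sup>+V. (\<integral>\<^sup>+t. \<Psi> t V \<partial>count_space A) \<partial>\<Omega>) = (\<integral>\<^sup>+t. (\<integral>\<^sup>+V. \<Psi> t V \<partial>\<Omega>) \<partial>count_space A)"
    using pp.nn_integral_snd[OF me] P.nn_integral_fst[OF me] by simp
  have "(%(V, t). \<Psi> t V) \<in> borel_measurable (\<Omega> \<Otimes>\<^sub>M count_space A)"
    using me by (subst measurable_pair_swap_iff) (simp add: case_prod_beta')
  then show "(%V. \<integral>\<^sup>+t. \<Psi> t V \<partial>count_space A) \<in> borel_measurable \<Omega>" by (rule pp.M1.borel_measurable_nn_integral[where f="%V t. \<Psi> t V"])
qed

text \<open>Both energies E_F and E_F - \<nu> lie in (a,b), where \<open>Kd\<close> is uniform; so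
  the bound does not depend on \<nu>.\<close>

lemma Fm_decay:
  assumes \<nu>: "0 \<le> \<nu>" "a < EF - \<nu>" and x: "x \<in> X"
  shows "EN (%V. kg (Fm \<nu>) V x o0) \<le> ennreal (2 * Kd * exp (- c0 * zdist d x o0))"
proof -
  let ?f = "kg (indicator {..EF})" and ?g = "kg (indicator {..EF - \<nu>})"
  note [measurable] = kg_measurable[OF bbm_atMost x zero_Zd]
  have E: "EF \<in> {a<..<b}" "EF - \<nu> \<in> {a<..<b}" using EF \<nu> by auto
  have k: "kg (Fm \<nu>) V x o0 = ?f V x o0 - ?g V x o0" for V
    unfolding Fm_diff[OF \<nu>(1)] by (rule kg_diff[OF bbm_atMost bbm_atMost x zero_Zd])
  have "EN (%V. kg (Fm \<nu>) V x o0) \<le> (\<integral>\<^sup>+V. ennreal \<bar>?f V x o0\<bar> + ennreal \<bar>?g V x o0\<bar> \<partial>\<Omega>)"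
    unfolding k by (intro nn_integral_mono) (simp add: ennreal_plus[symmetric] ennreal_leI del: ennreal_plus)
  also have "\<dots> = EN (%V. ?f V x o0) + EN (%V. ?g V x o0)" by (intro nn_integral_add) measurable
  also have "\<dots> \<le> ennreal (Kd * exp (- c0 * zdist d x o0)) + ennreal (Kd * exp (- c0 * zdist d x o0))"
    by (intro add_mono Kd(2) E x zero_Zd)
  also have "\<dots> = ennreal (2 * Kd * exp (- c0 * zdist d x o0))" using Kd(1) by (simp add: ennreal_plus[symmetric] del: ennreal_plus)
  finally show ?thesis .
qed

lemma nn_ez_scaled: "0 \<le> A ==> (\<integral>\<^sup>+x. ennreal (A * exp (- \<kappa> * zdist d x o0)) \<partial>count_space X) = ennreal (A * Sk d \<kappa>)"
  using nn_ez(2)[OF zero_Zd] by (simp add: ennreal_mult nn_integral_cmult Sk_nonneg)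

lemma phi_weight: "\<bar>real_of_int (x 0)\<bar> \<le> 1 / \<kappa> * exp (\<kappa> * zdist d x o0)"
  using weight_le[of x o0] by simp

lemma c0_kappa: "c0 = 6 * \<kappa>" by (simp add: \<kappa>_def)

lemma phi_meas: "x \<in> X ==> (%V. \<phi> \<nu> V x) \<in> borel_measurable \<Omega>"
  unfolding \<phi>_def using kg_measurable[OF bbm_Fm _ zero_Zd] by measurable

lemma phi_summable:
  assumes \<nu>: "0 \<le> \<nu>" "a < EF - \<nu>"
  shows "AE V in \<Omega>. integrable (count_space X) (\<phi> \<nu> V)"
proof -
  have "(\<integral>\<^sup>+x. EN (%V. \<phi> \<nu> V x) \<partial>count_space X) \<le> (\<integral>\<^sup>+x. ennreal (1 / \<kappa> * (2 * Kd) * exp (- \<kappa> * zdist d x o0)) \<partial>count_space X)"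
  proof (rule nn_integral_mono)
    fix x assume "x \<in> space (count_space X)" then have x: "x \<in> X" by simp
    note [measurable] = kg_measurable[OF bbm_Fm x zero_Zd]
    have "EN (%V. \<phi> \<nu> V x) = ennreal \<bar>real_of_int (x 0)\<bar> * EN (%V. kg (Fm \<nu>) V x o0)"
      unfolding \<phi>_def by (simp add: abs_mult ennreal_mult nn_integral_cmult)
    also have "\<dots> \<le> ennreal (1 / \<kappa> * exp (\<kappa> * zdist d x o0)) * ennreal (2 * Kd * exp (- c0 * zdist d x o0))"
      by (intro mult_mono ennreal_leI phi_weight Fm_decay \<nu> x) auto
    also have "\<dots> = ennreal (1 / \<kappa> * (2 * Kd) * exp (\<kappa> * zdist d x o0 - c0 * zdist d x o0))"
      using \<kappa> Kd(1) by (simp add: ennreal_mult[symmetric] exp_diff exp_minus divide_inverse mult_ac)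
    also have "\<dots> \<le> ennreal (1 / \<kappa> * (2 * Kd) * exp (- \<kappa> * zdist d x o0))"
      using \<kappa> Kd(1) zdist_nonneg[of d x o0] by (intro ennreal_leI mult_left_mono) (auto simp: c0_kappa)
    finally show "EN (%V. \<phi> \<nu> V x) \<le> ennreal (1 / \<kappa> * (2 * Kd) * exp (- \<kappa> * zdist d x o0))" .
  qed
  also have "\<dots> < \<infinity>" by (subst nn_ez_scaled) (use \<kappa> Kd(1) in auto)
  finally have "integrable (count_space X \<Otimes>\<^sub>M \<Omega>) (%p. \<phi> \<nu> (snd p) (fst p))"
    using phi_meas by (intro integrable_count_pair[OF countable_Zd, where \<Psi>="%x V. \<phi> \<nu> V x"])
  from Fubini_count(1)[OF countable_Zd this] show ?thesis .
qed

lemma yk_Fm_summable: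
  assumes \<nu>: "0 \<le> \<nu>" "a < EF - \<nu>"
  shows "AE V in \<Omega>. integrable (count_space (X \<times> X)) (%p. yk V (fst p) (snd p) * kg (Fm \<nu>) V (snd p) o0)"
proof -
  let ?\<Psi> = "%p V. yk V (fst p) (snd p) * kg (Fm \<nu>) V (snd p) o0"
  \<comment> \<open>The constant of \<open>E3\<close> for the factors P, F_- and the constant 1, the
    last with distance 0.\<close>
  define A where "A = Kd * 1 * 1 + 1 * (2 * Kd) * 1 + 1 * 1 * 1"
  have A: "0 \<le> A" using Kd(1) by (simp add: A_def)
  have cXX: "countable (X \<times> X)" by (intro countable_SIGMA countable_Zd)
  have "(\<integral>\<^sup>+p. EN (%V. ?\<Psi> p V) \<partial>count_space (X \<times> X)) \<le>
     (\<integral>\<^sup>+p. ennreal (exp (- (\<kappa> * zdist d (fst p) (snd p)))) * ennreal (1 / \<kappa> * A * exp (- \<kappa> * zdist d (snd p) o0)) \<partial>count_space (X \<times> X))"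
  proof (rule nn_integral_mono)
    fix p assume "p \<in> space (count_space (X \<times> X))"
    then obtain x u where p: "p = (x, u)" and x: "x \<in> X" and u: "u \<in> X" by auto
    note [measurable] = kg_measurable[OF bbm_Fm u zero_Zd] pk_measurable[OF x u]
    have "EN (%V. ?\<Psi> p V) = ennreal \<bar>real_of_int (x 0 - u 0)\<bar> * EN (%V. pk V x u * kg (Fm \<nu>) V u o0 * 1)"
      unfolding yk_def p by (subst nn_integral_cmult[symmetric]) (auto simp: abs_mult ennreal_mult[symmetric] mult.assoc)
    also have "\<dots> \<le> ennreal (1 / \<kappa> * exp (\<kappa> * zdist d x u)) * ennreal (A * exp (- (c0 / 3) * (zdist d x u + zdist d u o0 + 0)))"
    proof (intro mult_mono ennreal_leI weight_le)
      show "EN (%V. pk V x u * kg (Fm \<nu>) V u o0 * 1) \<le> ennreal (A * exp (- (c0 / 3) * (zdist d x u + zdist d u o0 + 0)))"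
        unfolding A_def
      proof (rule E3)
        show "EN (%V. pk V x u) \<le> ennreal (Kd * exp (- c0 * zdist d x u))"
          unfolding pk_def by (rule Kd(2)[OF EF_in x u])
        show "EN (%V. kg (Fm \<nu>) V u o0) \<le> ennreal (2 * Kd * exp (- c0 * zdist d u o0))" by (rule Fm_decay[OF \<nu> u])
      qed (use pk_bound[OF x u] Fm_bound[OF u zero_Zd] Kd(1) in \<open>auto simp: P.emeasure_space_1\<close>)
    qed auto
    also have "\<dots> = ennreal ((1 / \<kappa> * exp (\<kappa> * zdist d x u)) * (A * exp (- (c0 / 3) * (zdist d x u + zdist d u o0 + 0))))"
      by (rule ennreal_mult[symmetric]) (use \<kappa> A in auto)
    also have "(1 / \<kappa> * exp (\<kappa> * zdist d x u)) * (A * exp (- (c0 / 3) * (zdist d x u + zdist d u o0 + 0))) = 1 / \<kappa> * A * (exp (- (\<kappa> * zdist d x u)) * exp (- (2 * \<kappa>) * zdist d u o0))"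
    proof -
      have "exp (- (c0 / 3) * (zdist d x u + zdist d u o0 + 0)) = exp (- (2 * \<kappa> * zdist d x u)) * exp (- (2 * \<kappa>) * zdist d u o0)"
        unfolding exp_add[symmetric] by (simp add: c0_kappa algebra_simps)
      moreover have "exp (- (\<kappa> * zdist d x u)) = exp (\<kappa> * zdist d x u) * exp (- (2 * \<kappa> * zdist d x u))"
        unfolding exp_add[symmetric] by simp
      ultimately show ?thesis by (simp only: mult_ac)
    qed
    also have "\<dots> \<le> ennreal (1 / \<kappa> * A * (exp (- (\<kappa> * zdist d x u)) * exp (- \<kappa> * zdist d u o0)))"
      using \<kappa> A zdist_nonneg[of d u o0] by (intro ennreal_leI mult_left_mono mult_mono) auto
    also have "\<dots> = ennreal (exp (- (\<kappa> * zdist d x u))) * ennreal (1 / \<kappa> * A * exp (- \<kappa> * zdist d u o0))"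
      using \<kappa> A by (simp add: ennreal_mult[symmetric] mult_ac)
    finally show "EN (%V. ?\<Psi> p V) \<le> ennreal (exp (- (\<kappa> * zdist d (fst p) (snd p)))) * ennreal (1 / \<kappa> * A * exp (- \<kappa> * zdist d (snd p) o0))"
      by (simp add: p)
  qed
  also have "\<dots> = (\<integral>\<^sup>+u. (\<integral>\<^sup>+x. ennreal (exp (- (\<kappa> * zdist d x u))) * ennreal (1 / \<kappa> * A * exp (- \<kappa> * zdist d u o0)) \<partial>count_space X) \<partial>count_space X)"
    by (simp add: nn_count_prod2[OF countable_Zd countable_Zd])
  also have "\<dots> = (\<integral>\<^sup>+u. ennreal (Sk d \<kappa>) * ennreal (1 / \<kappa> * A * exp (- \<kappa> * zdist d u o0)) \<partial>count_space X)"
    by (intro nn_integral_cong) (simp add: nn_integral_multc nn_ez(2))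
  also have "\<dots> = ennreal (Sk d \<kappa>) * (\<integral>\<^sup>+u. ennreal (1 / \<kappa> * A * exp (- \<kappa> * zdist d u o0)) \<partial>count_space X)"
    by (rule nn_integral_cmult) simp
  also have "\<dots> < \<infinity>" by (subst nn_ez_scaled) (use \<kappa> A in \<open>auto simp: ennreal_mult_less_top\<close>)
  finally have "integrable (count_space (X \<times> X) \<Otimes>\<^sub>M \<Omega>) (%p. ?\<Psi> (fst p) (snd p))"
    by (intro integrable_count_pair[OF cXX, where \<Psi>="?\<Psi>"]) (auto intro!: borel_measurable_times yk_measurable kg_measurable[OF bbm_Fm] zero_Zd)
  from Fubini_count(1)[OF cXX this] show ?thesis .
qed

text \<open>Outside the box the share r \<kappa> of the rate is converted into smallness in L, while
  one \<kappa> is kept for the sum over sites.\<close>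

lemma tail_exp:
  assumes "x \<in> X - box d L" "0 \<le> r"
  shows "exp (- ((r + 1) * \<kappa>) * zdist d x o0) \<le> exp (- (r * \<kappa>) * real L) * exp (- \<kappa> * zdist d x o0)"
proof -
  have "real L \<le> zdist d x o0" using not_box_zdist[of x d L] assms by auto
  then have "r * \<kappa> * real L \<le> r * \<kappa> * zdist d x o0" using \<kappa> assms by (intro mult_left_mono) auto
  then show ?thesis unfolding exp_add[symmetric] by (simp add: algebra_simps)
qed

lemma nn_ez_sub: "0 \<le> A ==> (\<integral>\<^sup>+x. ennreal (A * exp (- \<kappa> * zdist d x o0)) \<partial>count_space (X - S)) \<le> ennreal (A * Sk d \<kappa>)"
  unfolding nn_ez_scaled[symmetric]
  by (subst (1 2) nn_integral_count_space_indicator) (auto intro!: nn_integral_mono simp: indicator_def)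

lemma tail1:
  assumes \<nu>: "0 \<le> \<nu>" "a < EF - \<nu>"
  shows "(\<integral>\<^sup>+V. (\<integral>\<^sup>+j. ennreal \<bar>kg (Fp \<nu>) V o0 j * kg (Fm \<nu>) V j o0\<bar> \<partial>count_space (X - box d L)) \<partial>\<Omega>)
     \<le> ennreal (2 * Kd * exp (- (5 * \<kappa>) * real L) * Sk d \<kappa>)"
proof -
  have "(\<integral>\<^sup>+V. (\<integral>\<^sup>+j. ennreal \<bar>kg (Fp \<nu>) V o0 j * kg (Fm \<nu>) V j o0\<bar> \<partial>count_space (X - box d L)) \<partial>\<Omega>)
    = (\<integral>\<^sup>+j. EN (%V. kg (Fp \<nu>) V o0 j * kg (Fm \<nu>) V j o0) \<partial>count_space (X - box d L))"
  proof (rule Tonelli_count(1))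
    fix j assume "j \<in> X - box d L"
    then have j: "j \<in> X" by simp
    note [measurable] = kg_measurable[OF bbm_Fp zero_Zd j] kg_measurable[OF bbm_Fm j zero_Zd]
    show "(%V. ennreal \<bar>kg (Fp \<nu>) V o0 j * kg (Fm \<nu>) V j o0\<bar>) \<in> borel_measurable \<Omega>" by measurable
  qed (rule countable_subset[OF _ countable_Zd], auto)
  also have "\<dots> \<le> (\<integral>\<^sup>+j. ennreal (2 * Kd * exp (- (5 * \<kappa>) * real L) * exp (- \<kappa> * zdist d j o0)) \<partial>count_space (X - box d L))"
  proof (rule nn_integral_mono)
    fix j assume "j \<in> space (count_space (X - box d L))"
    then have jb: "j \<in> X - box d L" and j: "j \<in> X" by auto
    have "EN (%V. kg (Fp \<nu>) V o0 j * kg (Fm \<nu>) V j o0) \<le> EN (%V. kg (Fm \<nu>) V j o0)"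
      using mult_right_mono[OF Fp_bound[OF zero_Zd j]] by (intro nn_integral_mono ennreal_leI) (fastforce simp: abs_mult)
    also have "\<dots> \<le> ennreal (2 * Kd * exp (- c0 * zdist d j o0))" by (rule Fm_decay[OF \<nu> j])
    also have "\<dots> \<le> ennreal (2 * Kd * (exp (- (5 * \<kappa>) * real L) * exp (- \<kappa> * zdist d j o0)))"
      using tail_exp[OF jb, of 5] Kd(1) by (intro ennreal_leI mult_left_mono) (simp_all add: c0_kappa)
    finally show "EN (%V. kg (Fp \<nu>) V o0 j * kg (Fm \<nu>) V j o0) \<le> ennreal (2 * Kd * exp (- (5 * \<kappa>) * real L) * exp (- \<kappa> * zdist d j o0))"
      by (simp add: mult.assoc)
  qed
  also have "\<dots> \<le> ennreal (2 * Kd * exp (- (5 * \<kappa>) * real L) * Sk d \<kappa>)" by (rule nn_ez_sub) (use Kd(1) in simp)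
  finally show ?thesis .
qed

text \<open>The two kernels are dependent, so the better of the two decay bounds is used: 6\<kappa>
  times the larger distance is at least 3\<kappa> times the sum. The coordinate weights cost
  \<kappa> at each site and leave 2\<kappa>.\<close>

lemma phi_pair:
  assumes \<nu>: "0 \<le> \<nu>" "a < EF - \<nu>" and x: "x \<in> X" "y \<in> X"
  shows "(\<integral>\<^sup>+V. ennreal \<bar>\<phi> \<nu> V x\<bar> * ennreal \<bar>\<phi> \<nu> V y\<bar> \<partial>\<Omega>) \<le> ennreal (2 * Kd / \<kappa>\<^sup>2 * (exp (- (2 * \<kappa>) * zdist d x o0) * exp (- (2 * \<kappa>) * zdist d y o0)))"
proof -
  let ?m = "kg (Fm \<nu>)" and ?D = "max (zdist d x o0) (zdist d y o0)"
  note [measurable] = kg_measurable[OF bbm_Fm x(1) zero_Zd] kg_measurable[OF bbm_Fm x(2) zero_Zd]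
  have m1: "EN (%V. ?m V x o0 * ?m V y o0) \<le> ennreal (2 * Kd * exp (- c0 * zdist d x o0))"
    by (rule order_trans[OF nn_integral_mono Fm_decay[OF \<nu> x(1)]])
      (use mult_left_mono[OF Fm_bound[OF x(2) zero_Zd]] in \<open>fastforce simp: abs_mult intro!: ennreal_leI\<close>)
  have m2: "EN (%V. ?m V x o0 * ?m V y o0) \<le> ennreal (2 * Kd * exp (- c0 * zdist d y o0))"
    by (rule order_trans[OF nn_integral_mono Fm_decay[OF \<nu> x(2)]])
      (use mult_right_mono[OF Fm_bound[OF x(1) zero_Zd]] in \<open>fastforce simp: abs_mult intro!: ennreal_leI\<close>)
  have "EN (%V. ?m V x o0 * ?m V y o0) \<le> ennreal (2 * Kd * exp (- c0 * ?D))"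
    using m1 m2 by (cases "zdist d x o0 \<le> zdist d y o0") (auto simp: max_def)
  also have "\<dots> \<le> ennreal (2 * Kd * exp (- (3 * \<kappa>) * zdist d x o0 - (3 * \<kappa>) * zdist d y o0))"
  proof (intro ennreal_leI mult_left_mono)
    have "(zdist d x o0 + zdist d y o0) / 2 \<le> ?D" by (auto simp: max_def)
    then have "6 * \<kappa> * ((zdist d x o0 + zdist d y o0) / 2) \<le> 6 * \<kappa> * ?D" using \<kappa> by (intro mult_left_mono) auto
    then show "exp (- c0 * ?D) \<le> exp (- (3 * \<kappa>) * zdist d x o0 - (3 * \<kappa>) * zdist d y o0)" by (simp add: c0_kappa algebra_simps)
  qed (use Kd(1) in auto)
  finally have m: "EN (%V. ?m V x o0 * ?m V y o0) \<le> ennreal (2 * Kd * exp (- (3 * \<kappa>) * zdist d x o0 - (3 * \<kappa>) * zdist d y o0))" .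
  let ?W = "\<bar>real_of_int (x 0)\<bar> * \<bar>real_of_int (y 0)\<bar>"
  have "(\<integral>\<^sup>+V. ennreal \<bar>\<phi> \<nu> V x\<bar> * ennreal \<bar>\<phi> \<nu> V y\<bar> \<partial>\<Omega>) = ennreal ?W * EN (%V. ?m V x o0 * ?m V y o0)"
    unfolding \<phi>_def by (subst nn_integral_cmult[symmetric]) (auto simp: abs_mult ennreal_mult[symmetric] mult_ac)
  also have "\<dots> \<le> ennreal ((1 / \<kappa> * exp (\<kappa> * zdist d x o0)) * (1 / \<kappa> * exp (\<kappa> * zdist d y o0))) * ennreal (2 * Kd * exp (- (3 * \<kappa>) * zdist d x o0 - (3 * \<kappa>) * zdist d y o0))"
    by (intro mult_mono ennreal_leI m phi_weight) (use \<kappa> in auto)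
  also have "\<dots> = ennreal (2 * Kd / \<kappa>\<^sup>2 * (exp (- (2 * \<kappa>) * zdist d x o0) * exp (- (2 * \<kappa>) * zdist d y o0)))"
  proof -
    have "exp (- (2 * \<kappa>) * zdist d z o0) = exp (\<kappa> * zdist d z o0) * exp (- (3 * \<kappa>) * zdist d z o0)" for z
      unfolding exp_add[symmetric] by simp
    moreover have "exp (- (3 * \<kappa>) * zdist d x o0 - (3 * \<kappa>) * zdist d y o0) = exp (- (3 * \<kappa>) * zdist d x o0) * exp (- (3 * \<kappa>) * zdist d y o0)"
      unfolding exp_add[symmetric] by simp
    moreover have "(1 / \<kappa> * p) * (1 / \<kappa> * q) * (2 * Kd * (u * v)) = 2 * Kd / \<kappa>\<^sup>2 * ((p * u) * (q * v))" for p q u v :: real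
      by (simp add: power2_eq_square)
    ultimately show ?thesis using \<kappa> Kd(1) by (subst ennreal_mult[symmetric]) auto
  qed
  finally show ?thesis .
qed

text \<open>The square is a sum over pairs of sites, with expectations bounded by
  \<open>phi_pair\<close>; of each rate 2\<kappa> one half gives smallness and the other
  summability.\<close>

lemma tail2:
  assumes \<nu>: "0 \<le> \<nu>" "a < EF - \<nu>"
  shows "(\<integral>\<^sup>+V. (\<integral>\<^sup>+x. ennreal \<bar>\<phi> \<nu> V x\<bar> \<partial>count_space (X - box d L))\<^sup>2 \<partial>\<Omega>)
     \<le> ennreal (2 * Kd / \<kappa>\<^sup>2 * (exp (- \<kappa> * real L) * Sk d \<kappa>)\<^sup>2)"
proof -
  let ?A = "X - box d L"
  have cA: "countable ?A" by (rule countable_subset[OF _ countable_Zd]) auto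
  have cAA: "countable (?A \<times> ?A)" by (intro countable_SIGMA cA)
  have "(\<integral>\<^sup>+x. ennreal \<bar>\<phi> \<nu> V x\<bar> \<partial>count_space ?A)\<^sup>2 = (\<integral>\<^sup>+p. ennreal \<bar>\<phi> \<nu> V (fst p)\<bar> * ennreal \<bar>\<phi> \<nu> V (snd p)\<bar> \<partial>count_space (?A \<times> ?A))" for V
    by (simp add: nn_count_prod[OF cA cA] nn_integral_cmult nn_integral_multc power2_eq_square)
  then have "(\<integral>\<^sup>+V. (\<integral>\<^sup>+x. ennreal \<bar>\<phi> \<nu> V x\<bar> \<partial>count_space ?A)\<^sup>2 \<partial>\<Omega>)
      = (\<integral>\<^sup>+V. (\<integral>\<^sup>+p. ennreal \<bar>\<phi> \<nu> V (fst p)\<bar> * ennreal \<bar>\<phi> \<nu> V (snd p)\<bar> \<partial>count_space (?A \<times> ?A)) \<partial>\<Omega>)" by simp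
  also have "\<dots> = (\<integral>\<^sup>+p. (\<integral>\<^sup>+V. ennreal \<bar>\<phi> \<nu> V (fst p)\<bar> * ennreal \<bar>\<phi> \<nu> V (snd p)\<bar> \<partial>\<Omega>) \<partial>count_space (?A \<times> ?A))"
  proof (rule Tonelli_count(1)[OF cAA])
    fix p assume "p \<in> ?A \<times> ?A"
    then have p: "fst p \<in> X" "snd p \<in> X" by auto
    note [measurable] = phi_meas[OF p(1)] phi_meas[OF p(2)]
    show "(%V. ennreal \<bar>\<phi> \<nu> V (fst p)\<bar> * ennreal \<bar>\<phi> \<nu> V (snd p)\<bar>) \<in> borel_measurable \<Omega>" by measurable
  qed
  also have "\<dots> \<le> (\<integral>\<^sup>+p. ennreal (2 * Kd / \<kappa>\<^sup>2) * (ennreal (exp (- \<kappa> * real L) * exp (- \<kappa> * zdist d (fst p) o0)) * ennreal (exp (- \<kappa> * real L) * exp (- \<kappa> * zdist d (snd p) o0))) \<partial>count_space (?A \<times> ?A))"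
  proof (rule nn_integral_mono)
    fix p assume "p \<in> space (count_space (?A \<times> ?A))"
    then have p: "fst p \<in> ?A" "snd p \<in> ?A" by auto
    then have "(\<integral>\<^sup>+V. ennreal \<bar>\<phi> \<nu> V (fst p)\<bar> * ennreal \<bar>\<phi> \<nu> V (snd p)\<bar> \<partial>\<Omega>) \<le> ennreal (2 * Kd / \<kappa>\<^sup>2 * (exp (- (2 * \<kappa>) * zdist d (fst p) o0) * exp (- (2 * \<kappa>) * zdist d (snd p) o0)))"
      by (intro phi_pair \<nu>) auto
    also have "\<dots> \<le> ennreal (2 * Kd / \<kappa>\<^sup>2 * ((exp (- \<kappa> * real L) * exp (- \<kappa> * zdist d (fst p) o0)) * (exp (- \<kappa> * real L) * exp (- \<kappa> * zdist d (snd p) o0))))"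
      using tail_exp[OF p(1), of 1] tail_exp[OF p(2), of 1] \<kappa> Kd(1) by (intro ennreal_leI mult_left_mono mult_mono) auto
    also have "\<dots> = ennreal (2 * Kd / \<kappa>\<^sup>2) * (ennreal (exp (- \<kappa> * real L) * exp (- \<kappa> * zdist d (fst p) o0)) * ennreal (exp (- \<kappa> * real L) * exp (- \<kappa> * zdist d (snd p) o0)))"
      using Kd(1) by (simp add: ennreal_mult[symmetric])
    finally show "(\<integral>\<^sup>+V. ennreal \<bar>\<phi> \<nu> V (fst p)\<bar> * ennreal \<bar>\<phi> \<nu> V (snd p)\<bar> \<partial>\<Omega>) \<le> \<dots>" .
  qed
  also have "\<dots> = ennreal (2 * Kd / \<kappa>\<^sup>2) * (\<integral>\<^sup>+x. ennreal (exp (- \<kappa> * real L) * exp (- \<kappa> * zdist d x o0)) \<partial>count_space ?A)\<^sup>2"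
    by (simp add: nn_count_prod[OF cA cA] nn_integral_cmult nn_integral_multc power2_eq_square)
  also have "\<dots> \<le> ennreal (2 * Kd / \<kappa>\<^sup>2) * (ennreal (exp (- \<kappa> * real L) * Sk d \<kappa>))\<^sup>2"
    by (intro mult_left_mono power_mono nn_ez_sub) auto
  also have "\<dots> = ennreal (2 * Kd / \<kappa>\<^sup>2 * (exp (- \<kappa> * real L) * Sk d \<kappa>)\<^sup>2)"
    using Kd(1) Sk_nonneg[of d \<kappa>] by (simp add: ennreal_mult[symmetric] ennreal_power)
  finally show ?thesis .
qed

text \<open>The three terms correspond to those of \<open>Q_le\<close>: Minami's estimate at each of
  the at most (2L + 1)^d sites of the box, then \<open>tail1\<close> and \<open>tail2\<close>. The
  radius L is still free.\<close>

lemma sigma_in_bound: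
  assumes \<nu>: "0 < \<nu>" "EF + \<nu> < b" "a < EF - \<nu>"
  shows "sigma_in d \<rho> EF \<nu> \<le> pi * (2 * (real L)\<^sup>2 * (real ((2 * L + 1) ^ d) * (4 * \<nu>\<^sup>2 * pi\<^sup>2 * rb\<^sup>2))
    + 4 * (real L)\<^sup>2 * (2 * Kd * exp (- (5 * \<kappa>) * real L) * Sk d \<kappa>)
    + 2 * (2 * Kd / \<kappa>\<^sup>2 * (exp (- \<kappa> * real L) * Sk d \<kappa>)\<^sup>2))"
proof -
  have \<nu>0: "0 \<le> \<nu>" using \<nu> by simp
  have dp: "dec (Fp \<nu>)" by (rule dec_Fp[OF \<nu>0 \<nu>(2)])
  let ?G = "%V. \<integral>t. Gq (Fp \<nu>) (Fm \<nu>) t V \<partial>count_space T4"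
  let ?A = "X - box d L"
  let ?t1 = "%V j. kg (Fp \<nu>) V o0 j * kg (Fm \<nu>) V j o0"
  let ?T1 = "%V. \<integral>\<^sup>+j. ennreal \<bar>?t1 V j\<bar> \<partial>count_space ?A"
  let ?T2 = "%V. \<integral>\<^sup>+x. ennreal \<bar>\<phi> \<nu> V x\<bar> \<partial>count_space ?A"
  note tr = Lf_trace[OF dp bbm_Fm[of \<nu>]]
  have cA: "countable ?A" by (rule countable_subset[OF _ countable_Zd]) auto
  have pos: "AE V in \<Omega>. 0 \<le> ?G V"
    using tr(2) by eventually_elim (use Q_nonneg[OF bbm_Fp Fp_range(1)] in auto)
  have [measurable]: "?T1 \<in> borel_measurable \<Omega>"
  proof (rule Tonelli_count(2)[OF cA])
    fix j assume "j \<in> ?A"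
    then have j: "j \<in> X" by simp
    note [measurable] = kg_measurable[OF bbm_Fp zero_Zd j] kg_measurable[OF bbm_Fm j zero_Zd]
    show "(%V. ennreal \<bar>?t1 V j\<bar>) \<in> borel_measurable \<Omega>" by measurable
  qed
  have [measurable]: "?T2 \<in> borel_measurable \<Omega>"
  proof (rule Tonelli_count(2)[OF cA])
    fix x assume "x \<in> ?A"
    then show "(%V. ennreal \<bar>\<phi> \<nu> V x\<bar>) \<in> borel_measurable \<Omega>" using phi_meas[of x \<nu>] by auto
  qed
  have en: "ennreal p * ennreal q + ennreal r * ennreal s + ennreal u * ennreal v = ennreal (p * q + r * s + u * v)"
    if "0 \<le> p" "0 \<le> q" "0 \<le> r" "0 \<le> s" "0 \<le> u" "0 \<le> v" for p q r s u v
    using that by (simp add: ennreal_mult)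
  have bb: "bbm (Fb \<nu>)" by (rule bbm_indicator) simp
  have [measurable]: "(%V. detF V (Fb \<nu>) j o0) \<in> borel_measurable \<Omega>" if "j \<in> box d L" for j
  proof -
    have j: "j \<in> X" using that box_sub_Zd[of d L] by auto
    note [measurable] = rfx_meas[OF bb j j] rfx_meas[OF bb zero_Zd zero_Zd] rfx_meas[OF bb j zero_Zd]
    show ?thesis unfolding detF_def by measurable
  qed
  have "ennreal (Lf (Fp \<nu>) (%t. Fm \<nu> t * Fm \<nu> t)) = (\<integral>\<^sup>+V. ennreal (?G V) \<partial>\<Omega>)"
    unfolding tr(1) by (rule nn_integral_eq_integral[symmetric, OF tr(3) pos])
  also have "\<dots> \<le> (\<integral>\<^sup>+V. ennreal (2 * (real L)\<^sup>2) * (\<Sum>j\<in>box d L. ennreal (detF V (Fb \<nu>) j o0))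
      + ennreal (4 * (real L)\<^sup>2) * ?T1 V + ennreal 2 * (?T2 V)\<^sup>2 \<partial>\<Omega>)"
  proof (rule nn_integral_mono_AE)
    show "AE V in \<Omega>. ennreal (?G V) \<le> ennreal (2 * (real L)\<^sup>2) * (\<Sum>j\<in>box d L. ennreal (detF V (Fb \<nu>) j o0))
      + ennreal (4 * (real L)\<^sup>2) * ?T1 V + ennreal 2 * (?T2 V)\<^sup>2"
      using tr(2) AE_good phi_summable[OF \<nu>0 \<nu>(3)] yk_Fm_summable[OF \<nu>0 \<nu>(3)]
    proof eventually_elim
      fix V
      assume G: "?G V = Q (Fp \<nu>) (Fm \<nu>) V \<and> integrable (count_space (X \<times> X)) (%p. kg (Fp \<nu>) V (fst p) (snd p) * (\<psi> (Fm \<nu>) V (fst p) * \<psi> (Fm \<nu>) V (snd p)))"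
        and g: "good V" and fi: "integrable (count_space X) (\<phi> \<nu> V)"
        and yi: "integrable (count_space (X \<times> X)) (%p. yk V (fst p) (snd p) * kg (Fm \<nu>) V (snd p) o0)"
      note fin = finite_box[of d L] box_sub_Zd[of d L]
      have i1: "integrable (count_space ?A) (%j. \<bar>?t1 V j\<bar>)"
        by (intro integrable_abs integral_count_split(2)[OF kg_mult(2)[OF bbm_Fp bbm_Fm zero_Zd zero_Zd] fin])
      have i2: "integrable (count_space ?A) (%x. \<bar>\<phi> \<nu> V x\<bar>)" by (intro integrable_abs integral_count_split(2)[OF fi fin])
      have T1: "?T1 V = ennreal (\<integral>j. \<bar>?t1 V j\<bar> \<partial>count_space ?A)" by (rule nn_integral_eq_integral[OF i1]) simp
      have T2: "?T2 V = ennreal (\<integral>x. \<bar>\<phi> \<nu> V x\<bar> \<partial>count_space ?A)" by (rule nn_integral_eq_integral[OF i2]) simp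
      have d0: "0 \<le> detF V (Fb \<nu>) j o0" if "j \<in> box d L" for j
        by (rule two_level_le(2)[OF g \<nu>0 _ zero_Zd]) (use that fin in auto)
      have "ennreal (?G V) \<le> ennreal (2 * (real L)\<^sup>2 * (\<Sum>j\<in>box d L. detF V (Fb \<nu>) j o0)
         + 4 * (real L)\<^sup>2 * (\<integral>j. \<bar>?t1 V j\<bar> \<partial>count_space ?A) + 2 * (\<integral>x. \<bar>\<phi> \<nu> V x\<bar> \<partial>count_space ?A)\<^sup>2)"
        using G Q_le[OF g \<nu>0 fi yi, of L] by (intro ennreal_leI) simp
      also have "\<dots> = ennreal (2 * (real L)\<^sup>2) * (\<Sum>j\<in>box d L. ennreal (detF V (Fb \<nu>) j o0)) + ennreal (4 * (real L)\<^sup>2) * ?T1 V + ennreal 2 * (?T2 V)\<^sup>2"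
        unfolding T1 T2 using d0 by (simp add: ennreal_plus ennreal_mult sum_nonneg ennreal_power sum_ennreal del: ennreal_numeral)
      finally show "ennreal (?G V) \<le> ennreal (2 * (real L)\<^sup>2) * (\<Sum>j\<in>box d L. ennreal (detF V (Fb \<nu>) j o0)) + ennreal (4 * (real L)\<^sup>2) * ?T1 V + ennreal 2 * (?T2 V)\<^sup>2" .
    qed
  qed
  also have "\<dots> = ennreal (2 * (real L)\<^sup>2) * (\<Sum>j\<in>box d L. \<integral>\<^sup>+V. ennreal (detF V (Fb \<nu>) j o0) \<partial>\<Omega>)
      + ennreal (4 * (real L)\<^sup>2) * (\<integral>\<^sup>+V. ?T1 V \<partial>\<Omega>) + ennreal 2 * (\<integral>\<^sup>+V. (?T2 V)\<^sup>2 \<partial>\<Omega>)"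
    by (simp add: nn_integral_add nn_integral_cmult nn_integral_sum del: ennreal_numeral)
  also have "\<dots> \<le> ennreal (2 * (real L)\<^sup>2) * ennreal (real ((2 * L + 1) ^ d) * (4 * \<nu>\<^sup>2 * pi\<^sup>2 * rb\<^sup>2))
      + ennreal (4 * (real L)\<^sup>2) * ennreal (2 * Kd * exp (- (5 * \<kappa>) * real L) * Sk d \<kappa>)
      + ennreal 2 * ennreal (2 * Kd / \<kappa>\<^sup>2 * (exp (- \<kappa> * real L) * Sk d \<kappa>)\<^sup>2)"
  proof (intro add_mono mult_left_mono tail1 tail2 \<nu>0 \<nu>(3))
    have "(\<Sum>j\<in>box d L. \<integral>\<^sup>+V. ennreal (detF V (Fb \<nu>) j o0) \<partial>\<Omega>) \<le> (\<Sum>j\<in>box d L. ennreal (4 * \<nu>\<^sup>2 * pi\<^sup>2 * rb\<^sup>2))"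
      by (intro sum_mono minami[OF \<nu>(1) _ zero_Zd]) (use box_sub_Zd[of d L] in auto)
    also have "\<dots> = ennreal (real (card (box d L)) * (4 * \<nu>\<^sup>2 * pi\<^sup>2 * rb\<^sup>2))" by (subst sum_ennreal) auto
    also have "\<dots> \<le> ennreal (real ((2 * L + 1) ^ d) * (4 * \<nu>\<^sup>2 * pi\<^sup>2 * rb\<^sup>2))"
      using card_box[of d L] by (intro ennreal_leI mult_right_mono) (auto simp only: of_nat_le_iff, simp)
    finally show "(\<Sum>j\<in>box d L. \<integral>\<^sup>+V. ennreal (detF V (Fb \<nu>) j o0) \<partial>\<Omega>) \<le> ennreal (real ((2 * L + 1) ^ d) * (4 * \<nu>\<^sup>2 * pi\<^sup>2 * rb\<^sup>2))" .
  qed auto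
  also have "\<dots> = ennreal (2 * (real L)\<^sup>2 * (real ((2 * L + 1) ^ d) * (4 * \<nu>\<^sup>2 * pi\<^sup>2 * rb\<^sup>2))
    + 4 * (real L)\<^sup>2 * (2 * Kd * exp (- (5 * \<kappa>) * real L) * Sk d \<kappa>)
    + 2 * (2 * Kd / \<kappa>\<^sup>2 * (exp (- \<kappa> * real L) * Sk d \<kappa>)\<^sup>2))" (is "_ = ennreal ?R")
    by (rule en) (use Kd(1) Sk_nonneg[of d \<kappa>] in auto)
  finally have le: "ennreal (Lf (Fp \<nu>) (%t. Fm \<nu> t * Fm \<nu> t)) \<le> ennreal ?R" .
  have "0 \<le> ?R" using Kd(1) Sk_nonneg[of d \<kappa>] by (intro add_nonneg_nonneg mult_nonneg_nonneg) auto
  with le have "Lf (Fp \<nu>) (%t. Fm \<nu> t * Fm \<nu> t) \<le> ?R" by simp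
  then have "pi * Lf (Fp \<nu>) (%t. Fm \<nu> t * Fm \<nu> t) \<le> pi * ?R" by (intro mult_left_mono) auto
  with sigma_in_le[OF \<nu>] show ?thesis by (rule order_trans)
qed

text \<open>The box of side \<open>L = \<lceil>12 l ln (1/\<nu>)\<rceil>\<close> makes both tails negligible: \<open>\<kappa> L \<ge> ln (1/\<nu>)\<close>.\<close>

lemma sigma_in_scaled:
  assumes \<nu>: "0 < \<nu>" "EF + \<nu> < b" "a < EF - \<nu>" and l1: "1 \<le> ln (1/\<nu>)" and l2: "1 \<le> l * ln (1/\<nu>)"
  shows "sigma_in d \<rho> EF \<nu> / (\<nu>\<^sup>2 * ln (1/\<nu>) ^ (d + 2)) \<le> 1352 * 27 ^ d * pi ^ 3 * rb\<^sup>2 * l ^ (d + 2)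
    + pi * (1352 * l\<^sup>2 * Kd * Sk d \<kappa>) * \<nu> + pi * (4 * Kd / \<kappa>\<^sup>2 * (Sk d \<kappa>)\<^sup>2) * (1 / ln (1/\<nu>))"
proof -
  define t where "t = ln (1/\<nu>)"
  define L where "L = nat \<lceil>12 * l * t\<rceil>"
  have t: "1 \<le> t" "1 \<le> l * t" using l1 l2 by (simp_all add: t_def)
  have \<nu>t: "\<nu> = exp (- t)" using \<nu>(1) by (simp add: t_def ln_div)
  have \<nu>1: "\<nu> \<le> 1" using t \<nu>t by simp
  have "0 \<le> 12 * l * t" using t l by simp
  then have L: "12 * l * t \<le> real L" "real L \<le> 12 * l * t + 1" unfolding L_def by linarith+
  \<comment> \<open>Since 1 \<le> l t, rounding up costs 12lt + 1 \<le> 13lt, and 2L + 1 \<le> 24lt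
    + 3 \<le> 27lt.\<close>
  have L13: "real L \<le> 13 * (l * t)" using L(2) t by simp
  have L27: "real (2 * L + 1) \<le> 27 * (l * t)" using L(2) t by simp
  have \<kappa>l: "\<kappa> * (12 * l) = 1" using l by (simp add: \<kappa>_def c0_def)
  have "\<kappa> * (12 * l * t) \<le> \<kappa> * real L" using L(1) \<kappa> by (intro mult_left_mono) auto
  then have \<kappa>L: "t \<le> \<kappa> * real L" using \<kappa>l by (metis mult.assoc mult_1)
  have e1: "exp (- \<kappa> * real L) \<le> \<nu>" unfolding \<nu>t using \<kappa>L by simp
  \<comment> \<open>Of the available \<nu>^5 only \<nu>^3 is kept: one power beyond \<nu>^2 already
    makes the term vanish in the limit.\<close>
  have e5: "exp (- (5 * \<kappa>) * real L) \<le> \<nu> ^ 3"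
  proof -
    have "3 * t \<le> 5 * (\<kappa> * real L)" using \<kappa>L t by simp
    then have "exp (- (5 * \<kappa>) * real L) \<le> exp (real 3 * (- t))" by simp
    also have "\<dots> = \<nu> ^ 3" unfolding \<nu>t by (rule exp_of_nat_mult)
    finally show ?thesis .
  qed
  have K0: "0 \<le> Kd" using Kd(1) by simp
  note S0 = Sk_nonneg[of d \<kappa>]
  let ?N = "\<nu>\<^sup>2 * t ^ (d + 2)"
  have N: "0 < ?N" using \<nu> t by simp
  have Lsq: "(real L)\<^sup>2 \<le> 169 * (l\<^sup>2 * t\<^sup>2)"
    using power_mono[OF L13, of 2] by (simp add: power_mult_distrib)
  \<comment> \<open>Here 1352 = 8 * 169 with 169 = 13^2; the 8 combines the 2 from
    \<open>Q_le\<close> with the 4 from \<open>minami\<close>.\<close>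
  have a1: "2 * (real L)\<^sup>2 * (real ((2 * L + 1) ^ d) * (4 * \<nu>\<^sup>2 * pi\<^sup>2 * rb\<^sup>2)) \<le> (1352 * 27 ^ d * pi\<^sup>2 * rb\<^sup>2 * l ^ (d + 2)) * ?N"
  proof -
    have "real ((2 * L + 1) ^ d) \<le> (27 * (l * t)) ^ d" unfolding of_nat_power by (rule power_mono[OF L27]) simp
    then have "(real L)\<^sup>2 * real ((2 * L + 1) ^ d) \<le> (169 * (l\<^sup>2 * t\<^sup>2)) * (27 * (l * t)) ^ d"
      by (intro mult_mono Lsq) auto
    then have "(real L)\<^sup>2 * real ((2 * L + 1) ^ d) * (8 * \<nu>\<^sup>2 * pi\<^sup>2 * rb\<^sup>2) \<le> (169 * (l\<^sup>2 * t\<^sup>2)) * (27 * (l * t)) ^ d * (8 * \<nu>\<^sup>2 * pi\<^sup>2 * rb\<^sup>2)"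
      by (rule mult_right_mono) simp
    also have "\<dots> = (1352 * 27 ^ d * pi\<^sup>2 * rb\<^sup>2 * l ^ (d + 2)) * ?N"
      by (simp add: power_mult_distrib power_add power2_eq_square mult_ac)
    finally show ?thesis by (simp add: mult_ac)
  qed
  have a2: "4 * (real L)\<^sup>2 * (2 * Kd * exp (- (5 * \<kappa>) * real L) * Sk d \<kappa>) \<le> (1352 * l\<^sup>2 * Kd * Sk d \<kappa> * \<nu>) * ?N"
  proof -
    have "t\<^sup>2 \<le> t ^ (d + 2)" using t by (intro power_increasing) auto
    then have "169 * (l\<^sup>2 * t\<^sup>2) \<le> 169 * (l\<^sup>2 * t ^ (d + 2))" by (intro mult_left_mono) auto
    with Lsq have "(real L)\<^sup>2 \<le> 169 * (l\<^sup>2 * t ^ (d + 2))" by linarith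
    then have "(real L)\<^sup>2 * exp (- (5 * \<kappa>) * real L) \<le> (169 * (l\<^sup>2 * t ^ (d + 2))) * \<nu> ^ 3"
      by (intro mult_mono e5) (use t in auto)
    then have "(real L)\<^sup>2 * exp (- (5 * \<kappa>) * real L) * (8 * Kd * Sk d \<kappa>) \<le> (169 * (l\<^sup>2 * t ^ (d + 2))) * \<nu> ^ 3 * (8 * Kd * Sk d \<kappa>)"
      by (rule mult_right_mono) (use K0 S0 in simp)
    also have "\<dots> = (1352 * l\<^sup>2 * Kd * Sk d \<kappa> * \<nu>) * ?N" by (simp add: power2_eq_square power3_eq_cube mult_ac)
    finally show ?thesis by (simp only: mult_ac)
  qed
  \<comment> \<open>No power of \<nu> is gained here, only the logarithms: this term is of order
    \<nu>^2, and after division by \<nu>^2 t^(d+2) it is at most a constant times 1/t.\<close>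
  have a3: "2 * (2 * Kd / \<kappa>\<^sup>2 * (exp (- \<kappa> * real L) * Sk d \<kappa>)\<^sup>2) \<le> (4 * Kd / \<kappa>\<^sup>2 * (Sk d \<kappa>)\<^sup>2 * (1 / t)) * ?N"
  proof -
    have "(exp (- \<kappa> * real L))\<^sup>2 \<le> \<nu>\<^sup>2" by (rule power_mono[OF e1]) simp
    moreover have "1 \<le> t ^ (d + 2) / t" using t power_increasing[of 1 "d + 2" t] by simp
    ultimately have "(exp (- \<kappa> * real L))\<^sup>2 * 1 \<le> \<nu>\<^sup>2 * (t ^ (d + 2) / t)" by (intro mult_mono) auto
    then have "(exp (- \<kappa> * real L))\<^sup>2 * (4 * Kd / \<kappa>\<^sup>2 * (Sk d \<kappa>)\<^sup>2) \<le> \<nu>\<^sup>2 * (t ^ (d + 2) / t) * (4 * Kd / \<kappa>\<^sup>2 * (Sk d \<kappa>)\<^sup>2)"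
      using K0 S0 by (intro mult_right_mono) auto
    moreover have "2 * (2 * Kd / \<kappa>\<^sup>2 * (p * q)) = p * (4 * Kd / \<kappa>\<^sup>2 * q)" for p q :: real by simp
    moreover have "(4 * Kd / \<kappa>\<^sup>2 * (Sk d \<kappa>)\<^sup>2 * (1 / t)) * ?N = \<nu>\<^sup>2 * (t ^ (d + 2) / t) * (4 * Kd / \<kappa>\<^sup>2 * (Sk d \<kappa>)\<^sup>2)" by simp
    ultimately show ?thesis unfolding power_mult_distrib by metis
  qed
  have "sigma_in d \<rho> EF \<nu> \<le> pi * ((1352 * 27 ^ d * pi\<^sup>2 * rb\<^sup>2 * l ^ (d + 2)) * ?N + (1352 * l\<^sup>2 * Kd * Sk d \<kappa> * \<nu>) * ?N + (4 * Kd / \<kappa>\<^sup>2 * (Sk d \<kappa>)\<^sup>2 * (1 / t)) * ?N)"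
    by (rule order_trans[OF sigma_in_bound[OF \<nu>, of L]]) (intro mult_left_mono add_mono a1 a2 a3, simp)
  also have "\<dots> = (1352 * 27 ^ d * pi ^ 3 * rb\<^sup>2 * l ^ (d + 2) + pi * (1352 * l\<^sup>2 * Kd * Sk d \<kappa>) * \<nu> + pi * (4 * Kd / \<kappa>\<^sup>2 * (Sk d \<kappa>)\<^sup>2) * (1 / t)) * ?N"
    by (simp add: distrib_left distrib_right power2_eq_square power3_eq_cube mult_ac)
  finally show ?thesis using N unfolding t_def[symmetric] by (simp add: pos_divide_le_eq)
qed

text \<open>Of the two error terms in \<open>sigma_in_scaled\<close> one vanishes like \<nu> and the
  other like 1/ln(1/\<nu>).\<close>

lemma limsup_sigma_in:
  "Limsup (at_right 0) (%\<nu>. ereal (sigma_in d \<rho> EF \<nu> / (\<nu>\<^sup>2 * ln (1/\<nu>) ^ (d + 2)))) \<le> ereal (1352 * 27 ^ d * pi ^ 3 * rb\<^sup>2 * l ^ (d + 2))"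
proof -
  let ?c = "1352 * 27 ^ d * pi ^ 3 * rb\<^sup>2 * l ^ (d + 2)"
  let ?R = "%\<nu>. ?c + pi * (1352 * l\<^sup>2 * Kd * Sk d \<kappa>) * \<nu> + pi * (4 * Kd / \<kappa>\<^sup>2 * (Sk d \<kappa>)\<^sup>2) * (1 / ln (1/\<nu>))"
  have lnl: "LIM (\<nu>::real) at_right 0. ln (1/\<nu>) :> at_top" by real_asymp
  have "((%\<nu>::real. \<nu>) \<longlongrightarrow> 0) (at_right 0)" "((%\<nu>::real. 1 / ln (1/\<nu>)) \<longlongrightarrow> 0) (at_right 0)" by real_asymp+
  then have "(?R \<longlongrightarrow> ?c + pi * (1352 * l\<^sup>2 * Kd * Sk d \<kappa>) * 0 + pi * (4 * Kd / \<kappa>\<^sup>2 * (Sk d \<kappa>)\<^sup>2) * 0) (at_right 0)"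
    by (intro tendsto_intros)
  then have "((%\<nu>. ereal (?R \<nu>)) \<longlongrightarrow> ereal ?c) (at_right 0)" by simp
  then have lim: "Limsup (at_right 0) (%\<nu>. ereal (?R \<nu>)) = ereal ?c" by (rule lim_imp_Limsup[rotated]) simp
  have r: "0 < min (b - EF) (EF - a)" using EF by simp
  have "\<forall>\<^sub>F \<nu> in at_right 0. \<nu> \<in> {0<..<min (b - EF) (EF - a)}" by (rule eventually_at_right_real[OF r])
  moreover have "\<forall>\<^sub>F \<nu> in at_right 0. max 1 (1 / l) \<le> ln (1/\<nu>)" using lnl by (simp only: filterlim_at_top)
  ultimately have "\<forall>\<^sub>F \<nu> in at_right 0. ereal (sigma_in d \<rho> EF \<nu> / (\<nu>\<^sup>2 * ln (1/\<nu>) ^ (d + 2))) \<le> ereal (?R \<nu>)"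
  proof eventually_elim
    fix \<nu> :: real assume h: "\<nu> \<in> {0<..<min (b - EF) (EF - a)}" and m: "max 1 (1 / l) \<le> ln (1/\<nu>)"
    have "1 \<le> l * ln (1/\<nu>)" using m l by (simp add: pos_divide_le_eq mult.commute)
    then have "sigma_in d \<rho> EF \<nu> / (\<nu>\<^sup>2 * ln (1/\<nu>) ^ (d + 2)) \<le> ?R \<nu>" by (intro sigma_in_scaled) (use h m in auto)
    then show "ereal (sigma_in d \<rho> EF \<nu> / (\<nu>\<^sup>2 * ln (1/\<nu>) ^ (d + 2))) \<le> ereal (?R \<nu>)" by simp
  qed
  then have "Limsup (at_right 0) (%\<nu>. ereal (sigma_in d \<rho> EF \<nu> / (\<nu>\<^sup>2 * ln (1/\<nu>) ^ (d + 2)))) \<le> Limsup (at_right 0) (%\<nu>. ereal (?R \<nu>))"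
    by (rule Limsup_mono)
  then show ?thesis unfolding lim .
qed

end

theorem theorem2p3:
  shows "\<exists>C>0. \<forall>(d::nat) \<rho> E\<^sub>F l a b s K.
     1 \<le> d \<and> single_site_density \<rho> \<and> a < E\<^sub>F \<and> E\<^sub>F < b \<and> 0 < s \<and> s < 1 \<and> 0 < l \<and>
     loc_estimate d \<rho> a b s K l \<longrightarrow>
     Limsup (at_right 0) (\<lambda>\<nu>. ereal (sigma_in d \<rho> E\<^sub>F \<nu> / (\<nu>^2 * (ln (1/\<nu>))^(d+2))))
       \<le> ereal (C^(d+2) * pi^3 * l^(d+2)) * (normInf \<rho>)^2"
proof (intro exI[of _ 100] conjI allI impI)
  fix d :: nat and \<rho> :: "real => real" and EF l a b s K :: real
  assume h: "1 \<le> d \<and> single_site_density \<rho> \<and> a < EF \<and> EF < b \<and> 0 < s \<and> s < 1 \<and> 0 < l \<and> loc_estimate d \<rho> a b s K l"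
  then interpret fermi d \<rho> a b s K l EF by unfold_locales auto
  \<comment> \<open>Both 27 and the square root of 1352 are below 100, so one base serves all
    dimensions.\<close>
  have "(1352::real) * 27 ^ d \<le> 100 ^ 2 * 100 ^ d" by (intro mult_mono power_mono) auto
  then have "1352 * 27 ^ d * (pi ^ 3 * rb\<^sup>2 * l ^ (d + 2)) \<le> (100 ^ 2 * 100 ^ d) * (pi ^ 3 * rb\<^sup>2 * l ^ (d + 2))"
    using l by (intro mult_right_mono) auto
  then have c: "1352 * 27 ^ d * pi ^ 3 * rb\<^sup>2 * l ^ (d + 2) \<le> 100 ^ (d + 2) * pi ^ 3 * l ^ (d + 2) * rb\<^sup>2"
    unfolding power_add[of 100] by (simp only: mult_ac)
  have "ereal (100 ^ (d + 2) * pi ^ 3 * l ^ (d + 2)) * (normInf \<rho>)\<^sup>2 = ereal (100 ^ (d + 2) * pi ^ 3 * l ^ (d + 2) * rb\<^sup>2)"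
    unfolding rb(1) by (simp add: power2_eq_square)
  with c order_trans[OF limsup_sigma_in]
  show "Limsup (at_right 0) (%\<nu>. ereal (sigma_in d \<rho> EF \<nu> / (\<nu>\<^sup>2 * ln (1/\<nu>) ^ (d + 2)))) \<le> ereal (100 ^ (d + 2) * pi ^ 3 * l ^ (d + 2)) * (normInf \<rho>)\<^sup>2"
    by simp
qed simp

end
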